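(* Let $\mathcal W\neq\{0\}$ be a finitely generated shift invariant subspace of $L^2(\mathbb R^k)$, let $d(x)=\dim J_{\mathcal W}(x)\le\ell\in\mathbb N$ for a.e. $x\in\mathbb T^k$, and for $i\in\mathbb I_\ell$ let $Z_i=d^{-1}(i)\subseteq\mathbb T^k$ and $p_i=|Z_i|$ (Lebesgue measure). Let $\alpha=(\alpha_i)_{i\in\mathbb I_n}$ with $\alpha_1\ge\dots\ge\alpha_n>0$, and fix $\varphi\in\mathrm{Conv}(\mathbb R_+)$. Then there exists $\mathcal F^{\rm op}\in\mathfrak B_\alpha(\mathcal W)$ such that: 1. $\lambda_j([S_{E(\mathcal F^{\rm op})}]_x)=:\psi^{\rm op}_{i,j}\in\mathbb R_+$ is a.e. constant for $x\in Z_i$, for each $j\in\mathbb I_i$ and $i\in\mathbb I_\ell$. 2. For every $\mathcal F\in\mathfrak B_\alpha(\mathcal W)$, $$\sum_{i\in\mathbb I_\ell}p_i\Big(\sum_{j\in\mathbb I_i}\varphi(\psi^{\rm op}_{i,j})\Big)=P_\varphi^{\mathcal W}(E(\mathcal F^{\rm op}))\le P_\varphi^{\mathcal W}(E(\mathcal F)).$$ If moreover $\varphi\in\mathrm{Conv_s}(\mathbb R_+)$, then: (a) If $\mathcal F\in\mathfrak B_\alpha(\mathcal W)$ is such that $P_\varphi^{\mathcal W}(E(\mathcal F))=P_\varphi^{\mathcal W}(E(\mathcal F^{\rm op}))$, then $S_{E(\mathcal F)}$ has the same fine spectral structure as $S_{E(\mathcal F^{\rm op})}$, i.e. $\lambda_j([S_{E(\mathcal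 F)}]_x)=\lambda_j([S_{E(\mathcal F^{\rm op})}]_x)$ for all $j\in\mathbb N$ and a.e. $x\in\mathbb T^k$. (b) If in addition $\varphi$ is differentiable in $\mathbb R_+$ and $n\ge i$ for every $i\in\mathbb I_\ell$ such that $p_i>0$, then for every $\mathcal F$ as in (a), $E(\mathcal F)$ is a frame for $\mathcal W$.
   Context: Notation: $\mathbb R_+=[0,\infty)$; $\mathbb I_m=\{1,\dots,m\}$; $\mathbb T=[-1/2,1/2)$, and $\mathbb T^k$ carries Lebesgue measure $|\cdot|$. $\mathrm{Conv}(\mathbb R_+)$ is the set of convex functions $\varphi:\mathbb R_+\to\mathbb R_+$ and $\mathrm{Conv_s}(\mathbb R_+)$ the subset of strictly convex ones. A closed subspace $\mathcal W\subset L^2(\mathbb R^k)$ is shift invariant (SI) if $T_\ell f\in\mathcal W$ for all $f\in\mathcal W$ and $\ell\in\mathbb Z^k$, where $T_yf(x)=f(x-y)$. It is finitely generated (FSI) if there is a finite set $\mathcal A\subset L^2(\mathbb R^k)$ with $\mathcal W=\overline{\mathrm{span}}\{T_\ell f: f\in\mathcal A,\ \ell\in\mathbb Z^k\}$. $\Gamma:L^2(\mathbb R^k)\to L^2(\mathbb T^k,\ell^2(\mathbb Z^k))$ is the isometric isomorphism extending $\Gamma f(x)=(\hat f(x+\ell))_{\ell\in\mathbb Z^k}$ for $f\in L^1\cap L^2$, where $\hat f(x)=\int_{\mathbb R^k}f(y)e^{-2\pi i\langle y,x\rangle}dy$. If $\mathcal W$ is the SI subspace generated by a finite set $\{h_i\}_i$,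 its range function is $J_{\mathcal W}(x)=\mathrm{span}\{\Gamma h_i(x)\}_i\subset\ell^2(\mathbb Z^k)$ (a.e. $x$). It is independent of the generators up to null sets, and $\mathcal W=\{f: \Gamma f(x)\in J_{\mathcal W}(x)\text{ for a.e. }x\in\mathbb T^k\}$. For $\mathcal F=\{f_i\}_{i\in\mathbb I_n}\in\mathcal W^n$, $E(\mathcal F)=\{T_\ell f_i\}_{(\ell,i)\in\mathbb Z^k\times\mathbb I_n}$. It is a Bessel sequence if there is $b>0$ with $\sum_{\ell,i}|\langle f,T_\ell f_i\rangle|^2\le b\|f\|^2$ for all $f\in L^2(\mathbb R^k)$. It is a frame for $\mathcal W$ if there are $0<a\le b$ with $a\|f\|^2\le\sum_{\ell,i}|\langle f,T_\ell f_i\rangle|^2\le b\|f\|^2$ for all $f\in\mathcal W$. The frame operator is $S_{E(\mathcal F)}f=\sum_{\ell,i}\langle f,T_\ell f_i\rangle T_\ell f_i$. It acts fiberwise, $\Gamma(S_{E(\mathcal F)}f)(x)=[S_{E(\mathcal F)}]_x\,\Gamma f(x)$, with $[S_{E(\mathcal F)}]_x=S_{\Gamma\mathcal F(x)}:\xi\mapsto\sum_{i\in\mathbb I_n}\langle\xi,\Gamma f_i(x)\rangle\Gamma f_i(x)$ on $\ell^2(\mathbb Z^k)$. For a positive finite rank operator $T$, $(\lambda_j(T))_{j\in\mathbb N}$ denotes its eigenvalues, counting multiplicities, arranged in non-increasing order and completed with zeros. The function $x\mapsto(\lambda_j([S_{E(\mathcal F)}]_x))_{j\in\mathbb N}$ is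 the fine spectral structure. $\mathfrak B_\alpha(\mathcal W)=\{\mathcal F=\{f_i\}_{i\in\mathbb I_n}\in\mathcal W^n: E(\mathcal F)\text{ is a Bessel sequence and }\|f_i\|^2=\alpha_i,\ i\in\mathbb I_n\}$. Convex potential: for $\varphi\in\mathrm{Conv}(\mathbb R_+)$ and $E(\mathcal F)$ Bessel, $P_\varphi^{\mathcal W}(E(\mathcal F))=\int_{\mathbb T^k}\mathrm{tr}\big(\varphi(S_{\Gamma\mathcal F(x)})\,P_{J_{\mathcal W}(x)}\big)\,dx$, where $\varphi(\cdot)$ is functional calculus and $P_{J_{\mathcal W}(x)}$ is the orthogonal projection onto $J_{\mathcal W}(x)$; equivalently $\int_{\mathbb T^k}\sum_{j=1}^{d(x)}\varphi(\lambda_j([S_{E(\mathcal F)}]_x))\,dx$. *)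

theory Defs
  imports "HOL-Analysis.Analysis" "HOL-Library.Function_Algebras"
begin

section \<open>Complex vector spaces of functions\<close>

definition cscale :: "complex \<Rightarrow> ('a \<Rightarrow> complex) \<Rightarrow> 'a \<Rightarrow> complex" where
  "cscale c f = (\<lambda>x. c * f x)"

global_interpretation cfun: vector_space "cscale :: complex \<Rightarrow> ('a \<Rightarrow> complex) \<Rightarrow> 'a \<Rightarrow> complex"
  by unfold_locales (auto simp: cscale_def fun_eq_iff algebra_simps)


section \<open>The space of square integrable functions\<close>

text \<open>
  Elements are Lebesgue measurable functions rather than almost-everywhere classes. Every closed
  subspace in the sense below is saturated under equality almost everywhere, because
  \<open>L2_norm\<close> does not see null sets.
\<close>

definition L2 :: "(real^'k \<Rightarrow> complex) set" where
  "L2 = {f \<in> borel_measurable lebesgue. integrable lebesgue (\<lambda>x. (cmod (f x))\<^sup>2)}"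

definition L2_inner :: "(real^'k \<Rightarrow> complex) \<Rightarrow> (real^'k \<Rightarrow> complex) \<Rightarrow> complex" where
  "L2_inner f g = (LINT x|lebesgue. f x * cnj (g x))"

definition L2_norm :: "(real^'k \<Rightarrow> complex) \<Rightarrow> real" where
  "L2_norm f = sqrt (LINT x|lebesgue. (cmod (f x))\<^sup>2)"

definition L2_closure :: "(real^'k \<Rightarrow> complex) set \<Rightarrow> (real^'k \<Rightarrow> complex) set" where
  "L2_closure V = {f \<in> L2. \<forall>e>0. \<exists>g\<in>V. L2_norm (f - g) < e}"

definition closed_L2_subspace :: "(real^'k \<Rightarrow> complex) set \<Rightarrow> bool" where
  "closed_L2_subspace W \<longleftrightarrow> W \<subseteq> L2 \<and> cfun.subspace W \<and> L2_closure W \<subseteq> W"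


section \<open>Shift invariant subspaces\<close>

definition lattice_vec :: "int^'k \<Rightarrow> real^'k" where
  "lattice_vec l = (\<chi> i. of_int (l $ i))"

definition translate :: "real^'k \<Rightarrow> (real^'k \<Rightarrow> complex) \<Rightarrow> real^'k \<Rightarrow> complex" where
  "translate y f = (\<lambda>x. f (x - y))"

definition shift_invariant :: "(real^'k \<Rightarrow> complex) set \<Rightarrow> bool" where
  "shift_invariant W \<longleftrightarrow>
     closed_L2_subspace W \<and> (\<forall>f\<in>W. \<forall>l. translate (lattice_vec l) f \<in> W)"

definition si_span :: "(real^'k \<Rightarrow> complex) set \<Rightarrow> (real^'k \<Rightarrow> complex) set" where
  "si_span A = L2_closure (cfun.span {translate (lattice_vec l) f |l f. f \<in> A})"

definition finitely_generated_si :: "(real^'k \<Rightarrow> complex) set \<Rightarrow> bool" where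
  "finitely_generated_si W \<longleftrightarrow>
     shift_invariant W \<and> (\<exists>A. finite A \<and> A \<subseteq> L2 \<and> W = si_span A)"


section \<open>Fiberization and range functions\<close>

definition torus :: "(real^'k) set" where
  "torus = {x. \<forall>i. -1/2 \<le> x $ i \<and> x $ i < 1/2}"

definition fourier :: "(real^'k \<Rightarrow> complex) \<Rightarrow> real^'k \<Rightarrow> complex" where
  "fourier f x = (LINT y|lebesgue. f y * exp (- 2 * of_real pi * \<i> * of_real (y \<bullet> x)))"

text \<open>
  The extension of the Fourier transform from integrable square integrable functions to \<open>L2\<close>
  by closing its graph. By Plancherel's theorem such a function exists for every element of
  \<open>L2\<close> and is unique up to a null set; a representative is chosen.
\<close>

definition L2_fourier :: "(real^'k \<Rightarrow> complex) \<Rightarrow> real^'k \<Rightarrow> complex" where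
  "L2_fourier f = (SOME g. g \<in> L2 \<and>
     (\<exists>h. (\<forall>m::nat. h m \<in> L2 \<and> integrable lebesgue (h m)) \<and>
          (\<lambda>m. L2_norm (h m - f)) \<longlonglongrightarrow> 0 \<and>
          (\<lambda>m. L2_norm (fourier (h m) - g)) \<longlonglongrightarrow> 0))"

definition Gam :: "(real^'k \<Rightarrow> complex) \<Rightarrow> real^'k \<Rightarrow> int^'k \<Rightarrow> complex" where
  "Gam f x = (\<lambda>l. L2_fourier f (x + lattice_vec l))"

text \<open>A range function is determined by the space only up to null sets.\<close>

definition is_range_function ::
    "(real^'k \<Rightarrow> complex) set \<Rightarrow> (real^'k \<Rightarrow> (int^'k \<Rightarrow> complex) set) \<Rightarrow> bool" where
  "is_range_function W J \<longleftrightarrow> (\<exists>A. finite A \<and> A \<subseteq> L2 \<and> W = si_span A \<and>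
     (AE x in lebesgue. x \<in> torus \<longrightarrow> J x = cfun.span ((\<lambda>h. Gam h x) ` A)))"


section \<open>Operators on the space of square summable families\<close>

definition ell2 :: "('a \<Rightarrow> complex) set" where
  "ell2 = {\<xi>. (\<lambda>a. (cmod (\<xi> a))\<^sup>2) summable_on UNIV}"

definition ell2_inner :: "('a \<Rightarrow> complex) \<Rightarrow> ('a \<Rightarrow> complex) \<Rightarrow> complex" where
  "ell2_inner \<xi> \<eta> = (\<Sum>\<^sub>\<infinity>a. \<xi> a * cnj (\<eta> a))"

text \<open>The orthogonal projection onto a closed subspace of \<open>ell2\<close>.\<close>

definition ell2_proj :: "('a \<Rightarrow> complex) set \<Rightarrow> ('a \<Rightarrow> complex) \<Rightarrow> 'a \<Rightarrow> complex" where
  "ell2_proj V \<xi> = (THE \<eta>. \<eta> \<in> V \<and> (\<forall>v\<in>V. ell2_inner (\<xi> - \<eta>) v = 0))"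

definition unit_family :: "'a \<Rightarrow> 'a \<Rightarrow> complex" where
  "unit_family a = (\<lambda>b. if b = a then 1 else 0)"

definition ell2_trace :: "(('a \<Rightarrow> complex) \<Rightarrow> 'a \<Rightarrow> complex) \<Rightarrow> complex" where
  "ell2_trace T = (\<Sum>\<^sub>\<infinity>a. ell2_inner (T (unit_family a)) (unit_family a))"

definition eigenspace ::
    "(('a \<Rightarrow> complex) \<Rightarrow> 'a \<Rightarrow> complex) \<Rightarrow> real \<Rightarrow> ('a \<Rightarrow> complex) set" where
  "eigenspace T \<mu> = {\<xi> \<in> ell2. T \<xi> = cscale (of_real \<mu>) \<xi>}"

definition eigenvalues :: "(('a \<Rightarrow> complex) \<Rightarrow> 'a \<Rightarrow> complex) \<Rightarrow> real set" where
  "eigenvalues T = {\<mu>. \<exists>\<xi>\<in>eigenspace T \<mu>. \<xi> \<noteq> 0}"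

text \<open>
  For a positive finite rank operator: the non-zero eigenvalues in non-increasing order, each
  repeated according to its multiplicity, and the resulting sequence completed with zeros.
  The sequence is indexed from 1; \<open>eigval T 0\<close> is meaningless.
\<close>

definition eigenvalue_list :: "(('a \<Rightarrow> complex) \<Rightarrow> 'a \<Rightarrow> complex) \<Rightarrow> real list" where
  "eigenvalue_list T =
     concat (map (\<lambda>\<mu>. replicate (cfun.dim (eigenspace T \<mu>)) \<mu>)
                 (rev (sorted_list_of_set (eigenvalues T - {0}))))"

definition eigval :: "nat \<Rightarrow> (('a \<Rightarrow> complex) \<Rightarrow> 'a \<Rightarrow> complex) \<Rightarrow> real" where
  "eigval j T =
     (if j \<le> length (eigenvalue_list T) then eigenvalue_list T ! (j - 1) else 0)"

text \<open>
  Functional calculus for a positive finite rank operator, through its spectral decomposition.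
  The eigenvalue 0 and the projection onto the kernel are included in the sum.
\<close>

definition fun_calc ::
    "(real \<Rightarrow> real) \<Rightarrow> (('a \<Rightarrow> complex) \<Rightarrow> 'a \<Rightarrow> complex) \<Rightarrow> ('a \<Rightarrow> complex) \<Rightarrow> 'a \<Rightarrow> complex" where
  "fun_calc \<phi> T \<xi> =
     (\<Sum>\<mu>\<in>eigenvalues T. cscale (of_real (\<phi> \<mu>)) (ell2_proj (eigenspace T \<mu>) \<xi>))"


section \<open>Families of integer translates\<close>

text \<open>A family \<open>F\<close> of \<open>n\<close> functions is given by its values on \<open>{1..n}\<close>.\<close>

definition bessel :: "nat \<Rightarrow> (nat \<Rightarrow> real^'k \<Rightarrow> complex) \<Rightarrow> bool" where
  "bessel n F \<longleftrightarrow> (\<exists>b>0. \<forall>f\<in>L2.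
     (\<lambda>(l, i). (cmod (L2_inner f (translate (lattice_vec l) (F i))))\<^sup>2)
       summable_on (UNIV \<times> {1..n}) \<and>
     (\<Sum>\<^sub>\<infinity>(l, i)\<in>UNIV \<times> {1..n}. (cmod (L2_inner f (translate (lattice_vec l) (F i))))\<^sup>2)
       \<le> b * (L2_norm f)\<^sup>2)"

definition frame_for ::
    "(real^'k \<Rightarrow> complex) set \<Rightarrow> nat \<Rightarrow> (nat \<Rightarrow> real^'k \<Rightarrow> complex) \<Rightarrow> bool" where
  "frame_for W n F \<longleftrightarrow> (\<exists>a b. 0 < a \<and> a \<le> b \<and> (\<forall>f\<in>W.
     (\<lambda>(l, i). (cmod (L2_inner f (translate (lattice_vec l) (F i))))\<^sup>2)
       summable_on (UNIV \<times> {1..n}) \<and>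
     a * (L2_norm f)\<^sup>2
       \<le> (\<Sum>\<^sub>\<infinity>(l, i)\<in>UNIV \<times> {1..n}. (cmod (L2_inner f (translate (lattice_vec l) (F i))))\<^sup>2) \<and>
     (\<Sum>\<^sub>\<infinity>(l, i)\<in>UNIV \<times> {1..n}. (cmod (L2_inner f (translate (lattice_vec l) (F i))))\<^sup>2)
       \<le> b * (L2_norm f)\<^sup>2))"

text \<open>The action on the fiber over \<open>x\<close> of the frame operator of the translates of \<open>F\<close>.\<close>

definition frame_op_fiber ::
    "nat \<Rightarrow> (nat \<Rightarrow> real^'k \<Rightarrow> complex) \<Rightarrow> real^'k \<Rightarrow> (int^'k \<Rightarrow> complex) \<Rightarrow> int^'k \<Rightarrow> complex" where
  "frame_op_fiber n F x \<xi> =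
     (\<Sum>i\<in>{1..n}. cscale (ell2_inner \<xi> (Gam (F i) x)) (Gam (F i) x))"

definition bessel_prescribed ::
    "nat \<Rightarrow> (nat \<Rightarrow> real) \<Rightarrow> (real^'k \<Rightarrow> complex) set \<Rightarrow> (nat \<Rightarrow> real^'k \<Rightarrow> complex) set" where
  "bessel_prescribed n \<alpha> W =
     {F. (\<forall>i\<in>{1..n}. F i \<in> W \<and> (L2_norm (F i))\<^sup>2 = \<alpha> i) \<and> bessel n F}"


section \<open>Convex potentials\<close>

definition Conv :: "(real \<Rightarrow> real) set" where
  "Conv = {\<phi>. convex_on {0..} \<phi> \<and> (\<forall>x\<ge>0. 0 \<le> \<phi> x)}"

definition Conv_s :: "(real \<Rightarrow> real) set" where
  "Conv_s = {\<phi> \<in> Conv. \<forall>x\<ge>0. \<forall>y\<ge>0. \<forall>t. x \<noteq> y \<longrightarrow> 0 < t \<longrightarrow> t < 1 \<longrightarrow>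
     \<phi> ((1 - t) * x + t * y) < (1 - t) * \<phi> x + t * \<phi> y}"

text \<open>
  For a Bessel family the spectra of the fibers are essentially bounded, hence the integrand is
  bounded and the integral is finite for every convex \<open>\<phi>\<close>.
\<close>

definition convex_potential ::
    "(real \<Rightarrow> real) \<Rightarrow> (real^'k \<Rightarrow> (int^'k \<Rightarrow> complex) set) \<Rightarrow>
     nat \<Rightarrow> (nat \<Rightarrow> real^'k \<Rightarrow> complex) \<Rightarrow> real" where
  "convex_potential \<phi> J n F =
     (LINT x:torus|lebesgue.
        Re (ell2_trace (\<lambda>\<xi>. fun_calc \<phi> (frame_op_fiber n F x) (ell2_proj (J x) \<xi>))))"

end

theory Submission
  imports Defs "HOL-Computational_Algebra.Fundamental_Theorem_Algebra" "HOL-Probability.Characteristic_Functions"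
begin

text \<open>
  On the Fourier side a shift invariant space is a closed module over the periodic functions, so
  Gram--Schmidt in the fibers yields measurable orthonormal fiber bases with coefficients in the
  module. The spectrum and the fiber norms of a Bessel family, averaged over the set where the fiber
  dimension is \<open>i\<close>, satisfy the Schur--Horn inequalities, and Jensen's inequality bounds the
  potential from below by its value at the averages. The averages range over a compact convex set;
  a minimizer there is realised by constant matrices in the fiber bases (Schur--Horn). Strict
  convexity gives uniqueness of the minimizer and equality in Jensen; it also rules out
  \<open>\<psi> i j = 0\<close> for \<open>j \<le> n\<close>, since a vanishing eigenvalue could be increased at the cost of a
  larger one.
\<close>

text \<open>Three obstacles shape the proof. A convex function on a closed half-line may jump at 0,
  so the potential can fail to be lower semicontinuous on the compact feasible set. The minimum is
  therefore taken for the continuous part of \<open>phi\<close>, ties are broken by the sum of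
  squares, and the exchange argument behind the positivity of the eigenvalues shows that the
  selected point has only the unavoidable zeros. Secondly, eigenvectors depend on the fiber in no
  controlled way. The eigenvalues are nevertheless measurable, because the traces of the powers of
  the Gram matrix are; and averaging is harmless, because the conditions relating ordered
  eigenvalues to norms are linear. Thirdly, generators may be modified only inside the given space.
  That multiplication by a measurable periodic function stays inside it, as long as the product is
  square integrable, is deduced from the invariance under characters alone; the same fact also
  yields the completeness of the exponentials on the torus, hence the Parseval identity that links
  Bessel bounds to fiber norms.\<close>

abbreviation leb_meas :: "('a::euclidean_space => 'b::topological_space) set" where
 "leb_meas == borel_measurable lebesgue"

abbreviation (input) seq_lim (infixr "---->" 60) where "X ----> L == X \<longlonglongrightarrow> L"

section \<open>The finite-dimensional optimization problem\<close>

text \<open>The Schur-Horn conditions with weights: \<open>a i r\<close> stands for the mean squared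
  fiber norm of generator \<open>r\<close> on the set of dimension \<open>i\<close>,
  \<open>psi i\<close> for the eigenvalues there, \<open>p i\<close> for its measure. The partial
  sums run over all subsets \<open>T\<close> instead of a sorted list, which keeps every condition
  linear in \<open>a\<close> and \<open>psi\<close>. The prescribed zeros outside the index range
  help to bound the feasible set and turn uniqueness into an equality of functions.\<close>

definition feasible ::
 "nat set => (nat => real) => nat => (nat => real) => (nat => nat => real) => (nat => nat => real) => bool" where
 "feasible R p n alp a psi \<longleftrightarrow>
   (\<forall>i r. 0 <= a i r & (i ~: R \<or> r ~: {1..n} --> a i r = 0)) \<and>
   (\<forall>i j. 0 <= psi i j & (i ~: R \<or> j ~: {1..i} --> psi i j = 0)) \<and>
   (\<forall>i. \<forall>j\<ge>1. psi i (Suc j) <= psi i j) \<and>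
   (\<forall>i. \<forall>T\<subseteq>{1..n}. (\<Sum>r\<in>T. a i r) <= (\<Sum>j\<in>{1..card T}. psi i j)) \<and>
   (\<forall>i. (\<Sum>r\<in>{1..n}. a i r) = (\<Sum>j\<in>{1..i}. psi i j)) \<and>
   (\<forall>r\<in>{1..n}. (\<Sum>i\<in>R. p i * a i r) = alp r)"

definition potential ::
 "nat set => (nat => real) => (real => real) => (nat => nat => real) => real" where
 "potential R p phi psi = (\<Sum>i\<in>R. p i * (\<Sum>j\<in>{1..i}. phi (psi i j)))"

lemma feasibleI:
 assumes "!!i r. 0 <= a i r" "!!i r. i ~: R \<or> r ~: {1..n} ==> a i r = 0"
  and "!!i j. 0 <= psi i j" "!!i j. i ~: R \<or> j ~: {1..i} ==> psi i j = 0"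
  and "!!i j. 1 <= j ==> psi i (Suc j) <= psi i j"
  and "!!i T. T <= {1..n} ==> (\<Sum>r\<in>T. a i r) <= (\<Sum>j\<in>{1..card T}. psi i j)"
  and "!!i. (\<Sum>r\<in>{1..n}. a i r) = (\<Sum>j\<in>{1..i}. psi i j)"
  and "!!r. r : {1..n} ==> (\<Sum>i\<in>R. p i * a i r) = alp r"
 shows "feasible R p n alp a psi"
 unfolding feasible_def using assms by simp

lemma feasibleD:
 assumes "feasible R p n alp a psi"
 shows "0 <= a i r" "i ~: R \<or> r ~: {1..n} ==> a i r = 0"
  and "0 <= psi i j" "i ~: R \<or> j ~: {1..i} ==> psi i j = 0"
  and "1 <= j ==> psi i (Suc j) <= psi i j"
  and "T <= {1..n} ==> (\<Sum>r\<in>T. a i r) <= (\<Sum>j\<in>{1..card T}. psi i j)"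
  and "(\<Sum>r\<in>{1..n}. a i r) = (\<Sum>j\<in>{1..i}. psi i j)"
  and "r : {1..n} ==> (\<Sum>i\<in>R. p i * a i r) = alp r"
 using assms unfolding feasible_def by simp_all

lemma sum_fun_upd:
 fixes g :: "'b => real"
 assumes "finite A"
 shows "(\<Sum>j\<in>A. g ((f(k := v)) j)) = (\<Sum>j\<in>A. g (f j)) + (if k : A then g v - g (f k) else 0)"
proof (cases "k : A")
 case True
 have "(\<Sum>j\<in>A. g ((f(k := v)) j)) = g v + (\<Sum>j\<in>A-{k}. g (f j))"
  using assms True by (subst sum.remove[of _ k]) (auto intro!: sum.cong)
 also have "... = (\<Sum>j\<in>A. g (f j)) + (g v - g (f k))"
  using assms True by (subst (2) sum.remove[of _ k]) auto
 finally show ?thesis using True by simp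
next
 case False
 then show ?thesis by (auto intro!: sum.cong)
qed

lemma potential_fun_upd:
 assumes "finite R" "i : R"
 shows "potential R p phi (psi(i := g)) =
  potential R p phi psi + p i * ((\<Sum>j\<in>{1..i}. phi (g j)) - (\<Sum>j\<in>{1..i}. phi (psi i j)))"
proof -
 have "potential R p phi (psi(i := g)) = p i * (\<Sum>j\<in>{1..i}. phi (g j)) +
   (\<Sum>i'\<in>R-{i}. p i' * (\<Sum>j\<in>{1..i'}. phi (psi i' j)))"
  unfolding potential_def using assms by (subst sum.remove[of _ i]) (auto intro!: sum.cong)
 moreover have "potential R p phi psi = p i * (\<Sum>j\<in>{1..i}. phi (psi i j)) +
   (\<Sum>i'\<in>R-{i}. p i' * (\<Sum>j\<in>{1..i'}. phi (psi i' j)))"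
  unfolding potential_def using assms by (subst sum.remove[of _ i]) auto
 ultimately show ?thesis by (simp add: algebra_simps)
qed

text \<open>Both quotients are compared with the slope of the chord over \<open>{0..y}\<close>. The
  estimate is what makes moving mass from a positive eigenvalue to a vanishing one harmless for a
  convex potential, and it tolerates a jump of \<open>phi\<close> at 0.\<close>

lemma convex_on_slope_transfer:
 fixes phi :: "real => real"
 assumes "convex_on {0..} phi" "0 < s" "s <= y" "0 < t" "t <= y"
 shows "(phi s - phi 0) / s <= (phi y - phi (y - t)) / t"
proof -
 have "(phi s - phi 0) / s <= (phi y - phi 0) / y"
 proof (cases "s = y")
  case False
  then have "(phi 0 - phi s) / (0 - s) <= (phi 0 - phi y) / (0 - y)"
   using assms False by (intro convex_on_slope_le) auto
  then show ?thesis by (metis diff_0 minus_diff_eq minus_divide_divide)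
 qed auto
 also have "... <= (phi y - phi (y - t)) / t"
 proof (cases "t = y")
  case False
  then have "(phi 0 - phi y) / (0 - y) <= (phi (y - t) - phi y) / ((y - t) - y)"
   using assms False by (intro convex_on_slope_le(2)) auto
  moreover have "(y - t) - y = - t" by simp
  ultimately show ?thesis by (metis diff_0 minus_diff_eq minus_divide_divide)
 qed auto
 finally show ?thesis .
qed

lemma feasible_mono:
 assumes "feasible R p n alp a psi" "1 <= j" "j <= k"
 shows "psi i k <= psi i j"
 using assms(3)
proof (induction rule: dec_induct)
 case (step m)
 have "psi i (Suc m) <= psi i m" using assms step unfolding feasible_def by auto
 then show ?case using step by linarith
qed auto

text \<open>The counterpart of the fact that \<open>n\<close> vectors span at most \<open>n\<close>
  dimensions: the full set \<open>T = {1..n}\<close> shows that the first \<open>n\<close>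
  eigenvalues already carry the whole sum, so nothing is left for later ones.\<close>

lemma feasible_zero_beyond:
 assumes "feasible R p n alp a psi" "n < j"
 shows "psi i j = 0"
proof -
 have nn: "!!j. 0 <= psi i j" and z: "!!j. j ~: {1..i} ==> psi i j = 0"
  using assms unfolding feasible_def by auto
 have "(\<Sum>r\<in>{1..n}. a i r) <= (\<Sum>j\<in>{1..n}. psi i j)"
  using assms(1) unfolding feasible_def by (metis card_atLeastAtMost diff_Suc_1 subset_refl)
 then have le: "(\<Sum>j\<in>{1..i}. psi i j) <= (\<Sum>j\<in>{1..n}. psi i j)"
  using assms(1) unfolding feasible_def by auto
 show ?thesis
 proof (cases "j : {1..i}")
  case True
  have "(\<Sum>j\<in>{1..n}. psi i j) + psi i j = (\<Sum>j\<in>insert j {1..n}. psi i j)"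
   using assms(2) by (subst sum.insert) auto
  also have "... <= (\<Sum>j\<in>{1..i}. psi i j)"
   using True assms(2) by (intro sum_mono2) (auto simp: nn)
  finally show ?thesis using le nn[of j] by linarith
 qed (use z in auto)
qed

text \<open>The exchange argument. Let \<open>q\<close> be the first vanishing eigenvalue at
  \<open>i0\<close>. If at least \<open>q\<close> generators are nonzero there, mass goes from
  eigenvalue \<open>q - 1\<close> to \<open>q\<close> with all norms kept. Otherwise some generator
  vanishes at \<open>i0\<close> and lives at another \<open>i1\<close>; part of it is moved from
  \<open>i1\<close> to \<open>i0\<close> at the cost of the last positive eigenvalue at
  \<open>i1\<close>. The new point does not depend on \<open>phi\<close>, so it serves several
  convex functions at once; squares make the gain strict.\<close>

lemma feasible_improve:
 assumes feas: "feasible R p n alp a psi" and fin: "finite R" and p: "!!i. i : R ==> 0 < p i"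
  and alp: "!!r. r : {1..n} ==> 0 < alp r"
  and i0: "i0 : R" "j0 : {1..i0}" "j0 <= n" "psi i0 j0 = 0"
 obtains a' psi' where "feasible R p n alp a' psi'"
  and "!!phi. convex_on {0..} phi ==> potential R p phi psi' <= potential R p phi psi"
  and "potential R p (%x. x\<^sup>2) psi' < potential R p (%x. x\<^sup>2) psi"
proof -
 note F = feas[unfolded feasible_def]
 have ann: "!!i r. 0 <= a i r" and psinn: "!!i j. 0 <= psi i j"
  and maj: "!!i T. T <= {1..n} ==> (\<Sum>r\<in>T. a i r) <= (\<Sum>j\<in>{1..card T}. psi i j)"
  and tot: "!!i. (\<Sum>r\<in>{1..n}. a i r) = (\<Sum>j\<in>{1..i}. psi i j)"
  and psi0: "!!i j. i ~: R \<or> j ~: {1..i} ==> psi i j = 0"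
  and a0: "!!i r. i ~: R \<or> r ~: {1..n} ==> a i r = 0"
  and wsum: "!!r. r\<in>{1..n} ==> (\<Sum>i\<in>R. p i * a i r) = alp r"
  using F by auto
 define q where "q = (LEAST j. 1 <= j & psi i0 j = 0)"
 have q: "1 <= q" "psi i0 q = 0" unfolding q_def using i0 by (metis (mono_tags, lifting) LeastI atLeastAtMost_iff)+
 have qle: "q <= j0" unfolding q_def using i0 by (intro Least_le) auto
 have qi: "q <= i0" "q <= n" using qle i0 by auto
 have below: "psi i0 j > 0" if "1 <= j" "j < q" for j
  using not_less_Least[of j "%j. 1 <= j & psi i0 j = 0"] that psinn[of i0 j] unfolding q_def by fastforce
 have above: "psi i0 j = 0" if "q <= j" for j
  using feasible_mono[OF feas q(1) that, of i0] q(2) psinn[of i0 j] by linarith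
 define N where "N = {r\<in>{1..n}. 0 < a i0 r}"
 have finN: "finite N" "N <= {1..n}" unfolding N_def by auto
 have aN: "a i0 r = 0" if "r ~: N" for r
  using that a0[of i0 r] ann[of i0 r] unfolding N_def by force
 have totN: "(\<Sum>r\<in>N. a i0 r) = (\<Sum>r\<in>{1..n}. a i0 r)"
  by (rule sum.mono_neutral_left) (use finN aN in auto)
 have totq: "(\<Sum>j\<in>{1..k}. psi i0 j) = (\<Sum>j\<in>{1..i0}. psi i0 j)" if "q - 1 <= k" for k
 proof -
  have "(\<Sum>j\<in>{1..k}. psi i0 j) = (\<Sum>j\<in>{1..q-1}. psi i0 j)"
   by (rule sum.mono_neutral_right) (use that above in auto)
  also have "... = (\<Sum>j\<in>{1..i0}. psi i0 j)"
   by (rule sum.mono_neutral_left) (use qi above in auto)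
  finally show ?thesis .
 qed
 show thesis
 proof (cases "q <= card N")
  case True
  have q1: "q ~= 1"
  proof
   assume "q = 1"
   then have "(\<Sum>r\<in>N. a i0 r) = 0" using totN tot[of i0] totq[of 0] by auto
   moreover have "N ~= {}" using True q by auto
   ultimately show False using finN
    by (metis (mono_tags, lifting) N_def less_irrefl mem_Collect_eq sum_pos)
  qed
  define r where "r = q - 1"
  have r: "1 <= r" "q = Suc r" using q q1 unfolding r_def by auto
  \<comment> \<open>Among the partial sums only that of the first \<open>r\<close> eigenvalues
    drops, by \<open>ep\<close>. A set \<open>T\<close> of \<open>r\<close> elements omits some
    element of \<open>N\<close>, since \<open>N\<close> has at least \<open>Suc r\<close>, and the
    weight of that element, at least \<open>dl\<close>, is the slack that absorbs the drop.\<close>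
  define dl where "dl = Min (a i0 ` N)"
  have Nne: "N ~= {}" using True q by auto
  have dl: "dl > 0" "!!s. s : N ==> dl <= a i0 s" unfolding dl_def using finN Nne by (auto simp: N_def)
  \<comment> \<open>Half of \<open>psi i0 r\<close> keeps the two new eigenvalues in decreasing
    order.\<close>
  define ep where "ep = min dl (psi i0 r / 2)"
  have ep: "0 < ep" "ep <= dl" "ep <= psi i0 r / 2" unfolding ep_def using dl below[of r] r by auto
  define g where "g = (psi i0)(r := psi i0 r - ep, q := ep)"
  have gsum: "(\<Sum>j\<in>A. phi (g j)) = (\<Sum>j\<in>A. phi (psi i0 j)) + (if r : A then phi (psi i0 r - ep) - phi (psi i0 r) else 0)
    + (if q : A then phi ep - phi 0 else 0)" if "finite A" for A and phi :: "real => real"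
   unfolding g_def using r q by (simp add: sum_fun_upd[OF that] del: fun_upd_apply) (simp add: fun_upd_def)
  have gsum1: "(\<Sum>j\<in>{1..k}. g j) = (\<Sum>j\<in>{1..k}. psi i0 j) - (if k = r then ep else 0)" for k
   using gsum[of "{1..k}" "%x. x"] r by auto
  have gmaj: "(\<Sum>s\<in>T. a i0 s) <= (\<Sum>j\<in>{1..card T}. g j)" if T: "T <= {1..n}" for T
  proof (cases "card T = r")
   case False
   then show ?thesis using maj[OF T, of i0] gsum1[of "card T"] by auto
  next
   case eq: True
   have finT: "finite T" using T finite_subset by blast
   obtain s where s: "s : N" "s ~: T"
    using True eq r finT by (metis card_mono not_less_eq_eq subsetI)
   have "(\<Sum>s\<in>T. a i0 s) + a i0 s = (\<Sum>s\<in>insert s T. a i0 s)"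
    using s finT by simp
   also have "... <= (\<Sum>s\<in>{1..n}. a i0 s)"
    using s T finN ann by (intro sum_mono2) auto
   also have "... = (\<Sum>j\<in>{1..r}. psi i0 j)"
    using tot[of i0] totq[of r] r by auto
   finally show ?thesis using ep dl(2)[OF s(1)] gsum1[of r] eq by auto
  qed
  have gmono: "g (Suc j) <= g j" if "1 <= j" for j
  proof -
   have "psi i0 (Suc j) <= psi i0 j" using feasible_mono[OF feas that] by auto
   moreover have "psi i0 (Suc q) = 0" using above by auto
   ultimately show ?thesis using ep r unfolding g_def by auto
  qed
  show thesis
  proof (rule that[of a "psi(i0 := g)"])
   have "(\<Sum>j\<in>{1..i0}. g j) = (\<Sum>j\<in>{1..i0}. psi i0 j)"
    using gsum1[of i0] qi r by auto
   moreover have "0 <= g j" "j ~: {1..i0} ==> g j = 0" for j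
    using psinn[of i0] psi0[of i0 j] ep below[of r] qi r unfolding g_def by auto
   ultimately show "feasible R p n alp a (psi(i0 := g))"
    unfolding feasible_def using F gmono gmaj i0(1) by auto
   have pot: "potential R p phi (psi(i0 := g)) = potential R p phi psi +
     p i0 * (phi (psi i0 r - ep) - phi (psi i0 r) + (phi ep - phi 0))" for phi
    using potential_fun_upd[OF fin i0(1), of p phi psi g] gsum[of "{1..i0}" phi] qi r by simp
   show "potential R p phi (psi(i0 := g)) <= potential R p phi psi" if "convex_on {0..} phi" for phi
   proof -
    have "(phi ep - phi 0) / ep <= (phi (psi i0 r) - phi (psi i0 r - ep)) / ep"
     using ep by (intro convex_on_slope_transfer that) auto
    then have "phi (psi i0 r - ep) - phi (psi i0 r) + (phi ep - phi 0) <= 0"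
     using ep by (simp add: divide_right_mono_neg divide_le_cancel)
    then show ?thesis using pot[of phi] p[OF i0(1)] by (simp add: mult_nonneg_nonpos)
   qed
   have "(psi i0 r - ep)\<^sup>2 - (psi i0 r)\<^sup>2 + (ep\<^sup>2 - 0\<^sup>2) = 2 * ep * (ep - psi i0 r)"
    by (simp add: power2_eq_square algebra_simps)
   also have "... < 0" using ep by (intro mult_pos_neg) auto
   finally show "potential R p (%x. x\<^sup>2) (psi(i0 := g)) < potential R p (%x. x\<^sup>2) psi"
    using pot[of "%x. x\<^sup>2"] p[OF i0(1)] by (simp add: mult_pos_neg)
  qed
 next
  case False
  then have "card N < n" using qi by auto
  then obtain r0 where r0: "r0 : {1..n}" "a i0 r0 = 0"
   using finN aN by (metis card_atLeastAtMost card_mono diff_Suc_1 leD subsetI)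
  have "(\<Sum>i\<in>R. p i * a i r0) > 0" using wsum[OF r0(1)] alp[OF r0(1)] by auto
  then obtain i1 where i1: "i1 : R" "a i1 r0 > 0"
   by (metis (no_types, lifting) ann less_eq_real_def mult_zero_right sum.neutral less_irrefl)
  then have neq: "i1 ~= i0" using r0 by auto
  define k where "k = Max {j\<in>{1..i1}. 0 < psi i1 j}"
  have "(\<Sum>j\<in>{1..i1}. psi i1 j) >= a i1 r0"
   using tot[of i1] r0 ann by (metis finite_atLeastAtMost member_le_sum)
  then have "(\<Sum>j\<in>{1..i1}. psi i1 j) ~= 0" using i1 by auto
  then have "{j\<in>{1..i1}. 0 < psi i1 j} ~= {}"
   using psinn[of i1] by (metis (mono_tags, lifting) empty_iff less_eq_real_def mem_Collect_eq sum.neutral)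
  then have "k : {j\<in>{1..i1}. 0 < psi i1 j}" unfolding k_def by (intro Max_in) auto
  then have k: "1 <= k" "k <= i1" "0 < psi i1 k" by auto
  have kabove: "psi i1 j = 0" if "k < j" for j
  proof (rule ccontr)
   assume "psi i1 j ~= 0"
   then have "j : {j\<in>{1..i1}. 0 < psi i1 j}" using psi0[of i1 j] psinn[of i1 j] by fastforce
   then have "j <= k" unfolding k_def by (intro Max_ge) auto
   then show False using that by auto
  qed
  define l where "l = psi i1 k"
  \<comment> \<open>\<open>B\<close> is the eigenvalue preceding the one to be raised; for
    \<open>q = 1\<close> there is none and any positive number will do. The common mass
    \<open>t\<close> is divided by the measures, so that the weighted norm of \<open>r0\<close> is
    unchanged. Its four bounds keep \<open>a' i1 r0\<close> nonnegative, make both increments at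
    most half of \<open>l\<close>, which is enough for the slope comparison and the strict gain, and
    keep the raised eigenvalue below its predecessor.\<close>
  define B where "B = (if q = 1 then 1 else psi i0 (q - 1))"
  have B: "B > 0" unfolding B_def using below[of "q - 1"] q by auto
  define t where "t = Min {p i1 * a i1 r0, p i1 * l / 2, p i0 * l / 2, p i0 * B}"
  define s0 where "s0 = t / p i0"
  define s1 where "s1 = t / p i1"
  have pp: "p i0 > 0" "p i1 > 0" using p i0 i1 by auto
  have lpos: "l > 0" using k l_def by auto
  have tpos: "t > 0" unfolding t_def using pp i1 lpos B by auto
  have t: "t <= p i1 * a i1 r0" "t <= p i1 * l / 2" "t <= p i0 * l / 2" "t <= p i0 * B"
   unfolding t_def by auto
  have s: "s0 > 0" "s1 > 0" "s1 <= a i1 r0" "s1 <= l / 2" "s0 <= l / 2" "s0 <= B"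
   using t pp tpos unfolding s0_def s1_def by (auto simp: field_simps)
  have ps: "p i0 * s0 = t" "p i1 * s1 = t" using pp unfolding s0_def s1_def by auto
  define a' where "a' = a(i0 := (a i0)(r0 := s0), i1 := (a i1)(r0 := a i1 r0 - s1))"
  define psi' where "psi' = psi(i0 := (psi i0)(q := s0), i1 := (psi i1)(k := l - s1))"
  have a'sum0: "(\<Sum>r\<in>T. a' i0 r) = (\<Sum>r\<in>T. a i0 r) + (if r0 : T then s0 else 0)" if "finite T" for T
   unfolding a'_def using neq r0 sum_fun_upd[OF that, of "%x. x" "a i0" r0 s0] by simp
  have a'sum1: "(\<Sum>r\<in>T. a' i1 r) = (\<Sum>r\<in>T. a i1 r) - (if r0 : T then s1 else 0)" if "finite T" for T
   unfolding a'_def using sum_fun_upd[OF that, of "%x. x" "a i1" r0 "a i1 r0 - s1"] by simp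
  have psum0: "(\<Sum>j\<in>T. psi' i0 j) = (\<Sum>j\<in>T. psi i0 j) + (if q : T then s0 else 0)" if "finite T" for T
   unfolding psi'_def using neq q sum_fun_upd[OF that, of "%x. x" "psi i0" q s0] by simp
  have psum1: "(\<Sum>j\<in>T. psi' i1 j) = (\<Sum>j\<in>T. psi i1 j) - (if k : T then s1 else 0)" if "finite T" for T
   unfolding psi'_def using sum_fun_upd[OF that, of "%x. x" "psi i1" k "l - s1"] l_def by simp
  \<comment> \<open>If \<open>r0\<close> is in \<open>T\<close>, then \<open>T - {r0}\<close> has
    the same old sum with one element less. This leaves eigenvalue number \<open>card T\<close> as
    slack: either the range up to it contains the raised one, or it is itself at least
    \<open>s0\<close>.\<close>
  have maj0: "(\<Sum>r\<in>T. a' i0 r) <= (\<Sum>j\<in>{1..card T}. psi' i0 j)" if T: "T <= {1..n}" for T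
  proof -
   have finT: "finite T" using T finite_subset by blast
   show ?thesis
   proof (cases "r0 : T")
    case False
    then show ?thesis using a'sum0[OF finT] psum0[of "{1..card T}"] maj[OF T, of i0] s by auto
   next
    case r0T: True
    define c where "c = card (T - {r0})"
    have c: "card T = Suc c" unfolding c_def using r0T finT by (metis card.remove)
    have "(\<Sum>r\<in>T. a i0 r) = (\<Sum>r\<in>T-{r0}. a i0 r)" using r0T finT r0 by (subst sum.remove[of _ r0]) auto
    also have "... <= (\<Sum>j\<in>{1..c}. psi i0 j)" unfolding c_def by (rule maj) (use T in auto)
    finally have A: "(\<Sum>r\<in>T. a i0 r) <= (\<Sum>j\<in>{1..c}. psi i0 j)" .
    show ?thesis
    proof (cases "q <= Suc c")
     case True
     then have "(\<Sum>j\<in>{1..Suc c}. psi' i0 j) = (\<Sum>j\<in>{1..c}. psi i0 j) + psi i0 (Suc c) + s0"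
      using psum0[of "{1..Suc c}"] q by simp
     then show ?thesis using A a'sum0[OF finT] r0T c psinn[of i0 "Suc c"] by simp
    next
     case False
     then have "(\<Sum>j\<in>{1..Suc c}. psi' i0 j) = (\<Sum>j\<in>{1..c}. psi i0 j) + psi i0 (Suc c)"
      using psum0[of "{1..Suc c}"] q by simp
     moreover have "psi i0 (Suc c) >= s0"
     proof -
      have "psi i0 (q - 1) <= psi i0 (Suc c)"
       using False by (intro feasible_mono[OF feas]) auto
      then show ?thesis using False s B_def by (auto split: if_splits)
     qed
     ultimately show ?thesis using A a'sum0[OF finT] r0T c by simp
    qed
   qed
  qed
  have tot1: "(\<Sum>r\<in>{1..n}. a' i1 r) = (\<Sum>j\<in>{1..i1}. psi' i1 j)"
   using a'sum1[of "{1..n}"] psum1[of "{1..i1}"] tot[of i1] r0 k by auto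
  have a'nn: "0 <= a' i r" for i r unfolding a'_def using ann s by auto
  \<comment> \<open>From \<open>card T >= k\<close> on the right side is the full trace at
    \<open>i1\<close>, because all later eigenvalues vanish.\<close>
  have maj1: "(\<Sum>r\<in>T. a' i1 r) <= (\<Sum>j\<in>{1..card T}. psi' i1 j)" if T: "T <= {1..n}" for T
  proof (cases "k <= card T")
   case False
   have finT: "finite T" using T finite_subset by blast
   show ?thesis using False a'sum1[OF finT] psum1[of "{1..card T}"] maj[OF T, of i1] s by auto
  next
   case True
   have "(\<Sum>r\<in>T. a' i1 r) <= (\<Sum>r\<in>{1..n}. a' i1 r)" using T a'nn by (intro sum_mono2) auto
   also have "... = (\<Sum>j\<in>{1..i1}. psi' i1 j)" by (rule tot1)
   also have "... = (\<Sum>j\<in>{1..k}. psi' i1 j)"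
    by (rule sum.mono_neutral_right) (use k kabove in \<open>auto simp: psi'_def\<close>)
   also have "... = (\<Sum>j\<in>{1..card T}. psi' i1 j)"
    by (rule sum.mono_neutral_left) (use True kabove in \<open>auto simp: psi'_def\<close>)
   finally show ?thesis .
  qed
  have mono1: "psi' i1 (Suc j) <= psi' i1 j" if "1 <= j" for j
   using feasible_mono[OF feas that, of "Suc j" i1] kabove[of "Suc k"] s k that psinn[of i1 "Suc j"]
   unfolding psi'_def l_def by auto
  have mono0: "psi' i0 (Suc j) <= psi' i0 j" if "1 <= j" for j
   using feasible_mono[OF feas that, of "Suc j" i0] above[of "Suc q"] s that q B_def
   unfolding psi'_def by (auto simp: neq[symmetric] split: if_splits)
  have other: "a' i = a i" "psi' i = psi i" if "i ~= i0" "i ~= i1" for i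
   using that unfolding a'_def psi'_def by auto
  have psi'nn: "0 <= psi' i j" for i j unfolding psi'_def using psinn s by auto
  have zero1: "a' i r = 0" if "i ~: R \<or> r ~: {1..n}" for i r
   using that a0[of i r] r0 i0 i1 unfolding a'_def by auto
  have zero2: "psi' i j = 0" if "i ~: R \<or> j ~: {1..i}" for i j
   using that psi0[of i j] k q qi i0 i1 unfolding psi'_def by auto
  have tot0: "(\<Sum>r\<in>{1..n}. a' i0 r) = (\<Sum>j\<in>{1..i0}. psi' i0 j)"
   using a'sum0[of "{1..n}"] psum0[of "{1..i0}"] tot[of i0] r0 q qi by auto
  have w': "(\<Sum>i\<in>R. p i * a' i r) = alp r" if "r : {1..n}" for r
  proof -
   have "(\<Sum>i\<in>R. p i * a' i r) = p i0 * a' i0 r + (p i1 * a' i1 r + (\<Sum>i\<in>R-{i0}-{i1}. p i * a' i r))"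
    using fin i0 i1 neq by (subst sum.remove[of _ i0], simp, simp, subst sum.remove[of _ i1]) auto
   also have "(\<Sum>i\<in>R-{i0}-{i1}. p i * a' i r) = (\<Sum>i\<in>R-{i0}-{i1}. p i * a i r)"
    by (rule sum.cong) (use other in auto)
   also have "p i0 * a' i0 r + (p i1 * a' i1 r + (\<Sum>i\<in>R-{i0}-{i1}. p i * a i r)) =
     p i0 * a i0 r + (p i1 * a i1 r + (\<Sum>i\<in>R-{i0}-{i1}. p i * a i r))"
    using ps neq r0 unfolding a'_def by (auto simp: algebra_simps)
   also have "... = (\<Sum>i\<in>R. p i * a i r)"
    using fin i0 i1 neq by (subst (2) sum.remove[of _ i0], simp, simp, subst (2) sum.remove[of _ i1]) auto
   finally show ?thesis using wsum[OF that] by simp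
  qed
  have pot: "potential R p phi psi' = potential R p phi psi + p i0 * (phi s0 - phi 0) + p i1 * (phi (l - s1) - phi l)" for phi
  proof -
   have "potential R p phi psi' = potential R p phi (psi(i0 := (psi i0)(q := s0))) + p i1 * (phi (l - s1) - phi l)"
    unfolding psi'_def using neq k
    by (subst potential_fun_upd[OF fin i1(1)]) (simp add: sum_fun_upd l_def del: fun_upd_apply, simp add: fun_upd_def l_def)
   also have "potential R p phi (psi(i0 := (psi i0)(q := s0))) = potential R p phi psi + p i0 * (phi s0 - phi 0)"
    using q qi by (subst potential_fun_upd[OF fin i0(1)]) (simp add: sum_fun_upd del: fun_upd_apply)
   finally show ?thesis by simp
  qed
  show thesis
  proof (rule that[of a' psi'])
   have A1: "psi' i (Suc j) <= psi' i j" if "1 <= j" for i j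
    using mono0[OF that] mono1[OF that] other[of i] F that by (cases "i = i0"; cases "i = i1") auto
   have A2: "(\<Sum>r\<in>T. a' i r) <= (\<Sum>j\<in>{1..card T}. psi' i j)" if "T <= {1..n}" for i T
    using maj0[OF that] maj1[OF that] other[of i] maj[OF that, of i] by (cases "i = i0"; cases "i = i1") auto
   have A3: "(\<Sum>r\<in>{1..n}. a' i r) = (\<Sum>j\<in>{1..i}. psi' i j)" for i
    using tot0 tot1 other[of i] tot[of i] by (cases "i = i0"; cases "i = i1") auto
   show "feasible R p n alp a' psi'"
    by (rule feasibleI) (fact a'nn zero1 psi'nn zero2 A1 A2 A3 w')+
   show "potential R p phi psi' <= potential R p phi psi" if "convex_on {0..} phi" for phi
   proof -
    have "(phi s0 - phi 0) / s0 <= (phi l - phi (l - s1)) / s1"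
     using s lpos by (intro convex_on_slope_transfer that) auto
    then have "t * ((phi s0 - phi 0) / s0) <= t * ((phi l - phi (l - s1)) / s1)"
     using tpos by (intro mult_left_mono) auto
    moreover have "t * ((phi s0 - phi 0) / s0) = p i0 * (phi s0 - phi 0)"
     using ps(1) s by (auto simp: field_simps)
    moreover have "t * ((phi l - phi (l - s1)) / s1) = p i1 * (phi l - phi (l - s1))"
     using ps(2) s by (auto simp: field_simps)
    ultimately show ?thesis using pot[of phi] by (simp add: algebra_simps)
   qed
   have "p i0 * (s0\<^sup>2 - 0\<^sup>2) + p i1 * ((l - s1)\<^sup>2 - l\<^sup>2) = (p i0 * s0) * s0 - (p i1 * s1) * (2 * l - s1)"
    by (simp add: power2_eq_square algebra_simps)
   also have "... = t * (s0 + s1 - 2 * l)" unfolding ps by (simp add: algebra_simps)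
   also have "... < 0" using tpos s lpos by (intro mult_pos_neg) auto
   finally show "potential R p (%x. x\<^sup>2) psi' < potential R p (%x. x\<^sup>2) psi"
    using pot[of "%x. x\<^sup>2"] by simp
  qed
 qed
qed

text \<open>Each generator is spread over \<open>R\<close> with equal mass, and the whole trace goes
  into the first eigenvalue, which then dominates every partial sum of the weights.\<close>

lemma feasible_exists:
 assumes fin: "finite R" and ne: "R ~= {}" and p: "!!i. i : R ==> 0 < p i" and R1: "!!i. i : R ==> 1 <= i"
  and alp: "!!r. r : {1..n} ==> 0 < alp r"
 shows "\<exists>a psi. feasible R p n alp a psi"
proof -
 define a where "a = (%i r. if i : R & r : {1..n} then alp r / (p i * card R) else 0)"
 define psi where "psi = (%i (j::nat). if i : R & j = 1 then (\<Sum>r\<in>{1..n}. a i r) else (0::real))"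
 have cR: "card R > 0" using fin ne by (simp add: card_gt_0_iff)
 have nn: "0 <= a i r" for i r unfolding a_def using p[of i] alp[of r] cR by auto
 have maj: "(\<Sum>r\<in>T. a i r) <= (\<Sum>j\<in>{1..card T}. psi i j)" if T: "T <= {1..n}" for i T
 proof (cases "i : R & T ~= {}")
  case True
  have "finite T" using T finite_subset by blast
  then have "1 <= card T" using True by (simp add: Suc_le_eq card_gt_0_iff)
  then have "(\<Sum>j\<in>{1..card T}. psi i j) = (\<Sum>j\<in>{1}. psi i j)"
   by (intro sum.mono_neutral_right) (auto simp: psi_def)
  also have "... = (\<Sum>r\<in>{1..n}. a i r)" using True by (simp add: psi_def)
  also have "... >= (\<Sum>r\<in>T. a i r)" using T nn by (intro sum_mono2) auto
  finally show ?thesis .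
 next
  case False
  then show ?thesis by (auto simp: psi_def a_def)
 qed
 have tot: "(\<Sum>r\<in>{1..n}. a i r) = (\<Sum>j\<in>{1..i}. psi i j)" for i
 proof (cases "i : R")
  case True
  then have "(\<Sum>j\<in>{1..i}. psi i j) = (\<Sum>j\<in>{1}. psi i j)"
   using R1[OF True] by (intro sum.mono_neutral_right) (auto simp: psi_def)
  then show ?thesis using True by (simp add: psi_def)
 qed (auto simp: psi_def a_def)
 have w: "(\<Sum>i\<in>R. p i * a i r) = alp r" if "r : {1..n}" for r
 proof -
  have "(\<Sum>i\<in>R. p i * a i r) = (\<Sum>i\<in>R. alp r / card R)"
   using that by (intro sum.cong) (auto simp: a_def dest: p)
  then show ?thesis using cR by simp
 qed
 have "0 <= psi i j" for i j unfolding psi_def by (auto intro!: sum_nonneg nn)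
 moreover have "psi i j = 0" if "i ~: R \<or> j ~: {1..i}" for i j
  using that R1[of i] unfolding psi_def by auto
 moreover have "a i r = 0" if "i ~: R \<or> r ~: {1..n}" for i r
  using that unfolding a_def by auto
 moreover have "psi i (Suc j) <= psi i j" if "1 <= j" for i j
  using that nn unfolding psi_def by (auto intro!: sum_nonneg)
 ultimately have "feasible R p n alp a psi"
  using nn maj tot w by (intro feasibleI)
 then show ?thesis by blast
qed

lemma feasible_midpoint:
 assumes "feasible R p n alp a psi" "feasible R p n alp a' psi'"
 shows "feasible R p n alp (%i r. (a i r + a' i r) / 2) (%i j. (psi i j + psi' i j) / 2)"
proof -
 note F = feasibleD[OF assms(1)] feasibleD[OF assms(2)]
 have w: "(\<Sum>i\<in>R. p i * ((a i r + a' i r) / 2)) = alp r" if "r : {1..n}" for r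
 proof -
  have "(\<Sum>i\<in>R. p i * ((a i r + a' i r) / 2)) = ((\<Sum>i\<in>R. p i * a i r) + (\<Sum>i\<in>R. p i * a' i r)) / 2"
   unfolding sum.distrib[symmetric] sum_divide_distrib by (simp add: field_simps)
  then show ?thesis by (simp only: F(8)[OF that] F(16)[OF that]) simp
 qed
 have "(\<Sum>r\<in>T. (a i r + a' i r) / 2) <= (\<Sum>j\<in>{1..card T}. (psi i j + psi' i j) / 2)" if "T <= {1..n}" for T i
 proof -
  have "(\<Sum>r\<in>T. a i r) <= (\<Sum>j\<in>{1..card T}. psi i j)" "(\<Sum>r\<in>T. a' i r) <= (\<Sum>j\<in>{1..card T}. psi' i j)"
   by (rule F(6)[OF that], rule F(14)[OF that])
  then show ?thesis by (simp add: sum_divide_distrib[symmetric] sum.distrib)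
 qed
 moreover have "(\<Sum>r\<in>{1..n}. (a i r + a' i r) / 2) = (\<Sum>j\<in>{1..i}. (psi i j + psi' i j) / 2)" for i
  using F(7)[of i] F(15)[of i] by (simp add: sum_divide_distrib[symmetric] sum.distrib)
 moreover have "(psi i (Suc j) + psi' i (Suc j)) / 2 <= (psi i j + psi' i j) / 2" if "1 <= j" for i j
 proof -
  have "psi i (Suc j) <= psi i j" "psi' i (Suc j) <= psi' i j" by (rule F(5)[OF that], rule F(13)[OF that])
  then show ?thesis by simp
 qed
 moreover have "0 <= (psi i j + psi' i j) / 2" "0 <= (a i j + a' i j) / 2" for i j
  using F(1,3,9,11) by simp_all
 moreover have "(psi i j + psi' i j) / 2 = 0" if "i ~: R \<or> j ~: {1..i}" for i j
  using F(4)[OF that] F(12)[OF that] by simp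
 moreover have "(a i r + a' i r) / 2 = 0" if "i ~: R \<or> r ~: {1..n}" for i r
  using F(2)[OF that] F(10)[OF that] by simp
 ultimately show ?thesis
  using w by (intro feasibleI)
qed

section \<open>Existence and uniqueness of minimizers\<close>

text \<open>The slopes \<open>q\<close> towards the point 1 are monotone, so they have a limit
  \<open>l\<close> at 0 from the right, and \<open>phi 1 - l\<close> is the limit of
  \<open>phi\<close> there. Putting this limit in place of \<open>phi 0\<close> gives the continuous
  part; the jump \<open>c\<close> is nonnegative because \<open>q 0 <= l\<close>.\<close>

lemma convex_on_Ici_split:
 fixes phi :: "real => real"
 assumes "convex_on {0..} phi"
 obtains phi' c where "convex_on {0..} phi'" "continuous_on {0..} phi'" "0 <= c"
  "!!x. 0 < x ==> phi x = phi' x" "phi 0 = phi' 0 + c"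
proof -
 define q where "q = (%x. (phi 1 - phi x) / (1 - x))"
 define I where "I = {0<..<(1::real)}"
 have qmono: "q x <= q y" if "0 <= x" "x <= y" "y < 1" for x y
 proof (cases "x = y")
  case False
  then have "(phi x - phi 1) / (x - 1) <= (phi y - phi 1) / (y - 1)"
   using that by (intro convex_on_slope_le(2)[OF assms]) auto
  then show ?thesis unfolding q_def by (metis minus_diff_eq minus_divide_divide)
 qed auto
 define l where "l = Inf (q ` ({0<..} \<inter> I))"
 have qlim: "(q \<longlongrightarrow> l) (at 0 within {0<..} \<inter> I)"
  unfolding l_def by (rule Lim_right_bound[where K="q 0"]) (auto intro!: qmono simp: I_def)
 have l0: "q 0 <= l" unfolding l_def
 proof (rule cInf_greatest)
  have "(1/2::real) : {0<..} \<inter> I" by (simp add: I_def)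
  then show "q ` ({0<..} \<inter> I) ~= {}" by blast
 qed (auto intro!: qmono simp: I_def)
 define phi' where "phi' = (%x. if x = 0 then phi 1 - l else phi x)"
 define c where "c = phi 0 - (phi 1 - l)"
 have c: "0 <= c" unfolding c_def using l0 unfolding q_def by simp
 have "((%x. phi 1 - q x * (1 - x)) \<longlongrightarrow> phi 1 - l * (1 - 0)) (at 0 within {0<..} \<inter> I)"
  by (intro tendsto_intros qlim)
 moreover have "phi' y = phi 1 - q y * (1 - y)" if "y : {0<..} \<inter> I" for y
  using that by (auto simp: phi'_def q_def I_def)
 ultimately have "(phi' \<longlongrightarrow> phi' 0) (at 0 within {0<..} \<inter> I)"
  by (subst Lim_cong_within[OF refl refl refl, where g="%x. phi 1 - q x * (1 - x)"]) (auto simp: phi'_def)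
 moreover have "at 0 within {0<..} \<inter> I = at (0::real) within {0..}"
  by (rule at_within_nhd[of _ "{-1<..<1}"]) (auto simp: I_def)
 ultimately have lim0: "(phi' \<longlongrightarrow> phi' 0) (at 0 within {0..})" by simp
 have conv0: "convex_on {0<..} phi"
  by (rule convex_on_subset[OF assms]) auto
 have cont0: "continuous_on {0<..} phi"
  by (rule convex_on_continuous[OF _ conv0]) auto
 have cont: "continuous_on {0..} phi'"
  unfolding continuous_on_def
 proof
  fix x :: real assume x: "x : {0..}"
  show "(phi' \<longlongrightarrow> phi' x) (at x within {0..})"
  proof (cases "x = 0")
   case False
   then have x0: "x > 0" using x by auto
   have "isCont phi x" using cont0 x0 by (simp add: continuous_on_eq_continuous_at)
   then have "(phi \<longlongrightarrow> phi x) (at x within {0..})"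
    unfolding isCont_def using tendsto_within_subset by blast
   moreover have "\<forall>\<^sub>F y in at x within {0..}. phi y = phi' y"
    unfolding eventually_at using x0 by (intro exI[of _ x]) (auto simp: phi'_def dist_real_def)
   ultimately show ?thesis using x0 by (simp add: tendsto_cong phi'_def)
  qed (use lim0 in simp)
 qed
 \<comment> \<open>At positive points the inequality is that of \<open>phi\<close>; shifting both
   arguments by \<open>e > 0\<close> and letting \<open>e\<close> tend to 0 reaches the end
   point.\<close>
 have "convex_on {0..} phi'"
 proof (rule convex_onI)
  fix t x y :: real assume t: "0 < t" "t < 1" and xy: "x : {0..}" "y : {0..}"
  have ev: "\<forall>\<^sub>F e in at_right (0::real). phi' ((1 - t) * (x + e) + t * (y + e)) <= (1 - t) * phi' (x + e) + t * phi' (y + e)"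
   unfolding eventually_at_filter
  proof (rule always_eventually, intro allI impI)
   fix e :: real assume e: "e : {0<..}"
   have "phi ((1 - t) *\<^sub>R (x + e) + t *\<^sub>R (y + e)) <= (1 - t) * phi (x + e) + t * phi (y + e)"
    using t xy e by (intro convex_onD[OF assms]) auto
   moreover have "(1 - t) * (x + e) + t * (y + e) > 0" using t xy e by (intro add_pos_pos mult_pos_pos add_nonneg_pos) auto
   ultimately show "phi' ((1 - t) * (x + e) + t * (y + e)) <= (1 - t) * phi' (x + e) + t * phi' (y + e)"
    using xy e unfolding phi'_def by auto
  qed
  have shift: "((%e. phi' (z e)) \<longlongrightarrow> phi' (z 0)) (at_right 0)"
   if "!!e. e >= 0 ==> z e >= 0" "isCont z 0" for z :: "real => real"
  proof -
   have "(z \<longlongrightarrow> z 0) (at_right 0)" using that(2) unfolding isCont_def using tendsto_within_subset by blast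
   moreover have "\<forall>\<^sub>F e in at_right 0. z e : {0..}"
    unfolding eventually_at_filter using that(1) by (intro always_eventually) auto
   ultimately show ?thesis using continuous_on_tendsto_compose[OF cont] that(1)[of 0] by simp
  qed
  show "phi' ((1 - t) *\<^sub>R x + t *\<^sub>R y) <= (1 - t) * phi' x + t * phi' y"
  proof (rule tendsto_le[OF _ _ _ ev])
   show "((%e. phi' ((1 - t) * (x + e) + t * (y + e))) \<longlongrightarrow> phi' ((1 - t) *\<^sub>R x + t *\<^sub>R y)) (at_right 0)"
    using shift[of "%e. (1 - t) * (x + e) + t * (y + e)"] t xy by (simp add: continuous_intros)
   have "((%e. phi' (x + e)) \<longlongrightarrow> phi' x) (at_right 0)" "((%e. phi' (y + e)) \<longlongrightarrow> phi' y) (at_right 0)"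
    using shift[of "%e. x + e"] shift[of "%e. y + e"] xy by (auto simp: continuous_intros)
   then show "((%e. (1 - t) * phi' (x + e) + t * phi' (y + e)) \<longlongrightarrow> (1 - t) * phi' x + t * phi' y) (at_right 0)"
    by (intro tendsto_intros)
  qed auto
 qed auto
 then show thesis
  by (rule that[OF _ cont c]) (auto simp: phi'_def c_def)
qed

text \<open>Tychonoff's theorem, applied in each of the two arguments.\<close>

lemma compact_box_fun2: "compact {f :: nat => nat => real. \<forall>i j. f i j : {0..B}}"
proof -
 have 1: "compact {f :: nat => real. \<forall>j. f j : {0..B}}"
 proof -
  have "compactin (product_topology (%_::nat. euclidean) UNIV) (Pi\<^sub>E UNIV (%_. {0..B}))"
   by (subst compactin_PiE) auto
  moreover have "Pi\<^sub>E UNIV (%_::nat. {0..B}) = {f. \<forall>j. f j : {0..B}}" by (auto simp: PiE_def Pi_def)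
  ultimately show ?thesis by (simp add: euclidean_product_topology compactin_euclidean_iff)
 qed
 have "compactin (product_topology (%_::nat. euclidean) UNIV) (Pi\<^sub>E UNIV (%_. {f :: nat => real. \<forall>j. f j : {0..B}}))"
  by (subst compactin_PiE) (use 1 in \<open>auto simp: compactin_euclidean_iff\<close>)
 moreover have "Pi\<^sub>E UNIV (%_::nat. {f :: nat => real. \<forall>j. f j : {0..B}}) = {f. \<forall>i j. f i j : {0..B}}"
  by (auto simp: PiE_def Pi_def)
 ultimately show ?thesis by (simp add: euclidean_product_topology compactin_euclidean_iff)
qed

lemma feasible_bounded:
 assumes feas: "feasible R p n alp a psi" and fin: "finite R" and p: "!!i. i : R ==> 0 < p i"
 obtains B where "!!a psi i r. feasible R p n alp a psi ==> a i r : {0..B} & psi i r : {0..B}"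
proof -
 define B where "B = (\<Sum>i\<in>R. (\<Sum>r\<in>{1..n}. alp r) / p i)"
 have "a i r : {0..B} & psi i r : {0..B}" if f: "feasible R p n alp a psi" for a psi i r
 proof -
  note F = f[unfolded feasible_def]
  have nn: "!!i r. 0 <= a i r" "!!i r. 0 <= psi i r" using F by auto
  have al: "alp r >= 0" if "r : {1..n}" for r
  proof -
   have "0 <= (\<Sum>i\<in>R. p i * a i r)" using nn p by (intro sum_nonneg mult_nonneg_nonneg) (auto simp: less_imp_le)
   then show ?thesis using F that by auto
  qed
  have Bi: "(\<Sum>r\<in>{1..n}. a i r) <= B" if i: "i : R" for i
  proof -
   have "(\<Sum>r\<in>{1..n}. a i r) <= (\<Sum>r\<in>{1..n}. alp r / p i)"
   proof (rule sum_mono)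
    fix r assume r: "r : {1..n}"
    have "p i * a i r <= (\<Sum>i\<in>R. p i * a i r)"
     using i nn p fin by (intro member_le_sum) (auto simp: less_imp_le)
    then have "p i * a i r <= alp r" using F r by auto
    then show "a i r <= alp r / p i" using p[OF i] by (simp add: field_simps)
   qed
   also have "... = (\<Sum>r\<in>{1..n}. alp r) / p i" by (simp add: sum_divide_distrib)
   also have "... <= B" unfolding B_def using i p fin al
    by (intro member_le_sum) (auto simp: less_imp_le intro!: divide_nonneg_pos sum_nonneg)
   finally show ?thesis .
  qed
  have B0: "B >= 0" unfolding B_def using p al by (intro sum_nonneg divide_nonneg_pos) auto
  have "a i r <= B"
  proof (cases "i : R & r : {1..n}")
   case True
   then have "a i r <= (\<Sum>r\<in>{1..n}. a i r)" using nn by (intro member_le_sum) auto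
   then show ?thesis using Bi True by force
  next
   case False
   then have "a i r = 0" using F by blast
   then show ?thesis using B0 by simp
  qed
  moreover have "psi i r <= B"
  proof (cases "i : R & r : {1..i}")
   case True
   then have "psi i r <= (\<Sum>j\<in>{1..i}. psi i j)" using nn by (intro member_le_sum) auto
   also have "... = (\<Sum>r\<in>{1..n}. a i r)" using F by simp
   finally show ?thesis using Bi True by force
  next
   case False
   then have "psi i r = 0" using F by blast
   then show ?thesis using B0 by simp
  qed
  ultimately show ?thesis using nn by auto
 qed
 then show thesis by (rule that)
qed

lemma continuous_on_apply2: "continuous_on S f ==> continuous_on S (%x. f x i j)"
 for f :: "'x::topological_space => nat => nat => real"
 by (rule continuous_on_product_then_coordinatewise, rule continuous_on_product_then_coordinatewise)

lemma compact_feasible: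
 assumes fin: "finite R" and p: "!!i. i : R ==> 0 < p i"
 shows "compact {z. feasible R p n alp (fst z) (snd z)}"
proof (cases "\<exists>a psi. feasible R p n alp a psi")
 case True
 then obtain B where B: "!!a psi i r. feasible R p n alp a psi ==> a i r : {0..B} & psi i r : {0..B}"
  using feasible_bounded[of R p n alp, OF _ fin p] by metis
 have cont: "continuous_on UNIV (%z::(nat=>nat=>real)\<times>(nat=>nat=>real). fst z i j)"
  "continuous_on UNIV (%z::(nat=>nat=>real)\<times>(nat=>nat=>real). snd z i j)" for i j
  by (rule continuous_on_apply2, intro continuous_on_fst continuous_on_snd continuous_on_id)+
 have 1: "closed {z. 0 <= fst (z :: (nat => nat => real) \<times> (nat => nat => real)) i r & (i ~: R \<or> r ~: {1..n} --> fst z i r = (0::real))}" for i r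
 proof (cases "i ~: R \<or> r ~: {1..n}")
  case True
  then show ?thesis by simp (intro closed_Collect_conj closed_Collect_le closed_Collect_eq cont continuous_on_const)
 next
  case False
  then show ?thesis by simp (intro closed_Collect_le cont continuous_on_const)
 qed
 have 2: "closed {z. 0 <= snd (z :: (nat => nat => real) \<times> (nat => nat => real)) i j & (i ~: R \<or> j ~: {1..i} --> snd z i j = (0::real))}" for i j
 proof (cases "i ~: R \<or> j ~: {1..i}")
  case True
  then show ?thesis by simp (intro closed_Collect_conj closed_Collect_le closed_Collect_eq cont continuous_on_const)
 next
  case False
  then show ?thesis by simp (intro closed_Collect_le cont continuous_on_const)
 qed
 have 3: "closed {z. snd (z :: (nat => nat => real) \<times> (nat => nat => real)) i (Suc j) <= (snd z i j :: real)}" for i j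
  by (intro closed_Collect_le cont)
 have 4: "closed {z. (\<Sum>r\<in>T. fst (z :: (nat => nat => real) \<times> (nat => nat => real)) i r) <= (\<Sum>j\<in>{1..card T}. snd z i j :: real)}" for i T
  by (intro closed_Collect_le continuous_on_sum cont)
 have 5: "closed {z. (\<Sum>r\<in>{1..n}. fst (z :: (nat => nat => real) \<times> (nat => nat => real)) i r) = (\<Sum>j\<in>{1..i}. snd z i j :: real)}" for i
  by (intro closed_Collect_eq continuous_on_sum cont)
 have 6: "closed {z. (\<Sum>i\<in>R. p i * fst (z :: (nat => nat => real) \<times> (nat => nat => real)) i r) = alp r}" for r
  by (intro closed_Collect_eq continuous_on_sum continuous_on_mult continuous_on_const cont)
 have "closed {z. feasible R p n alp (fst z) (snd z)}"
 proof -
  have "{z. feasible R p n alp (fst z) (snd z)} =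
    (\<Inter>i. \<Inter>r. {z. 0 <= fst z i r & (i ~: R \<or> r ~: {1..n} --> fst z i r = (0::real))}) \<inter>
    (\<Inter>i. \<Inter>j. {z. 0 <= snd z i j & (i ~: R \<or> j ~: {1..i} --> snd z i j = (0::real))}) \<inter>
    (\<Inter>i. \<Inter>j\<in>{1..}. {z. snd z i (Suc j) <= snd z i j}) \<inter>
    (\<Inter>i. \<Inter>T\<in>{T. T <= {1..n}}. {z. (\<Sum>r\<in>T. fst z i r) <= (\<Sum>j\<in>{1..card T}. snd z i j)}) \<inter>
    (\<Inter>i. {z. (\<Sum>r\<in>{1..n}. fst z i r) = (\<Sum>j\<in>{1..i}. snd z i j)}) \<inter>
    (\<Inter>r\<in>{1..n}. {z. (\<Sum>i\<in>R. p i * fst z i r) = alp r})"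
   unfolding feasible_def set_eq_iff Int_iff INT_iff mem_Collect_eq atLeast_iff Ball_def by simp
  then show ?thesis by (simp only:) (intro closed_Int closed_INT ballI 1 2 3 4 5 6)
 qed
 moreover have "compact ({f :: nat => nat => real. \<forall>i j. f i j : {0..B}} \<times> {f :: nat => nat => real. \<forall>i j. f i j : {0..B}})"
  by (intro compact_Times compact_box_fun2)
 ultimately have "compact (({f. \<forall>i j. f i j : {0..B}} \<times> {f. \<forall>i j. f i j : {0..B}}) \<inter> {z. feasible R p n alp (fst z) (snd z)})"
  by (rule compact_Int_closed[rotated])
 moreover have "(({f. \<forall>i j. f i j : {0..B}} \<times> {f. \<forall>i j. f i j : {0..B}}) \<inter> {z. feasible R p n alp (fst z) (snd z)})
   = {z. feasible R p n alp (fst z) (snd z)}" using B by fastforce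
 ultimately show ?thesis by simp
qed auto

text \<open>Compactness minimizes only the continuous part \<open>phi'\<close>. Among its minimizers
  one with least sum of squares is selected; by the exchange argument its eigenvalues with
  \<open>j <= n\<close> are all nonzero. The zeros at \<open>j > n\<close> occur at every feasible
  point, so the contribution of the jump at 0 is minimal as well.\<close>

lemma potential_attains_min:
 assumes fin: "finite R" and ne: "R ~= {}" and p: "!!i. i : R ==> 0 < p i" and R1: "!!i. i : R ==> 1 <= i"
  and alp: "!!r. r : {1..n} ==> 0 < alp r" and cvx: "convex_on {0..} phi"
 obtains a psi where "feasible R p n alp a psi"
  and "!!a' psi'. feasible R p n alp a' psi' ==> potential R p phi psi <= potential R p phi psi'"
proof -
 obtain phi' c where phi': "convex_on {0..} phi'" "continuous_on {0..} phi'" "0 <= c"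
  "!!x. 0 < x ==> phi x = phi' x" "phi 0 = phi' 0 + c"
  using convex_on_Ici_split[OF cvx] by metis
 define K where "K = {z. feasible R p n alp (fst z) (snd z)}"
 have K: "compact K" "K ~= {}"
  unfolding K_def using compact_feasible[OF fin p] feasible_exists[OF fin ne p R1 alp] by auto
 have contP: "continuous_on K (%z. potential R p g (snd z))" if "continuous_on {0..} g" for g
 proof -
  have "continuous_on K (%z. snd z i j)" for i j
   by (rule continuous_on_apply2, intro continuous_on_snd continuous_on_id)
  then have "continuous_on K (%z. g (snd z i j))" for i j
   by (rule continuous_on_compose2[OF that]) (auto simp: K_def feasible_def)
  then show ?thesis unfolding potential_def
   by (intro continuous_on_sum continuous_on_mult continuous_on_const)
 qed
 obtain z0 where z0: "z0 : K" "!!z. z : K ==> potential R p phi' (snd z0) <= potential R p phi' (snd z)"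
  using continuous_attains_inf[OF K contP[OF phi'(2)]] by blast
 define M where "M = {z\<in>K. potential R p phi' (snd z) : {..potential R p phi' (snd z0)}}"
 have "closedin (top_of_set K) M"
  unfolding M_def by (rule continuous_closedin_preimage[OF contP[OF phi'(2)], unfolded Int_def vimage_def, simplified]) auto
 then have "compact M" by (rule closedin_compact[OF K(1)])
 moreover have "z0 : M" using z0(1) unfolding M_def by simp
 ultimately have M: "compact M" "M ~= {}" "M <= K" unfolding M_def by blast+
 obtain z1 where z1: "z1 : M"
  "!!z. z : M ==> potential R p (%x. x\<^sup>2) (snd z1) <= potential R p (%x. x\<^sup>2) (snd z)"
  using continuous_attains_inf[OF M(1,2) continuous_on_subset[OF contP[OF continuous_on_power[OF continuous_on_id]] M(3)]]
  by blast
 obtain a psi where z1eq: "z1 = (a, psi)" by (cases z1)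
 have feas: "feasible R p n alp a psi" using z1(1) M(3) z1eq unfolding K_def by auto
 have min': "potential R p phi' psi <= potential R p phi' psi'" if "feasible R p n alp a' psi'" for a' psi'
  using z1(1) z0(2)[of "(a', psi')"] that unfolding z1eq M_def K_def by auto
 have pos: "psi i j ~= 0" if ij: "i : R" "j : {1..i}" "j <= n" for i j
 proof
  assume z: "psi i j = 0"
  obtain a' psi' where f': "feasible R p n alp a' psi'"
   and le: "!!phi. convex_on {0..} phi ==> potential R p phi psi' <= potential R p phi psi"
   and lt: "potential R p (%x. x\<^sup>2) psi' < potential R p (%x. x\<^sup>2) psi"
   using feasible_improve[OF feas fin p alp ij z] by metis
  have "(a', psi') : M"
   using f' le[OF phi'(1)] z1(1) unfolding z1eq M_def K_def by auto
  then show False using z1(2) lt z1eq by fastforce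
 qed
 show thesis
 proof (rule that[OF feas])
  fix a' psi' assume f': "feasible R p n alp a' psi'"
  have decomp: "potential R p phi psi = potential R p phi' psi + (\<Sum>i\<in>R. p i * (\<Sum>j\<in>{1..i}. if psi i j = 0 then c else 0))"
   if "!!i j. 0 <= psi i j" for psi :: "nat => nat => real"
  proof -
   have "phi (psi i j) = phi' (psi i j) + (if psi i j = 0 then c else 0)" for i j
    using phi'(4)[of "psi i j"] phi'(5) that[of i j] by (cases "psi i j = 0") auto
   then show ?thesis unfolding potential_def by (simp add: sum.distrib distrib_left)
  qed
  have zle: "(if psi i j = 0 then c else 0) <= (if psi' i j = 0 then c else 0)" if "i : R" "j : {1..i}" for i j
   using pos[OF that] feasible_zero_beyond[OF f', of j i] phi'(3) by (cases "j <= n") auto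
  have "(\<Sum>i\<in>R. p i * (\<Sum>j\<in>{1..i}. if psi i j = 0 then c else 0)) <= (\<Sum>i\<in>R. p i * (\<Sum>j\<in>{1..i}. if psi' i j = 0 then c else 0))"
   using p zle by (intro sum_mono mult_left_mono) (auto simp: less_imp_le)
  then show "potential R p phi psi <= potential R p phi psi'"
   using decomp[of psi] decomp[of psi'] feas f' min'[OF f'] unfolding feasible_def by auto
 qed
qed

text \<open>Strict convexity at the midpoint. Only \<open>psi\<close> is determined, since the
  potential does not see the weights \<open>a\<close>.\<close>

lemma minimizer_unique:
 assumes fin: "finite R" and p: "!!i. i : R ==> 0 < p i"
  and strict: "phi : Conv_s"
  and f: "feasible R p n alp a psi" "feasible R p n alp a' psi'"
  and min: "!!a' psi'. feasible R p n alp a' psi' ==> potential R p phi psi <= potential R p phi psi'"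
  and eq: "potential R p phi psi' <= potential R p phi psi"
 shows "psi' = psi"
proof (rule ccontr)
 assume "psi' ~= psi"
 then obtain i0 j0 where ij: "psi' i0 j0 ~= psi i0 j0" by (metis ext)
 have nn: "!!i j. 0 <= psi i j" "!!i j. 0 <= psi' i j"
  and z: "!!i j. i ~: R \<or> j ~: {1..i} ==> psi i j = 0 & psi' i j = 0"
  using f unfolding feasible_def by auto
 have i0: "i0 : R" "j0 : {1..i0}" using z[of i0 j0] ij by metis+
 have half: "phi ((x + y) / 2) < (phi x + phi y) / 2" if "0 <= x" "0 <= y" "x ~= y" for x y
 proof -
  have "phi ((1 - 1/2) * x + 1/2 * y) < (1 - 1/2) * phi x + 1/2 * phi y"
  proof -
   have "\<forall>x\<ge>0. \<forall>y\<ge>0. \<forall>t. x ~= y --> 0 < t --> t < 1 -->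
    phi ((1 - t) * x + t * y) < (1 - t) * phi x + t * phi y"
    using strict unfolding Conv_s_def by blast
   from this[rule_format, OF that, of "1/2"] show ?thesis by simp
  qed
  moreover have "(1 - 1/2) * x + 1/2 * y = (x + y) / 2" by (simp add: field_simps)
  moreover have "(1 - 1/2) * phi x + 1/2 * phi y = (phi x + phi y) / 2" by (simp add: field_simps)
  ultimately show ?thesis by (simp only:)
 qed
 have halfle: "phi ((x + y) / 2) <= (phi x + phi y) / 2" if "0 <= x" "0 <= y" for x y
  using half[OF that] by (cases "x = y") auto
 have "potential R p phi (%i j. (psi i j + psi' i j) / 2) < (\<Sum>i\<in>R. p i * (\<Sum>j\<in>{1..i}. (phi (psi i j) + phi (psi' i j)) / 2))"
  unfolding potential_def
 proof (rule sum_strict_mono_ex1[OF fin])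
  show "\<forall>i\<in>R. p i * (\<Sum>j\<in>{1..i}. phi ((psi i j + psi' i j) / 2)) <= p i * (\<Sum>j\<in>{1..i}. (phi (psi i j) + phi (psi' i j)) / 2)"
   using p nn by (intro ballI mult_left_mono sum_mono halfle) (auto simp: less_imp_le)
  have "(\<Sum>j\<in>{1..i0}. phi ((psi i0 j + psi' i0 j) / 2)) < (\<Sum>j\<in>{1..i0}. (phi (psi i0 j) + phi (psi' i0 j)) / 2)"
  proof (rule sum_strict_mono_ex1)
   show "\<forall>j\<in>{1..i0}. phi ((psi i0 j + psi' i0 j) / 2) <= (phi (psi i0 j) + phi (psi' i0 j)) / 2"
    using halfle nn by blast
   have "phi ((psi i0 j0 + psi' i0 j0) / 2) < (phi (psi i0 j0) + phi (psi' i0 j0)) / 2"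
    by (rule half[OF nn]) (use ij in simp)
   then show "\<exists>j\<in>{1..i0}. phi ((psi i0 j + psi' i0 j) / 2) < (phi (psi i0 j) + phi (psi' i0 j)) / 2"
    using i0(2) by blast
  qed simp
  then have "p i0 * (\<Sum>j\<in>{1..i0}. phi ((psi i0 j + psi' i0 j) / 2)) < p i0 * (\<Sum>j\<in>{1..i0}. (phi (psi i0 j) + phi (psi' i0 j)) / 2)"
   by (rule mult_strict_left_mono) (rule p[OF i0(1)])
  then show "\<exists>i\<in>R. p i * (\<Sum>j\<in>{1..i}. phi ((psi i j + psi' i j) / 2)) < p i * (\<Sum>j\<in>{1..i}. (phi (psi i j) + phi (psi' i j)) / 2)"
   by (rule bexI[OF _ i0(1)])
 qed
 also have "... = (\<Sum>i\<in>R. (p i * (\<Sum>j\<in>{1..i}. phi (psi i j)) + p i * (\<Sum>j\<in>{1..i}. phi (psi' i j))) / 2)"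
 proof (rule sum.cong[OF refl])
  fix i
  have "(\<Sum>j\<in>{1..i}. (phi (psi i j) + phi (psi' i j)) / 2) = ((\<Sum>j\<in>{1..i}. phi (psi i j)) + (\<Sum>j\<in>{1..i}. phi (psi' i j))) / 2"
   by (simp add: sum_divide_distrib[symmetric] sum.distrib)
  then show "p i * (\<Sum>j\<in>{1..i}. (phi (psi i j) + phi (psi' i j)) / 2) =
    (p i * (\<Sum>j\<in>{1..i}. phi (psi i j)) + p i * (\<Sum>j\<in>{1..i}. phi (psi' i j))) / 2"
   by (simp only: distrib_left times_divide_eq_right)
 qed
 also have "... = (potential R p phi psi + potential R p phi psi') / 2"
  unfolding potential_def by (simp add: sum_divide_distrib[symmetric] sum.distrib)
 finally show False
  using min[OF feasible_midpoint[OF f]] eq by simp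
qed

text \<open>The point produced by the exchange argument would again be a minimizer and hence have
  the same eigenvalues, whereas its sum of squares is strictly smaller.\<close>

lemma minimizer_pos:
 assumes fin: "finite R" and p: "!!i. i : R ==> 0 < p i"
  and alp: "!!r. r : {1..n} ==> 0 < alp r"
  and strict: "phi : Conv_s"
  and f: "feasible R p n alp a psi"
  and min: "!!a' psi'. feasible R p n alp a' psi' ==> potential R p phi psi <= potential R p phi psi'"
  and ij: "i : R" "j : {1..i}" "j <= n"
 shows "0 < psi i j"
proof (rule ccontr)
 assume "\<not> 0 < psi i j"
 then have z: "psi i j = 0" using f unfolding feasible_def by (metis less_eq_real_def)
 obtain a' psi' where f': "feasible R p n alp a' psi'"
  and le: "!!phi. convex_on {0..} phi ==> potential R p phi psi' <= potential R p phi psi"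
  and lt: "potential R p (%x. x\<^sup>2) psi' < potential R p (%x. x\<^sup>2) psi"
  using feasible_improve[OF f fin p alp ij z] by metis
 have "convex_on {0..} phi" using strict unfolding Conv_s_def Conv_def by auto
 then have "psi' = psi" by (intro minimizer_unique[OF fin p strict f f' min] le)
 then show False using lt by simp
qed

section \<open>The Schur--Horn theorem\<close>

text \<open>Rotating the pair \<open>x\<close>, \<open>y\<close> leaves the sum of their rank-one
  matrices unchanged, while the squared norm of the first vector varies continuously from that of
  \<open>x\<close> at angle 0 to that of \<open>y\<close> at angle \<open>pi / 2\<close>.\<close>

lemma plane_rotation_norm:
 fixes x y :: "nat => real"
 assumes b: "(\<Sum>j\<in>D. (y j)\<^sup>2) <= t" "t <= (\<Sum>j\<in>D. (x j)\<^sup>2)"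
 obtains u v where "(\<Sum>j\<in>D. (u j)\<^sup>2) = t"
  and "!!j k. u j * u k + v j * v k = x j * x k + y j * (y k :: real)"
proof -
 define h where "h = (%th. \<Sum>j\<in>D. (cos th * x j + sin th * y j)\<^sup>2)"
 have "\<exists>th\<ge>0. th <= pi / 2 & h th = t"
 proof (rule IVT2')
  show "h (pi / 2) <= t" "t <= h 0" using b unfolding h_def by auto
  show "continuous_on {0..pi / 2} h" unfolding h_def by (intro continuous_intros)
 qed auto
 then obtain th where th: "h th = t" by blast
 define u where "u = (%j. cos th * x j + sin th * y j)"
 define v where "v = (%j. - sin th * x j + cos th * y j)"
 have "u j * u k + v j * v k = x j * x k + y j * y k" for j k
 proof -
  have "u j * u k + v j * v k = ((sin th)\<^sup>2 + (cos th)\<^sup>2) * (x j * x k + y j * y k)"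
   unfolding u_def v_def power2_eq_square by algebra
  then show ?thesis by (simp only: sin_cos_squared_add mult_1_left)
 qed
 then show thesis using that[of u v] th unfolding h_def u_def by auto
qed

text \<open>Induction on the prescribed norms, largest first. The invariant is the matrix of the
  sums of \<open>x j * x k\<close> over all rows, that is, the frame operator of the rows, which a
  rotation of two rows does not change.\<close>

lemma rows_with_norms:
 fixes B :: "(nat => real) list" and a :: "real list"
 assumes "length B = length a" "sorted_wrt (\<ge>) a"
  and "sorted_wrt (\<ge>) (map (%x. \<Sum>j\<in>D. (x j)\<^sup>2) B)"
  and "!!m. m <= length a ==> sum_list (take m a) <= sum_list (take m (map (%x. \<Sum>j\<in>D. (x j)\<^sup>2) B))"
  and "sum_list a = sum_list (map (%x. \<Sum>j\<in>D. (x j)\<^sup>2) B)"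
 shows "\<exists>M. length M = length a & map (%x. \<Sum>j\<in>D. (x j)\<^sup>2) M = a \<and>
  (\<forall>j k. sum_list (map (%x. x j * x k) M) = sum_list (map (%x. x j * x k) B))"
 using assms
proof (induction a arbitrary: B)
 case Nil
 then show ?case by auto
next
 case (Cons a1 as)
 define N where "N = (%x::nat=>real. \<Sum>j\<in>D. (x j)\<^sup>2)"
 note C = Cons.prems[folded N_def]
 define b where "b = map N B"
 have lb: "length b = Suc (length as)" "length B = Suc (length as)" unfolding b_def using C(1) by auto
 have bs: "b ! j <= b ! i" if "i <= j" "j < length b" for i j
  using C(3) that unfolding b_def by (cases "i = j") (auto simp: sorted_wrt_iff_nth_less)
 have pre: "sum_list (take m (a1 # as)) <= sum_list (take m b)" if "m <= Suc (length as)" for m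
  using C(4)[of m] that unfolding b_def by auto
 have tot: "a1 + sum_list as = sum_list b" using C(5) unfolding b_def by simp
 have a1ge: "x <= a1" if "x : set as" for x using C(2) that by auto
 have a1b: "a1 <= b ! 0" using pre[of 1] lb by (cases b) auto
 show ?case
 proof (cases "as = []")
  case True
  then obtain x where x: "B = [x]" using lb by (metis One_nat_def length_0_conv length_Suc_conv list.size(3))
  then show ?thesis using C(5) True by (intro exI[of _ B]) (auto simp: N_def)
 next
  case ne: False
  \<comment> \<open>The two rows at \<open>k\<close> and \<open>k + 1\<close> have squared norms on either side of \<open>a1\<close>; rotating
   them in their plane splits off a row of squared norm \<open>a1\<close>.\<close>
  have "\<exists>k. Suc k < length b & a1 <= b ! k & b ! (Suc k) <= a1"
  proof (rule ccontr)
   assume con: "\<not> ?thesis"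
   \<comment> \<open>Without a crossing every row after the first would exceed \<open>a1\<close>,
     and the total of the rows would be larger than the total of the prescribed norms, none of which
     exceeds \<open>a1\<close>.\<close>
   have "a1 <= b ! k & (0 < k --> a1 < b ! k)" if "k < length b" for k
    using that
   proof (induction k)
    case (Suc k)
    then show ?case using con by (metis Suc_lessD linorder_not_le less_imp_le)
   qed (use a1b in auto)
   then have gt: "a1 <= b ! k" "0 < k ==> a1 < b ! k" if "k < length b" for k using that by auto
   have "sum_list as <= (\<Sum>x\<leftarrow>as. a1)" using a1ge by (induction as) (auto intro: add_mono)
   then have "sum_list (a1 # as) <= (\<Sum>i<length b. a1)" using lb by (simp add: sum_list_triv algebra_simps)
   also have "... < (\<Sum>i<length b. b ! i)"
    using gt lb ne by (intro sum_strict_mono_ex1) (auto intro!: bexI[of _ 1])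
   also have "... = sum_list b" by (simp add: sum_list_sum_nth atLeast0LessThan)
   finally show False using tot by simp
  qed
  then obtain k where k: "Suc k < length b" "a1 <= b ! k" "b ! (Suc k) <= a1" by blast
  define pr where "pr = take k B"
  define po where "po = drop (Suc (Suc k)) B"
  define x where "x = B ! k"
  define y where "y = B ! Suc k"
  have kB: "Suc k < length B" using k lb by auto
  have Beq: "B = pr @ x # y # po"
   unfolding pr_def po_def x_def y_def using kB by (metis Cons_nth_drop_Suc Suc_lessD append_take_drop_id)
  have lpr: "length pr = k" unfolding pr_def using kB by auto
  have Nx: "N x = b ! k" "N y = b ! Suc k" unfolding x_def y_def b_def using kB by auto
  obtain u v where uv: "N u = a1" "!!j k. u j * u k + v j * v k = x j * x k + y j * y k"
   using plane_rotation_norm[of y D a1 x] k Nx unfolding N_def by metis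
  have Nv: "N v = N x + N y - a1"
  proof -
   have "N u + N v = N x + N y" unfolding N_def sum.distrib[symmetric] using uv(2) by (simp add: power2_eq_square)
   then show ?thesis using uv by simp
  qed
  have vb: "N y <= N v" "N v <= N x" using Nv k Nx by auto
  \<comment> \<open>The squared norm of the second rotated row \<open>v\<close> lies between those
    of \<open>y\<close> and \<open>x\<close>, so it can take their place without disturbing the
    order.\<close>
  define B' where "B' = pr @ v # po"
  have beq: "b = map N pr @ N x # N y # map N po" unfolding b_def Beq by simp
  have lB': "length B' = length as" unfolding B'_def using lb Beq by auto
  have sb: "sorted_wrt (\<ge>) (map N pr @ N x # N y # map N po)" using C(3) unfolding b_def[symmetric] beq .
  have sB': "sorted_wrt (\<ge>) (map N B')"
   using sb vb unfolding B'_def by (fastforce simp: sorted_wrt_append)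
  have as_sorted: "sorted_wrt (\<ge>) as" using C(2) by simp
  have take_b: "sum_list (take m b) = sum_list (take m (map N pr))" if "m <= k" for m
   unfolding beq using that lpr by simp
  \<comment> \<open>Up to position \<open>k\<close> the prefixes of \<open>B'\<close> are those of
    \<open>B\<close>, and dropping the largest prescribed norm only lowers the left side. Beyond it
    both sides are the prefixes of length \<open>Suc m\<close> diminished by
    \<open>a1\<close>.\<close>
  have tk: "sum_list (take m as) <= sum_list (take m (map N B'))" if m: "m <= length as" for m
  proof (cases "m <= k")
   case True
   have "sum_list (take m as) <= sum_list (take m (a1 # as))"
   proof (cases m)
    case (Suc m')
    have "sum_list (take (Suc m') as) = sum_list (take m' as) + as ! m'"
     using m Suc by (simp add: take_Suc_conv_app_nth)
    then show ?thesis using Suc a1ge[of "as ! m'"] m by simp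
   qed simp
   also have "... <= sum_list (take m b)" using pre m by simp
   also have "... = sum_list (take m (map N B'))" using take_b[OF True] True lpr unfolding B'_def by simp
   finally show ?thesis .
  next
   case False
   then obtain c where c: "m = Suc (k + c)" by (metis less_imp_Suc_add linorder_not_le)
   have "a1 + sum_list (take m as) <= sum_list (take (Suc m) b)" using pre[of "Suc m"] m by simp
   also have "... = sum_list (map N pr) + N x + N y + sum_list (take c (map N po))"
    unfolding beq c using lpr by simp
   also have "... = a1 + sum_list (take m (map N B'))" unfolding B'_def c using lpr Nv by simp
   finally show ?thesis by simp
  qed
  have tot': "sum_list as = sum_list (map N B')" using tot unfolding beq B'_def by (simp add: Nv)
  obtain M where M: "length M = length as" "map N M = as"
   "!!j k. sum_list (map (%x. x j * x k) M) = sum_list (map (%x. x j * x k) B')"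
   using Cons.IH[of B', folded N_def, OF lB' as_sorted sB' tk tot'] by blast
  show ?thesis
   unfolding N_def[symmetric]
   using M uv by (intro exI[of _ "u # M"]) (auto simp: B'_def Beq algebra_simps)
 qed
qed

lemma sum_take_distinct:
 fixes f :: "'b => real"
 assumes "distinct xs" "m <= length xs"
 shows "sum_list (take m (map f xs)) = (\<Sum>x\<in>set (take m xs). f x)" "card (set (take m xs)) = m"
 using assms by (simp_all add: take_map sum_list_distinct_conv_sum_set distinct_card)

text \<open>The Horn half of the Schur--Horn theorem, for the rows of a real matrix.\<close>

lemma matrix_with_row_norms:
 fixes a psi :: "nat => real"
 assumes nn: "!!j. 0 <= psi j" and dec: "!!j. 1 <= j ==> psi (Suc j) <= psi j"
  and z: "!!j. j ~: {1..d} \<or> n < j ==> psi j = 0"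
  and maj: "!!T. T <= {1..n} ==> (\<Sum>r\<in>T. a r) <= (\<Sum>j\<in>{1..card T}. psi j)"
  and tot: "(\<Sum>r\<in>{1..n}. a r) = (\<Sum>j\<in>{1..d}. psi j)"
 obtains M :: "nat => nat => real"
  where "!!r. r : {1..n} ==> (\<Sum>j\<in>{1..d}. (M r j)\<^sup>2) = a r"
   and "!!j k. j : {1..d} ==> k : {1..d} ==> (\<Sum>r\<in>{1..n}. M r j * M r k) = (if j = k then psi j else 0)"
proof -
 define xs where "xs = rev (sort_key a [1..<Suc n])"
 define as where "as = map a xs"
 have xs: "distinct xs" "set xs = {1..n}" "length xs = n" unfolding xs_def by auto
 have sa: "sorted_wrt (\<ge>) as"
  unfolding as_def xs_def rev_map[symmetric] sorted_wrt_rev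
  using sorted_sort_key[of a "[1..<Suc n]"] by simp
 \<comment> \<open>The square root of the diagonal matrix of the \<open>psi r\<close>, with one row
   per generator. Only the columns in \<open>{1..d}\<close> enter the norms; as \<open>psi\<close>
   vanishes beyond \<open>d\<close> and beyond \<open>n\<close>, the sums agree whichever of the two
   is larger.\<close>
 define B where "B = map (%r j. if j = r then sqrt (psi r) else 0) [1..<Suc n]"
 define N where "N = (%x::nat=>real. \<Sum>j\<in>{1..d}. (x j)\<^sup>2)"
 have NB: "N (%j. if j = r then sqrt (psi r) else 0) = psi r" for r
 proof -
  have "N (%j. if j = r then sqrt (psi r) else 0) = (\<Sum>j\<in>{1..d}. if j = r then psi r else 0)"
   unfolding N_def using nn by (intro sum.cong) auto
  then show ?thesis using z[of r] by auto
 qed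
 have mB: "map N B = map psi [1..<Suc n]" unfolding B_def using NB by (simp del: upt_Suc)
 have dec': "psi k <= psi j" if "1 <= j" "j <= k" for j k
  using that(2)
 proof (induction rule: dec_induct)
  case (step m) then show ?case using dec[of m] that by linarith
 qed auto
 have sB: "sorted_wrt (\<ge>) (map N B)"
  unfolding mB sorted_wrt_map
  by (rule sorted_wrt_mono_rel[where P="(<)"]) (auto intro!: dec' simp del: upt_Suc)
 have tk: "sum_list (take m (map psi [1..<Suc n])) = (\<Sum>j\<in>{1..m}. psi j)" if "m <= n" for m
  using that by (simp add: take_map sum_list_distinct_conv_sum_set atLeastLessThanSuc_atLeastAtMost take_upt del: upt_Suc)
 have "\<exists>M. length M = length as & map N M = as \<and>
  (\<forall>j k. sum_list (map (%x. x j * x k) M) = sum_list (map (%x. x j * x k) B))"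
  unfolding N_def
 proof (rule rows_with_norms)
  show "length B = length as" unfolding B_def as_def by (simp add: xs(3) del: upt_Suc)
  show "sum_list (take m as) <= sum_list (take m (map (%x. \<Sum>j\<in>{1..d}. (x j)\<^sup>2) B))" if "m <= length as" for m
  proof -
   have m: "m <= n" using that unfolding as_def xs by (simp add: xs)
   show ?thesis unfolding N_def[symmetric] mB tk[OF m] unfolding as_def
    using sum_take_distinct(1)[OF xs(1), of m a] sum_take_distinct(2)[OF xs(1), of m] m xs maj[of "set (take m xs)"] by (metis set_take_subset)
  qed
  have "sum_list as = (\<Sum>r\<in>{1..n}. a r)" unfolding as_def using xs by (simp add: sum_list_distinct_conv_sum_set)
  also have "... = (\<Sum>j\<in>{1..n}. psi j)" unfolding tot by (rule sum.mono_neutral_cong) (use z in auto)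
  also have "... = sum_list (map psi [1..<Suc n])" using tk[of n] by (simp del: upt_Suc)
  finally show "sum_list as = sum_list (map (%x. \<Sum>j\<in>{1..d}. (x j)\<^sup>2) B)" unfolding N_def[symmetric] mB .
 qed (use sa sB in \<open>auto simp: N_def\<close>)
 then obtain M where M: "length M = length as" "map N M = as"
  "!!j k. sum_list (map (%x. x j * x k) M) = sum_list (map (%x. x j * x k) B)" by blast
 \<comment> \<open>Inverse of the sorting permutation: it returns the rows to the generators they
   belong to.\<close>
 define ix where "ix = (%r. THE i. i < n & xs ! i = r)"
 have ix: "ix (xs ! i) = i" if "i < n" for i
  unfolding ix_def using that xs by (intro the_equality) (auto simp: nth_eq_iff_index_eq)
 have bij: "bij_betw (%i. xs ! i) {..<n} {1..n}" using bij_betw_nth[OF xs(1)] xs(2,3) by auto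
 define M' where "M' = (%r. M ! ix r)"
 have lM: "length M = n" using M(1) xs unfolding as_def by simp
 have re: "(\<Sum>r\<in>{1..n}. g (M' r)) = sum_list (map g M)" for g :: "(nat => real) => real"
 proof -
  have "(\<Sum>r\<in>{1..n}. g (M' r)) = (\<Sum>i<n. g (M' (xs ! i)))" by (rule sum.reindex_bij_betw[OF bij, symmetric])
  also have "... = (\<Sum>i<n. g (M ! i))" unfolding M'_def using ix by (intro sum.cong) auto
  also have "... = sum_list (map g M)" using lM by (simp add: sum_list_sum_nth atLeast0LessThan)
  finally show ?thesis .
 qed
 show thesis
 proof (rule that[of M'])
  fix r assume "r : {1..n}"
  then obtain i where i: "i < n" "r = xs ! i" using xs by (metis in_set_conv_nth)
  have "N (M ! i) = as ! i" using M(2) i lM by (metis nth_map)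
  then show "(\<Sum>j\<in>{1..d}. (M' r j)\<^sup>2) = a r" unfolding M'_def i(2) ix[OF i(1)] as_def using i xs by (simp add: N_def)
 next
  fix j k assume jk: "j : {1..d}" "k : {1..d}"
  have "(\<Sum>r\<in>{1..n}. M' r j * M' r k) = sum_list (map (%x. x j * x k) B)"
   using re[of "%x. x j * x k"] M(3) by simp
  also have "... = (\<Sum>r\<in>{1..n}. (if j = r then sqrt (psi r) else 0) * (if k = r then sqrt (psi r) else 0))"
   unfolding B_def map_map by (subst sum_list_distinct_conv_sum_set) (auto simp: comp_def atLeastLessThanSuc_atLeastAtMost simp del: upt_Suc intro!: sum.cong)
  also have "... = (\<Sum>r\<in>{1..n}. if j = r then (if j = k then psi j else 0) else 0)"
   using nn by (intro sum.cong) auto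
  also have "... = (if j = k then psi j else 0)" using jk z[of j] by auto
  finally show "(\<Sum>r\<in>{1..n}. M' r j * M' r k) = (if j = k then psi j else 0)" .
 qed
qed

section \<open>Spectral resolutions of finite rank operators\<close>

text \<open>The form is only semidefinite, so that one development serves both \<open>ell2\<close>
  and the functions in \<open>L2\<close>, where a function vanishing almost everywhere has norm zero
  without being zero.\<close>

locale semi_inner =
 fixes V :: "('b => complex) set" and ip :: "('b => complex) => ('b => complex) => complex"
 assumes sub: "cfun.subspace V"
  and add_left: "!!f g h. f : V ==> g : V ==> h : V ==> ip (f + g) h = ip f h + ip g h"
  and scale_left: "!!f h c. f : V ==> h : V ==> ip (cscale c f) h = c * ip f h"
  and commute: "!!f g. f : V ==> g : V ==> ip g f = cnj (ip f g)"
  and nonneg: "!!f. f : V ==> 0 <= Re (ip f f)"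
begin

definition sq :: "('b => complex) => real" where "sq f = Re (ip f f)"

lemma V_add: "f : V ==> g : V ==> f + g : V" using sub by (rule cfun.subspace_add)
lemma V_diff: "f : V ==> g : V ==> f - g : V" using sub by (rule cfun.subspace_diff)
lemma V_scale: "f : V ==> cscale c f : V" using sub by (rule cfun.subspace_scale)
lemma V_zero: "0 : V" using sub by (rule cfun.subspace_0)
lemma V_sum: "(!!i. i : I ==> f i : V) ==> (\<Sum>i\<in>I. f i) : V" using sub by (rule cfun.subspace_sum)

lemma zero_left: "h : V ==> ip 0 h = 0"
 using scale_left[of h h 0] by (simp add: cfun.scale_zero_left)

lemma diff_left: "f : V ==> g : V ==> h : V ==> ip (f - g) h = ip f h - ip g h"
 using add_left[of "f - g" g h] by (simp add: V_diff)

lemma add_right: "f : V ==> g : V ==> h : V ==> ip h (f + g) = ip h f + ip h g"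
 using add_left[of f g h] by (simp add: commute[of _ h] V_add)

lemma scale_right: "f : V ==> h : V ==> ip h (cscale c f) = cnj c * ip h f"
 using scale_left[of f h c] by (simp add: commute[of _ h] V_scale)

lemma diff_right: "f : V ==> g : V ==> h : V ==> ip h (f - g) = ip h f - ip h g"
 using diff_left[of f g h] by (simp add: commute[of _ h] V_diff)

lemma zero_right: "h : V ==> ip h 0 = 0"
 using zero_left[of h] by (simp add: commute[of _ h] V_zero)

lemma sum_left:
 assumes "!!i. i : I ==> f i : V" "h : V"
 shows "ip (\<Sum>i\<in>I. f i) h = (\<Sum>i\<in>I. ip (f i) h)"
 using assms(1)
proof (induction I rule: infinite_finite_induct)
 case (insert i I)
 have "ip (f i + (\<Sum>i\<in>I. f i)) h = ip (f i) h + ip (\<Sum>i\<in>I. f i) h"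
  using insert by (intro add_left V_sum assms(2)) auto
 then show ?case using insert by (simp only: sum.insert insert_iff simp_thms)
qed (auto simp: zero_left assms)

lemma sum_right:
 assumes "!!i. i : I ==> f i : V" "h : V"
 shows "ip h (\<Sum>i\<in>I. f i) = (\<Sum>i\<in>I. ip h (f i))"
proof -
 have "ip h (\<Sum>i\<in>I. f i) = cnj (ip (\<Sum>i\<in>I. f i) h)" using assms by (intro commute V_sum)
 also have "... = (\<Sum>i\<in>I. cnj (ip (f i) h))" using sum_left[of I f h] assms by simp
 also have "... = (\<Sum>i\<in>I. ip h (f i))" using assms by (intro sum.cong) (auto simp: commute[of _ h])
 finally show ?thesis .
qed

lemma ip_self: "f : V ==> ip f f = of_real (sq f)"
 using commute[of f f] unfolding sq_def by (simp add: complex_eq_iff)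

lemma sq_nonneg: "f : V ==> 0 <= sq f" unfolding sq_def by (rule nonneg)

lemma sq_scale: "f : V ==> sq (cscale c f) = (cmod c)\<^sup>2 * sq f"
proof -
 assume f: "f : V"
 have "ip (cscale c f) (cscale c f) = (c * cnj c) * ip f f"
  using f by (simp add: scale_left scale_right V_scale)
 then have "ip (cscale c f) (cscale c f) = of_real ((cmod c)\<^sup>2 * sq f)"
  using f by (simp add: ip_self complex_norm_square del: of_real_power)
 then show ?thesis unfolding sq_def by (metis Re_complex_of_real)
qed

lemma sq_add: "f : V ==> g : V ==> sq (f + g) = sq f + 2 * Re (ip f g) + sq g"
 unfolding sq_def using commute[of f g] by (simp add: add_left add_right V_add)

lemma sq_diff: "f : V ==> g : V ==> sq (f - g) = sq f - 2 * Re (ip f g) + sq g"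
 unfolding sq_def using commute[of f g] by (simp add: diff_left diff_right V_diff)

lemma sq_diff_commute: "f : V ==> g : V ==> sq (f - g) = sq (g - f)"
 using commute[of f g] by (simp add: sq_diff)

lemma Cauchy_Schwarz_sq:
 assumes f: "f : V" and g: "g : V"
 shows "(cmod (ip f g))\<^sup>2 <= sq f * sq g"
proof -
 define c where "c = ip f g"
 have key: "0 <= sq f - 2 * t * (cmod c)\<^sup>2 + t\<^sup>2 * (cmod c)\<^sup>2 * sq g" for t
 proof -
  have "0 <= sq (f - cscale (of_real t * c) g)" using f g by (intro sq_nonneg V_diff V_scale)
  also have "... = sq f - 2 * Re (cnj (of_real t * c) * c) + (cmod (of_real t * c))\<^sup>2 * sq g"
   using f g by (simp add: sq_diff V_scale sq_scale scale_right c_def)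
  also have "cnj (of_real t * c) * c = of_real (t * (cmod c)\<^sup>2)"
   by (simp add: complex_norm_square mult_ac del: of_real_power)
  finally show ?thesis by (simp add: norm_mult power_mult_distrib)
 qed
 show ?thesis
 proof (cases "sq g = 0")
  case True
  have "c = 0"
  proof (rule ccontr)
   assume "c ~= 0"
   then have "(cmod c)\<^sup>2 > 0" by simp
   then show False using key[of "(sq f + 1) / (2 * (cmod c)\<^sup>2)"] True by simp
  qed
  then show ?thesis using True c_def by simp
 next
  case False
  then have G: "sq g > 0" using sq_nonneg[OF g] by simp
  have "0 <= sq f - (cmod c)\<^sup>2 / sq g" using key[of "1 / sq g"] G by (simp add: field_simps power2_eq_square)
  then show ?thesis using G unfolding c_def by (simp add: field_simps)
 qed
qed

lemma Cauchy_Schwarz: "f : V ==> g : V ==> cmod (ip f g) <= sqrt (sq f) * sqrt (sq g)"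
 using Cauchy_Schwarz_sq[of f g] by (metis abs_norm_cancel real_sqrt_abs real_sqrt_le_iff real_sqrt_mult)

lemma triangle: "f : V ==> g : V ==> sqrt (sq (f + g)) <= sqrt (sq f) + sqrt (sq g)"
proof -
 assume f: "f : V" and g: "g : V"
 have "Re (ip f g) <= sqrt (sq f) * sqrt (sq g)"
  using Cauchy_Schwarz[OF f g] complex_Re_le_cmod order_trans by blast
 then have "sq (f + g) <= (sqrt (sq f) + sqrt (sq g))\<^sup>2"
  using f g by (simp add: sq_add power2_sum sq_nonneg)
 then show ?thesis using f g by (intro real_le_lsqrt) (auto intro!: add_nonneg_nonneg sq_nonneg)
qed

lemma finite_expansion:
 assumes fin: "finite I" and e: "!!i. i : I ==> e i : V"
  and on: "!!i j. i : I ==> j : I ==> ip (e i) (e j) = (if i = j then 1 else 0)"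
  and f: "f : V"
 defines "r \<equiv> f - (\<Sum>i\<in>I. cscale (ip f (e i)) (e i))"
 shows "r : V" "!!j. j : I ==> ip r (e j) = 0" "sq f = (\<Sum>i\<in>I. (cmod (ip f (e i)))\<^sup>2) + sq r"
proof -
 define s where "s = (\<Sum>i\<in>I. cscale (ip f (e i)) (e i))"
 have s: "s : V" unfolding s_def using e by (intro V_sum V_scale)
 show r: "r : V" unfolding r_def using f s s_def by (simp add: V_diff)
 have se: "ip s (e j) = ip f (e j)" if j: "j : I" for j
 proof -
  have "ip s (e j) = (\<Sum>i\<in>I. ip f (e i) * (if i = j then 1 else 0))"
   unfolding s_def using e j on by (subst sum_left) (auto simp: V_scale scale_left intro!: sum.cong)
  also have "... = ip f (e j)" using j fin by (simp add: if_distrib cong: if_cong)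
  finally show ?thesis .
 qed
 show re: "ip r (e j) = 0" if "j : I" for j
  unfolding r_def s_def[symmetric] using f s e[OF that] se[OF that] by (simp add: diff_left)
 have rs: "ip r s = 0"
  unfolding s_def using r e re by (subst sum_right) (auto simp: V_scale scale_right)
 have ss: "ip s s = of_real (\<Sum>i\<in>I. (cmod (ip f (e i)))\<^sup>2)"
 proof -
  have "ip s s = (\<Sum>i\<in>I. cnj (ip f (e i)) * ip s (e i))"
   by (subst (2) s_def, subst sum_right) (use s e in \<open>auto simp: V_scale scale_right\<close>)
  also have "... = (\<Sum>i\<in>I. of_real ((cmod (ip f (e i)))\<^sup>2))"
   using se by (intro sum.cong) (auto simp: complex_norm_square mult_ac simp del: of_real_power)
  finally show ?thesis by simp
 qed
 have "f = r + s" unfolding r_def s_def by simp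
 then have "sq f = sq r + 2 * Re (ip r s) + sq s" using sq_add[OF r s] by simp
 also have "sq s = (\<Sum>i\<in>I. (cmod (ip f (e i)))\<^sup>2)" using ss unfolding sq_def by simp
 finally show "sq f = (\<Sum>i\<in>I. (cmod (ip f (e i)))\<^sup>2) + sq r" using rs by simp
qed

lemma sq_combination:
 assumes fin: "finite I" and e: "!!i. i : I ==> e i : V"
  and on: "!!i j. i : I ==> j : I ==> ip (e i) (e j) = (if i = j then 1 else 0)"
 shows "ip (\<Sum>i\<in>I. cscale (c i) (e i)) (\<Sum>i\<in>I. cscale (b i) (e i)) = (\<Sum>i\<in>I. c i * cnj (b i))"
  and "j : I ==> ip (\<Sum>i\<in>I. cscale (c i) (e i)) (e j) = c j"
proof -
 have 1: "ip (\<Sum>i\<in>I. cscale (c i) (e i)) (e j) = c j" if "j : I" for j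
 proof -
  have "ip (\<Sum>i\<in>I. cscale (c i) (e i)) (e j) = (\<Sum>i\<in>I. c i * (if i = j then 1 else 0))"
   using e that on by (subst sum_left) (auto simp: V_scale scale_left intro!: sum.cong)
  then show ?thesis using that fin by (simp add: if_distrib cong: if_cong)
 qed
 then show "j : I ==> ip (\<Sum>i\<in>I. cscale (c i) (e i)) (e j) = c j" .
 show "ip (\<Sum>i\<in>I. cscale (c i) (e i)) (\<Sum>i\<in>I. cscale (b i) (e i)) = (\<Sum>i\<in>I. c i * cnj (b i))"
  using e 1 by (subst sum_right) (auto simp: V_scale V_sum scale_right intro!: sum.cong)
qed

end

section \<open>The inner product space of square summable families\<close>

lemma ell2_mult_summable:
 assumes "f : ell2" "g : ell2"
 shows "(%a. cmod (f a * cnj (g a))) summable_on UNIV"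
proof (rule Infinite_Sum.abs_summable_on_comparison_test)
 have "(%a. (cmod (f a))\<^sup>2 + (cmod (g a))\<^sup>2) summable_on UNIV"
  using assms unfolding ell2_def by (intro summable_on_add) auto
 then show "(%a. norm ((cmod (f a))\<^sup>2 + (cmod (g a))\<^sup>2)) summable_on UNIV"
  by simp
 show "norm (f a * cnj (g a)) <= norm ((cmod (f a))\<^sup>2 + (cmod (g a))\<^sup>2)" for a
 proof -
  have "2 * (cmod (f a) * cmod (g a)) <= (cmod (f a))\<^sup>2 + (cmod (g a))\<^sup>2"
   using sum_squares_bound[of "cmod (f a)" "cmod (g a)"] by simp
  moreover have "0 <= cmod (f a) * cmod (g a)" by simp
  ultimately have "cmod (f a) * cmod (g a) <= (cmod (f a))\<^sup>2 + (cmod (g a))\<^sup>2" by linarith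
  then show ?thesis by (simp add: norm_mult)
 qed
qed

lemma ell2_subspace: "cfun.subspace ell2"
proof (rule cfun.subspaceI)
 show "0 : ell2" unfolding ell2_def by simp
 show "f + g : ell2" if "f : ell2" "g : ell2" for f g :: "'a => complex"
 proof -
  have "(%a. 2 * (cmod (f a))\<^sup>2 + 2 * (cmod (g a))\<^sup>2) summable_on UNIV"
   using that unfolding ell2_def by (intro summable_on_add summable_on_cmult_right) auto
  then have "(%a. (cmod ((f + g) a))\<^sup>2) summable_on UNIV"
  proof (rule summable_on_comparison_test)
   fix a
   have "(cmod (f a + g a))\<^sup>2 <= (cmod (f a) + cmod (g a))\<^sup>2" by (intro power_mono norm_triangle_ineq) auto
   also have "... <= 2 * (cmod (f a))\<^sup>2 + 2 * (cmod (g a))\<^sup>2"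
    using sum_squares_bound[of "cmod (f a)" "cmod (g a)"] by (simp add: power2_sum)
   finally show "(cmod ((f + g) a))\<^sup>2 <= 2 * (cmod (f a))\<^sup>2 + 2 * (cmod (g a))\<^sup>2" by simp
  qed auto
  then show ?thesis unfolding ell2_def by simp
 qed
 show "cscale c f : ell2" if "f : ell2" for c and f :: "'a => complex"
  using that unfolding ell2_def cscale_def
  by (auto simp: norm_mult power_mult_distrib intro!: summable_on_cmult_right)
qed

lemma infsum_complex_of_real:
 "f summable_on A ==> (\<Sum>\<^sub>\<infinity>a\<in>A. complex_of_real (f a)) = of_real (\<Sum>\<^sub>\<infinity>a\<in>A. f a)"
 by (rule infsumI[OF has_sum_of_real[OF has_sum_infsum]])

global_interpretation ell2: semi_inner ell2 ell2_inner
proof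
 show "cfun.subspace ell2" by (rule ell2_subspace)
 note s = ell2_mult_summable[THEN abs_summable_summable]
 show "ell2_inner (f + g) h = ell2_inner f h + ell2_inner g h"
  if "f : ell2" "g : ell2" "h : ell2" for f g h :: "'a => complex"
  unfolding ell2_inner_def using infsum_add[OF s[OF that(1,3)] s[OF that(2,3)]] by (simp add: distrib_right)
 show "ell2_inner (cscale c f) h = c * ell2_inner f h" if "f : ell2" "h : ell2" for f h :: "'a => complex" and c
  unfolding ell2_inner_def cscale_def using infsum_cmult_right[OF s[OF that], of c] by (simp add: mult.assoc)
 show "ell2_inner g f = cnj (ell2_inner f g)" if "f : ell2" "g : ell2" for f g :: "'a => complex"
  unfolding ell2_inner_def by (simp add: mult.commute flip: infsum_cnj)
 show "0 <= Re (ell2_inner f f)" if "f : ell2" for f :: "'a => complex"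
 proof -
  have "ell2_inner f f = (\<Sum>\<^sub>\<infinity>a. of_real ((cmod (f a))\<^sup>2))"
   unfolding ell2_inner_def by (simp only: complex_norm_square)
  also have "... = of_real (\<Sum>\<^sub>\<infinity>a. (cmod (f a))\<^sup>2)" by (rule infsum_complex_of_real) (use that in \<open>simp add: ell2_def\<close>)
  finally show ?thesis by (simp add: infsum_nonneg del: of_real_power)
 qed
qed

lemma ell2_sq:
 assumes "f : ell2"
 shows "ell2.sq f = (\<Sum>\<^sub>\<infinity>a. (cmod (f a))\<^sup>2)"
proof -
 have "ell2_inner f f = (\<Sum>\<^sub>\<infinity>a. of_real ((cmod (f a))\<^sup>2))"
  unfolding ell2_inner_def by (simp only: complex_norm_square)
 also have "... = of_real (\<Sum>\<^sub>\<infinity>a. (cmod (f a))\<^sup>2)" by (rule infsum_complex_of_real) (use assms in \<open>simp add: ell2_def\<close>)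
 finally show ?thesis unfolding ell2.sq_def by (simp del: of_real_power)
qed

lemma ell2_sq_eq_0_iff: "f : ell2 ==> ell2.sq f = 0 \<longleftrightarrow> f = 0"
proof
 assume f: "f : ell2" and z: "ell2.sq f = 0"
 have "(cmod (f a))\<^sup>2 = 0" for a
  using z f unfolding ell2_sq[OF f] unfolding ell2_def by (intro nonneg_infsum_le_0D[of _ UNIV]) auto
 then show "f = 0" by (simp add: fun_eq_iff)
qed (simp add: ell2_sq ell2.V_zero)

lemma unit_family_ell2: "unit_family a : ell2"
proof -
 have "(%b. (cmod (unit_family a b))\<^sup>2) summable_on {a}" by simp
 then show ?thesis unfolding ell2_def
  by (simp, subst summable_on_cong_neutral[where T="{a}" and g="%b. (cmod (unit_family a b))\<^sup>2"]) (auto simp: unit_family_def)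
qed

lemma ell2_inner_unit: "ell2_inner f (unit_family a) = f a"
proof -
 have "ell2_inner f (unit_family a) = (\<Sum>\<^sub>\<infinity>b\<in>{a}. f b * cnj (unit_family a b))"
  unfolding ell2_inner_def by (rule infsum_cong_neutral) (auto simp: unit_family_def)
 then show ?thesis by (simp add: unit_family_def)
qed

lemma sum_fun_apply: "(\<Sum>i\<in>I. f i) x = (\<Sum>i\<in>I. f i x)"
 by (induction I rule: infinite_finite_induct) auto

lemma has_sum_finite_sum:
 fixes f :: "'i => 'x => 'c :: {topological_comm_monoid_add}"
 assumes "!!i. i : I ==> (f i has_sum s i) A"
 shows "((%x. \<Sum>i\<in>I. f i x) has_sum (\<Sum>i\<in>I. s i)) A"
 using assms
proof (induction I rule: infinite_finite_induct)
 case (insert i I)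
 then show ?case by (simp add: has_sum_add)
qed auto

section \<open>The spectral theorem for symmetric operators of finite rank\<close>

text \<open>No determinants: with \<open>ev p\<close> for the polynomial \<open>p\<close> of
  \<open>S\<close> applied to \<open>v\<close>, a nonzero \<open>p\<close> of least degree with
  \<open>ev p = 0\<close> has a root \<open>z\<close>, and the cofactor \<open>q\<close> of the
  linear factor gives an eigenvector \<open>ev q\<close>, nonzero by minimality.\<close>

lemma eigenvector_exists:
 assumes U: "cfun.subspace U" and B: "finite B" "U <= cfun.span B"
  and maps: "!!f. f : U ==> S f : U"
  and Sadd: "!!f g. f : U ==> g : U ==> S (f + g) = S f + S g"
  and Sscale: "!!c f. f : U ==> S (cscale c f) = cscale c (S f)"
  and v: "v : U" "v ~= 0"
 obtains z xi where "xi : U" "xi ~= 0" "S xi = cscale z xi"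
proof -
 define w where "w = (%k. (S ^^ k) v)"
 have w: "w k : U" "S (w k) = w (Suc k)" for k
  by (induction k) (auto simp: w_def v maps)
 have S0: "S 0 = 0" using Sscale[of 0 0] cfun.subspace_0[OF U] by (simp add: cfun.scale_zero_left)
 have Ssum: "S (\<Sum>i\<in>I. g i) = (\<Sum>i\<in>I. S (g i))" if "!!i. i : I ==> g i : U" for I :: "nat set" and g
  using that
 proof (induction I rule: infinite_finite_induct)
  case (insert i I)
  have "S (g i + (\<Sum>i\<in>I. g i)) = S (g i) + S (\<Sum>i\<in>I. g i)"
   using insert by (intro Sadd cfun.subspace_sum[OF U]) auto
  then show ?case using insert by (simp only: sum.insert insert_iff simp_thms)
 qed (auto simp: S0)
 define ev where "ev = (%p. \<Sum>k\<le>degree p. cscale (coeff p k) (w k))"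
 have ev_ext: "ev p = (\<Sum>k\<le>N. cscale (coeff p k) (w k))" if "degree p <= N" for p N
  unfolding ev_def by (rule sum.mono_neutral_left) (use that in \<open>auto simp: coeff_eq_0 cfun.scale_zero_left\<close>)
 have evU: "ev p : U" for p
  unfolding ev_def using w by (intro cfun.subspace_sum[OF U] cfun.subspace_scale[OF U]) auto
 have "\<exists>p. p ~= 0 & ev p = 0"
 \<comment> \<open>Linear dependence is a property of sets of vectors, so a repetition among the
   \<open>w k\<close> has to be treated apart from a relation between distinct ones.\<close>
 proof (cases "inj_on w {..card B}")
  case False
  then obtain i j where ij: "i ~= j" "w i = w j" unfolding inj_on_def by auto
  define p where "p = monom (1::complex) i - monom 1 j"
  have "coeff p i = 1" unfolding p_def using ij by simp
  then have p0: "p ~= 0" by auto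
  have "ev p = (\<Sum>k\<le>max (degree p) (max i j). cscale (coeff p k) (w k))" by (intro ev_ext) auto
  also have "... = (\<Sum>k\<in>{i,j}. cscale (coeff p k) (w k))"
   by (rule sum.mono_neutral_right) (auto simp: p_def cfun.scale_zero_left)
  also have "... = 0" using ij by (simp add: p_def cscale_def fun_eq_iff)
  finally show ?thesis using p0 by blast
 next
  case True
  have "cfun.dependent (w ` {..card B})"
  proof (rule ccontr)
   assume "\<not> cfun.dependent (w ` {..card B})"
   moreover have "w ` {..card B} <= cfun.span B" using w B by blast
   ultimately have "card (w ` {..card B}) <= card B" using cfun.independent_span_bound[OF B(1)] by blast
   then show False using card_image[OF True] by simp
  qed
  then obtain u where u: "\<exists>x\<in>w ` {..card B}. u x ~= 0" "(\<Sum>x\<in>w ` {..card B}. cscale (u x) x) = 0"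
   using cfun.dependent_finite[of "w ` {..card B}"] by auto
  then obtain i where i: "i <= card B" "u (w i) ~= 0" by auto
  define p where "p = (\<Sum>k\<le>card B. monom (u (w k)) k)"
  have cp: "coeff p k = (if k <= card B then u (w k) else 0)" for k
   unfolding p_def by (simp add: coeff_sum)
  have "p ~= 0" using cp[of i] i by auto
  moreover have "degree p <= card B" by (rule degree_le) (simp add: cp)
  then have "ev p = (\<Sum>k\<le>card B. cscale (coeff p k) (w k))" by (rule ev_ext)
  then have "ev p = (\<Sum>k\<le>card B. cscale (u (w k)) (w k))" by (simp add: cp)
  then have "ev p = 0" using u(2) by (simp add: sum.reindex[OF True])
  ultimately show ?thesis by blast
 qed
 then obtain p where p: "p ~= 0" "ev p = 0" and pmin: "!!q. q ~= 0 ==> ev q = 0 ==> degree p <= degree q"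
  using ex_has_least_nat[of "%p. p ~= 0 & ev p = 0" _ degree] by blast
 have "degree p ~= 0"
 proof
  assume d: "degree p = 0"
  then have "ev p = cscale (coeff p 0) v" unfolding ev_def w_def by simp
  moreover have "coeff p 0 ~= 0" using d p(1) by (metis leading_coeff_0_iff)
  ultimately show False using p(2) v(2) by (metis cfun.scale_eq_0_iff)
 qed
 then have "\<not> constant (poly p)" by (simp add: constant_degree)
 then obtain z where "poly p z = 0" using fundamental_theorem_of_algebra by blast
 then obtain q where q: "p = [:-z, 1:] * q" by (metis poly_eq_0_iff_dvd dvd_def)
 have q0: "q ~= 0" using p q by auto
 have dp: "degree p = Suc (degree q)" unfolding q using q0 by (subst degree_mult_eq) auto
 have evq: "ev q ~= 0" using pmin[OF q0] dp by auto
 have cp: "coeff p 0 = - z * coeff q 0" "coeff p (Suc k) = coeff q k - z * coeff q (Suc k)" for k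
  unfolding q by (auto simp: algebra_simps)
 have Sev: "S (ev q) = (\<Sum>k\<le>degree q. cscale (coeff q k) (w (Suc k)))"
  unfolding ev_def using w by (subst Ssum) (auto simp: Sscale cfun.subspace_scale[OF U])
 have zev: "cscale z (ev q) = (\<Sum>k\<le>Suc (degree q). cscale (z * coeff q k) (w k))"
  by (subst ev_ext[of q "Suc (degree q)"]) (auto simp: cfun.scale_sum_right cfun.scale_scale simp del: sum.atMost_Suc)
 have "ev p = cscale (coeff p 0) (w 0) + (\<Sum>k\<le>degree q. cscale (coeff p (Suc k)) (w (Suc k)))"
  unfolding ev_def dp by (simp only: sum.atMost_Suc_shift)
 also have "... = S (ev q) - cscale z (ev q)"
  unfolding Sev zev sum.atMost_Suc_shift cp
  by (simp add: cfun.scale_left_diff_distrib sum_subtractf cfun.scale_minus_left del: cfun.scale_sum_right)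
 finally have "S (ev q) = cscale z (ev q)" using p(2) by simp
 then show thesis using that evU evq by blast
qed

definition orthonormal :: "nat => (nat => 'a => complex) => bool" where
 "orthonormal d e \<longleftrightarrow> (\<forall>i\<in>{1..d}. e i : ell2) \<and>
   (\<forall>i\<in>{1..d}. \<forall>j\<in>{1..d}. ell2_inner (e i) (e j) = (if i = j then 1 else 0))"

lemma orthonormalD:
 assumes "orthonormal d e"
 shows "i : {1..d} ==> e i : ell2"
  and "i : {1..d} ==> j : {1..d} ==> ell2_inner (e i) (e j) = (if i = j then 1 else 0)"
 using assms unfolding orthonormal_def by auto

lemma orthonormal_inj: "orthonormal d e ==> inj_on e {1..d}"
 by (rule inj_onI) (metis orthonormalD(2) zero_neq_one)

lemma orthonormal_independent:
 assumes "orthonormal d e"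
 shows "cfun.independent (e ` {1..d})"
proof -
 note on = orthonormalD[OF assms]
 have "u (e k) = 0" if u: "(\<Sum>x\<in>e ` {1..d}. cscale (u x) x) = 0" and k: "k : {1..d}" for u k
 proof -
  have "(\<Sum>i\<in>{1..d}. cscale (u (e i)) (e i)) = 0"
   using u by (simp only: sum.reindex[OF orthonormal_inj[OF assms]] comp_def)
  then have "ell2_inner (\<Sum>i\<in>{1..d}. cscale (u (e i)) (e i)) (e k) = 0"
   using on(1)[OF k] by (simp add: ell2.zero_left)
  then show ?thesis using ell2.sq_combination(2)[of "{1..d}" e k] on k by simp
 qed
 then show ?thesis using cfun.dependent_finite[of "e ` {1..d}"] by auto
qed

lemma orthonormal_span_expansion:
 assumes on: "orthonormal d e" and f: "f : cfun.span (e ` {1..d})"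
 shows "f = (\<Sum>j\<in>{1..d}. cscale (ell2_inner f (e j)) (e j))"
proof -
 note o = orthonormalD[OF on]
 obtain u where "f = (\<Sum>x\<in>e ` {1..d}. cscale (u x) x)"
  using f cfun.span_finite[of "e ` {1..d}"] by auto
 then have f: "f = (\<Sum>i\<in>{1..d}. cscale (u (e i)) (e i))"
  by (simp only: sum.reindex[OF orthonormal_inj[OF on]] comp_def)
 have "ell2_inner f (e j) = u (e j)" if "j : {1..d}" for j
  unfolding f using ell2.sq_combination(2)[of "{1..d}" e j] o that by simp
 then show ?thesis using f by simp
qed

lemma dim_span_orthonormal: "orthonormal d e ==> cfun.dim (cfun.span (e ` {1..d})) = d"
 using cfun.dim_span_eq_card_independent[OF orthonormal_independent] card_image[OF orthonormal_inj]
 by (metis card_atLeastAtMost diff_Suc_1)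

text \<open>Deflation: the orthogonal complement of an eigenvector in \<open>U\<close> is again
  invariant under \<open>S\<close>. The induction runs on a bound \<open>m\<close> for the size of
  independent subsets of \<open>U\<close>; it drops by one, because \<open>xi\<close> can be added
  to every independent subset of the complement.\<close>

lemma spectral_decomposition:
 assumes "cfun.subspace U" "finite B" "U <= cfun.span B" "U <= ell2"
  and "!!f. f : U ==> S f : U"
  and "!!f g. f : U ==> g : U ==> S (f + g) = S f + S g"
  and "!!c f. f : U ==> S (cscale c f) = cscale c (S f)"
  and sym: "!!f g. f : U ==> g : U ==> ell2_inner (S f) g = ell2_inner f (S g)"
  and "!!A. A <= U ==> cfun.independent A ==> card A <= m"
 shows "\<exists>d e mu. orthonormal d e & U = cfun.span (e ` {1..d}) & (\<forall>j\<in>{1..d}. S (e j) = cscale (of_real (mu j)) (e j))"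
 using assms
proof (induction m arbitrary: U)
 case 0
 have "x = 0" if "x : U" for x
 proof (rule ccontr)
  assume "x ~= 0"
  then have "cfun.independent {x}" by (simp add: cfun.dependent_single)
  then show False using "0.prems"(9)[of "{x}"] that by simp
 qed
 then have "U = {0}" using cfun.subspace_0[OF "0.prems"(1)] by auto
 then show ?case by (intro exI[of _ 0]) (auto simp: orthonormal_def)
next
 case (Suc m)
 note U = Suc.prems(1) and UE = subsetD[OF Suc.prems(4)]
 show ?case
 proof (cases "\<exists>v\<in>U. v ~= 0")
  case False
  then have "U = {0}" using cfun.subspace_0[OF U] by auto
  then show ?thesis by (intro exI[of _ 0]) (auto simp: orthonormal_def)
 next
  case True
  then obtain v where v: "v : U" "v ~= 0" by blast
  obtain z x where x: "x : U" "x ~= 0" "S x = cscale z x"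
   by (rule eigenvector_exists[where S=S, OF U Suc.prems(2,3,5,6,7) v])
  have sqx: "ell2.sq x > 0" using x ell2_sq_eq_0_iff[of x] ell2.sq_nonneg[of x] UE by force
  define xi where "xi = cscale (of_real (1 / sqrt (ell2.sq x))) x"
  have xiU: "xi : U" unfolding xi_def using x by (intro cfun.subspace_scale[OF U])
  have "ell2.sq xi = 1" unfolding xi_def using sqx x UE by (subst ell2.sq_scale) (auto simp: norm_divide power_divide)
  then have xi1: "ell2_inner xi xi = 1" using ell2.ip_self[of xi] xiU UE by simp
  have Sxi: "S xi = cscale z xi"
   unfolding xi_def Suc.prems(7)[OF x(1)] x(3) cfun.scale_scale by (simp only: mult.commute)
  have zr: "z = of_real (Re z)"
  proof -
   have "z = cnj z"
    using Suc.prems(8)[OF xiU xiU] xi1 xiU UE by (simp add: Sxi ell2.scale_left ell2.scale_right)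
   then show ?thesis by (simp add: complex_eq_iff)
  qed
  define U' where "U' = {f : U. ell2_inner f xi = 0}"
  have U'U: "U' <= U" unfolding U'_def by auto
  have xiE: "xi : ell2" by (rule UE[OF xiU])
  have subU': "cfun.subspace U'"
  proof (rule cfun.subspaceI)
   show "0 : U'" unfolding U'_def using cfun.subspace_0[OF U] ell2.zero_left[OF xiE] by simp
   show "f + g : U'" if "f : U'" "g : U'" for f g
    using that cfun.subspace_add[OF U] ell2.add_left[OF UE UE xiE] unfolding U'_def by simp
   show "cscale c f : U'" if "f : U'" for c f
    using that cfun.subspace_scale[OF U] ell2.scale_left[OF UE xiE] unfolding U'_def by simp
  qed
  have mapsU': "S f : U'" if "f : U'" for f
  proof -
   have f: "f : U" "ell2_inner f xi = 0" using that unfolding U'_def by auto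
   have "ell2_inner (S f) xi = ell2_inner f (S xi)" using Suc.prems(8)[OF f(1) xiU] .
   also have "... = 0" unfolding Sxi using f xiU UE by (simp add: ell2.scale_right)
   finally show ?thesis unfolding U'_def using Suc.prems(5) f by auto
  qed
  have card: "card A <= m" if A: "A <= U'" "cfun.independent A" for A
  proof -
   have "finite A" using cfun.independent_span_bound[OF Suc.prems(2) A(2)] A(1) U'U Suc.prems(3) by blast
   have "xi ~: cfun.span A"
   proof
    assume "xi : cfun.span A"
    then have "xi : U'" using cfun.span_minimal[OF A(1) subU'] by blast
    then show False using xi1 unfolding U'_def by simp
   qed
   then have "cfun.independent (insert xi A)" "xi ~: A"
    using A(2) by (auto simp: cfun.independent_insert intro: cfun.span_base)
   then show ?thesis using Suc.prems(9)[of "insert xi A"] A(1) U'U xiU \<open>finite A\<close> by auto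
  qed
  have "\<exists>d e mu. orthonormal d e & U' = cfun.span (e ` {1..d}) & (\<forall>j\<in>{1..d}. S (e j) = cscale (of_real (mu j)) (e j))"
  proof (rule Suc.IH[OF subU' Suc.prems(2) order_trans[OF U'U Suc.prems(3)] order_trans[OF U'U Suc.prems(4)]])
   show "S f : U'" if "f : U'" for f by (rule mapsU'[OF that])
   show "S (f + g) = S f + S g" if "f : U'" "g : U'" for f g
    using that U'U by (intro Suc.prems(6)) auto
   show "S (cscale c f) = cscale c (S f)" if "f : U'" for c f
    using that U'U by (intro Suc.prems(7)) auto
   show "ell2_inner (S f) g = ell2_inner f (S g)" if "f : U'" "g : U'" for f g
    using that U'U by (intro Suc.prems(8)) auto
   show "card A <= m" if "A <= U'" "cfun.independent A" for A by (rule card[OF that])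
  qed
  then obtain d e mu where IH: "orthonormal d e" "U' = cfun.span (e ` {1..d})"
   "!!j. j\<in>{1..d} ==> S (e j) = cscale (of_real (mu j)) (e j)" by metis
  have eU': "e j : U'" if "j : {1..d}" for j using IH(2) that by (simp add: cfun.span_base)
  define e' where "e' = (%j. if j = Suc d then xi else e j)"
  define mu' where "mu' = (%j. if j = Suc d then Re z else mu j)"
  have ins: "{1..Suc d} = insert (Suc d) {1..d}" by auto
  have "orthonormal (Suc d) e'"
   unfolding orthonormal_def
  proof (intro conjI ballI)
   fix i assume i: "i : {1..Suc d}"
   show "e' i : ell2" using i orthonormalD(1)[OF IH(1)] xiU UE unfolding e'_def by auto
   fix j assume j: "j : {1..Suc d}"
   have a: "ell2_inner (e j) xi = 0" if "j : {1..d}" for j using eU'[OF that] unfolding U'_def by simp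
   have b: "ell2_inner xi (e j) = 0" if "j : {1..d}" for j
    using a[OF that] ell2.commute[of "e j" xi] orthonormalD(1)[OF IH(1) that] xiU UE by simp
   show "ell2_inner (e' i) (e' j) = (if i = j then 1 else 0)"
    using i j a b xi1 orthonormalD(2)[OF IH(1)] unfolding e'_def by auto
  qed
  moreover have "U = cfun.span (e' ` {1..Suc d})"
  proof
   have "e' ` {1..Suc d} <= U" using eU' U'U xiU unfolding e'_def by auto
   then show "cfun.span (e' ` {1..Suc d}) <= U" by (rule cfun.span_minimal[OF _ U])
   show "U <= cfun.span (e' ` {1..Suc d})"
   proof
    fix f assume f: "f : U"
    define g where "g = f - cscale (ell2_inner f xi) xi"
    have "g : U" unfolding g_def by (intro cfun.subspace_diff[OF U] cfun.subspace_scale[OF U] f xiU)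
    moreover have "ell2_inner g xi = 0"
     unfolding g_def using ell2.diff_left[OF UE[OF f] ell2.V_scale[OF xiE] xiE] ell2.scale_left[OF xiE xiE] xi1 by simp
    ultimately have "g : U'" unfolding U'_def by simp
    moreover have "e ` {1..d} <= e' ` {1..Suc d}" unfolding e'_def by force
    ultimately have "g : cfun.span (e' ` {1..Suc d})" using IH(2) cfun.span_mono by blast
    moreover have "xi : e' ` {1..Suc d}" unfolding e'_def by force
    ultimately have "g + cscale (ell2_inner f xi) xi : cfun.span (e' ` {1..Suc d})"
     by (rule cfun.span_add[OF _ cfun.span_scale[OF cfun.span_base]])
    then show "f : cfun.span (e' ` {1..Suc d})" unfolding g_def by simp
   qed
  qed
  moreover have "\<forall>j\<in>{1..Suc d}. S (e' j) = cscale (of_real (mu' j)) (e' j)"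
   using IH(3) Sxi zr unfolding e'_def mu'_def by auto
  ultimately show ?thesis by blast
 qed
qed

lemma ell2_proj_eq:
 assumes "cfun.subspace V" "V <= ell2" "xi : ell2" "eta : V" "!!v. v : V ==> ell2_inner (xi - eta) v = 0"
 shows "ell2_proj V xi = eta"
 unfolding ell2_proj_def
proof (rule the_equality)
 show "eta : V & (\<forall>v\<in>V. ell2_inner (xi - eta) v = 0)" using assms by auto
 fix \<zeta> assume z: "\<zeta> : V & (\<forall>v\<in>V. ell2_inner (xi - \<zeta>) v = 0)"
 define x where "x = \<zeta> - eta"
 have x: "x : V" unfolding x_def using z assms by (intro cfun.subspace_diff) auto
 have E: "\<zeta> : ell2" "eta : ell2" "x : ell2" using z assms x by auto
 have "x = (xi - eta) - (xi - \<zeta>)" unfolding x_def by simp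
 then have "ell2_inner x x = ell2_inner (xi - eta) x - ell2_inner (xi - \<zeta>) x"
  using E assms(3) by (metis ell2.diff_left ell2.V_diff)
 then have "ell2_inner x x = 0" using x z assms(5) by auto
 then have "x = 0" using ell2_sq_eq_0_iff[OF E(3)] unfolding ell2.sq_def by simp
 then show "\<zeta> = eta" unfolding x_def by simp
qed

text \<open>A spectral resolution of \<open>S\<close> with the eigenvalues in non-increasing order;
 \<open>l j = 0\<close> is allowed, so that the \<open>e j\<close> may also span part of the kernel.\<close>

definition spectral_res :: "(('a => complex) => 'a => complex) => nat => (nat => 'a => complex) => (nat => real) => bool" where
 "spectral_res S d e l \<longleftrightarrow> orthonormal d e & (\<forall>j. 0 <= l j) & (\<forall>j. j ~: {1..d} --> l j = 0) \<and>
   (\<forall>j\<ge>1. l (Suc j) <= l j) \<and>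
   (\<forall>xi\<in>ell2. S xi = (\<Sum>j\<in>{1..d}. cscale (of_real (l j) * ell2_inner xi (e j)) (e j)))"

context
 fixes S :: "('a => complex) => 'a => complex" and d e l
 assumes res: "spectral_res S d e l"
begin

lemma res_on: "orthonormal d e" and res_nonneg: "0 <= l j" and res_zero: "j ~: {1..d} ==> l j = 0"
 and res_apply: "xi : ell2 ==> S xi = (\<Sum>j\<in>{1..d}. cscale (of_real (l j) * ell2_inner xi (e j)) (e j))"
 using res unfolding spectral_res_def by auto

lemmas res_e = orthonormalD[OF res_on]

lemma res_mono: "1 <= j ==> j <= k ==> l k <= l j"
proof (rotate_tac, induction rule: dec_induct)
 case (step m)
 have "l (Suc m) <= l m" using res step unfolding spectral_res_def by auto
 then show ?case using step by linarith
qed auto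

lemma res_S_inner: "xi : ell2 ==> j : {1..d} ==> ell2_inner (S xi) (e j) = of_real (l j) * ell2_inner xi (e j)"
 unfolding res_apply using ell2.sq_combination(2)[of "{1..d}" e j] res_e by simp

lemma res_S_e: "j : {1..d} ==> S (e j) = cscale (of_real (l j)) (e j)"
proof -
 assume j: "j : {1..d}"
 have "S (e j) = (\<Sum>i\<in>{1..d}. cscale (of_real (l i) * ell2_inner (e j) (e i)) (e i))"
  using res_e(1)[OF j] by (rule res_apply)
 also have "... = (\<Sum>i\<in>{1..d}. if i = j then cscale (of_real (l j)) (e j) else 0)"
  by (rule sum.cong) (use res_e(2) j in \<open>auto simp: cfun.scale_zero_left\<close>)
 finally show ?thesis using j by simp
qed

lemma res_e_nonzero: "j : {1..d} ==> e j ~= 0"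
 using res_e(2)[of j j] res_e(1)[of j] by (auto simp: ell2.zero_left)

text \<open>Division by \<open>mu\<close> puts an eigenvector into the range of \<open>S\<close>,
  hence into the span of the \<open>e j\<close>. The kernel is left out, as it also contains
  everything orthogonal to all \<open>e j\<close>.\<close>

lemma eigenspace_res:
 assumes "mu ~= 0"
 shows "eigenspace S mu = cfun.span (e ` {j\<in>{1..d}. l j = mu})"
proof
 show "eigenspace S mu <= cfun.span (e ` {j\<in>{1..d}. l j = mu})"
 proof
  fix x assume "x : eigenspace S mu"
  then have x: "x : ell2" "S x = cscale (of_real mu) x" unfolding eigenspace_def by auto
  have z: "ell2_inner x (e j) = 0" if j: "j : {1..d}" "l j ~= mu" for j
   using res_S_inner[OF x(1) j(1)] x res_e(1)[OF j(1)] j(2) by (simp add: ell2.scale_left)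
  have "x = cscale (of_real (1 / mu)) (S x)" using x assms by (simp add: cscale_def fun_eq_iff)
  also have "... : cfun.span (e ` {j\<in>{1..d}. l j = mu})"
   unfolding res_apply[OF x(1)]
  proof (rule cfun.span_scale, rule cfun.span_sum)
   fix j assume \<open>j\<in>{1..d}\<close>
   show "cscale (of_real (l j) * ell2_inner x (e j)) (e j) : cfun.span (e ` {j\<in>{1..d}. l j = mu})"
   proof (cases "l j = mu")
    case True
    then show ?thesis using \<open>j\<in>{1..d}\<close> by (intro cfun.span_scale cfun.span_base) auto
   next
    case False
    then show ?thesis using z[OF \<open>j\<in>{1..d}\<close>] by (simp add: cfun.scale_zero_left cfun.span_zero)
   qed
  qed
  finally show "x : cfun.span (e ` {j\<in>{1..d}. l j = mu})" .
 qed
 have Ssub: "cfun.subspace (eigenspace S mu)"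
 proof (rule cfun.subspaceI)
  have Sadd: "S (x + y) = S x + S y" if "x : ell2" "y : ell2" for x y
   using that res_e by (simp add: res_apply ell2.V_add ell2.add_left distrib_left cfun.scale_left_distrib sum.distrib)
  have Sscale: "S (cscale c x) = cscale c (S x)" if "x : ell2" for x c
   using that res_e by (simp add: res_apply ell2.V_scale ell2.scale_left cfun.scale_sum_right cfun.scale_scale mult.left_commute)
  show "0 : eigenspace S mu" unfolding eigenspace_def
   using Sscale[of 0 0] by (simp add: ell2.V_zero cfun.scale_zero_left)
  show "x + y : eigenspace S mu" if "x : eigenspace S mu" "y : eigenspace S mu" for x y
   using that Sadd unfolding eigenspace_def by (auto simp: ell2.V_add cfun.scale_right_distrib)
  show "cscale c x : eigenspace S mu" if "x : eigenspace S mu" for c x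
   using that Sscale unfolding eigenspace_def by (auto simp: ell2.V_scale cfun.scale_scale mult.commute)
 qed
 show "cfun.span (e ` {j\<in>{1..d}. l j = mu}) <= eigenspace S mu"
  by (rule cfun.span_minimal[OF _ Ssub]) (use res_e(1) res_S_e in \<open>auto simp: eigenspace_def\<close>)
qed

lemma dim_eigenspace_res: "mu ~= 0 ==> cfun.dim (eigenspace S mu) = card {j\<in>{1..d}. l j = mu}"
proof -
 assume "mu ~= 0"
 have ind: "cfun.independent (e ` {j\<in>{1..d}. l j = mu})"
  by (rule cfun.independent_mono[OF orthonormal_independent[OF res_on]]) auto
 have inj: "inj_on e {j\<in>{1..d}. l j = mu}"
  by (rule inj_on_subset[OF orthonormal_inj[OF res_on]]) auto
 show ?thesis
  unfolding eigenspace_res[OF \<open>mu ~= 0\<close>]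
  by (rule trans[OF cfun.dim_span_eq_card_independent[OF ind] card_image[OF inj]])
qed

lemma eigenvalues_res: "eigenvalues S - {0} = l ` {1..d} - {0}"
proof -
 have "mu : eigenvalues S \<longleftrightarrow> mu : l ` {1..d}" if "mu ~= 0" for mu
 proof
  assume "mu : eigenvalues S"
  then obtain x where x: "x : eigenspace S mu" "x ~= 0" unfolding eigenvalues_def by auto
  show "mu : l ` {1..d}"
  proof (rule ccontr)
   assume "mu ~: l ` {1..d}"
   then have "{j\<in>{1..d}. l j = mu} = {}" by auto
   then have "x : cfun.span (e ` {})" using x(1) unfolding eigenspace_res[OF that] by (simp only:)
   then show False using x(2) by (simp add: cfun.span_empty)
  qed
 next
  assume "mu : l ` {1..d}"
  then obtain j where j: "j : {1..d}" "l j = mu" by auto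
  then show "mu : eigenvalues S"
   using res_e(1)[OF j(1)] res_S_e[OF j(1)] res_e_nonzero[OF j(1)]
   unfolding eigenvalues_def eigenspace_def by auto
 qed
 then show ?thesis by auto
qed

lemma finite_eigenvalues: "finite (eigenvalues S)" and l_in_eigenvalues: "j : {1..d} ==> l j : eigenvalues S"
proof -
 have "finite (eigenvalues S - {0})" unfolding eigenvalues_res by simp
 then show "finite (eigenvalues S)" by simp
 show "l j : eigenvalues S" if j: "j : {1..d}"
  using res_e(1)[OF j] res_S_e[OF j] res_e_nonzero[OF j] unfolding eigenvalues_def eigenspace_def by auto
qed

text \<open>Both lists are sorted in non-increasing order and contain every number equally often.
  The padding stands for the indices in \<open>{1..d}\<close> with \<open>l j = 0\<close>, which
  \<open>eigenvalue_list\<close> leaves out.\<close>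

lemma eigenvalue_list_res: "map l [1..<Suc d] = eigenvalue_list S @ replicate (card {j\<in>{1..d}. l j = 0}) 0"
proof -
 define X where "X = l ` {1..d} - {0}"
 define E where "E = eigenvalue_list S"
 define R where "R = replicate (card {j\<in>{1..d}. l j = 0}) (0::real)"
 have finX: "finite X" unfolding X_def by simp
 have E: "E = concat (map (%mu. replicate (card {j\<in>{1..d}. l j = mu}) mu) (rev (sorted_list_of_set X)))"
 proof -
  have "map (%mu. replicate (cfun.dim (eigenspace S mu)) mu) (rev (sorted_list_of_set X)) =
    map (%mu. replicate (card {j\<in>{1..d}. l j = mu}) mu) (rev (sorted_list_of_set X))"
   by (rule map_cong[OF refl]) (use finX in \<open>auto simp: dim_eigenspace_res X_def\<close>)
  then show ?thesis unfolding E_def eigenvalue_list_def eigenvalues_res X_def[symmetric] by (simp only:)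
 qed
 have Xpos: "x > 0" if "x : X" for x using that res_nonneg unfolding X_def by (auto simp: less_le)
 have setE: "set E <= X" unfolding E using finX by auto
 have sortX: "sorted_wrt (>) (rev (sorted_list_of_set X))"
  by (simp add: sorted_wrt_rev)
 have srt: "sorted_wrt (\<ge>) (concat (map (%mu. replicate (c mu) mu) xs))" if "sorted_wrt (>) xs" for c :: "real => nat" and xs :: "real list"
  using that
 proof (induction xs)
  case (Cons x xs)
  have "sorted_wrt (\<ge>) (replicate m x)" for m by (induction m) auto
  then show ?case using Cons by (fastforce simp: sorted_wrt_append)
 qed auto
 have sE: "sorted_wrt (\<ge>) E" unfolding E by (rule srt[OF sortX])
 have sR: "sorted_wrt (\<ge>) R" by (simp add: R_def sorted_wrt_iff_nth_less)
 have sER: "sorted_wrt (\<ge>) (E @ R)"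
  using sE sR setE Xpos by (auto simp: sorted_wrt_append R_def dest!: subsetD intro: less_imp_le)
 have sl: "sorted_wrt (\<ge>) (map l [1..<Suc d])"
  unfolding sorted_wrt_map
  by (rule sorted_wrt_mono_rel[where P="(<)"]) (auto intro!: res_mono simp del: upt_Suc)
 have cl: "count (mset (map l [1..<Suc d])) x = card {j\<in>{1..d}. l j = x}" for x
 proof -
  have "count (mset (map l xs)) x = card {j\<in>set xs. l j = x}" if "distinct xs" for xs
   using that
  proof (induction xs)
   case (Cons a xs)
   have "{j\<in>set (a # xs). l j = x} = (if l a = x then insert a {j\<in>set xs. l j = x} else {j\<in>set xs. l j = x})" by auto
   then show ?case using Cons by auto
  qed simp
  from this[of "[1..<Suc d]"] show ?thesis
   by (simp add: atLeastLessThanSuc_atLeastAtMost del: upt_Suc)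
 qed
 have cE: "count (mset E) x = (if x : X then card {j\<in>{1..d}. l j = x} else 0)" for x
 proof -
  have "count (mset (concat (map (%mu. replicate (c mu) mu) xs))) x = (if x : set xs then c x else 0)"
   if "distinct xs" for c :: "real => nat" and xs
   using that by (induction xs) auto
  from this[of "rev (sorted_list_of_set X)"] show ?thesis unfolding E using finX by simp
 qed
 have "mset (map l [1..<Suc d]) = mset (E @ R)"
 proof (rule multiset_eqI)
  fix x
  show "count (mset (map l [1..<Suc d])) x = count (mset (E @ R)) x"
  proof (cases "x = 0")
   case True
   then show ?thesis unfolding cl by (simp add: cE R_def X_def)
  next
   case False
   have "x ~: X ==> {j\<in>{1..d}. l j = x} = {}" using False unfolding X_def by auto
   then show ?thesis unfolding cl using False by (auto simp: cE R_def)
  qed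
 qed
 then have "mset (rev (map l [1..<Suc d])) = mset (rev (E @ R))" by (simp only: mset_rev)
 moreover have "sorted (rev (map l [1..<Suc d]))" "sorted (rev (E @ R))"
  using sl sER by (simp_all only: sorted_wrt_rev)
 ultimately have "rev (map l [1..<Suc d]) = rev (E @ R)"
  using properties_for_sort[of "rev (map l [1..<Suc d])" "rev (E @ R)"] sorted_sort_id[of "rev (E @ R)"] by simp
 then have "map l [1..<Suc d] = E @ R" by (simp only: rev_is_rev_conv)
 then show ?thesis unfolding E_def R_def .
qed

lemma eigval_res:
 assumes "1 <= j"
 shows "eigval j S = l j"
proof -
 define E where "E = eigenvalue_list S"
 define c where "c = card {j\<in>{1..d}. l j = 0}"
 have eq: "map l [1..<Suc d] = E @ replicate c 0" unfolding E_def c_def by (rule eigenvalue_list_res)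
 have len: "d = length E + c" using arg_cong[OF eq, of length] by (simp del: upt_Suc)
 have nth: "l j = (E @ replicate c 0) ! (j - 1)" if "j <= d"
 proof -
  have "map l [1..<Suc d] ! (j - 1) = l j" using assms that by (subst nth_map) (auto simp del: upt_Suc)
  then show ?thesis unfolding eq by simp
 qed
 show ?thesis
 proof (cases "j <= length E")
  case True
  then show ?thesis using nth len assms unfolding eigval_def E_def[symmetric] by (simp add: nth_append)
 next
  case False
  then have "l j = 0"
  proof (cases "j <= d")
   case True
   then show ?thesis using nth False len by (simp add: nth_append)
  qed (use res_zero in auto)
  then show ?thesis using False unfolding eigval_def E_def[symmetric] by simp
 qed
qed

text \<open>The projection onto \<open>J\<close> removes the part of the kernel of \<open>S\<close>
  orthogonal to \<open>J\<close>, where \<open>phi 0\<close> would contribute too. So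
  \<open>phi 0\<close> is counted exactly as often as 0 occurs among the \<open>l j\<close> with
  \<open>j\<close> in \<open>{1..d}\<close>.\<close>

lemma trace_res:
 assumes J: "J = cfun.span (e ` {1..d})"
 shows "Re (ell2_trace (%xi. fun_calc phi S (ell2_proj J xi))) = (\<Sum>j\<in>{1..d}. phi (l j))"
proof -
 have eE: "e ` {1..d} <= ell2" using res_e(1) by auto
 have JE: "J <= ell2" unfolding J by (rule cfun.span_minimal[OF eE ell2_subspace])
 have P: "ell2_proj J xi = (\<Sum>j\<in>{1..d}. cscale (ell2_inner xi (e j)) (e j))" if x: "xi : ell2" for xi
 proof (rule ell2_proj_eq[OF _ JE x])
  show "cfun.subspace J" unfolding J by (rule cfun.subspace_span)
  show "(\<Sum>j\<in>{1..d}. cscale (ell2_inner xi (e j)) (e j)) : J"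
   unfolding J by (intro cfun.span_sum cfun.span_scale cfun.span_base) auto
  fix v assume v: "v : J"
  define r where "r = xi - (\<Sum>j\<in>{1..d}. cscale (ell2_inner xi (e j)) (e j))"
  have r: "r : ell2" "!!j. j : {1..d} ==> ell2_inner r (e j) = 0"
   unfolding r_def using ell2.finite_expansion(1,2)[of "{1..d}" e xi] res_e x by auto
  have "v = (\<Sum>j\<in>{1..d}. cscale (ell2_inner v (e j)) (e j))"
   using orthonormal_span_expansion[OF res_on] v unfolding J by blast
  then have "ell2_inner r v = (\<Sum>j\<in>{1..d}. ell2_inner r (cscale (ell2_inner v (e j)) (e j)))"
   using ell2.sum_right[of "{1..d}" "%j. cscale (ell2_inner v (e j)) (e j)" r] r(1) res_e(1)
   by (simp add: ell2.V_scale)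
  also have "... = 0" using r res_e(1) by (simp add: ell2.scale_right)
  finally show "ell2_inner (xi - (\<Sum>j\<in>{1..d}. cscale (ell2_inner xi (e j)) (e j))) v = 0" unfolding r_def .
 qed
 \<comment> \<open>For \<open>mu = 0\<close> the eigenspace is in general larger than the span of
   the \<open>e j\<close> with \<open>l j = 0\<close>, but a combination of the \<open>e j\<close>
   has no component in the rest.\<close>
 have Pe: "ell2_proj (eigenspace S mu) (\<Sum>j\<in>{1..d}. cscale (c j) (e j)) = (\<Sum>j\<in>{j\<in>{1..d}. l j = mu}. cscale (c j) (e j))" for mu c
 proof (rule ell2_proj_eq)
  show "eigenspace S mu <= ell2" unfolding eigenspace_def by auto
  have Sadd: "S (x + y) = S x + S y" if "x : ell2" "y : ell2" for x y
   using that res_e by (simp add: res_apply ell2.V_add ell2.add_left distrib_left cfun.scale_left_distrib sum.distrib)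
  have Sscale: "S (cscale c x) = cscale c (S x)" if "x : ell2" for x c
   using that res_e by (simp add: res_apply ell2.V_scale ell2.scale_left cfun.scale_sum_right cfun.scale_scale mult.left_commute)
  show sub: "cfun.subspace (eigenspace S mu)"
  proof (rule cfun.subspaceI)
   show "0 : eigenspace S mu" unfolding eigenspace_def
    using Sscale[of 0 0] by (simp add: ell2.V_zero cfun.scale_zero_left)
   show "x + y : eigenspace S mu" if "x : eigenspace S mu" "y : eigenspace S mu" for x y
    using that Sadd unfolding eigenspace_def by (auto simp: ell2.V_add cfun.scale_right_distrib)
   show "cscale c x : eigenspace S mu" if "x : eigenspace S mu" for c x
    using that Sscale unfolding eigenspace_def by (auto simp: ell2.V_scale cfun.scale_scale mult.commute)
  qed
  show "(\<Sum>j\<in>{1..d}. cscale (c j) (e j)) : ell2" using res_e(1) by (intro ell2.V_sum ell2.V_scale)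
  show "(\<Sum>j\<in>{j\<in>{1..d}. l j = mu}. cscale (c j) (e j)) : eigenspace S mu"
   by (intro cfun.subspace_sum[OF sub] cfun.subspace_scale[OF sub])
     (use res_e(1) res_S_e in \<open>auto simp: eigenspace_def\<close>)
  fix v assume "v : eigenspace S mu"
  then have v: "v : ell2" "S v = cscale (of_real mu) v" unfolding eigenspace_def by auto
  have z: "ell2_inner (e j) v = 0" if j: "j : {1..d}" "l j ~= mu" for j
   using res_S_inner[OF v(1) j(1)] v res_e(1)[OF j(1)] j(2) ell2.commute[of v "e j"] by (simp add: ell2.scale_left)
  have "(\<Sum>j\<in>{1..d}. cscale (c j) (e j)) - (\<Sum>j\<in>{j\<in>{1..d}. l j = mu}. cscale (c j) (e j)) =
    (\<Sum>j\<in>{j\<in>{1..d}. l j ~= mu}. cscale (c j) (e j))"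
  proof -
   have "(\<Sum>j\<in>{1..d}. cscale (c j) (e j)) = (\<Sum>j\<in>{j\<in>{1..d}. l j = mu} \<union> {j\<in>{1..d}. l j ~= mu}. cscale (c j) (e j))"
    by (rule sum.cong) auto
   also have "... = (\<Sum>j\<in>{j\<in>{1..d}. l j = mu}. cscale (c j) (e j)) + (\<Sum>j\<in>{j\<in>{1..d}. l j ~= mu}. cscale (c j) (e j))"
    by (rule sum.union_disjoint) auto
   finally show ?thesis by (simp only: add_diff_cancel_left')
  qed
  moreover have "ell2_inner (\<Sum>j\<in>{j\<in>{1..d}. l j ~= mu}. cscale (c j) (e j)) v = 0"
   using v z res_e(1) by (subst ell2.sum_left) (auto simp: ell2.V_scale ell2.scale_left)
  ultimately show "ell2_inner ((\<Sum>j\<in>{1..d}. cscale (c j) (e j)) - (\<Sum>j\<in>{j\<in>{1..d}. l j = mu}. cscale (c j) (e j))) v = 0"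
   by (simp only:)
 qed
 have T: "fun_calc phi S (ell2_proj J xi) = (\<Sum>j\<in>{1..d}. cscale (of_real (phi (l j)) * ell2_inner xi (e j)) (e j))" if x: "xi : ell2" for xi
 proof -
  have "fun_calc phi S (ell2_proj J xi) = (\<Sum>mu\<in>eigenvalues S. cscale (of_real (phi mu)) (\<Sum>j\<in>{j\<in>{1..d}. l j = mu}. cscale (ell2_inner xi (e j)) (e j)))"
   unfolding fun_calc_def P[OF x] Pe ..
  also have "... = (\<Sum>mu\<in>eigenvalues S. \<Sum>j\<in>{j\<in>{1..d}. l j = mu}. cscale (of_real (phi (l j)) * ell2_inner xi (e j)) (e j))"
   unfolding cfun.scale_sum_right cfun.scale_scale by (intro sum.cong refl) auto
  also have "... = (\<Sum>j\<in>{1..d}. cscale (of_real (phi (l j)) * ell2_inner xi (e j)) (e j))"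
   by (rule sum.group) (use finite_eigenvalues l_in_eigenvalues in auto)
  finally show ?thesis .
 qed
 have sm0: "(%a. e j a * cnj (e j a)) summable_on UNIV" if "j : {1..d}" for j
  by (rule abs_summable_summable[OF ell2_mult_summable[OF res_e(1)[OF that] res_e(1)[OF that]]])
 have sm: "(%a. of_real (phi (l j)) * (e j a * cnj (e j a))) summable_on UNIV" if "j : {1..d}" for j
  by (rule summable_on_cmult_right[OF sm0[OF that]])
 have "ell2_trace (%xi. fun_calc phi S (ell2_proj J xi)) = (\<Sum>\<^sub>\<infinity>a. \<Sum>j\<in>{1..d}. of_real (phi (l j)) * (e j a * cnj (e j a)))"
  unfolding ell2_trace_def ell2_inner_unit
 proof (rule infsum_cong)
  fix a :: 'a
  have "ell2_inner (unit_family a) (e j) = cnj (e j a)" if "j : {1..d}" for j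
   using ell2.commute[OF res_e(1)[OF that] unit_family_ell2[of a]] by (simp add: ell2_inner_unit)
  then show "fun_calc phi S (ell2_proj J (unit_family a)) a = (\<Sum>j\<in>{1..d}. of_real (phi (l j)) * (e j a * cnj (e j a)))"
   unfolding T[OF unit_family_ell2] unfolding sum_fun_apply by (auto simp: cscale_def mult_ac intro!: sum.cong)
 qed
 also have "... = (\<Sum>j\<in>{1..d}. \<Sum>\<^sub>\<infinity>a. of_real (phi (l j)) * (e j a * cnj (e j a)))"
  by (rule infsumI, rule has_sum_finite_sum, rule has_sum_infsum) (rule sm)
 also have "... = (\<Sum>j\<in>{1..d}. of_real (phi (l j)) * ell2_inner (e j) (e j))"
  unfolding ell2_inner_def
  by (intro sum.cong refl infsum_cmult_right sm0)
 also have "... = of_real (\<Sum>j\<in>{1..d}. phi (l j))" using res_e(2) by simp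
 finally show ?thesis by simp
qed

end

section \<open>Frame operators of finite families of vectors\<close>

definition fop :: "nat => (nat => 'a => complex) => ('a => complex) => 'a => complex" where
 "fop n v xi = (\<Sum>r\<in>{1..n}. cscale (ell2_inner xi (v r)) (v r))"

lemma fop_ell2: "v ` {1..n} <= ell2 ==> fop n v xi : ell2"
 unfolding fop_def by (intro ell2.V_sum ell2.V_scale) auto

lemma fop_inner:
 assumes v: "v ` {1..n} <= ell2" and "eta : ell2"
 shows "ell2_inner (fop n v xi) eta = (\<Sum>r\<in>{1..n}. ell2_inner xi (v r) * ell2_inner (v r) eta)"
 unfolding fop_def using assms
 by (subst ell2.sum_left) (auto simp: ell2.V_scale ell2.scale_left image_subset_iff intro!: sum.cong)

lemma fop_sym:
 assumes v: "v ` {1..n} <= ell2" and x: "xi : ell2" "eta : ell2"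
 shows "ell2_inner (fop n v xi) eta = ell2_inner xi (fop n v eta)"
proof -
 have "ell2_inner xi (fop n v eta) = cnj (ell2_inner (fop n v eta) xi)"
  by (rule ell2.commute[OF fop_ell2[OF v] x(1)])
 also have "... = (\<Sum>r\<in>{1..n}. ell2_inner xi (v r) * ell2_inner (v r) eta)"
  unfolding fop_inner[OF v x(1)] cnj_sum complex_cnj_mult
 proof (intro sum.cong refl)
  fix r assume "r : {1..n}"
  then have vr: "v r : ell2" using v by auto
  show "cnj (ell2_inner eta (v r)) * cnj (ell2_inner (v r) xi) = ell2_inner xi (v r) * ell2_inner (v r) eta"
   by (simp add: ell2.commute[OF vr x(1)] ell2.commute[OF x(2) vr] mult.commute)
 qed
 finally show ?thesis unfolding fop_inner[OF v x(2)] by simp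
qed

lemma fop_quadratic:
 assumes v: "v ` {1..n} <= ell2" and x: "xi : ell2"
 shows "ell2_inner (fop n v xi) xi = of_real (\<Sum>r\<in>{1..n}. (cmod (ell2_inner xi (v r)))\<^sup>2)"
proof -
 have "ell2_inner (v r) xi = cnj (ell2_inner xi (v r))" if "r : {1..n}" for r
  using that v x by (intro ell2.commute) auto
 then show ?thesis
  unfolding fop_inner[OF v x] of_real_sum complex_norm_square by (intro sum.cong refl) simp
qed

text \<open>The operator is diagonalized on all of \<open>J\<close>, not only on the span of the
  vectors \<open>v\<close>, so that the list of eigenvalues has length \<open>cfun.dim J\<close>,
  zeros included. Since the operator maps into \<open>J\<close> and is symmetric, the formula holds
  for all of \<open>ell2\<close>. The eigenvectors are renumbered to make the eigenvalues
  decrease.\<close>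

lemma fop_spectral:
 assumes vJ: "v ` {1..n} <= J" and H: "finite H" "H <= ell2" and J: "J = cfun.span H"
 obtains e l where "spectral_res (fop n v) (cfun.dim J) e l" "J = cfun.span (e ` {1..cfun.dim J})"
proof -
 have subJ: "cfun.subspace J" unfolding J by (rule cfun.subspace_span)
 have JE: "J <= ell2" unfolding J by (rule cfun.span_minimal[OF H(2) ell2_subspace])
 have v: "v r : J" if "r : {1..n}" for r using that vJ by auto
 have vE: "v r : ell2" if "r : {1..n}" for r using v[OF that] JE by auto
 have vI: "v ` {1..n} <= ell2" using vE by auto
 have fJ: "fop n v xi : J" for xi
  unfolding fop_def by (intro cfun.subspace_sum[OF subJ] cfun.subspace_scale[OF subJ] v)
 have fadd: "fop n v (f + g) = fop n v f + fop n v g" if "f : ell2" "g : ell2" for f g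
  unfolding fop_def sum.distrib[symmetric] using that vE
  by (intro sum.cong refl) (simp add: ell2.add_left cfun.scale_left_distrib)
 have fscale: "fop n v (cscale c f) = cscale c (fop n v f)" if "f : ell2" for f c
  unfolding fop_def cfun.scale_sum_right using that vE
  by (intro sum.cong refl) (simp add: ell2.scale_left cfun.scale_scale)
 have "\<exists>d e mu. orthonormal d e & J = cfun.span (e ` {1..d}) & (\<forall>j\<in>{1..d}. fop n v (e j) = cscale (of_real (mu j)) (e j))"
 proof (rule spectral_decomposition[OF subJ H(1) _ JE, where m="card H"])
  show "J <= cfun.span H" using J by simp
  show "ell2_inner (fop n v f) g = ell2_inner f (fop n v g)" if "f : J" "g : J" for f g
   using that JE by (intro fop_sym vI) auto
  show "card A <= card H" if "A <= J" "cfun.independent A" for A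
   using cfun.independent_span_bound[OF H(1) that(2)] that(1) J by simp
  show "fop n v (f + g) = fop n v f + fop n v g" if "f : J" "g : J" for f g
   using that JE by (intro fadd) auto
  show "fop n v (cscale c f) = cscale c (fop n v f)" if "f : J" for c f
   using that JE by (intro fscale) auto
 qed (rule fJ)
 then obtain d e mu where e: "orthonormal d e" "J = cfun.span (e ` {1..d})"
  and mu: "!!j. j\<in>{1..d} ==> fop n v (e j) = cscale (of_real (mu j)) (e j)" by metis
 have dim: "cfun.dim J = d" unfolding e(2) by (rule dim_span_orthonormal[OF e(1)])
 note eD = orthonormalD[OF e(1)]
 have mu0: "0 <= mu j" if j: "j : {1..d}" for j
 proof -
  have "of_real (mu j) = ell2_inner (fop n v (e j)) (e j)"
   unfolding mu[OF j] using eD[OF j] eD(2)[OF j j] by (simp add: ell2.scale_left)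
  also have "... = of_real (\<Sum>r\<in>{1..n}. (cmod (ell2_inner (e j) (v r)))\<^sup>2)"
   by (rule fop_quadratic[OF vI eD(1)[OF j]])
  finally have "mu j = (\<Sum>r\<in>{1..n}. (cmod (ell2_inner (e j) (v r)))\<^sup>2)" by (simp only: of_real_eq_iff)
  then show ?thesis by (simp add: sum_nonneg)
 qed
 define xs where "xs = rev (sort_key mu [1..<Suc d])"
 have xs: "distinct xs" "set xs = {1..d}" "length xs = d" unfolding xs_def by auto
 define ix where "ix = (%j. xs ! (j - 1))"
 have sxs: "sorted_wrt (\<ge>) (map mu xs)"
  unfolding xs_def rev_map[symmetric] sorted_wrt_rev using sorted_sort_key[of mu "[1..<Suc d]"] by simp
 have ix: "ix j : {1..d}" if "j : {1..d}" for j
  unfolding ix_def xs(2)[symmetric] using that xs(3) by (intro nth_mem) auto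
 have ix_eq: "ix i = ix j \<longleftrightarrow> i = j" if "i : {1..d}" "j : {1..d}" for i j
  unfolding ix_def using that xs by (subst nth_eq_iff_index_eq) auto
 have ix_onto: "\<exists>j\<in>{1..d}. ix j = i" if i: "i : {1..d}" for i
 proof -
  obtain k where "k < d" "xs ! k = i" using i xs by (metis in_set_conv_nth)
  then show ?thesis unfolding ix_def by (intro bexI[of _ "Suc k"]) auto
 qed
 have ixim: "ix ` {1..d} = {1..d}" using ix ix_onto by blast
 define e' where "e' = (%j. e (ix j))"
 define l where "l = (%j. if j : {1..d} then mu (ix j) else 0)"
 have e'im: "e' ` {1..d} = e ` {1..d}" unfolding e'_def image_image[symmetric, of e ix] ixim ..
 have on': "orthonormal d e'"
  unfolding orthonormal_def e'_def using eD ix ix_eq by auto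
 have Je': "J = cfun.span (e' ` {1..d})" using e(2) e'im by simp
 have "l (Suc j) <= l j" if "1 <= j" for j
 proof (cases "Suc j : {1..d}")
  case True
  then have "map mu xs ! (j - 1) >= map mu xs ! j"
   using sxs that xs(3) unfolding sorted_wrt_iff_nth_less by auto
  then show ?thesis using True that xs(3) unfolding l_def ix_def by auto
 next
  case False
  then show ?thesis unfolding l_def using mu0 ix by auto
 qed
 moreover have "fop n v xi = (\<Sum>j\<in>{1..d}. cscale (of_real (l j) * ell2_inner xi (e' j)) (e' j))" if x: "xi : ell2" for xi
 proof -
  have "fop n v xi = (\<Sum>j\<in>{1..d}. cscale (ell2_inner (fop n v xi) (e' j)) (e' j))"
   by (rule orthonormal_span_expansion[OF on']) (use fJ Je' in auto)
  also have "... = (\<Sum>j\<in>{1..d}. cscale (of_real (l j) * ell2_inner xi (e' j)) (e' j))"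
  proof (intro sum.cong refl)
   fix j assume j: "j : {1..d}"
   have "ell2_inner (fop n v xi) (e' j) = ell2_inner xi (fop n v (e' j))"
    using x orthonormalD(1)[OF on' j] by (intro fop_sym vI) auto
   also have "... = of_real (l j) * ell2_inner xi (e' j)"
    unfolding e'_def mu[OF ix[OF j]] using eD(1)[OF ix[OF j]] x j by (simp add: ell2.scale_right l_def)
   finally show "cscale (ell2_inner (fop n v xi) (e' j)) (e' j) = cscale (of_real (l j) * ell2_inner xi (e' j)) (e' j)" by simp
  qed
  finally show ?thesis .
 qed
 ultimately have "spectral_res (fop n v) d e' l"
  unfolding spectral_res_def using on' mu0 ix by (auto simp: l_def)
 then show thesis using that Je' unfolding dim by blast
qed

context
 fixes n v and d e l J
 assumes vJ: "v ` {1..n} <= J" and Je: "J = cfun.span (e ` {1..d})"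
  and res: "spectral_res (fop n v) d e l"
begin

lemma fop_vE: "r : {1..n} ==> v r : ell2"
proof -
 assume r: "r : {1..n}"
 have "e ` {1..d} <= ell2" using res_e(1)[OF res] by auto
 then have "J <= ell2" unfolding Je by (rule cfun.span_minimal[OF _ ell2_subspace])
 moreover have "v r : J" using vJ r by blast
 ultimately show ?thesis by blast
qed

lemma fop_vI: "v ` {1..n} <= ell2" using fop_vE by auto

lemma fop_cross:
 assumes j: "j : {1..d}" "k : {1..d}"
 shows "(\<Sum>r\<in>{1..n}. ell2_inner (e j) (v r) * ell2_inner (v r) (e k)) = (if j = k then of_real (l j) else 0)"
proof -
 have "(\<Sum>r\<in>{1..n}. ell2_inner (e j) (v r) * ell2_inner (v r) (e k)) = ell2_inner (fop n v (e j)) (e k)"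
  using res_e(1)[OF res j(2)] by (intro fop_inner[symmetric] fop_vI)
 also have "... = (if j = k then of_real (l j) else 0)"
  using res_S_inner[OF res res_e(1)[OF res j(1)] j(2)] res_e(2)[OF res j] by simp
 finally show ?thesis .
qed

lemma fop_weights:
 assumes j: "j : {1..d}"
 shows "(\<Sum>r\<in>{1..n}. (cmod (ell2_inner (v r) (e j)))\<^sup>2) = l j"
proof -
 have "of_real (\<Sum>r\<in>{1..n}. (cmod (ell2_inner (v r) (e j)))\<^sup>2) =
   (\<Sum>r\<in>{1..n}. ell2_inner (e j) (v r) * ell2_inner (v r) (e j))"
  unfolding of_real_sum
  by (intro sum.cong refl)
    (simp add: ell2.commute[OF fop_vE res_e(1)[OF res j]] complex_norm_square mult.commute del: of_real_power)
 also have "... = of_real (l j)" using fop_cross[OF j j] by simp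
 finally show ?thesis by (simp only: of_real_eq_iff)
qed

lemma v_expansion: "r : {1..n} ==> v r = (\<Sum>j\<in>{1..d}. cscale (ell2_inner (v r) (e j)) (e j))"
 using orthonormal_span_expansion[OF res_on[OF res]] vJ unfolding Je by blast

lemma v_sq: "r : {1..n} ==> ell2.sq (v r) = (\<Sum>j\<in>{1..d}. (cmod (ell2_inner (v r) (e j)))\<^sup>2)"
proof -
 assume r: "r : {1..n}"
 have "v r - (\<Sum>j\<in>{1..d}. cscale (ell2_inner (v r) (e j)) (e j)) = 0" using v_expansion[OF r] by simp
 then show ?thesis
  using ell2.finite_expansion(3)[of "{1..d}" e "v r"] res_e[OF res] fop_vE[OF r] ell2_sq_eq_0_iff[OF ell2.V_zero] by simp
qed

lemma fop_total: "(\<Sum>r\<in>{1..n}. ell2.sq (v r)) = (\<Sum>j\<in>{1..d}. l j)"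
proof -
 have "(\<Sum>r\<in>{1..n}. ell2.sq (v r)) = (\<Sum>r\<in>{1..n}. \<Sum>j\<in>{1..d}. (cmod (ell2_inner (v r) (e j)))\<^sup>2)"
  by (intro sum.cong refl v_sq)
 also have "... = (\<Sum>j\<in>{1..d}. \<Sum>r\<in>{1..n}. (cmod (ell2_inner (v r) (e j)))\<^sup>2)" by (rule sum.swap)
 also have "... = (\<Sum>j\<in>{1..d}. l j)" by (intro sum.cong refl fop_weights)
 finally show ?thesis .
qed

text \<open>The row sums of the unitary-stochastic matrix \<open>|<v r, e j>|^2 / l j\<close> are at most 1:
 with \<open>y\<close> the image of \<open>v r\<close> under the pseudo-inverse, \<open>s = <y, v r>\<close> satisfies
 \<open>s^2 <= <S y, y> = s\<close>.\<close>

lemma fop_row_sum: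
 assumes r: "r : {1..n}"
 shows "(\<Sum>j\<in>{1..d}. (cmod (ell2_inner (v r) (e j)))\<^sup>2 / l j) <= 1"
proof -
 define s where "s = (\<Sum>j\<in>{1..d}. (cmod (ell2_inner (v r) (e j)))\<^sup>2 / l j)"
 define c where "c = (%j. ell2_inner (v r) (e j) / of_real (l j))"
 define y where "y = (\<Sum>j\<in>{1..d}. cscale (c j) (e j))"
 note eD = res_e[OF res]
 have yE: "y : ell2" unfolding y_def using eD by (intro ell2.V_sum ell2.V_scale)
 have ye: "ell2_inner y (e j) = c j" if "j : {1..d}" for j
  unfolding y_def using ell2.sq_combination(2)[of "{1..d}" e j c] eD that by simp
 have yv: "ell2_inner y (v r) = of_real s"
 proof -
  have "ell2_inner y (v r) = (\<Sum>j\<in>{1..d}. c j * cnj (ell2_inner (v r) (e j)))"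
   by (subst v_expansion[OF r], unfold y_def, rule ell2.sq_combination(1)) (use eD in auto)
  also have "... = of_real s"
   unfolding s_def of_real_sum c_def of_real_divide complex_norm_square by simp
  finally show ?thesis .
 qed
 have "ell2_inner (fop n v y) y = (\<Sum>j\<in>{1..d}. (of_real (l j) * c j) * cnj (c j))"
 proof -
  have "fop n v y = (\<Sum>j\<in>{1..d}. cscale (of_real (l j) * c j) (e j))"
   using res_apply[OF res yE] ye by simp
  then have "ell2_inner (fop n v y) y =
    ell2_inner (\<Sum>j\<in>{1..d}. cscale (of_real (l j) * c j) (e j)) (\<Sum>j\<in>{1..d}. cscale (c j) (e j))"
   by (simp only: y_def[symmetric])
  also have "... = (\<Sum>j\<in>{1..d}. (of_real (l j) * c j) * cnj (c j))"
   by (rule ell2.sq_combination(1)) (use eD in auto)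
  finally show ?thesis .
 qed
 also have "... = of_real s"
  unfolding s_def of_real_sum
 proof (intro sum.cong refl)
  fix j assume "j : {1..d}"
  show "of_real (l j) * c j * cnj (c j) = of_real ((cmod (ell2_inner (v r) (e j)))\<^sup>2 / l j)"
   unfolding of_real_divide complex_norm_square c_def by (cases "l j = 0") simp_all
 qed
 finally have "ell2_inner (fop n v y) y = of_real s" .
 then have "of_real (\<Sum>t\<in>{1..n}. (cmod (ell2_inner y (v t)))\<^sup>2) = complex_of_real s"
  using fop_quadratic[OF fop_vI yE] by simp
 then have "(\<Sum>t\<in>{1..n}. (cmod (ell2_inner y (v t)))\<^sup>2) = s" by (simp only: of_real_eq_iff)
 moreover have "(cmod (ell2_inner y (v r)))\<^sup>2 <= (\<Sum>t\<in>{1..n}. (cmod (ell2_inner y (v t)))\<^sup>2)"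
  using r by (intro member_le_sum) auto
 ultimately have \<open>s\<^sup>2 <= s\<close> unfolding yv by simp
 have "s <= 1"
 proof (rule ccontr)
  assume "\<not> s <= 1"
  then have "s * 1 < s * s" by (intro mult_strict_left_mono) auto
  then show False using \<open>s\<^sup>2 <= s\<close> by (simp add: power2_eq_square)
 qed
 then show ?thesis unfolding s_def .
qed

text \<open>Weights at most 1 with total at most \<open>m\<close> are best spent on the
  \<open>m\<close> largest values. Subtracting the threshold \<open>l m\<close> makes the terms up
  to \<open>m\<close> nonnegative and the later ones nonpositive. The case \<open>m = 0\<close>
  stands apart, because \<open>l 0 = 0\<close> is only a default value and no threshold.\<close>

lemma weighted_top_sum:
 fixes c :: "nat => real"
 assumes c: "!!j. j : {1..d} ==> 0 <= c j" "!!j. j : {1..d} ==> c j <= 1" and sc: "(\<Sum>j\<in>{1..d}. c j) <= real m"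
 shows "(\<Sum>j\<in>{1..d}. l j * c j) <= (\<Sum>j\<in>{1..m}. l j)"
proof (cases "m = 0")
 case True
 then have "(\<Sum>j\<in>{1..d}. c j) = 0" using sc c(1) by (metis of_nat_0 order_antisym sum_nonneg)
 then have "c j = 0" if "j : {1..d}" for j using that c(1) by (metis finite_atLeastAtMost sum_nonneg_eq_0_iff)
 then show ?thesis using True by simp
next
 case False
 define D where "D = max d m"
 define c' where "c' = (%j. if j : {1..d} then c j else 0)"
 note mono = res_mono[OF res] and nn = res_nonneg[OF res]
 have ext: "(\<Sum>j\<in>{1..d}. f j * c j) = (\<Sum>j\<in>{1..D}. f j * c' j)" for f :: "nat => real"
  by (rule sum.mono_neutral_cong_left) (auto simp: D_def c'_def)
 have "(\<Sum>j\<in>{1..D}. (l j - l m) * c' j) <= (\<Sum>j\<in>{1..D}. if j : {1..m} then l j - l m else 0)"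
 proof (rule sum_mono)
  fix j assume j: "j : {1..D}"
  show "(l j - l m) * c' j <= (if j : {1..m} then l j - l m else 0)"
  proof (cases "j <= m")
   case True
   then have "l m <= l j" using j by (intro mono) auto
   moreover have "c' j <= 1" unfolding c'_def using c by auto
   ultimately show ?thesis using True j mult_left_le[of "c' j" "l j - l m"] by simp
  next
   case f: False
   then have "l j <= l m" using False by (intro mono) auto
   moreover have "0 <= c' j" unfolding c'_def using c by auto
   ultimately show ?thesis using f by (simp add: mult_nonpos_nonneg)
  qed
 qed
 also have "... = (\<Sum>j\<in>{1..m}. l j - l m)"
  by (rule sum.mono_neutral_cong_right) (auto simp: D_def)
 also have "... = (\<Sum>j\<in>{1..m}. l j) - real m * l m" by (simp add: sum_subtractf)
 finally have "(\<Sum>j\<in>{1..d}. l j * c j) - l m * (\<Sum>j\<in>{1..d}. c j) <= (\<Sum>j\<in>{1..m}. l j) - real m * l m"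
  using ext[of "%j. l j - l m"] by (simp add: left_diff_distrib sum_subtractf sum_distrib_left)
 moreover have "l m * (\<Sum>j\<in>{1..d}. c j) <= l m * real m" using sc nn by (intro mult_left_mono)
 ultimately show ?thesis by (simp add: mult.commute)
qed

text \<open>The Schur half of the Schur-Horn theorem. The numbers \<open>w r j / l j\<close> have
  row and column sums at most 1, so their sums over \<open>T\<close> are admissible weights of total
  at most \<open>card T\<close>. Where \<open>l j = 0\<close> the numerator vanishes too, and the
  default quotient 0 does no harm.\<close>

lemma schur_majorization:
 assumes T: "T <= {1..n}"
 shows "(\<Sum>r\<in>T. ell2.sq (v r)) <= (\<Sum>j\<in>{1..card T}. l j)"
proof -
 define w where "w = (%r j. (cmod (ell2_inner (v r) (e j)))\<^sup>2)"
 have finT: "finite T" using T finite_subset by blast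
 define c where "c = (%j. (\<Sum>r\<in>T. w r j / l j))"
 have nn: "0 <= w r j / l j" for r j unfolding w_def using res_nonneg[OF res] by simp
 have lw: "l j * (w r j / l j) = w r j" if "j : {1..d}" "r : {1..n}" for r j
 proof (cases "l j = 0")
  case True
  then have "w r j = 0" using fop_weights[OF that(1)] that(2)
   unfolding w_def by (metis (no_types, lifting) finite_atLeastAtMost sum_nonneg_eq_0_iff zero_le_power2)
  then show ?thesis by simp
 qed simp
 have "(\<Sum>r\<in>T. ell2.sq (v r)) = (\<Sum>r\<in>T. \<Sum>j\<in>{1..d}. w r j)"
  using T by (intro sum.cong refl) (auto simp: v_sq w_def)
 also have "... = (\<Sum>j\<in>{1..d}. \<Sum>r\<in>T. w r j)" by (rule sum.swap)
 also have "... = (\<Sum>j\<in>{1..d}. l j * c j)"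
  unfolding c_def sum_distrib_left using T by (intro sum.cong refl lw[symmetric]) auto
 also have "... <= (\<Sum>j\<in>{1..card T}. l j)"
 proof (rule weighted_top_sum)
  show "0 <= c j" for j unfolding c_def using nn by (intro sum_nonneg)
  show "c j <= 1" if j: "j : {1..d}" for j
  proof -
   have "c j <= (\<Sum>r\<in>{1..n}. w r j / l j)" unfolding c_def using T nn by (intro sum_mono2) auto
   also have "... = l j / l j" using fop_weights[OF j] unfolding w_def by (simp add: sum_divide_distrib[symmetric])
   also have "... <= 1" by simp
   finally show ?thesis .
  qed
  have "(\<Sum>j\<in>{1..d}. c j) = (\<Sum>r\<in>T. \<Sum>j\<in>{1..d}. w r j / l j)" unfolding c_def by (rule sum.swap)
  also have "... <= (\<Sum>r\<in>T. 1)" using T fop_row_sum unfolding w_def by (intro sum_mono) auto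
  finally show "(\<Sum>j\<in>{1..d}. c j) <= real (card T)" by simp
 qed
 finally show ?thesis .
qed

text \<open>The source of the lower frame bound: in the eigenbasis the quadratic form is a sum of
  squares weighted by the \<open>l j\<close>.\<close>

lemma fop_lower_bound:
 assumes x: "xi : J" and c: "!!j. j : {1..d} ==> c <= l j"
 shows "c * ell2.sq xi <= (\<Sum>r\<in>{1..n}. (cmod (ell2_inner xi (v r)))\<^sup>2)"
proof -
 note eD = res_e[OF res]
 define b where "b = (%j. ell2_inner xi (e j))"
 have xe: "xi = (\<Sum>j\<in>{1..d}. cscale (b j) (e j))"
  unfolding b_def using orthonormal_span_expansion[OF res_on[OF res]] x unfolding Je by blast
 have xE: "xi : ell2" unfolding xe using eD by (intro ell2.V_sum ell2.V_scale)
 have "ell2_inner xi xi = (\<Sum>j\<in>{1..d}. b j * cnj (b j))"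
  by (subst (1 2) xe, rule ell2.sq_combination(1)) (use eD in auto)
 also have "... = of_real (\<Sum>j\<in>{1..d}. (cmod (b j))\<^sup>2)" by (simp add: complex_norm_square del: of_real_power)
 finally have s: "ell2.sq xi = (\<Sum>j\<in>{1..d}. (cmod (b j))\<^sup>2)" unfolding ell2.sq_def by simp
 have "fop n v xi = (\<Sum>j\<in>{1..d}. cscale (of_real (l j) * b j) (e j))"
  using res_apply[OF res xE] unfolding b_def .
 then have "ell2_inner (fop n v xi) xi = ell2_inner (\<Sum>j\<in>{1..d}. cscale (of_real (l j) * b j) (e j)) (\<Sum>j\<in>{1..d}. cscale (b j) (e j))"
  using xe by simp
 also have "... = (\<Sum>j\<in>{1..d}. of_real (l j) * b j * cnj (b j))"
  by (rule ell2.sq_combination(1)) (use eD in auto)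
 also have "... = of_real (\<Sum>j\<in>{1..d}. l j * (cmod (b j))\<^sup>2)" by (simp add: complex_norm_square mult.assoc del: of_real_power)
 finally have "(\<Sum>r\<in>{1..n}. (cmod (ell2_inner xi (v r)))\<^sup>2) = (\<Sum>j\<in>{1..d}. l j * (cmod (b j))\<^sup>2)"
  unfolding fop_quadratic[OF fop_vI xE] by (simp only: of_real_eq_iff)
 moreover have "c * ell2.sq xi <= (\<Sum>j\<in>{1..d}. l j * (cmod (b j))\<^sup>2)"
  unfolding s sum_distrib_left using c by (intro sum_mono mult_right_mono) auto
 ultimately show ?thesis by simp
qed

end

text \<open>Entry (\<open>r\<close>, \<open>s\<close>) of the power \<open>Suc k\<close> of the Gram
  matrix of the family. Such entries are polynomial in the inner products and therefore depend
  measurably on the fiber.\<close>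

fun gram_power :: "nat => (nat => 'a => complex) => nat => nat => nat => complex" where
 "gram_power n v 0 r s = ell2_inner (v r) (v s)"
| "gram_power n v (Suc k) r s = (\<Sum>t\<in>{1..n}. gram_power n v k r t * ell2_inner (v t) (v s))"

text \<open>Gram matrix and frame operator have the same nonzero eigenvalues. Inserting the basis
  \<open>e\<close> between consecutive Gram factors leaves sums over the generators, which
  \<open>fop_cross\<close> collapses to the diagonal.\<close>

lemma gram_power_trace:
 assumes vJ: "v ` {1..n} <= J" and Je: "J = cfun.span (e ` {1..d})"
  and res: "spectral_res (fop n v) d e l"
 shows "(\<Sum>r\<in>{1..n}. gram_power n v k r r) = of_real (\<Sum>j\<in>{1..d}. l j ^ Suc k)"
proof -
 note eD = res_e[OF res] and vE = fop_vE[OF vJ Je res] and vx = v_expansion[OF vJ Je res]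
 have vv: "ell2_inner (v r) (v s) = (\<Sum>j\<in>{1..d}. ell2_inner (v r) (e j) * ell2_inner (e j) (v s))"
  if r: "r : {1..n}" and s: "s : {1..n}" for r s
 proof -
  have "ell2_inner (v r) (v s) = (\<Sum>j\<in>{1..d}. ell2_inner (v r) (e j) * cnj (ell2_inner (v s) (e j)))"
   by (subst vx[OF r], subst vx[OF s], rule ell2.sq_combination(1)) (use eD in auto)
  also have "... = (\<Sum>j\<in>{1..d}. ell2_inner (v r) (e j) * ell2_inner (e j) (v s))"
   by (intro sum.cong refl) (simp add: ell2.commute[OF vE[OF s] eD(1)])
  finally show ?thesis .
 qed
 have H: "gram_power n v k r s = (\<Sum>j\<in>{1..d}. of_real (l j ^ k) * (ell2_inner (v r) (e j) * ell2_inner (e j) (v s)))"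
  if r: "r : {1..n}" and s: "s : {1..n}" for r s
  using s
 proof (induction k arbitrary: s)
  case 0
  then show ?case using vv[OF r 0] by simp
 next
  case (Suc k)
  have "gram_power n v (Suc k) r s =
    (\<Sum>t\<in>{1..n}. (\<Sum>j\<in>{1..d}. of_real (l j ^ k) * (ell2_inner (v r) (e j) * ell2_inner (e j) (v t))) *
     (\<Sum>i\<in>{1..d}. ell2_inner (v t) (e i) * ell2_inner (e i) (v s)))"
   using Suc.IH vv[OF _ Suc.prems] by simp
  also have "... = (\<Sum>j\<in>{1..d}. \<Sum>i\<in>{1..d}. (of_real (l j ^ k) * ell2_inner (v r) (e j) * ell2_inner (e i) (v s)) *
     (\<Sum>t\<in>{1..n}. ell2_inner (e j) (v t) * ell2_inner (v t) (e i)))"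
  proof -
   define F where "F = (%t j i. of_real (l j ^ k) * (ell2_inner (v r) (e j) * ell2_inner (e j) (v t)) *
     (ell2_inner (v t) (e i) * ell2_inner (e i) (v s)))"
   have "(\<Sum>t\<in>{1..n}. (\<Sum>j\<in>{1..d}. of_real (l j ^ k) * (ell2_inner (v r) (e j) * ell2_inner (e j) (v t))) *
     (\<Sum>i\<in>{1..d}. ell2_inner (v t) (e i) * ell2_inner (e i) (v s))) = (\<Sum>t\<in>{1..n}. \<Sum>j\<in>{1..d}. \<Sum>i\<in>{1..d}. F t j i)"
    unfolding F_def sum_product ..
   also have "... = (\<Sum>j\<in>{1..d}. \<Sum>t\<in>{1..n}. \<Sum>i\<in>{1..d}. F t j i)" by (rule sum.swap)
   also have "... = (\<Sum>j\<in>{1..d}. \<Sum>i\<in>{1..d}. \<Sum>t\<in>{1..n}. F t j i)"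
    by (rule sum.cong[OF refl]) (rule sum.swap)
   finally show ?thesis unfolding F_def sum_distrib_left by (simp only: mult_ac)
  qed
  also have "... = (\<Sum>j\<in>{1..d}. \<Sum>i\<in>{1..d}. if j = i then of_real (l j ^ Suc k) * (ell2_inner (v r) (e j) * ell2_inner (e j) (v s)) else 0)"
  proof (intro sum.cong refl)
   fix j i assume ji: "j : {1..d}" "i : {1..d}"
   show "(of_real (l j ^ k) * ell2_inner (v r) (e j) * ell2_inner (e i) (v s)) *
     (\<Sum>t\<in>{1..n}. ell2_inner (e j) (v t) * ell2_inner (v t) (e i)) =
     (if j = i then of_real (l j ^ Suc k) * (ell2_inner (v r) (e j) * ell2_inner (e j) (v s)) else 0)"
    unfolding fop_cross[OF vJ Je res ji] by auto
  qed
  also have "... = (\<Sum>j\<in>{1..d}. of_real (l j ^ Suc k) * (ell2_inner (v r) (e j) * ell2_inner (e j) (v s)))"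
   by (intro sum.cong refl) simp
  finally show ?case .
 qed
 have "(\<Sum>r\<in>{1..n}. gram_power n v k r r) = (\<Sum>r\<in>{1..n}. \<Sum>j\<in>{1..d}. of_real (l j ^ k) * (ell2_inner (e j) (v r) * ell2_inner (v r) (e j)))"
  using H by (intro sum.cong refl) (simp add: mult.commute)
 also have "... = (\<Sum>j\<in>{1..d}. of_real (l j ^ k) * (\<Sum>r\<in>{1..n}. ell2_inner (e j) (v r) * ell2_inner (v r) (e j)))"
  unfolding sum_distrib_left by (rule sum.swap)
 also have "... = (\<Sum>j\<in>{1..d}. of_real (l j ^ Suc k))"
  by (intro sum.cong refl) (simp add: fop_cross[OF vJ Je res, simplified] mult.commute)
 finally show ?thesis by simp
qed

text \<open>The columns of \<open>M\<close> are orthogonal with squared lengths \<open>l j\<close>,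
  so the frame operator of the rows is diagonal in the basis \<open>e\<close>.\<close>

lemma fop_matrix_res:
 assumes on: "orthonormal d e"
  and v: "!!r. r : {1..n} ==> v r = (\<Sum>j\<in>{1..d}. cscale (of_real (M r j)) (e j))"
  and M: "!!j k. j : {1..d} ==> k : {1..d} ==> (\<Sum>r\<in>{1..n}. M r j * M r k) = (if j = k then l j else (0::real))"
  and l: "!!j. 0 <= l j" "!!j. j ~: {1..d} ==> l j = 0" "!!j. 1 <= j ==> l (Suc j) <= l j"
 shows "spectral_res (fop n v) d e l" "r : {1..n} ==> ell2.sq (v r) = (\<Sum>j\<in>{1..d}. (M r j)\<^sup>2)"
proof -
 note eD = orthonormalD[OF on]
 have "fop n v xi = (\<Sum>j\<in>{1..d}. cscale (of_real (l j) * ell2_inner xi (e j)) (e j))" if x: "xi : ell2" for xi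
 proof -
  have xv: "ell2_inner xi (v r) = (\<Sum>k\<in>{1..d}. of_real (M r k) * ell2_inner xi (e k))" if "r : {1..n}" for r
   unfolding v[OF that] using eD(1) x by (subst ell2.sum_right) (auto simp: ell2.V_scale ell2.scale_right)
  have "fop n v xi = (\<Sum>r\<in>{1..n}. \<Sum>j\<in>{1..d}. cscale (\<Sum>k\<in>{1..d}. of_real (M r j * M r k) * ell2_inner xi (e k)) (e j))"
   unfolding fop_def
  proof (intro sum.cong refl)
   fix r assume r: "r : {1..n}"
   have "cscale (ell2_inner xi (v r)) (v r) = (\<Sum>j\<in>{1..d}. cscale (ell2_inner xi (v r) * of_real (M r j)) (e j))"
    by (subst (2) v[OF r]) (simp only: cfun.scale_sum_right cfun.scale_scale)
   also have "... = (\<Sum>j\<in>{1..d}. cscale (\<Sum>k\<in>{1..d}. of_real (M r j * M r k) * ell2_inner xi (e k)) (e j))"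
    unfolding xv[OF r] sum_distrib_right by (simp add: mult_ac)
   finally show "cscale (ell2_inner xi (v r)) (v r) = (\<Sum>j\<in>{1..d}. cscale (\<Sum>k\<in>{1..d}. of_real (M r j * M r k) * ell2_inner xi (e k)) (e j))" .
  qed
  also have "... = (\<Sum>j\<in>{1..d}. cscale (\<Sum>r\<in>{1..n}. \<Sum>k\<in>{1..d}. of_real (M r j * M r k) * ell2_inner xi (e k)) (e j))"
   unfolding cfun.scale_sum_left by (rule sum.swap)
  also have "... = (\<Sum>j\<in>{1..d}. cscale (of_real (l j) * ell2_inner xi (e j)) (e j))"
  proof (intro sum.cong refl arg_cong2[where f=cscale])
   fix j assume j: "j : {1..d}"
   have "(\<Sum>r\<in>{1..n}. \<Sum>k\<in>{1..d}. of_real (M r j * M r k) * ell2_inner xi (e k)) =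
     (\<Sum>k\<in>{1..d}. of_real (\<Sum>r\<in>{1..n}. M r j * M r k) * ell2_inner xi (e k))"
    unfolding of_real_sum sum_distrib_right by (rule sum.swap)
   also have "... = (\<Sum>k\<in>{1..d}. if j = k then of_real (l j) * ell2_inner xi (e j) else 0)"
    by (intro sum.cong refl) (auto simp: M[OF j, simplified])
   also have "... = of_real (l j) * ell2_inner xi (e j)" using j by simp
   finally show "(\<Sum>r\<in>{1..n}. \<Sum>k\<in>{1..d}. of_real (M r j * M r k) * ell2_inner xi (e k)) = of_real (l j) * ell2_inner xi (e j)" .
  qed
  finally show ?thesis .
 qed
 then show "spectral_res (fop n v) d e l"
  unfolding spectral_res_def using on l by auto
 show "ell2.sq (v r) = (\<Sum>j\<in>{1..d}. (M r j)\<^sup>2)" if r: "r : {1..n}"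
 proof -
  have "ell2_inner (v r) (v r) = (\<Sum>j\<in>{1..d}. of_real (M r j) * cnj (of_real (M r j)))"
   unfolding v[OF r] by (rule ell2.sq_combination(1)) (use eD in auto)
  also have "... = of_real (\<Sum>j\<in>{1..d}. (M r j)\<^sup>2)" by (simp add: power2_eq_square)
  finally show ?thesis unfolding ell2.sq_def by simp
 qed
qed

section \<open>Eigenvalue functions and Jensen inequality\<close>

text \<open>Norms of growing exponent converge to the maximum. The exponents start at 1 because
  roots of order 0 are degenerate.\<close>

lemma power_sum_root_limit:
 fixes l :: "nat => real"
 assumes m: "m <= N" and nn: "!!j. 0 <= l j" and mono: "!!j. m <= j ==> j <= N ==> l j <= l m"
 shows "(%k. root (Suc k) (\<Sum>j\<in>{m..N}. l j ^ Suc k)) ----> l m"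
proof (rule tendsto_sandwich[where f="%_. l m" and h="%k. root (Suc k) (real (Suc N)) * l m"])
 show "\<forall>\<^sub>F k in sequentially. l m <= root (Suc k) (\<Sum>j\<in>{m..N}. l j ^ Suc k)"
 proof (rule always_eventually, rule allI)
  fix k
  have "l m ^ Suc k <= (\<Sum>j\<in>{m..N}. l j ^ Suc k)"
   using m nn by (intro member_le_sum) (auto intro!: mult_nonneg_nonneg zero_le_power)
  then have "root (Suc k) (l m ^ Suc k) <= root (Suc k) (\<Sum>j\<in>{m..N}. l j ^ Suc k)"
   by (rule real_root_le_mono[OF zero_less_Suc])
  then show "l m <= root (Suc k) (\<Sum>j\<in>{m..N}. l j ^ Suc k)"
   by (simp only: real_root_power_cancel[OF zero_less_Suc nn])
 qed
 show "\<forall>\<^sub>F k in sequentially. root (Suc k) (\<Sum>j\<in>{m..N}. l j ^ Suc k) <= root (Suc k) (real (Suc N)) * l m"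
 proof (rule always_eventually, rule allI)
  fix k
  have "(\<Sum>j\<in>{m..N}. l j ^ Suc k) <= real (card {m..N}) * l m ^ Suc k"
   using mono nn by (intro sum_bounded_above power_mono) auto
  also have "... <= real (Suc N) * l m ^ Suc k"
   using nn by (intro mult_right_mono zero_le_power) auto
  finally have "root (Suc k) (\<Sum>j\<in>{m..N}. l j ^ Suc k) <= root (Suc k) (real (Suc N) * l m ^ Suc k)"
   by (rule real_root_le_mono[OF zero_less_Suc])
  then show "root (Suc k) (\<Sum>j\<in>{m..N}. l j ^ Suc k) <= root (Suc k) (real (Suc N)) * l m"
   by (simp only: real_root_mult real_root_power_cancel[OF zero_less_Suc nn])
 qed
 have "(%k. root k (real (Suc N))) ----> 1" by (intro LIMSEQ_root_const) auto
 then have "(%k. root (Suc k) (real (Suc N))) ----> 1" by (rule LIMSEQ_Suc)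
 then have "(%k. root (Suc k) (real (Suc N)) * l m) ----> 1 * l m" by (intro tendsto_intros)
 then show "(%k. root (Suc k) (real (Suc N)) * l m) ----> l m" by simp
qed auto

text \<open>The values are recovered one after the other: subtracting the powers of those already
  known to be measurable leaves the power sums of the rest, whose roots converge to the largest
  remaining value.\<close>

lemma measurable_from_power_sums:
 fixes l :: "'x => nat => real"
 assumes nn: "!!x j. 0 <= l x j" and mono: "!!x j k. 1 <= j ==> j <= k ==> l x k <= l x j"
  and ps: "!!k. (%x. \<Sum>j\<in>{1..N}. l x j ^ Suc k) : borel_measurable M"
  and m: "1 <= m" "m <= N"
 shows "(%x. l x m) : borel_measurable M"
 using m
proof (induction m rule: less_induct)
 case (less m)
 have eq: "(\<Sum>j\<in>{m..N}. l x j ^ Suc k) = (\<Sum>j\<in>{1..N}. l x j ^ Suc k) - (\<Sum>j\<in>{1..<m}. l x j ^ Suc k)" for x k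
 proof -
  have "{1..N} = {1..<m} \<union> {m..N}" using less.prems by auto
  then have "(\<Sum>j\<in>{1..N}. l x j ^ Suc k) = (\<Sum>j\<in>{1..<m}. l x j ^ Suc k) + (\<Sum>j\<in>{m..N}. l x j ^ Suc k)"
   by (simp only:) (rule sum.union_disjoint, auto)
  then show ?thesis by simp
 qed
 have meas: "(%x. root (Suc k) (\<Sum>j\<in>{m..N}. l x j ^ Suc k)) : borel_measurable M" for k
 proof -
  have "(%x. l x j ^ Suc k) : borel_measurable M" if "j : {1..<m}" for j
   using that less.prems by (intro borel_measurable_power less.IH) auto
  then have "(%x. \<Sum>j\<in>{m..N}. l x j ^ Suc k) : borel_measurable M"
   unfolding eq by (intro borel_measurable_diff ps borel_measurable_sum)
  then show ?thesis by measurable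
 qed
 show ?case
 proof (rule borel_measurable_LIMSEQ_real[OF _ meas])
  show "(%k. root (Suc k) (\<Sum>j\<in>{m..N}. l x j ^ Suc k)) ----> l x m" for x
   using less.prems by (intro power_sum_root_limit nn mono) auto
 qed
qed

text \<open>The value at 0 is split off, since \<open>phi\<close> is continuous only on the open
  half-line.\<close>

lemma convex_Ici_measurable:
 assumes cvx: "convex_on {0..} phi" and f: "f : borel_measurable M" and nn: "!!x. 0 <= (f x :: real)"
 shows "(%x. phi (f x)) : borel_measurable M"
proof -
 obtain phi' c where phi': "continuous_on {0..} phi'" "!!x. 0 < x ==> phi x = phi' x"
  using convex_on_Ici_split[OF cvx] by metis
 have "continuous_on UNIV (%x. phi' (max 0 x))"
  by (rule continuous_on_compose2[OF phi'(1)]) (auto intro!: continuous_intros)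
 then have g: "(%x. phi' (max 0 x)) : borel_measurable borel" by (rule borel_measurable_continuous_onI)
 have "(%x. phi' (max 0 (f x))) : borel_measurable M"
  by (rule measurable_compose[OF f g])
 then have "(%x. if f x = 0 then phi 0 else phi' (max 0 (f x))) : borel_measurable M"
  using f by measurable
 moreover have "(if f x = 0 then phi 0 else phi' (max 0 (f x))) = phi (f x)" for x
  using nn[of x] phi'(2)[of "f x"] by (auto simp: max_def)
 ultimately show ?thesis by simp
qed

lemma convex_Ici_bounded:
 assumes "phi : Conv" "0 <= x" "x <= C"
 shows "0 <= phi x & phi x <= max (phi 0) (phi C)"
proof -
 have cvx: "convex_on {0..} phi" and nn: "0 <= phi x" using assms unfolding Conv_def by auto
 have "convex_on {0..C} phi" by (rule convex_on_subset[OF cvx]) auto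
 then have "phi x <= max (phi 0) (phi C)"
 proof (cases "C = 0")
  case False
  define t where "t = x / C"
  have t: "0 <= t" "t <= 1" "x = (1 - t) *\<^sub>R 0 + t *\<^sub>R C" using assms False unfolding t_def by auto
  have "phi x <= (1 - t) * phi 0 + t * phi C" unfolding t(3) using t(1,2) assms by (intro convex_onD[OF cvx]) auto
  also have "... <= (1 - t) * max (phi 0) (phi C) + t * max (phi 0) (phi C)"
   using t by (intro add_mono mult_left_mono) auto
  also have "... = max (phi 0) (phi C)" by (simp add: algebra_simps)
  finally show ?thesis .
 qed (use assms in auto)
 then show ?thesis using nn by simp
qed

text \<open>At a mean \<open>c > 0\<close>, an interior point, \<open>phi\<close> has a supporting
  line, and the gap \<open>h\<close> above it is integrated. At \<open>c = 0\<close> a supporting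
  line may fail to exist; there \<open>f\<close> vanishes almost everywhere and both sides
  coincide.\<close>

lemma jensen_Ici:
 fixes f :: "'x => real"
 assumes fin: "finite_measure M" and p: "0 < measure M (space M)"
  and cvx: "convex_on {0..} phi" and nn: "!!x. 0 <= f x"
  and int: "integrable M f" "integrable M (%x. phi (f x))"
 defines "c \<equiv> (LINT x|M. f x) / measure M (space M)"
 shows "measure M (space M) * phi c <= (LINT x|M. phi (f x))"
  and "phi : Conv_s ==> (LINT x|M. phi (f x)) <= measure M (space M) * phi c ==> AE x in M. f x = c"
proof -
 interpret finite_measure M by (rule fin)
 have c0: "0 <= c" unfolding c_def using nn p by (intro divide_nonneg_pos Bochner_Integration.integral_nonneg) auto
 have "measure M (space M) * phi c <= (LINT x|M. phi (f x)) \<and>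
  (phi : Conv_s --> (LINT x|M. phi (f x)) <= measure M (space M) * phi c --> (AE x in M. f x = c))"
 proof (cases "c = 0")
  case True
  then have "(LINT x|M. f x) = 0" unfolding c_def using p by simp
  then have ae: "AE x in M. f x = 0"
   using integral_nonneg_eq_0_iff_AE[OF int(1)] nn by simp
  have "(LINT x|M. phi (f x)) = (LINT x|M. phi 0)"
   by (rule integral_cong_AE) (use int ae in auto)
  then show ?thesis using ae True by simp
 next
  case False
  then have cpos: "c > 0" using c0 by simp
  define s where "s = Inf ((%t. (phi c - phi t) / (c - t)) ` ({c<..} \<inter> {0..}))"
  have "interior {0::real..} = {0<..}" by (rule interior_real_atLeast)
  then have slope: "phi c + s * (y - c) <= phi y" if "0 <= y" for y
   unfolding s_def using cpos that by (intro convex_le_Inf_differential[OF cvx]) auto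
  define h where "h = (%x. phi (f x) - (phi c + s * (f x - c)))"
  have h0: "0 <= h x" for x unfolding h_def using slope[OF nn] by simp
  have hint: "integrable M h" unfolding h_def using int by auto
  have cm: "(LINT x|M. f x) = c * measure M (space M)" unfolding c_def using p by simp
  have hI: "(LINT x|M. h x) = (LINT x|M. phi (f x)) - measure M (space M) * phi c"
  proof -
   have "(LINT x|M. h x) = (LINT x|M. phi (f x)) - (LINT x|M. phi c + s * (f x - c))"
    unfolding h_def using int by (intro Bochner_Integration.integral_diff) auto
   also have "(LINT x|M. phi c + s * (f x - c)) = (LINT x|M. phi c) + s * ((LINT x|M. f x) - (LINT x|M. c))"
    using int by simp
   also have "... = measure M (space M) * phi c" using cm by simp
   finally show ?thesis .
  qed
  have "AE x in M. f x = c" if strict: "phi : Conv_s" and le: "(LINT x|M. phi (f x)) <= measure M (space M) * phi c"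
  proof -
   have "(LINT x|M. h x) = 0" using hI le Bochner_Integration.integral_nonneg[of M h] h0 by auto
   then have ae: "AE x in M. h x = 0" using integral_nonneg_eq_0_iff_AE[OF hint] h0 by simp
   have sc: "\<forall>x\<ge>0. \<forall>y\<ge>0. \<forall>t. x ~= y --> 0 < t --> t < 1 --> phi ((1 - t) * x + t * y) < (1 - t) * phi x + t * phi y"
    using strict unfolding Conv_s_def by blast
   \<comment> \<open>If \<open>phi\<close> met its supporting line at a second point
     \<open>f x\<close>, strict convexity would push it below that line at the midpoint
     \<open>z\<close>.\<close>
   have "f x = c" if "h x = 0" for x
   proof (rule ccontr)
    assume ne: "f x ~= c"
    define z where "z = (1 - 1/2) * f x + 1/2 * c"
    define K where "K = s * (f x - c)"
    have "phi z < (1 - 1/2) * phi (f x) + 1/2 * phi c"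
     unfolding z_def by (rule sc[rule_format]) (use nn c0 ne in auto)
    moreover have "phi c + s * (z - c) <= phi z"
     by (rule slope) (use nn[of x] c0 in \<open>auto simp: z_def\<close>)
    moreover have "s * (z - c) = K / 2" by (simp add: z_def K_def field_simps)
    moreover have "phi (f x) = phi c + K" using that unfolding h_def K_def by simp
    then have "(1 - 1/2) * phi (f x) + 1/2 * phi c = phi c + K / 2" by (simp add: field_simps)
    ultimately show False by linarith
   qed
   then show ?thesis using ae by auto
  qed
  then show ?thesis using hI Bochner_Integration.integral_nonneg[of M h] h0 by auto
 qed
 then show "measure M (space M) * phi c <= (LINT x|M. phi (f x))"
  and "phi : Conv_s ==> (LINT x|M. phi (f x)) <= measure M (space M) * phi c ==> AE x in M. f x = c" by blast+
qed

section \<open>The Hilbert space of square integrable functions\<close>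

lemma L2D: "f : L2 ==> f : leb_meas" "f : L2 ==> integrable lebesgue (%x. (cmod (f x))\<^sup>2)"
 unfolding L2_def by auto

lemma borel_measurable_cnj [measurable (raw)]:
 "f : borel_measurable M ==> (%x. cnj (f x)) : borel_measurable M"
 by (rule measurable_compose[OF _ borel_measurable_continuous_onI[OF continuous_on_cnj[OF continuous_on_id]]])

lemma cmod_mult_le_sum_squares: "cmod (a * cnj b) <= (cmod a)\<^sup>2 + (cmod b)\<^sup>2"
proof -
 have "2 * (cmod a * cmod b) <= (cmod a)\<^sup>2 + (cmod b)\<^sup>2"
  using sum_squares_bound[of "cmod a" "cmod b"] by simp
 moreover have "0 <= cmod a * cmod b" by simp
 ultimately have "cmod a * cmod b <= (cmod a)\<^sup>2 + (cmod b)\<^sup>2" by linarith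
 then show ?thesis by (simp add: norm_mult)
qed

lemma cmod_add_squared_le: "(cmod (a + b))\<^sup>2 <= 2 * (cmod a)\<^sup>2 + 2 * (cmod b)\<^sup>2"
proof -
 have "(cmod (a + b))\<^sup>2 <= (cmod a + cmod b)\<^sup>2" by (intro power_mono norm_triangle_ineq) auto
 also have "... <= 2 * (cmod a)\<^sup>2 + 2 * (cmod b)\<^sup>2"
  using sum_squares_bound[of "cmod a" "cmod b"] by (simp add: power2_sum)
 finally show ?thesis .
qed

lemma L2_mult_integrable:
 assumes "f : L2" "g : L2"
 shows "integrable lebesgue (%x. f x * cnj (g x))"
proof (rule Bochner_Integration.integrable_bound)
 show "integrable lebesgue (%x. (cmod (f x))\<^sup>2 + (cmod (g x))\<^sup>2)"
  using assms by (intro Bochner_Integration.integrable_add L2D)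
 show "(%x. f x * cnj (g x)) : leb_meas"
  using L2D(1)[OF assms(1)] L2D(1)[OF assms(2)] by measurable
 show "AE x in lebesgue. norm (f x * cnj (g x)) <= norm ((cmod (f x))\<^sup>2 + (cmod (g x))\<^sup>2)"
  using cmod_mult_le_sum_squares by auto
qed

lemma L2_bounded_mult:
 assumes f: "f : L2" and m: "m : leb_meas" and b: "AE x in lebesgue. cmod (m x) <= C"
 shows "(%x. m x * f x) : L2"
proof -
 have "(%x. m x * f x) : leb_meas" using m L2D(1)[OF f] by measurable
 moreover have "integrable lebesgue (%x. (cmod (m x * f x))\<^sup>2)"
 proof (rule Bochner_Integration.integrable_bound)
  show "integrable lebesgue (%x. C\<^sup>2 * (cmod (f x))\<^sup>2)" using L2D(2)[OF f] by simp
  show "(%x. (cmod (m x * f x))\<^sup>2) : leb_meas" using m L2D(1)[OF f] by measurable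
  show "AE x in lebesgue. norm ((cmod (m x * f x))\<^sup>2) <= norm (C\<^sup>2 * (cmod (f x))\<^sup>2)"
   using b
  proof eventually_elim
   case (elim x)
   have "(cmod (m x))\<^sup>2 <= C\<^sup>2" using elim by (intro power_mono) auto
   then have "(cmod (m x))\<^sup>2 * (cmod (f x))\<^sup>2 <= C\<^sup>2 * (cmod (f x))\<^sup>2" by (rule mult_right_mono) simp
   then show ?case by (simp add: norm_mult power_mult_distrib)
  qed
 qed
 ultimately show ?thesis unfolding L2_def by simp
qed

lemma L2_subspace: "cfun.subspace (L2 :: (real^'k => complex) set)"
proof (rule cfun.subspaceI)
 show "0 : (L2 :: (real^'k => complex) set)" unfolding L2_def zero_fun_def by simp
 show "f + g : L2" if f: "f : L2" "g : L2" for f g :: "real^'k => complex"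
 proof -
  have m: "(%x. f x + g x) : leb_meas"
   using L2D(1)[OF f(1)] L2D(1)[OF f(2)] by measurable
  have "integrable lebesgue (%x. (cmod (f x + g x))\<^sup>2)"
  proof (rule Bochner_Integration.integrable_bound)
   show "integrable lebesgue (%x. 2 * (cmod (f x))\<^sup>2 + 2 * (cmod (g x))\<^sup>2)"
    using L2D(2)[OF f(1)] L2D(2)[OF f(2)] by simp
   show "(%x. (cmod (f x + g x))\<^sup>2) : leb_meas" using m by measurable
   show "AE x in lebesgue. norm ((cmod (f x + g x))\<^sup>2) <= norm (2 * (cmod (f x))\<^sup>2 + 2 * (cmod (g x))\<^sup>2)"
    using cmod_add_squared_le by auto
  qed
  then show ?thesis unfolding L2_def plus_fun_def using m by simp
 qed
 show "cscale c f : L2" if f: "f : L2" for c and f :: "real^'k => complex"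
  unfolding cscale_def by (rule L2_bounded_mult[OF f, of _ "cmod c"]) auto
qed

global_interpretation L2: semi_inner "L2 :: (real^'k => complex) set" L2_inner
proof
 show "cfun.subspace (L2 :: (real^'k => complex) set)" by (rule L2_subspace)
 show "L2_inner (f + g) h = L2_inner f h + L2_inner g h" if "f : L2" "g : L2" "h : L2" for f g h :: "real^'k => complex"
  unfolding L2_inner_def using L2_mult_integrable[OF that(1,3)] L2_mult_integrable[OF that(2,3)]
  by (simp add: distrib_right)
 show "L2_inner (cscale c f) h = c * L2_inner f h" if "f : L2" "h : L2" for f h :: "real^'k => complex" and c
  unfolding L2_inner_def cscale_def by (simp add: mult.assoc)
 show "L2_inner g f = cnj (L2_inner f g)" if "f : L2" "g : L2" for f g :: "real^'k => complex"
 proof -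
  have "L2_inner g f = (LINT x|lebesgue. cnj (f x * cnj (g x)))" unfolding L2_inner_def by (simp add: mult.commute)
  also have "... = cnj (L2_inner f g)" unfolding L2_inner_def by (rule Bochner_Integration.integral_cnj)
  finally show ?thesis .
 qed
 show "0 <= Re (L2_inner f f)" if "f : L2" for f :: "real^'k => complex"
 proof -
  have "L2_inner f f = (LINT x|lebesgue. of_real ((cmod (f x))\<^sup>2))"
   unfolding L2_inner_def by (simp only: complex_norm_square)
  also have "... = of_real (LINT x|lebesgue. (cmod (f x))\<^sup>2)" by (rule integral_complex_of_real)
  finally show ?thesis by simp
 qed
qed

lemma L2_sq: "L2.sq f = (LINT x|lebesgue. (cmod (f x))\<^sup>2)"
proof -
 have "L2_inner f f = (LINT x|lebesgue. of_real ((cmod (f x))\<^sup>2))"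
  unfolding L2_inner_def by (simp only: complex_norm_square)
 also have "... = of_real (LINT x|lebesgue. (cmod (f x))\<^sup>2)" by (rule integral_complex_of_real)
 finally show ?thesis unfolding L2.sq_def by simp
qed

lemma L2_norm_sq: "(L2_norm f)\<^sup>2 = L2.sq f" and L2_norm_eq: "L2_norm f = sqrt (L2.sq f)"
 and L2_norm_nonneg: "0 <= L2_norm f"
 unfolding L2_norm_def L2_sq by simp_all

lemma L2_sq_nn: "f : L2 ==> ennreal (L2.sq f) = (\<integral>\<^sup>+x. ennreal ((cmod (f x))\<^sup>2) \<partial>lebesgue)"
 unfolding L2_sq by (rule nn_integral_eq_integral[symmetric]) (auto simp: L2_def)

lemma L2I_nn:
 assumes "f : leb_meas" "(\<integral>\<^sup>+x. ennreal ((cmod (f x))\<^sup>2) \<partial>lebesgue) <= ennreal c" "0 <= c"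
 shows "f : L2" "L2.sq f <= c"
proof -
 have "(\<integral>\<^sup>+x. ennreal (norm ((cmod (f x))\<^sup>2)) \<partial>lebesgue) < \<infinity>"
  using assms(2) by (simp add: order.strict_trans1 ennreal_less_top)
 moreover have "(%x. (cmod (f x))\<^sup>2) : leb_meas" using assms(1) by measurable
 ultimately show f: "f : L2" unfolding L2_def using assms(1) by (auto intro: integrableI_bounded)
 show "L2.sq f <= c" using assms(2,3) unfolding L2_sq_nn[OF f, symmetric] by simp
qed

lemma L2_AE_cong:
 assumes f: "f : L2" and ae: "AE x in lebesgue. f x = g x"
 shows "g : L2" "L2.sq g = L2.sq f"
proof -
 have g: "g : leb_meas" using borel_measurable_AE[OF L2D(1)[OF f] ae] .
 have "integrable lebesgue (%x. (cmod (g x))\<^sup>2) \<longleftrightarrow> integrable lebesgue (%x. (cmod (f x))\<^sup>2)"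
 proof (rule integrable_cong_AE)
  show "AE x in lebesgue. (cmod (g x))\<^sup>2 = (cmod (f x))\<^sup>2" using ae by eventually_elim simp
 qed (use g L2D(1)[OF f] in measurable)
 then show "g : L2" using f g unfolding L2_def by auto
 show "L2.sq g = L2.sq f" unfolding L2_sq
 proof (rule integral_cong_AE)
  show "AE x in lebesgue. (cmod (g x))\<^sup>2 = (cmod (f x))\<^sup>2" using ae by eventually_elim simp
 qed (use g L2D(1)[OF f] in measurable)
qed

lemma L2_sq_eq_0_iff: "f : L2 ==> L2.sq f = 0 \<longleftrightarrow> (AE x in lebesgue. f x = 0)"
 unfolding L2_sq using integral_nonneg_eq_0_iff_AE[OF L2D(2)] by simp

lemma L2_inner_AE_cong:
 assumes "f : leb_meas" "g : leb_meas"
  "AE x in lebesgue. f x = f' x" "AE x in lebesgue. g x = g' x"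
 shows "L2_inner f g = L2_inner f' g'"
 unfolding L2_inner_def
proof (rule integral_cong_AE)
 show "(%x. f x * cnj (g x)) : leb_meas" using assms by measurable
 show "(%x. f' x * cnj (g' x)) : leb_meas"
  using borel_measurable_AE[OF assms(1,3)] borel_measurable_AE[OF assms(2,4)] by measurable
 show "AE x in lebesgue. f x * cnj (g x) = f' x * cnj (g' x)" using assms(3,4) by eventually_elim simp
qed

lemma L2_dominated:
 assumes h: "!!m. h m : L2" and g: "g : L2" and u: "u : L2"
  and lim: "AE x in lebesgue. (%m. h m x) ----> g x" and dom: "!!m. AE x in lebesgue. cmod (h m x) <= cmod (u x)"
 shows "(%m. L2.sq (h m - g)) ----> 0"
proof -
 have "(%m. LINT x|lebesgue. (cmod (h m x - g x))\<^sup>2) ----> (LINT x|(lebesgue :: (real^'a) measure). 0)"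
 proof (rule integral_dominated_convergence)
  show "integrable lebesgue (%x. 2 * (cmod (u x))\<^sup>2 + 2 * (cmod (g x))\<^sup>2)"
   using L2D(2)[OF u] L2D(2)[OF g] by simp
  show "(%x. (cmod (h m x - g x))\<^sup>2) : leb_meas" for m
   using L2D(1)[OF h] L2D(1)[OF g] by measurable
  show "AE x in lebesgue. (%m. (cmod (h m x - g x))\<^sup>2) ----> 0"
   using lim
  proof eventually_elim
   case (elim x)
   have "(%m. (cmod (h m x - g x))\<^sup>2) ----> (cmod (g x - g x))\<^sup>2" by (intro tendsto_intros elim)
   then show ?case by simp
  qed
  show "AE x in lebesgue. norm ((cmod (h m x - g x))\<^sup>2) <= 2 * (cmod (u x))\<^sup>2 + 2 * (cmod (g x))\<^sup>2" for m
   using dom[of m]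
  proof eventually_elim
   case (elim x)
   have "(cmod (h m x + - g x))\<^sup>2 <= 2 * (cmod (h m x))\<^sup>2 + 2 * (cmod (- g x))\<^sup>2" by (rule cmod_add_squared_le)
   moreover have "(cmod (h m x))\<^sup>2 <= (cmod (u x))\<^sup>2" using elim by (intro power_mono) auto
   ultimately show ?case unfolding norm_minus_cancel diff_conv_add_uminus[symmetric] real_norm_def abs_power2
    by linarith
  qed
 qed simp
 then show ?thesis unfolding L2_sq by simp
qed

text \<open>Riesz-Fischer along a subsequence with squared steps at most \<open>(1/4) ^ j\<close>.
  The weights \<open>2 ^ j\<close> keep the sum of the integrals finite and force geometric decay of
  \<open>D j x\<close> for almost every \<open>x\<close>; Fatou's lemma then turns pointwise
  convergence into convergence in norm.\<close>

lemma L2_complete: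
 fixes h :: "nat => real^'k => complex"
 assumes h: "!!m. h m : L2" and cauchy: "!!e. e > 0 ==> \<exists>N. \<forall>m\<ge>N. \<forall>k\<ge>N. L2.sq (h m - h k) < e"
 obtains g where "g : L2" "(%m. L2.sq (h m - g)) ----> 0"
proof -
 have "\<exists>N. \<forall>m\<ge>N. \<forall>k\<ge>N. L2.sq (h m - h k) < (1/4) ^ j" for j :: nat by (rule cauchy) simp
 then obtain N where N: "!!j m k. N j <= m ==> N j <= k ==> L2.sq (h m - h k) < (1/4) ^ j" by metis
 \<comment> \<open>Summation makes \<open>s j\<close> an upper bound for all \<open>N i\<close> with
   \<open>i <= j\<close> at once.\<close>
 define s where "s = (%j. \<Sum>i\<le>j. N i)"
 have sN: "N i <= s j" if "i <= j" for i j unfolding s_def using that by (intro member_le_sum) auto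
 define D where "D = (%j. h (s (Suc j)) - h (s j))"
 have DL: "D j : L2" for j unfolding D_def by (intro L2.V_diff h)
 have Dm: "D j : leb_meas" for j by (rule L2D(1)[OF DL])
 have hm: "h j : leb_meas" for j by (rule L2D(1)[OF h])
 have Dsq: "L2.sq (D j) <= (1/4) ^ j" for j
  unfolding D_def using N[of j "s (Suc j)" "s j"] sN[of j "Suc j"] sN[of j j] by simp
 have "(\<integral>\<^sup>+x. (\<Sum>j. ennreal (2 ^ j * (cmod (D j x))\<^sup>2)) \<partial>lebesgue) = (\<Sum>j. \<integral>\<^sup>+x. ennreal (2 ^ j * (cmod (D j x))\<^sup>2) \<partial>lebesgue)"
  by (rule nn_integral_suminf) (use Dm in measurable)
 also have "... <= (\<Sum>j. ennreal ((1/2) ^ j))"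
 proof (intro suminf_le allI summableI)
  fix j
  have "(\<integral>\<^sup>+x. ennreal (2 ^ j * (cmod (D j x))\<^sup>2) \<partial>lebesgue) = (\<integral>\<^sup>+x. ennreal (2 ^ j) * ennreal ((cmod (D j x))\<^sup>2) \<partial>lebesgue)"
   by (simp add: ennreal_mult)
  also have "... = ennreal (2 ^ j) * ennreal (L2.sq (D j))"
   unfolding L2_sq_nn[OF DL] by (rule nn_integral_cmult) (use Dm in measurable)
  also have "... = ennreal (2 ^ j * L2.sq (D j))" using L2.sq_nonneg[OF DL] by (simp add: ennreal_mult)
  also have "2 ^ j * L2.sq (D j) <= 2 ^ j * (1/4) ^ j" using Dsq by (intro mult_left_mono) auto
  also have "2 ^ j * (1/4) ^ j = (1/2::real) ^ j" by (simp flip: power_mult_distrib)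
  finally show "(\<integral>\<^sup>+x. ennreal (2 ^ j * (cmod (D j x))\<^sup>2) \<partial>lebesgue) <= ennreal ((1/2) ^ j)" by (simp add: ennreal_leI)
 qed
 also have "... = ennreal (\<Sum>j. (1/2) ^ j)"
  by (rule suminf_ennreal2) auto
 also have "... < \<infinity>" by simp
 finally have fin: "(\<integral>\<^sup>+x. (\<Sum>j. ennreal (2 ^ j * (cmod (D j x))\<^sup>2)) \<partial>lebesgue) ~= \<infinity>" by simp
 have "AE x in lebesgue. (\<Sum>j. ennreal (2 ^ j * (cmod (D j x))\<^sup>2)) ~= \<infinity>"
  by (rule nn_integral_noteq_infinite[OF _ fin]) (use Dm in measurable)
 then have conv: "AE x in lebesgue. convergent (%j. h (s j) x)"
 proof eventually_elim
  case (elim x)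
  then have sm: "summable (%j. 2 ^ j * (cmod (D j x))\<^sup>2)" by (intro summable_suminf_not_top) auto
  then have "(%j. 2 ^ j * (cmod (D j x))\<^sup>2) ----> 0" by (rule summable_LIMSEQ_zero)
  then have "Bseq (%j. 2 ^ j * (cmod (D j x))\<^sup>2)" by (intro convergent_imp_Bseq convergentI)
  then obtain C where C: "!!j. \<bar>2 ^ j * (cmod (D j x))\<^sup>2\<bar> <= C" unfolding Bseq_def by auto
  have Dle: "cmod (D j x) <= sqrt C * (sqrt (1/2)) ^ j" for j
  proof -
   have "(cmod (D j x))\<^sup>2 <= C * (1/2) ^ j" using C[of j] by (simp add: field_simps)
   then have "cmod (D j x) <= sqrt (C * (1/2) ^ j)" by (rule real_le_rsqrt)
   then show ?thesis by (simp only: real_sqrt_mult real_sqrt_power)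
  qed
  have "summable (%j. sqrt C * (sqrt (1/2)) ^ j)"
   by (intro summable_mult summable_geometric) (simp add: real_sqrt_lt_1_iff)
  then have "summable (%j. D j x)"
   by (rule summable_comparison_test'[where N=0]) (rule Dle)
  then have "convergent (%n. \<Sum>j<n. D j x)" by (simp add: summable_iff_convergent)
  moreover have "(\<Sum>j<n. D j x) = h (s n) x - h (s 0) x" for n
   by (induction n) (auto simp: D_def)
  ultimately have "convergent (%n. h (s n) x - h (s 0) x)" by simp
  then show ?case by (simp add: convergent_diff_const_right_iff)
 qed
 define g where "g = (%x. lim (%j. h (s j) x))"
 have gm: "g : leb_meas" unfolding g_def using hm by (rule borel_measurable_lim_metric)
 have glim: "AE x in lebesgue. (%j. h (s j) x) ----> g x"
  using conv by eventually_elim (simp add: g_def convergent_LIMSEQ_iff)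
 have key: "(\<integral>\<^sup>+x. ennreal ((cmod (h m x - g x))\<^sup>2) \<partial>lebesgue) <= ennreal ((1/4) ^ p)" if m: "N p <= m" for m p
 proof -
  have "(\<integral>\<^sup>+x. ennreal ((cmod (h m x - g x))\<^sup>2) \<partial>lebesgue) = (\<integral>\<^sup>+x. liminf (%j. ennreal ((cmod (h m x - h (s j) x))\<^sup>2)) \<partial>lebesgue)"
  proof (rule nn_integral_cong_AE)
   show "AE x in lebesgue. ennreal ((cmod (h m x - g x))\<^sup>2) = liminf (%j. ennreal ((cmod (h m x - h (s j) x))\<^sup>2))"
    using glim
   proof eventually_elim
    case (elim x)
    have "(%j. ennreal ((cmod (h m x - h (s j) x))\<^sup>2)) ----> ennreal ((cmod (h m x - g x))\<^sup>2)"
     by (intro tendsto_intros elim tendsto_ennrealI)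
    then show ?case by (rule lim_imp_Liminf[OF trivial_limit_sequentially, symmetric])
   qed
  qed
  also have "... <= liminf (%j. \<integral>\<^sup>+x. ennreal ((cmod (h m x - h (s j) x))\<^sup>2) \<partial>lebesgue)"
   by (rule nn_integral_liminf) (use hm in measurable)
  also have "... <= ennreal ((1/4) ^ p)"
  proof (rule Liminf_le)
   show "\<forall>\<^sub>F j in sequentially. (\<integral>\<^sup>+x. ennreal ((cmod (h m x - h (s j) x))\<^sup>2) \<partial>lebesgue) <= ennreal ((1/4) ^ p)"
    unfolding eventually_sequentially
   proof (intro exI allI impI)
    fix j assume "p <= j"
    then have "L2.sq (h m - h (s j)) < (1/4) ^ p" using N[OF m sN] by simp
    then have "ennreal (L2.sq (h m - h (s j))) <= ennreal ((1/4) ^ p)" by (intro ennreal_leI) simp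
    then show "(\<integral>\<^sup>+x. ennreal ((cmod (h m x - h (s j) x))\<^sup>2) \<partial>lebesgue) <= ennreal ((1/4) ^ p)"
     unfolding L2_sq_nn[OF L2.V_diff[OF h h]] by simp
   qed
  qed simp
  finally show ?thesis .
 qed
 have dm: "(%x. h m x - g x) : leb_meas" for m using hm gm by measurable
 have dL: "h m - g : L2" "L2.sq (h m - g) <= (1/4) ^ p" if "N p <= m" for m p
  using L2I_nn[OF dm key[OF that]] unfolding fun_diff_def by auto
 have gL: "g : L2"
 proof -
  have "h (N 0) - (h (N 0) - g) : L2" by (intro L2.V_diff h dL(1)[of 0]) simp
  then show ?thesis by simp
 qed
 have "(%m. L2.sq (h m - g)) ----> 0"
 proof (rule LIMSEQ_I)
  fix r :: real assume r: "0 < r"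
  obtain p where p: "(1/4) ^ p < r" using real_arch_pow_inv[OF r, of "1/4"] by auto
  have "norm (L2.sq (h m - g) - 0) < r" if "N p <= m" for m
   using dL(2)[OF that] p L2.sq_nonneg[OF L2.V_diff[OF h gL]] by simp
  then show "\<exists>no. \<forall>m\<ge>no. norm (L2.sq (h m - g) - 0) < r" by blast
 qed
 then show thesis using that gL by blast
qed

section \<open>The theorem of Plancherel\<close>

lemma lborel_eq_distr_PiM: "(lborel :: (real^'k) measure) = distr (Pi\<^sub>M Basis (%b. lborel)) borel (%f. \<Sum>b\<in>Basis. f b *\<^sub>R b)"
 by (subst lborel_def) (simp add: lborel_eq_real)

lemma lborel_prod_integral:
 fixes u :: "real^'k => real => complex"
 assumes u: "!!b. b : Basis ==> integrable lborel (u b)"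
 shows "integrable lborel (%x. \<Prod>b\<in>Basis. u b (x \<bullet> b))"
  and "(LINT x|lborel. (\<Prod>b\<in>Basis. u b (x \<bullet> b))) = (\<Prod>b\<in>Basis. (LINT t|lborel. u b t))"
proof -
 interpret product_sigma_finite "%b::real^'k. lborel :: real measure" ..
 have meas: "(%x. \<Prod>b\<in>Basis. u b (x \<bullet> b)) : borel_measurable borel"
 proof (rule borel_measurable_prod)
  fix b :: "real^'k" assume "b : Basis"
  then have "u b : borel_measurable borel" using u[of b] by auto
  then show "(%x. u b (x \<bullet> b)) : borel_measurable borel" by measurable
 qed
 have T: "(%f. \<Sum>b\<in>Basis. f b *\<^sub>R b) : measurable (Pi\<^sub>M Basis (%b::real^'k. lborel :: real measure)) borel"
  by measurable
 have eq: "(\<Prod>b\<in>Basis. u b ((\<Sum>b\<in>Basis. f b *\<^sub>R b) \<bullet> b)) = (\<Prod>b\<in>Basis. u b (f b))" for f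
  by (intro prod.cong refl) (simp add: inner_sum_left inner_Basis if_distrib sum.delta cong: if_cong)
 have int: "integrable (Pi\<^sub>M Basis (%b. lborel)) (%f. \<Prod>b\<in>Basis. u b (f b))"
  using u by (intro product_integrable_prod) auto
 show "integrable lborel (%x. \<Prod>b\<in>Basis. u b (x \<bullet> b))"
  unfolding lborel_eq_distr_PiM using int by (subst integrable_distr_eq[OF T meas]) (simp only: eq)
 show "(LINT x|lborel. (\<Prod>b\<in>Basis. u b (x \<bullet> b))) = (\<Prod>b\<in>Basis. (LINT t|lborel. u b t))"
  by (subst lborel_eq_distr_PiM, subst integral_distr[OF T meas], unfold eq)
    (rule product_integral_prod, use u in auto)
qed

text \<open>The characteristic function of the standard normal distribution, freed from its
  normalization.\<close>

lemma gaussian_1d: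
 shows "integrable lborel (%t::real. exp (\<i> * of_real (s * t)) * of_real (exp (- t\<^sup>2 / 2)))"
  and "(LINT t|lborel. exp (\<i> * of_real (s * t)) * of_real (exp (- t\<^sup>2 / 2))) = of_real (sqrt (2 * pi) * exp (- s\<^sup>2 / 2))"
proof -
 have dens: "std_normal_density t = exp (- t\<^sup>2 / 2) / sqrt (2 * pi)" for t
  by (simp add: std_normal_density_def)
 have nd: "integrable lborel std_normal_density" by (rule integrable_normal_density) simp
 then have "integrable lborel (%t. sqrt (2 * pi) * std_normal_density t)" by simp
 then have e: "integrable lborel (%t. exp (- t\<^sup>2 / 2 :: real))" unfolding dens by simp
 show int: "integrable lborel (%t::real. exp (\<i> * of_real (s * t)) * of_real (exp (- t\<^sup>2 / 2)))"
  by (rule Bochner_Integration.integrable_bound[OF e]) (auto simp: norm_mult)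
 have "of_real (exp (- s\<^sup>2 / 2)) = char std_normal_distribution s" by (simp add: char_std_normal_distribution)
 also have "... = (LINT t|lborel. std_normal_density t *\<^sub>R exp (\<i> * of_real (s * t)))"
  unfolding char_def by (subst integral_density) auto
 also have "... = (LINT t|lborel. of_real (1 / sqrt (2 * pi)) * (exp (\<i> * of_real (s * t)) * of_real (exp (- t\<^sup>2 / 2))))"
  unfolding dens by (intro Bochner_Integration.integral_cong refl) (simp add: scaleR_conv_of_real mult_ac)
 also have "... = of_real (1 / sqrt (2 * pi)) * (LINT t|lborel. exp (\<i> * of_real (s * t)) * of_real (exp (- t\<^sup>2 / 2)))"
  by (rule Bochner_Integration.integral_mult_right_zero)
 finally have *: "of_real (exp (- s\<^sup>2 / 2)) = of_real (1 / sqrt (2 * pi)) * (LINT t|lborel. exp (\<i> * of_real (s * t)) * of_real (exp (- t\<^sup>2 / 2)))" .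
 have "of_real (sqrt (2 * pi) * exp (- s\<^sup>2 / 2)) = complex_of_real (sqrt (2 * pi)) * of_real (exp (- s\<^sup>2 / 2))" by simp
 also have "... = of_real (sqrt (2 * pi) * (1 / sqrt (2 * pi))) * (LINT t|lborel. exp (\<i> * of_real (s * t)) * of_real (exp (- t\<^sup>2 / 2)))"
  unfolding * by (simp only: of_real_mult mult.assoc)
 also have "sqrt (2 * pi) * (1 / sqrt (2 * pi)) = 1" by simp
 finally show "(LINT t|lborel. exp (\<i> * of_real (s * t)) * of_real (exp (- t\<^sup>2 / 2))) = of_real (sqrt (2 * pi) * exp (- s\<^sup>2 / 2))"
  by simp
qed

definition gauss :: "real^'k => real" where "gauss x = exp (- (x \<bullet> x) / 2)"

lemma gauss_pos: "0 < gauss x" and gauss_le_1: "gauss x <= 1" and gauss_measurable[measurable]: "gauss : borel_measurable borel"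
 unfolding gauss_def by (auto intro!: borel_measurable_continuous_onI continuous_intros)

lemma gauss_fourier:
 fixes t :: "real^'k"
 shows "integrable lborel (%x::real^'k. exp (\<i> * of_real (t \<bullet> x)) * of_real (gauss x))"
  and "(LINT x|lborel. exp (\<i> * of_real (t \<bullet> x)) * of_real (gauss x)) = of_real (sqrt (2 * pi) ^ CARD('k) * gauss t)"
proof -
 define u where "u = (%b s. exp (\<i> * of_real ((t \<bullet> b) * s)) * complex_of_real (exp (- s\<^sup>2 / 2)))"
 have gp: "gauss x = (\<Prod>b\<in>Basis. exp (- (x \<bullet> b)\<^sup>2 / 2))" for x :: "real^'k"
  unfolding gauss_def exp_sum[OF finite_Basis, symmetric]
  by (subst euclidean_inner) (simp add: power2_eq_square sum_negf sum_divide_distrib)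
 have eq: "exp (\<i> * of_real (t \<bullet> x)) * of_real (gauss x) = (\<Prod>b\<in>Basis. u b (x \<bullet> b))" for x
 proof -
  have "exp (\<i> * of_real (t \<bullet> x)) = (\<Prod>b\<in>Basis. exp (\<i> * of_real ((t \<bullet> b) * (x \<bullet> b))))"
   unfolding exp_sum[OF finite_Basis, symmetric]
   by (subst euclidean_inner) (simp add: sum_distrib_left)
  then show ?thesis unfolding gp u_def prod.distrib by simp
 qed
 show "integrable lborel (%x::real^'k. exp (\<i> * of_real (t \<bullet> x)) * of_real (gauss x))"
  unfolding eq by (rule lborel_prod_integral(1)) (simp only: u_def gaussian_1d)
 have "(LINT x|lborel. exp (\<i> * of_real (t \<bullet> x)) * of_real (gauss x)) = (\<Prod>b\<in>(Basis :: (real^'k) set). (LINT s|lborel. u b s))"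
  unfolding eq by (rule lborel_prod_integral(2)) (simp only: u_def gaussian_1d)
 also have "... = (\<Prod>b\<in>(Basis :: (real^'k) set). of_real (sqrt (2 * pi)) * of_real (exp (- (t \<bullet> b)\<^sup>2 / 2)))"
  unfolding u_def gaussian_1d by simp
 also have "... = of_real (sqrt (2 * pi) ^ CARD('k) * gauss t)"
  unfolding prod.distrib gp by simp
 finally show "(LINT x|lborel. exp (\<i> * of_real (t \<bullet> x)) * of_real (gauss x)) = of_real (sqrt (2 * pi) ^ CARD('k) * gauss t)" .
qed

lemma gauss_integral:
 shows "integrable lborel (gauss :: real^'k => real)"
  and "(LINT x|lborel. gauss (x :: real^'k)) = sqrt (2 * pi) ^ CARD('k)"
proof -
 have "integrable lborel (%x::real^'k. complex_of_real (gauss x))" using gauss_fourier(1)[of "0 :: real^'k"] by simp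
 then show "integrable lborel (gauss :: real^'k => real)" by (simp add: complex_of_real_integrable_eq)
 have "complex_of_real (LINT x|lborel. gauss (x :: real^'k)) = of_real (sqrt (2 * pi) ^ CARD('k))"
  using gauss_fourier(2)[of "0 :: real^'k"] by (simp add: gauss_def[of 0] integral_complex_of_real)
 then show "(LINT x|lborel. gauss (x :: real^'k)) = sqrt (2 * pi) ^ CARD('k)" by (simp only: of_real_eq_iff)
qed

lemma lborel_integral_affine:
 fixes F :: "real^'k => 'b::{banach, second_countable_topology}"
 assumes c: "c ~= 0" and F: "F : borel_measurable borel"
 shows "(LINT x|lborel. F x) = \<bar>c\<bar> ^ CARD('k) *\<^sub>R (LINT x|lborel. F (t + c *\<^sub>R x))"
  and "integrable lborel F \<longleftrightarrow> integrable lborel (%x. F (t + c *\<^sub>R x))"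
proof -
 have A: "lborel = density (distr lborel borel (%x::real^'k. t + c *\<^sub>R x)) (%_. ennreal (\<bar>c\<bar> ^ CARD('k)))"
  using lborel_affine[OF c, of t] by (simp add: ennreal_power)
 have T: "(%x. t + c *\<^sub>R x) : measurable lborel (borel :: (real^'k) measure)" by measurable
 have F': "F : borel_measurable (distr lborel borel (%x::real^'k. t + c *\<^sub>R x))" using F by simp
 have "(LINT x|lborel. F x) = (LINT x|distr lborel borel (%x. t + c *\<^sub>R x). \<bar>c\<bar> ^ CARD('k) *\<^sub>R F x)"
  by (subst A, subst integral_density[OF F']) auto
 also have "... = \<bar>c\<bar> ^ CARD('k) *\<^sub>R (LINT x|lborel. F (t + c *\<^sub>R x))"
  by (simp add: integral_distr[OF T F])
 finally show "(LINT x|lborel. F x) = \<bar>c\<bar> ^ CARD('k) *\<^sub>R (LINT x|lborel. F (t + c *\<^sub>R x))" .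
 have "integrable lborel F \<longleftrightarrow> integrable (distr lborel borel (%x. t + c *\<^sub>R x)) (%x. \<bar>c\<bar> ^ CARD('k) *\<^sub>R F x)"
  by (subst A, subst integrable_density[OF F']) auto
 also have "... \<longleftrightarrow> integrable lborel (%x. F (t + c *\<^sub>R x))"
 proof -
  have k: "\<bar>c\<bar> ^ CARD('k) ~= 0" using c by simp
  have sc: "integrable M (%x. k *\<^sub>R G x) \<longleftrightarrow> integrable M G" if "k ~= 0"
   for M :: "(real^'k) measure" and k :: real and G :: "real^'k => 'b"
   using that integrable_scaleR_right[of "1 / k" M "%x. k *\<^sub>R G x"] integrable_scaleR_right[of k M G] by auto
  show ?thesis unfolding sc[OF k] by (rule integrable_distr_eq[OF T F])
 qed
 finally show "integrable lborel F \<longleftrightarrow> integrable lborel (%x. F (t + c *\<^sub>R x))" .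
qed

lemma lborel_integral_translate:
 fixes F :: "real^'k => 'b::{banach, second_countable_topology}"
 assumes F: "F : borel_measurable borel"
 shows "(LINT x|lborel. F (x + t)) = (LINT x|lborel. F x)" "integrable lborel (%x. F (x + t)) \<longleftrightarrow> integrable lborel F"
 using lborel_integral_affine[OF _ F, of 1 t] by (simp_all add: add.commute)

text \<open>Approximation by simple functions reduces the claim to an indicator, and outer
  regularity to that of an open set \<open>U\<close>: a point of \<open>U\<close> stays in
  \<open>U\<close> under small translations.\<close>

lemma translation_continuous_L1:
 fixes f :: "real^'k => complex" and t :: "nat => real^'k"
 assumes f: "integrable lborel f" and t: "t ----> 0"
 shows "(%m. LINT y|lborel. cmod (f (y + t m) - f y)) ----> 0"
 using f
proof (induction f rule: integrable_induct)
 case (base A c)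
 have A: "A : sets borel" using base by simp
 have shift: "integrable lborel (%y. F (y + s))" "(LINT y|lborel. F (y + s)) = (LINT y|lborel. F y)"
  if "integrable lborel F" for F :: "real^'k => real" and s
  using lborel_integral_translate[of F s] that by (auto dest: borel_measurable_integrable)
 have key: "(%m. LINT y|lborel. \<bar>indicator A (y + t m) - indicator A y :: real\<bar>) ----> 0"
 proof (rule LIMSEQ_I)
  fix r :: real assume r: "0 < r"
  have "A : sets lebesgue" using A by auto
  then obtain U where U: "open U" "A <= U" "U - A : lmeasurable" "emeasure lebesgue (U - A) < ennreal (r / 4)"
   using sets_lebesgue_outer_open[of A "r / 4"] r by auto
  have Ub: "U : sets borel" using U by auto
  have UA: "emeasure lborel (U - A) < ennreal (r / 4)" using U(4) Ub A by simp
  have intA: "integrable lborel (indicator A :: real^'k => real)" using base by simp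
  have intUA: "integrable lborel (indicator (U - A) :: real^'k => real)"
   using UA Ub A by (simp add: order.strict_trans)
  have mUA: "(LINT y|lborel. indicator (U - A) y) < r / 4"
  proof -
   have "emeasure lborel (U - A) ~= top" using UA by auto
   then have "ennreal (measure lborel (U - A)) < ennreal (r / 4)" using UA by (simp add: emeasure_eq_ennreal_measure)
   then have "measure lborel (U - A) < r / 4" using r by (simp add: ennreal_less_iff)
   then show ?thesis using Ub A by simp
  qed
  have dec: "indicator U y = (indicator A y + indicator (U - A) y :: real)" for y
   using U(2) by (auto simp: indicator_def)
  have intU: "integrable lborel (indicator U :: real^'k => real)"
  proof -
   have "integrable lborel (%y. indicator A y + indicator (U - A) y :: real)" using intA intUA by simp
   then show ?thesis by (simp only: dec[symmetric])
  qed
  \<comment> \<open>At points of the boundary of \<open>U\<close> the translated indicator need not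
    converge to that of \<open>U\<close>. The factor \<open>indicator U y\<close> ignores them, and
    \<open>Ueq\<close> recovers the full difference because both indicators have the same
    integral.\<close>
  have lim: "(%m. LINT y|lborel. indicator U y * indicator U (y + t m) :: real) ----> (LINT y|lborel. indicator U y)"
  proof (rule integral_dominated_convergence[OF _ _ intU])
   show "indicator U : borel_measurable lborel" using Ub by simp
   show "(%y. indicator U y * indicator U (y + t m) :: real) : borel_measurable lborel" for m
    using Ub by measurable
   show "AE y in lborel. (%m. indicator U y * indicator U (y + t m) :: real) ----> indicator U y"
   proof (rule AE_I2)
    fix y
    show "(%m. indicator U y * indicator U (y + t m) :: real) ----> indicator U y"
    proof (cases "y : U")
     case True
     have "(%m. y + t m) ----> y + 0" by (intro tendsto_intros t)
     then have "\<forall>\<^sub>F m in sequentially. y + t m : U" using U(1) True by (simp add: topological_tendstoD)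
     then have "\<forall>\<^sub>F m in sequentially. indicator U y * indicator U (y + t m) = (indicator U y :: real)"
      by eventually_elim (use True in auto)
     then show ?thesis by (rule tendsto_eventually)
    qed simp
   qed
   show "AE y in lborel. norm (indicator U y * indicator U (y + t m) :: real) <= indicator U y" for m
    by (auto simp: indicator_def)
  qed
  have Ueq: "(LINT y|lborel. \<bar>indicator U (y + t m) - indicator U y :: real\<bar>) =
    2 * (LINT y|lborel. indicator U y) - 2 * (LINT y|lborel. indicator U y * indicator U (y + t m))" for m
  proof -
   have int2: "integrable lborel (%y. indicator U y * indicator U (y + t m) :: real)"
    by (rule Bochner_Integration.integrable_bound[OF intU]) (use Ub in \<open>auto simp: indicator_def\<close>)
   have "(LINT y|lborel. \<bar>indicator U (y + t m) - indicator U y :: real\<bar>) =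
     (LINT y|lborel. indicator U (y + t m) + indicator U y - 2 * (indicator U y * indicator U (y + t m)))"
    by (rule Bochner_Integration.integral_cong) (auto simp: indicator_def)
   also have "... = (LINT y|lborel. indicator U (y + t m)) + (LINT y|lborel. indicator U y) - 2 * (LINT y|lborel. indicator U y * indicator U (y + t m))"
    using intU shift(1)[OF intU, of "t m"] int2 by simp
   finally show ?thesis using shift(2)[OF intU, of "t m"] by simp
  qed
  have "(%m. 2 * (LINT y|lborel. indicator U y) - 2 * (LINT y|lborel. indicator U y * indicator U (y + t m)) :: real)
    ----> 2 * (LINT y|lborel. indicator U y) - 2 * (LINT y|lborel. indicator U y)"
   by (intro tendsto_intros lim)
  then have lim0: "(%m. LINT y|lborel. \<bar>indicator U (y + t m) - indicator U y :: real\<bar>) ----> 0" unfolding Ueq by simp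
  have "0 < r / 2" using r by simp
  from LIMSEQ_D[OF lim0 this] obtain N where N: "!!m. m >= N ==> norm ((LINT y|lborel. \<bar>indicator U (y + t m) - indicator U y :: real\<bar>) - 0) < r / 2"
   by blast
  have "norm ((LINT y|lborel. \<bar>indicator A (y + t m) - indicator A y :: real\<bar>) - 0) < r" if m: "m >= N" for m
  proof -
   have "(LINT y|lborel. \<bar>indicator A (y + t m) - indicator A y :: real\<bar>) \<le>
     (LINT y|lborel. \<bar>indicator U (y + t m) - indicator U y\<bar> + indicator (U - A) (y + t m) + indicator (U - A) y)"
   proof (rule integral_mono)
    show "integrable lborel (%y. \<bar>indicator A (y + t m) - indicator A y :: real\<bar>)"
     using intA shift(1)[OF intA, of "t m"] by simp
    show "integrable lborel (%y. \<bar>indicator U (y + t m) - indicator U y\<bar> + indicator (U - A) (y + t m) + indicator (U - A) y :: real)"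
     using intU shift(1)[OF intU, of "t m"] intUA shift(1)[OF intUA, of "t m"] by simp
    fix y
    have "0 <= indicat_real (U - A) (y + t m)" "0 <= indicat_real (U - A) y" by simp_all
    then show "\<bar>indicat_real A (y + t m) - indicat_real A y\<bar> \<le>
      \<bar>indicator U (y + t m) - indicator U y\<bar> + indicator (U - A) (y + t m) + indicator (U - A) y"
     unfolding dec by linarith
   qed
   also have "... = (LINT y|lborel. \<bar>indicator U (y + t m) - indicator U y :: real\<bar>) + (LINT y|lborel. indicator (U - A) (y + t m)) + (LINT y|lborel. indicator (U - A) y)"
    using intU shift(1)[OF intU, of "t m"] intUA shift(1)[OF intUA, of "t m"] by simp
   also have "... < r / 2 + r / 4 + r / 4"
    using N[OF m] mUA shift(2)[OF intUA, of "t m"] by simp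
   finally show ?thesis by simp
  qed
  then show "\<exists>no. \<forall>m\<ge>no. norm ((LINT y|lborel. \<bar>indicator A (y + t m) - indicator A y :: real\<bar>) - 0) < r" by blast
 qed
 have "cmod (indicator A (y + t m) *\<^sub>R c - indicator A y *\<^sub>R c) = cmod c * \<bar>indicator A (y + t m) - indicator A y\<bar>" for y m
  by (auto simp: indicator_def)
 then show ?case using tendsto_mult_right_zero[OF key, of "cmod c"] by simp
next
 case (add f g)
 have int: "integrable lborel (%y. cmod (F (y + t m) - F y))" if "integrable lborel F" for F :: "real^'k => complex" and m
  using that lborel_integral_translate(2)[of F "t m"] by (auto dest: borel_measurable_integrable)
 show ?case
 proof (rule tendsto_sandwich[where f="%_. 0"])
  show "(%m. (LINT y|lborel. cmod (f (y + t m) - f y)) + (LINT y|lborel. cmod (g (y + t m) - g y))) ----> 0"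
   using tendsto_add[OF add(3,4)] by simp
  show "\<forall>\<^sub>F m in sequentially. (LINT y|lborel. cmod (f (y + t m) + g (y + t m) - (f y + g y))) \<le>
    (LINT y|lborel. cmod (f (y + t m) - f y)) + (LINT y|lborel. cmod (g (y + t m) - g y))"
  proof (rule always_eventually, rule allI)
   fix m
   have "(LINT y|lborel. cmod (f (y + t m) + g (y + t m) - (f y + g y))) <= (LINT y|lborel. cmod (f (y + t m) - f y) + cmod (g (y + t m) - g y))"
   proof (rule integral_mono)
    show "integrable lborel (%y. cmod (f (y + t m) + g (y + t m) - (f y + g y)))"
     using int[of "%y. f y + g y" m] add by simp
    show "integrable lborel (%y. cmod (f (y + t m) - f y) + cmod (g (y + t m) - g y))"
     using int add by simp
    show "cmod (f (y + t m) + g (y + t m) - (f y + g y)) <= cmod (f (y + t m) - f y) + cmod (g (y + t m) - g y)" for y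
     using norm_triangle_ineq[of "f (y + t m) - f y" "g (y + t m) - g y"] by (simp add: algebra_simps)
   qed
   also have "... = (LINT y|lborel. cmod (f (y + t m) - f y)) + (LINT y|lborel. cmod (g (y + t m) - g y))"
    using int add by simp
   finally show "(LINT y|lborel. cmod (f (y + t m) + g (y + t m) - (f y + g y))) \<le>
     (LINT y|lborel. cmod (f (y + t m) - f y)) + (LINT y|lborel. cmod (g (y + t m) - g y))" .
  qed
 qed auto
next
 case (lim f s)
 have tr: "integrable lborel (%y. F (y + u))" "(LINT y|lborel. cmod (F (y + u))) = (LINT y|lborel. cmod (F y))"
  if "integrable lborel F" for F :: "real^'k => complex" and u
  using that lborel_integral_translate(2)[of F u] lborel_integral_translate(1)[of "%y. cmod (F y)" u]
  by (auto dest: borel_measurable_integrable)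
 have sf: "(%i. LINT y|lborel. cmod (s i y - f y)) ----> (LINT y|(lborel::(real^'k) measure). 0)"
 proof (rule integral_dominated_convergence)
  show "integrable lborel (%y. 3 * cmod (f y))" using lim by simp
  show "(%y. cmod (s i y - f y)) : borel_measurable lborel" for i
   using lim(1)[of i] lim(4) by (auto dest: borel_measurable_integrable)
  show "AE y in lborel. (%i. cmod (s i y - f y)) ----> 0"
  proof (rule AE_I2)
   fix y
   have "(%i. cmod (s i y - f y)) ----> cmod (f y - f y)" by (intro tendsto_intros lim(2)) simp
   then show "(%i. cmod (s i y - f y)) ----> 0" by simp
  qed
  show "AE y in lborel. norm (cmod (s i y - f y)) <= 3 * cmod (f y)" for i
  proof (rule AE_I2)
   fix y
   have "cmod (s i y - f y) <= cmod (s i y) + cmod (f y)" by (rule norm_triangle_ineq4)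
   then show "norm (cmod (s i y - f y)) <= 3 * cmod (f y)" using lim(3)[of y i] by simp
  qed
 qed simp
 show ?case
 proof (rule LIMSEQ_I)
  fix r :: real assume r: "0 < r"
  then have r3: "0 < r / 3" by simp
  from LIMSEQ_D[OF sf r3] obtain i where "\<forall>n\<ge>i. norm ((LINT y|lborel. cmod (s n y - f y)) - (LINT y|(lborel::(real^'k) measure). 0)) < r / 3"
   by blast
  then have i: "(LINT y|lborel. cmod (s i y - f y)) < r / 3" by (auto dest: spec[of _ i])
  from LIMSEQ_D[OF lim(5)[of i] r3] obtain N where N: "!!m. m >= N ==> norm ((LINT y|lborel. cmod (s i (y + t m) - s i y)) - 0) < r / 3"
   by blast
  have tri: "cmod (- a + b + c) <= cmod a + cmod b + cmod c" for a b c
   using norm_triangle_ineq[of "- a + b" c] norm_triangle_ineq[of "- a" b] unfolding norm_minus_cancel by linarith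
  have si: "integrable lborel (s i)" and fi: "integrable lborel f" using lim by auto
  have d: "integrable lborel (%y. s i y - f y)" using si fi by simp
  have "norm ((LINT y|lborel. cmod (f (y + t m) - f y)) - 0) < r" if m: "m >= N" for m
  proof -
   have "(LINT y|lborel. cmod (f (y + t m) - f y)) \<le>
    (LINT y|lborel. cmod (s i (y + t m) - f (y + t m)) + cmod (s i (y + t m) - s i y) + cmod (s i y - f y))"
   proof (rule integral_mono)
    show "integrable lborel (%y. cmod (f (y + t m) - f y))" using fi tr(1)[OF fi, of "t m"] by simp
    show "integrable lborel (%y. cmod (s i (y + t m) - f (y + t m)) + cmod (s i (y + t m) - s i y) + cmod (s i y - f y))"
     using fi si tr(1)[OF fi, of "t m"] tr(1)[OF si, of "t m"] by simp
    fix y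
    have "f (y + t m) - f y = - (s i (y + t m) - f (y + t m)) + (s i (y + t m) - s i y) + (s i y - f y)" by simp
    then show "cmod (f (y + t m) - f y) <= cmod (s i (y + t m) - f (y + t m)) + cmod (s i (y + t m) - s i y) + cmod (s i y - f y)"
     using tri[of "s i (y + t m) - f (y + t m)" "s i (y + t m) - s i y" "s i y - f y"] by (simp only:)
   qed
   also have "... = (LINT y|lborel. cmod (s i (y + t m) - f (y + t m))) + (LINT y|lborel. cmod (s i (y + t m) - s i y)) + (LINT y|lborel. cmod (s i y - f y))"
    using fi si tr(1)[OF fi, of "t m"] tr(1)[OF si, of "t m"] by simp
   also have "... < r / 3 + r / 3 + r / 3"
    using i N[OF m] tr(2)[OF d, of "t m"] by simp
   finally show ?thesis by simp
  qed
  then show "\<exists>no. \<forall>m\<ge>no. norm ((LINT y|lborel. cmod (f (y + t m) - f y)) - 0) < r" by blast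
 qed
qed

definition expi :: "real^'k => real^'k => complex" where
 "expi y x = exp (- 2 * of_real pi * \<i> * of_real (y \<bullet> x))"

lemma cmod_expi: "cmod (expi y x) = 1" unfolding expi_def by simp

lemma expi_add: "expi (a + b) x = expi a x * expi b x"
 unfolding expi_def by (simp add: inner_add_left exp_add[symmetric] algebra_simps)

lemma cnj_expi: "cnj (expi y x) = expi (- y) x"
 unfolding expi_def by (simp add: exp_cnj)

lemma expi_commute: "expi y x = expi x y" unfolding expi_def by (simp add: inner_commute)

lemma expi_measurable [measurable (raw)]:
 "f : borel_measurable M ==> g : borel_measurable M ==> (%x. expi (f x) (g x)) : borel_measurable M"
 unfolding expi_def by measurable

lemma fourier_expi: "fourier f x = (LINT y|lebesgue. f y * expi y x)"
 unfolding fourier_def expi_def ..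

lemma fourier_lborel: "f : borel_measurable borel ==> fourier f x = (LINT y|lborel. f y * expi y x)"
 unfolding fourier_expi by (rule integral_completion) simp

lemma fourier_measurable: "f : borel_measurable borel ==> fourier f : borel_measurable (borel :: (real^'k) measure)"
proof -
 assume f [measurable]: "f : borel_measurable borel"
 have "(%x. LINT y|lborel. f y * expi y x) : borel_measurable (lborel :: (real^'k) measure)"
  by measurable
 moreover have "fourier f = (%x. LINT y|lborel. f y * expi y x)" by (rule ext) (rule fourier_lborel[OF f])
 ultimately show ?thesis by simp
qed

lemma integrable_product_bound:
 fixes F :: "(real^'k) \<times> (real^'k) => complex"
 assumes F: "F : borel_measurable (lborel \<Otimes>\<^sub>M lborel)" and g: "integrable lborel g" and h: "integrable lborel h"
  and b: "!!x y. cmod (F (x, y)) <= g x * (h y :: real)"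
 shows "integrable (lborel \<Otimes>\<^sub>M lborel) F"
proof (rule Bochner_Integration.integrable_bound)
 have m [measurable]: "g : borel_measurable lborel" "h : borel_measurable lborel" using g h by auto
 show "integrable (lborel \<Otimes>\<^sub>M lborel) (%z. \<bar>g (fst z) * h (snd z)\<bar>)"
 proof (rule lborel_pair.Fubini_integrable)
  show "(%z. \<bar>g (fst z) * h (snd z)\<bar>) : borel_measurable (lborel \<Otimes>\<^sub>M lborel)" by measurable
  show "integrable lborel (%x. LINT y|lborel. norm \<bar>g (fst (x, y)) * h (snd (x, y))\<bar>)"
   using g by (simp add: abs_mult)
  show "AE x in lborel. integrable lborel (%y. \<bar>g (fst (x, y)) * h (snd (x, y))\<bar>)"
   using h by (simp add: abs_mult)
 qed
 show "AE x in lborel \<Otimes>\<^sub>M lborel. norm (F x) <= norm \<bar>g (fst x) * h (snd x)\<bar>"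
 proof (rule AE_I2)
  fix z :: "(real^'k) \<times> (real^'k)"
  show "norm (F z) <= norm \<bar>g (fst z) * h (snd z)\<bar>" using b[of "fst z" "snd z"] by simp
 qed
qed (rule F)

text \<open>The Gaussian factor makes the double integrals absolutely convergent. Carrying out the
  frequency integral first turns it into a Gaussian of width \<open>ep / (2 * pi)\<close>, and the
  substitution \<open>y = z + dl u\<close> leaves an average of the autocorrelation of
  \<open>f\<close> near 0.\<close>

lemma gaussian_mean_fourier:
 fixes f :: "real^'k => complex"
 assumes f: "integrable lborel f" "f : borel_measurable borel" and C: "!!x. cmod (f x) <= C" and eps: "0 < ep"
 shows "integrable lborel (%x. (cmod (fourier f x))\<^sup>2 * gauss (ep *\<^sub>R x))"
  and "of_real (LINT x|lborel. (cmod (fourier f x))\<^sup>2 * gauss (ep *\<^sub>R x)) =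
   of_real (sqrt (2 * pi) ^ CARD('k) / (2 * pi) ^ CARD('k)) *
   (LINT u|lborel. of_real (gauss u) * (LINT z|lborel. f (z + (ep / (2 * pi)) *\<^sub>R u) * cnj (f z)))"
proof -
 note [measurable] = f(2)
 define B where "B = (LINT y|lborel. cmod (f y))"
 define K where "K = sqrt (2 * pi) ^ CARD('k)"
 define w where "w = (%x::real^'k. gauss (ep *\<^sub>R x))"
 define dl where "dl = ep / (2 * pi)"
 have d0: "dl > 0" unfolding dl_def using eps by simp
 have F [measurable]: "fourier f : borel_measurable borel" by (rule fourier_measurable) (rule f(2))
 have w [measurable]: "w : borel_measurable borel" unfolding w_def by measurable
 have wint: "integrable lborel w"
 proof -
  have "integrable lborel (%x::real^'k. gauss (0 + ep *\<^sub>R x))"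
   by (rule iffD1[OF lborel_integral_affine(2) gauss_integral(1)]) (use eps in auto)
  then show ?thesis unfolding w_def by simp
 qed
 have w0: "0 <= w x" for x unfolding w_def using gauss_pos less_imp_le by blast
 have fn: "integrable lborel (%y. cmod (f y))" using f(1) by simp
 have FB: "cmod (fourier f x) <= B" for x
 proof -
  have "cmod (fourier f x) <= (LINT y|lborel. cmod (f y * expi y x))"
   unfolding fourier_lborel[OF f(2)] by (rule integral_norm_bound)
  then show ?thesis unfolding B_def by (simp add: norm_mult cmod_expi)
 qed
 have B0: "0 <= B" unfolding B_def by simp
 show I: "integrable lborel (%x. (cmod (fourier f x))\<^sup>2 * gauss (ep *\<^sub>R x))"
 proof (rule Bochner_Integration.integrable_bound[of _ "%x. B\<^sup>2 * w x"])
  show "integrable lborel (%x. B\<^sup>2 * w x)" using wint by simp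
  show "AE x in lborel. norm ((cmod (fourier f x))\<^sup>2 * gauss (ep *\<^sub>R x)) <= norm (B\<^sup>2 * w x)"
  proof (rule AE_I2)
   fix x
   have "(cmod (fourier f x))\<^sup>2 * w x <= B\<^sup>2 * w x" using FB w0 by (intro mult_right_mono power_mono) auto
   then show "norm ((cmod (fourier f x))\<^sup>2 * gauss (ep *\<^sub>R x)) <= norm (B\<^sup>2 * w x)"
    using w0[of x] unfolding w_def by (simp add: abs_mult)
  qed
 qed measurable
 have inner: "(LINT x|lborel. expi (y - z) x * of_real (w x)) = of_real (K / ep ^ CARD('k) * gauss ((1 / dl) *\<^sub>R (y - z)))" for y z
 proof -
  define t where "t = - (1 / dl) *\<^sub>R (y - z)"
  define G where "G = (%x. exp (\<i> * of_real (t \<bullet> x)) * complex_of_real (gauss x))"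
  have "t \<bullet> (ep *\<^sub>R x) = - (2 * pi * ((y - z) \<bullet> x))" for x
   unfolding t_def dl_def inner_scaleR_left inner_scaleR_right using eps by simp
  then have "expi (y - z) x = exp (\<i> * of_real (t \<bullet> (ep *\<^sub>R x)))" for x
   unfolding expi_def by (simp add: mult_ac)
  then have eq: "expi (y - z) x * of_real (w x) = G (0 + ep *\<^sub>R x)" for x unfolding G_def w_def by simp
  have "G : borel_measurable borel" unfolding G_def by measurable
  then have "(LINT x|lborel. G x) = \<bar>ep\<bar> ^ CARD('k) *\<^sub>R (LINT x|lborel. G (0 + ep *\<^sub>R x))"
   using eps by (intro lborel_integral_affine(1)) auto
  then have "ep ^ CARD('k) *\<^sub>R (LINT x|lborel. expi (y - z) x * of_real (w x)) = of_real (K * gauss t)"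
   unfolding eq G_def gauss_fourier(2) K_def using eps by simp
  then have "(LINT x|lborel. expi (y - z) x * of_real (w x)) = of_real (K * gauss t) / of_real (ep ^ CARD('k))"
   using eps by (simp add: scaleR_conv_of_real field_simps)
  moreover have "gauss t = gauss ((1 / dl) *\<^sub>R (y - z))" unfolding t_def gauss_def by simp
  ultimately show ?thesis by simp
 qed
 have stepB: "(LINT x|lborel. fourier f x * of_real (w x) * cnj (expi z x)) =
   of_real (K / (2 * pi) ^ CARD('k)) * (LINT u|lborel. f (z + dl *\<^sub>R u) * of_real (gauss u))" for z
 proof -
  have "(LINT x|lborel. fourier f x * of_real (w x) * cnj (expi z x)) =
    (LINT x|lborel. (LINT y|lborel. f y * (expi (y - z) x * of_real (w x))))"
  proof (rule Bochner_Integration.integral_cong[OF refl])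
   fix x
   have "fourier f x * of_real (w x) * cnj (expi z x) = (LINT y|lborel. (f y * expi y x) * (of_real (w x) * cnj (expi z x)))"
    unfolding fourier_lborel[OF f(2)] by simp
   also have "... = (LINT y|lborel. f y * (expi (y - z) x * of_real (w x)))"
    by (rule Bochner_Integration.integral_cong) (simp_all add: cnj_expi expi_add diff_conv_add_uminus mult_ac del: add_uminus_conv_diff)
   finally show "fourier f x * of_real (w x) * cnj (expi z x) = (LINT y|lborel. f y * (expi (y - z) x * of_real (w x)))" .
  qed
  also have "... = (LINT y|lborel. (LINT x|lborel. f y * (expi (y - z) x * of_real (w x))))"
  proof (rule lborel_pair.Fubini_integral[symmetric])
   show "integrable (lborel \<Otimes>\<^sub>M lborel) (%(x, y). f y * (expi (y - z) x * of_real (w x)))"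
    by (rule integrable_product_bound[OF _ wint fn]) (use w0 in \<open>auto simp: norm_mult cmod_expi mult.commute\<close>)
  qed
  also have "... = (LINT y|lborel. f y * of_real (K / ep ^ CARD('k) * gauss ((1 / dl) *\<^sub>R (y - z))))"
   by (simp add: inner)
  also have "... = \<bar>dl\<bar> ^ CARD('k) *\<^sub>R (LINT u|lborel. f (z + dl *\<^sub>R u) * of_real (K / ep ^ CARD('k) * gauss ((1 / dl) *\<^sub>R ((z + dl *\<^sub>R u) - z))))"
   by (rule lborel_integral_affine(1)[of dl _ z]) (use d0 in \<open>auto simp: gauss_def\<close>)
  also have "... = \<bar>dl\<bar> ^ CARD('k) *\<^sub>R (LINT u|lborel. of_real (K / ep ^ CARD('k)) * (f (z + dl *\<^sub>R u) * of_real (gauss u)))"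
   using d0 by (simp add: mult_ac)
  also have "... = of_real (dl ^ CARD('k) * (K / ep ^ CARD('k))) * (LINT u|lborel. f (z + dl *\<^sub>R u) * of_real (gauss u))"
   using d0 by (simp add: scaleR_conv_of_real)
  also have "dl ^ CARD('k) * (K / ep ^ CARD('k)) = K / (2 * pi) ^ CARD('k)"
   unfolding dl_def using eps by (simp add: power_divide)
  finally show ?thesis .
 qed
 have "complex_of_real (LINT x|lborel. (cmod (fourier f x))\<^sup>2 * gauss (ep *\<^sub>R x)) =
   (LINT x|lborel. complex_of_real ((cmod (fourier f x))\<^sup>2 * w x))"
  unfolding w_def by (rule integral_complex_of_real[symmetric])
 also have "... = (LINT x|lborel. (LINT z|lborel. fourier f x * of_real (w x) * cnj (f z * expi z x)))"
 proof (rule Bochner_Integration.integral_cong[OF refl])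
  fix x
  have "of_real ((cmod (fourier f x))\<^sup>2 * w x) = fourier f x * of_real (w x) * cnj (fourier f x)"
   by (simp add: complex_norm_square mult_ac del: of_real_power)
  also have "... = fourier f x * of_real (w x) * (LINT z|lborel. cnj (f z * expi z x))"
   by (subst (2) fourier_lborel[OF f(2)]) (simp only: Bochner_Integration.integral_cnj)
  also have "... = (LINT z|lborel. fourier f x * of_real (w x) * cnj (f z * expi z x))"
   by (rule Bochner_Integration.integral_mult_right_zero[symmetric])
  finally show "of_real ((cmod (fourier f x))\<^sup>2 * w x) = (LINT z|lborel. fourier f x * of_real (w x) * cnj (f z * expi z x))" .
 qed
 also have "... = (LINT z|lborel. (LINT x|lborel. fourier f x * of_real (w x) * cnj (f z * expi z x)))"
 proof (rule lborel_pair.Fubini_integral[symmetric])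
  show "integrable (lborel \<Otimes>\<^sub>M lborel) (%(x, z). fourier f x * of_real (w x) * cnj (f z * expi z x))"
  proof (rule integrable_product_bound[of _ "%x. B * w x", OF _ _ fn])
   show "cmod (case (x, z) of (x, z) => fourier f x * of_real (w x) * cnj (f z * expi z x)) <= B * w x * cmod (f z)" for x z
    using FB[of x] w0[of x] by (auto simp: norm_mult cmod_expi intro!: mult_right_mono)
  qed (use wint in auto)
 qed
 also have "... = (LINT z|lborel. cnj (f z) * (LINT x|lborel. fourier f x * of_real (w x) * cnj (expi z x)))"
 proof (rule Bochner_Integration.integral_cong[OF refl])
  fix z
  show "(LINT x|lborel. fourier f x * of_real (w x) * cnj (f z * expi z x)) = cnj (f z) * (LINT x|lborel. fourier f x * of_real (w x) * cnj (expi z x))"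
   unfolding Bochner_Integration.integral_mult_right_zero[symmetric]
   by (rule Bochner_Integration.integral_cong) (simp_all add: mult_ac)
 qed
 also have "... = (LINT z|lborel. of_real (K / (2 * pi) ^ CARD('k)) * (LINT u|lborel. of_real (gauss u) * (f (z + dl *\<^sub>R u) * cnj (f z))))"
 proof (rule Bochner_Integration.integral_cong[OF refl])
  fix z
  have "cnj (f z) * (LINT u|lborel. f (z + dl *\<^sub>R u) * of_real (gauss u)) = (LINT u|lborel. of_real (gauss u) * (f (z + dl *\<^sub>R u) * cnj (f z)))"
   unfolding Bochner_Integration.integral_mult_right_zero[symmetric]
   by (rule Bochner_Integration.integral_cong) (simp_all add: mult_ac)
  then show "cnj (f z) * (LINT x|lborel. fourier f x * of_real (w x) * cnj (expi z x)) =
   of_real (K / (2 * pi) ^ CARD('k)) * (LINT u|lborel. of_real (gauss u) * (f (z + dl *\<^sub>R u) * cnj (f z)))"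
   unfolding stepB by (simp add: mult.left_commute)
 qed
 also have "... = of_real (K / (2 * pi) ^ CARD('k)) * (LINT z|lborel. (LINT u|lborel. of_real (gauss u) * (f (z + dl *\<^sub>R u) * cnj (f z))))"
  by (rule Bochner_Integration.integral_mult_right_zero)
 also have "(LINT z|lborel. (LINT u|lborel. of_real (gauss u) * (f (z + dl *\<^sub>R u) * cnj (f z)))) =
   (LINT u|lborel. (LINT z|lborel. of_real (gauss u) * (f (z + dl *\<^sub>R u) * cnj (f z))))"
 proof (rule lborel_pair.Fubini_integral[symmetric])
  show "integrable (lborel \<Otimes>\<^sub>M lborel) (%(z, u). of_real (gauss u) * (f (z + dl *\<^sub>R u) * cnj (f z)))"
  proof (rule integrable_product_bound[of _ "%z. C * cmod (f z)", OF _ _ gauss_integral(1)])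
   show "cmod (case (z, u) of (z, u) => of_real (gauss u) * (f (z + dl *\<^sub>R u) * cnj (f z))) <= C * cmod (f z) * gauss u" for z u
   proof -
    have "gauss u * (cmod (f (z + dl *\<^sub>R u)) * cmod (f z)) <= gauss u * (C * cmod (f z))"
     using C gauss_pos[of u] by (intro mult_left_mono mult_right_mono) auto
    then show ?thesis using gauss_pos[of u] by (simp add: norm_mult mult_ac)
   qed
  qed (use fn in auto)
 qed
 also have "... = (LINT u|lborel. of_real (gauss u) * (LINT z|lborel. f (z + dl *\<^sub>R u) * cnj (f z)))"
  by (simp only: Bochner_Integration.integral_mult_right_zero)
 finally show "of_real (LINT x|lborel. (cmod (fourier f x))\<^sup>2 * gauss (ep *\<^sub>R x)) =
   of_real (sqrt (2 * pi) ^ CARD('k) / (2 * pi) ^ CARD('k)) *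
   (LINT u|lborel. of_real (gauss u) * (LINT z|lborel. f (z + (ep / (2 * pi)) *\<^sub>R u) * cnj (f z)))"
  unfolding K_def dl_def .
qed

text \<open>As \<open>ep\<close> decreases to 0, the left side of the Gaussian identity increases to
  the full integral, and the right side converges because the autocorrelation \<open>A\<close> is
  bounded and continuous at 0. The constants cancel by \<open>KK\<close>.\<close>

lemma plancherel_bounded:
 fixes f :: "real^'k => complex"
 assumes f: "integrable lborel f" "f : borel_measurable borel" and C: "!!x. cmod (f x) <= C"
 shows "(\<integral>\<^sup>+x. ennreal ((cmod (fourier f x))\<^sup>2) \<partial>lborel) = ennreal (LINT x|lborel. (cmod (f x))\<^sup>2)"
proof -
 note [measurable] = f(2)
 have F [measurable]: "fourier f : borel_measurable borel" by (rule fourier_measurable) (rule f(2))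
 define K where "K = sqrt (2 * pi) ^ CARD('k)"
 have KK: "K * K = (2 * pi) ^ CARD('k)" unfolding K_def power_mult_distrib[symmetric] by simp
 have K0: "K > 0" unfolding K_def by simp
 define A where "A = (%t. LINT z|lborel. f (z + t) * cnj (f z))"
 define ep where "ep = (%m. 1 / real (Suc m))"
 have e0: "ep m > 0" for m unfolding ep_def by simp
 have elim: "ep ----> 0" unfolding ep_def by (rule LIMSEQ_inverse_real_of_nat[unfolded inverse_eq_divide])
 have fn: "integrable lborel (%y. cmod (f y))" using f(1) by simp
 have C0: "0 <= C" using C[of 0] norm_ge_zero order_trans by blast
 have prod_int: "integrable lborel (%z. f (z + t) * cnj (f z))" for t
 proof (rule Bochner_Integration.integrable_bound)
  show "integrable lborel (%z. C * cmod (f z))" using fn by simp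
  show "AE z in lborel. norm (f (z + t) * cnj (f z)) <= norm (C * cmod (f z))"
   using C C0 by (auto simp: norm_mult abs_mult intro!: mult_right_mono)
 qed measurable
 have Alim: "(%m. A (t m)) ----> A 0" if t: "t ----> 0" for t :: "nat => real^'k"
 proof -
  have "(%m. A (t m) - A 0) ----> 0"
  proof (rule Lim_null_comparison)
   show "(%m. C * (LINT y|lborel. cmod (f (y + t m) - f y))) ----> 0"
    using tendsto_mult_right_zero[OF translation_continuous_L1[OF f(1) t]] .
   show "\<forall>\<^sub>F m in sequentially. norm (A (t m) - A 0) <= C * (LINT y|lborel. cmod (f (y + t m) - f y))"
   proof (rule always_eventually, rule allI)
    fix m
    have fi: "integrable lborel (%z. cmod (f (z + t m) - f z))"
     using f lborel_integral_translate(2)[OF f(2), of "t m"] by simp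
    have "A (t m) - A 0 = (LINT z|lborel. f (z + t m) * cnj (f z) - f (z + 0) * cnj (f z))"
     unfolding A_def by (rule Bochner_Integration.integral_diff[symmetric]) (rule prod_int)+
    also have "norm \<dots> <= (LINT z|lborel. norm (f (z + t m) * cnj (f z) - f (z + 0) * cnj (f z)))"
     by (rule integral_norm_bound)
    also have "... <= (LINT z|lborel. C * cmod (f (z + t m) - f z))"
    proof (rule integral_mono)
     show "integrable lborel (%z. norm (f (z + t m) * cnj (f z) - f (z + 0) * cnj (f z)))"
      using prod_int[of "t m"] prod_int[of 0] by simp
     show "integrable lborel (%z. C * cmod (f (z + t m) - f z))" using fi by simp
     fix z
     have "norm (f (z + t m) * cnj (f z) - f (z + 0) * cnj (f z)) = cmod (f (z + t m) - f z) * cmod (f z)"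
      by (simp add: left_diff_distrib[symmetric] norm_mult)
     also have "... <= cmod (f (z + t m) - f z) * C" by (intro mult_left_mono C) auto
     finally show "norm (f (z + t m) * cnj (f z) - f (z + 0) * cnj (f z)) <= C * cmod (f (z + t m) - f z)"
      by (simp add: mult.commute)
    qed
    finally show "norm (A (t m) - A 0) <= C * (LINT y|lborel. cmod (f (y + t m) - f y))" by simp
   qed
  qed
  then show ?thesis by (rule LIM_zero_cancel)
 qed
 have Abound: "cmod (A t) <= C * (LINT y|lborel. cmod (f y))" for t
 proof -
  have "cmod (A t) <= (LINT z|lborel. cmod (f (z + t) * cnj (f z)))" unfolding A_def by (rule integral_norm_bound)
  also have "... <= (LINT z|lborel. C * cmod (f z))"
  proof (rule integral_mono)
   show "integrable lborel (%z. cmod (f (z + t) * cnj (f z)))" by (rule integrable_norm[OF prod_int])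
   show "integrable lborel (%z. C * cmod (f z))" using fn by simp
   show "cmod (f (z + t) * cnj (f z)) <= C * cmod (f z)" for z
    using C by (auto simp: norm_mult intro!: mult_right_mono)
  qed
  finally show ?thesis by simp
 qed
 have Am: "(%u. A (c *\<^sub>R u)) : borel_measurable lborel" for c
  unfolding A_def by measurable
 have "(%m. LINT u|lborel. of_real (gauss u) * A ((ep m / (2 * pi)) *\<^sub>R u)) ----> (LINT u|lborel. of_real (gauss (u :: real^'k)) * A 0)"
 proof (rule integral_dominated_convergence)
  have "integrable lborel (gauss :: real^'k => real)" by (rule gauss_integral(1))
  then show "integrable lborel (%u::real^'k. gauss u * (C * (LINT y|lborel. cmod (f y))))" by simp
  show "(%u. of_real (gauss u) * A ((ep m / (2 * pi)) *\<^sub>R u)) : borel_measurable lborel" for m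
   using Am by measurable
  show "AE u in lborel. (%m. of_real (gauss u) * A ((ep m / (2 * pi)) *\<^sub>R u)) ----> of_real (gauss u) * A 0"
  proof (rule AE_I2)
   fix u :: "real^'k"
   have "(%m. (ep m / (2 * pi)) *\<^sub>R u) ----> (0 / (2 * pi)) *\<^sub>R u" by (intro tendsto_intros elim) simp
   then have "(%m. A ((ep m / (2 * pi)) *\<^sub>R u)) ----> A 0" by (intro Alim) simp
   then show "(%m. of_real (gauss u) * A ((ep m / (2 * pi)) *\<^sub>R u)) ----> of_real (gauss u) * A 0"
    by (intro tendsto_intros)
  qed
  show "AE u in lborel. norm (of_real (gauss u) * A ((ep m / (2 * pi)) *\<^sub>R u)) <= gauss u * (C * (LINT y|lborel. cmod (f y)))" for m
  proof (rule AE_I2)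
   fix u :: "real^'k"
   have "gauss u * cmod (A ((ep m / (2 * pi)) *\<^sub>R u)) <= gauss u * (C * (LINT y|lborel. cmod (f y)))"
    using Abound gauss_pos[of u] by (intro mult_left_mono) auto
   then show "norm (of_real (gauss u) * A ((ep m / (2 * pi)) *\<^sub>R u)) <= gauss u * (C * (LINT y|lborel. cmod (f y)))"
    using gauss_pos[of u] by (simp add: norm_mult)
  qed
 qed measurable
 moreover have "(LINT u|lborel. of_real (gauss (u :: real^'k)) * A 0) = of_real K * A 0"
  unfolding K_def by (simp add: integral_complex_of_real gauss_integral(2))
 ultimately have "(%m. LINT u|lborel. of_real (gauss u) * A ((ep m / (2 * pi)) *\<^sub>R u)) ----> of_real K * A 0"
  by (simp only:)
 then have "(%m. of_real (K / (2 * pi) ^ CARD('k)) * (LINT u|lborel. of_real (gauss u) * A ((ep m / (2 * pi)) *\<^sub>R u)))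
   ----> of_real (K / (2 * pi) ^ CARD('k)) * (of_real K * A 0)"
  by (rule tendsto_mult_left)
 also have "of_real (K / (2 * pi) ^ CARD('k)) * (of_real K * A 0) = A 0"
 proof -
  have "of_real (K / (2 * pi) ^ CARD('k)) * (of_real K * A 0) = of_real (K / (K * K) * K) * A 0" unfolding KK by simp
  also have "K / (K * K) * K = 1" using K0 by simp
  finally show ?thesis by simp
 qed
 also have "A 0 = of_real (LINT x|lborel. (cmod (f x))\<^sup>2)"
  unfolding A_def by (simp add: integral_complex_of_real[symmetric] complex_norm_square del: of_real_power)
 finally have "(%m. complex_of_real (LINT x|lborel. (cmod (fourier f x))\<^sup>2 * gauss (ep m *\<^sub>R x))) ----> of_real (LINT x|lborel. (cmod (f x))\<^sup>2)"
  unfolding gaussian_mean_fourier(2)[OF f C e0] A_def K_def .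
 then have lim1: "(%m. LINT x|lborel. (cmod (fourier f x))\<^sup>2 * gauss (ep m *\<^sub>R x)) ----> (LINT x|lborel. (cmod (f x))\<^sup>2)"
  by (simp only: tendsto_of_real_iff)
 have nn: "0 <= (cmod (fourier f x))\<^sup>2 * gauss y" for x y :: "real^'k" using gauss_pos[of y] by simp
 have "(%m. ennreal (LINT x|lborel. (cmod (fourier f x))\<^sup>2 * gauss (ep m *\<^sub>R x))) ----> ennreal (LINT x|lborel. (cmod (f x))\<^sup>2)"
  by (rule tendsto_ennrealI[OF lim1])
 moreover have "ennreal (LINT x|lborel. (cmod (fourier f x))\<^sup>2 * gauss (ep m *\<^sub>R x)) = (\<integral>\<^sup>+x. ennreal ((cmod (fourier f x))\<^sup>2 * gauss (ep m *\<^sub>R x)) \<partial>lborel)" for m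
  using nn by (intro nn_integral_eq_integral[symmetric] gaussian_mean_fourier(1)[OF f C e0]) auto
 ultimately have lim2: "(%m. \<integral>\<^sup>+x. ennreal ((cmod (fourier f x))\<^sup>2 * gauss (ep m *\<^sub>R x)) \<partial>lborel) ----> ennreal (LINT x|lborel. (cmod (f x))\<^sup>2)"
  by simp
 have "(%m. \<integral>\<^sup>+x. ennreal ((cmod (fourier f x))\<^sup>2 * gauss (ep m *\<^sub>R x)) \<partial>lborel) ----> (\<integral>\<^sup>+x. ennreal ((cmod (fourier f x))\<^sup>2) \<partial>lborel)"
 proof (rule nn_integral_LIMSEQ)
  show "incseq (%m x. ennreal ((cmod (fourier f x))\<^sup>2 * gauss (ep m *\<^sub>R x)))"
  proof (intro incseq_SucI le_funI ennreal_leI mult_left_mono)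
   fix m and x :: "real^'k"
   have "ep (Suc m) <= ep m" unfolding ep_def by (simp add: frac_le)
   then have "(ep (Suc m))\<^sup>2 <= (ep m)\<^sup>2" using e0[of "Suc m"] by (intro power_mono) auto
   then have "(ep (Suc m))\<^sup>2 * (x \<bullet> x) <= (ep m)\<^sup>2 * (x \<bullet> x)" by (intro mult_right_mono) auto
   then show "gauss (ep m *\<^sub>R x) <= gauss (ep (Suc m) *\<^sub>R x)" unfolding gauss_def by (simp add: power2_eq_square mult.assoc)
  qed simp
  show "(%x. ennreal ((cmod (fourier f x))\<^sup>2 * gauss (ep m *\<^sub>R x))) : borel_measurable lborel" for m by measurable
  fix x :: "real^'k"
  have "(%m. gauss (ep m *\<^sub>R x)) ----> exp (- (((0 *\<^sub>R x) \<bullet> (0 *\<^sub>R x)) / 2))"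
   unfolding gauss_def minus_divide_left by (intro tendsto_intros elim) simp
  then have "(%m. (cmod (fourier f x))\<^sup>2 * gauss (ep m *\<^sub>R x)) ----> (cmod (fourier f x))\<^sup>2 * 1"
   by (intro tendsto_intros) simp
  then show "(%m. ennreal ((cmod (fourier f x))\<^sup>2 * gauss (ep m *\<^sub>R x))) ----> ennreal ((cmod (fourier f x))\<^sup>2)"
   by (intro tendsto_ennrealI) simp
 qed
 then show ?thesis using lim2 by (rule LIMSEQ_unique)
qed

section \<open>Extension of the Fourier transform to all of \<open>L2\<close>\<close>

lemma complex_borel_representative:
 fixes f :: "real^'k => complex"
 assumes f: "f : leb_meas"
 obtains f' where "f' : borel_measurable borel" "AE x in lebesgue. f x = f' x"
proof -
 have re: "(%x. Re (f x)) : leb_meas" and im: "(%x. Im (f x)) : leb_meas"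
  using f by measurable
 from completion_ex_borel_measurable_real[OF re]
 obtain g where g: "g : borel_measurable lborel" "AE x in lborel. Re (f x) = g x" by blast
 from completion_ex_borel_measurable_real[OF im]
 obtain h where h: "h : borel_measurable lborel" "AE x in lborel. Im (f x) = h x" by blast
 have "(%x. Complex (g x) (h x)) : borel_measurable borel"
  using g(1) h(1) unfolding Complex_eq by measurable
 moreover have "AE x in lborel. f x = Complex (g x) (h x)"
  using g(2) h(2) by eventually_elim (simp add: complex_eq_iff)
 ultimately show thesis by (rule that[OF _ AE_completion])
qed

context semi_inner
begin

lemma sqrt_sq_diff: "f : V ==> g : V ==> \<bar>sqrt (sq f) - sqrt (sq g)\<bar> <= sqrt (sq (f - g))"
 using triangle[of "f - g" g] triangle[of "g - f" f] sq_diff_commute[of f g] by (simp add: V_diff)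

lemma sq_tendsto:
 assumes h: "!!m. h m : V" and g: "g : V" and lim: "(%m. sq (h m - g)) ----> 0"
 shows "(%m. sq (h m)) ----> sq g"
proof -
 have \<open>(%m. sqrt (sq (h m - g))) ----> sqrt 0\<close> by (intro tendsto_intros lim)
 have "(%m. sqrt (sq (h m)) - sqrt (sq g)) ----> 0"
 proof (rule Lim_null_comparison[of _ "%m. sqrt (sq (h m - g))"])
  show "\<forall>\<^sub>F m in sequentially. norm (sqrt (sq (h m)) - sqrt (sq g)) <= sqrt (sq (h m - g))"
   using sqrt_sq_diff[OF h g] by simp
 next
  show "(%m. sqrt (sq (h m - g))) ----> 0" using \<open>(%m. sqrt (sq (h m - g))) ----> sqrt 0\<close> by simp
 qed
 then have "(%m. sqrt (sq (h m))) ----> sqrt (sq g)" by (rule LIM_zero_cancel)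
 then have "(%m. (sqrt (sq (h m)))\<^sup>2) ----> (sqrt (sq g))\<^sup>2" by (rule tendsto_power)
 then show ?thesis using sq_nonneg[OF h] sq_nonneg[OF g] by simp
qed

lemma sq_add_le: "f : V ==> g : V ==> sq (f + g) <= 2 * sq f + 2 * sq g"
proof -
 assume f: "f : V" and g: "g : V"
 have "0 <= sq (f - g)" using f g by (intro sq_nonneg V_diff)
 then show ?thesis using f g by (simp add: sq_add sq_diff)
qed

lemma sq_triangle_le: "f : V ==> g : V ==> h : V ==> sq (f - h) <= 2 * sq (f - g) + 2 * sq (g - h)"
 using sq_add_le[of "f - g" "g - h"] by (simp add: V_diff)

lemma limit_cauchy:
 assumes h: "!!m. h m : V" and g: "g : V" and lim: "(%m. sq (h m - g)) ----> 0" and e: "0 < e"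
 shows "\<exists>N. \<forall>m\<ge>N. \<forall>k\<ge>N. sq (h m - h k) < e"
proof -
 have "0 < e / 4" using e by simp
 from LIMSEQ_D[OF lim this] obtain N where N: "\<forall>m\<ge>N. norm (sq (h m - g) - 0) < e / 4" by blast
 have "sq (h m - h k) < e" if "m >= N" "k >= N" for m k
 proof -
  have "sq (h m - g) < e / 4" "sq (h k - g) < e / 4" using N that by auto
  then show ?thesis using sq_triangle_le[OF h g h, of m k] sq_diff_commute[OF h g, of k] by simp
 qed
 then show ?thesis by blast
qed

lemma polarization:
 assumes "f : V" "g : V"
 shows "ip f g = Complex ((sq (f + g) - sq f - sq g) / 2) ((sq (f + cscale \<i> g) - sq f - sq g) / 2)"
proof -
 have "sq (f + g) = sq f + 2 * Re (ip f g) + sq g" using assms by (rule sq_add)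
 moreover have "sq (f + cscale \<i> g) = sq f + 2 * Re (ip f (cscale \<i> g)) + sq (cscale \<i> g)"
  using assms by (intro sq_add V_scale)
 moreover have "Re (ip f (cscale \<i> g)) = Im (ip f g)" using assms by (simp add: scale_right)
 moreover have "sq (cscale \<i> g) = sq g" using assms by (simp add: sq_scale)
 ultimately show ?thesis by (simp add: complex_eq_iff)
qed

end

lemma fourier_AE_cong:
 fixes f :: "real^'k => complex"
 assumes f: "f : leb_meas" and ae: "AE x in lebesgue. f x = f' x"
 shows "fourier f = fourier f'"
proof (rule ext)
 fix x :: "real^'k"
 have f': "f' : leb_meas" by (rule borel_measurable_AE[OF f ae])
 have e: "(%y. expi y x) : leb_meas"
  by (rule measurable_completion) measurable
 show "fourier f x = fourier f' x"
  unfolding fourier_expi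
 proof (rule integral_cong_AE)
  show "AE y in lebesgue. f y * expi y x = f' y * expi y x" using ae by eventually_elim simp
 qed (use f f' e in measurable)
qed

lemma fourier_diff:
 fixes f g :: "real^'k => complex"
 assumes "integrable lebesgue f" "integrable lebesgue g"
 shows "fourier (f - g) = fourier f - fourier g"
  and "fourier (f + cscale c g) = fourier f + cscale c (fourier g)"
proof -
 have e: "(%y. expi y x) : leb_meas" for x :: "real^'k"
  by (rule measurable_completion) measurable
 have I: "integrable lebesgue (%y. F y * expi y x)" if "integrable lebesgue F" for F :: "real^'k => complex" and x
  by (rule Bochner_Integration.integrable_bound[OF that])
    (use that e[of x] in \<open>auto simp: norm_mult cmod_expi\<close>)
 show "fourier (f - g) = fourier f - fourier g"
  unfolding fourier_expi[abs_def] fun_diff_def using I[OF assms(1)] I[OF assms(2)] by (simp add: left_diff_distrib)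
 show "fourier (f + cscale c g) = fourier f + cscale c (fourier g)"
  unfolding fourier_expi[abs_def] plus_fun_def cscale_def using I[OF assms(1)] I[OF assms(2)]
  by (simp add: distrib_right mult.assoc)
qed

lemma plancherel_borel_bounded:
 fixes f :: "real^'k => complex"
 assumes f: "integrable lborel f" "f : borel_measurable borel" and C: "!!x. cmod (f x) <= C"
 shows "fourier f : L2" "L2.sq (fourier f) = L2.sq f"
proof -
 note [measurable] = f(2)
 have F [measurable]: "fourier f : borel_measurable borel" by (rule fourier_measurable) (rule f(2))
 have sqf: "L2.sq f = (LINT x|lborel. (cmod (f x))\<^sup>2)" unfolding L2_sq by (rule integral_completion) measurable
 have Fl: "fourier f : leb_meas" by (rule measurable_completion) simp
 have nn: "(\<integral>\<^sup>+x. ennreal ((cmod (fourier f x))\<^sup>2) \<partial>lebesgue) = ennreal (L2.sq f)"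
  unfolding sqf plancherel_bounded[OF f C, symmetric] by (rule nn_integral_completion)
 have s0: "0 <= L2.sq f" unfolding L2_sq by simp
 show L: "fourier f : L2" using L2I_nn(1)[OF Fl _ s0] nn by simp
 have "ennreal (L2.sq (fourier f)) = ennreal (L2.sq f)" unfolding L2_sq_nn[OF L] nn ..
 then show "L2.sq (fourier f) = L2.sq f" using s0 L2.sq_nonneg[OF L] by simp
qed

text \<open>Truncation at height \<open>m\<close> reduces this to bounded functions. As
  \<open>f\<close> is integrable, the transforms of the truncations converge pointwise to that of
  \<open>f\<close>, and Fatou's lemma shows that they also converge in norm.\<close>

lemma plancherel:
 fixes f :: "real^'k => complex"
 assumes f: "integrable lebesgue f" "f : L2"
 shows "fourier f : L2" "L2.sq (fourier f) = L2.sq f"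
proof -
 obtain f' where f' [measurable]: "f' : borel_measurable borel" and ae: "AE x in lebesgue. f x = f' x"
  using complex_borel_representative[OF L2D(1)[OF f(2)]] by blast
 have f'm: "f' : leb_meas" by (rule measurable_completion) simp
 have f'i: "integrable lebesgue f'" using f(1) integrable_cong_AE[OF L2D(1)[OF f(2)] f'm ae] by simp
 have f'I: "integrable lborel f'" using f'i integrable_completion[of f' lborel] by simp
 have f'L: "f' : L2" "L2.sq f' = L2.sq f" using L2_AE_cong[OF f(2) ae] by auto
 define h where "h = (%m x. if cmod (f' x) <= real m then f' x else 0)"
 have hb [measurable]: "h m : borel_measurable borel" for m unfolding h_def by measurable
 have hle: "cmod (h m x) <= cmod (f' x)" for m x unfolding h_def by auto
 have hI: "integrable lborel (h m)" for m
  by (rule Bochner_Integration.integrable_bound[OF f'I]) (use hle in auto)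
 have hi: "integrable lebesgue (h m)" for m using hI[of m] integrable_completion[of "h m" lborel] by simp
 have hlim: "(%m. h m x) ----> f' x" for x
 proof (rule tendsto_eventually)
  obtain N where "cmod (f' x) <= real N" using real_arch_simple by blast
  then show "\<forall>\<^sub>F m in sequentially. h m x = f' x"
   unfolding eventually_sequentially h_def by (intro exI[of _ N]) auto
 qed
 have hL: "h m : L2" for m
 proof -
  have "(%x. (if cmod (f' x) <= real m then 1 else 0) * f' x) : L2"
  proof (rule L2_bounded_mult[OF f'L(1)])
   show "(%x. if cmod (f' x) <= real m then 1 else 0) : leb_meas"
    using f'm by measurable
   show "AE x in lebesgue. cmod (if cmod (f' x) <= real m then 1 else 0) <= 1" by auto
  qed
  moreover have "h m = (%x. (if cmod (f' x) <= real m then 1 else 0) * f' x)" unfolding h_def by auto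
  ultimately show ?thesis by simp
 qed
 have hconv: "(%m. L2.sq (h m - f')) ----> 0"
  by (rule L2_dominated[OF hL f'L(1) f'L(1)]) (use hlim hle in auto)
 have db: "fourier (h m - h p) : L2" "L2.sq (fourier (h m - h p)) = L2.sq (h m - h p)" for m p
 proof -
  have *: "integrable lborel (h m - h p)" "h m - h p : borel_measurable borel"
   using hI[of m] hI[of p] unfolding fun_diff_def by auto
  have "cmod ((h m - h p) x) <= real m + real p" for x
  proof -
   have "cmod (h m x - h p x) <= cmod (h m x) + cmod (h p x)" by (rule norm_triangle_ineq4)
   also have "... <= real m + real p" unfolding h_def by (intro add_mono) auto
   finally show ?thesis by simp
  qed
  then show "fourier (h m - h p) : L2" "L2.sq (fourier (h m - h p)) = L2.sq (h m - h p)"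
   using plancherel_borel_bounded[OF *] by blast+
 qed
 have hF: "fourier (h m) : L2" "L2.sq (fourier (h m)) = L2.sq (h m)" for m
 proof -
  have "cmod (h m x) <= real m" for x unfolding h_def by auto
  then show "fourier (h m) : L2" "L2.sq (fourier (h m)) = L2.sq (h m)"
   using plancherel_borel_bounded[OF hI hb] by blast+
 qed
 have Fm [measurable]: "fourier f' : borel_measurable borel" "fourier (h m) : borel_measurable borel" for m
  by (rule fourier_measurable, simp)+
 have Fl: "fourier f' : leb_meas" "fourier (h m) : leb_meas" for m
  by (rule measurable_completion, simp)+
 have ptw: "(%p. fourier (h p) x) ----> fourier f' x" for x
  unfolding fourier_lborel[OF f'] fourier_lborel[OF hb]
 proof (rule integral_dominated_convergence)
  show "integrable lborel (%y. cmod (f' y))" using f'I by simp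
  show "AE y in lborel. (%p. h p y * expi y x) ----> f' y * expi y x"
   by (intro AE_I2 tendsto_intros hlim)
  show "AE y in lborel. norm (h p y * expi y x) <= cmod (f' y)" for p
   using hle by (auto simp: norm_mult cmod_expi)
 qed measurable
 have key: "(\<integral>\<^sup>+x. ennreal ((cmod (fourier (h m) x - fourier f' x))\<^sup>2) \<partial>lebesgue) <= ennreal (L2.sq (h m - f'))" for m
 proof -
  have "(\<integral>\<^sup>+x. ennreal ((cmod (fourier (h m) x - fourier f' x))\<^sup>2) \<partial>lebesgue) =
    (\<integral>\<^sup>+x. liminf (%p. ennreal ((cmod (fourier (h m) x - fourier (h p) x))\<^sup>2)) \<partial>lebesgue)"
  proof (rule nn_integral_cong)
   fix x
   have "(%p. ennreal ((cmod (fourier (h m) x - fourier (h p) x))\<^sup>2)) ----> ennreal ((cmod (fourier (h m) x - fourier f' x))\<^sup>2)"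
    by (intro tendsto_intros ptw tendsto_ennrealI)
   then show "ennreal ((cmod (fourier (h m) x - fourier f' x))\<^sup>2) = liminf (%p. ennreal ((cmod (fourier (h m) x - fourier (h p) x))\<^sup>2))"
    by (rule lim_imp_Liminf[OF trivial_limit_sequentially, symmetric])
  qed
  also have "... <= liminf (%p. \<integral>\<^sup>+x. ennreal ((cmod (fourier (h m) x - fourier (h p) x))\<^sup>2) \<partial>lebesgue)"
   by (rule nn_integral_liminf) (use Fl in measurable)
  also have "(%p. \<integral>\<^sup>+x. ennreal ((cmod (fourier (h m) x - fourier (h p) x))\<^sup>2) \<partial>lebesgue) = (%p. ennreal (L2.sq (h m - h p)))"
  proof
   fix p
   have "(\<integral>\<^sup>+x. ennreal ((cmod (fourier (h m - h p) x))\<^sup>2) \<partial>lebesgue) = ennreal (L2.sq (h m - h p))"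
    using L2_sq_nn[OF db(1), of m p] db(2)[of m p] by simp
   then show "(\<integral>\<^sup>+x. ennreal ((cmod (fourier (h m) x - fourier (h p) x))\<^sup>2) \<partial>lebesgue) = ennreal (L2.sq (h m - h p))"
    unfolding fourier_diff(1)[OF hi hi] by simp
  qed
  also have "liminf (%p. ennreal (L2.sq (h m - h p))) = ennreal (L2.sq (h m - f'))"
  proof (rule lim_imp_Liminf[OF trivial_limit_sequentially], rule tendsto_ennrealI, rule L2.sq_tendsto)
   have "(h m - h p) - (h m - f') = f' - h p" for p by simp
   then show "(%p. L2.sq (h m - h p - (h m - f'))) ----> 0"
    using hconv L2.sq_diff_commute[OF hL f'L(1)] by simp
  qed (intro L2.V_diff hL f'L)+
  finally show ?thesis .
 qed
 have dm: "(%x. fourier (h m) x - fourier f' x) : leb_meas" for m using Fl by measurable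
 have dL: "fourier (h m) - fourier f' : L2" "L2.sq (fourier (h m) - fourier f') <= L2.sq (h m - f')" for m
  using L2I_nn[OF dm key L2.sq_nonneg[OF L2.V_diff[OF hL f'L(1)]]] unfolding fun_diff_def by auto
 have FL: "fourier f' : L2"
 proof -
  have "fourier (h 0) - (fourier (h 0) - fourier f') : L2" by (intro L2.V_diff hF dL)
  then show ?thesis by simp
 qed
 have "(%m. L2.sq (fourier (h m) - fourier f')) ----> 0"
  by (rule tendsto_sandwich[OF _ _ tendsto_const hconv]) (simp_all add: dL L2.sq_nonneg)
 then have "(%m. L2.sq (fourier (h m))) ----> L2.sq (fourier f')" by (rule L2.sq_tendsto[OF hF(1) FL])
 moreover have "(%m. L2.sq (fourier (h m))) ----> L2.sq f'"
  unfolding hF(2) by (rule L2.sq_tendsto[OF hL f'L(1) hconv])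
 ultimately have "L2.sq (fourier f') = L2.sq f'" by (rule LIMSEQ_unique)
 then show "fourier f : L2" "L2.sq (fourier f) = L2.sq f"
  using FL f'L(2) fourier_AE_cong[OF L2D(1)[OF f(2)] ae] by auto
qed

text \<open>The relation from which \<open>L2_fourier\<close> chooses. Linearity, isometry and the
  effect of translations are proved for the relation and reach the chosen representatives through
  \<open>is_FT_unique\<close>, where equalities of functions hold almost everywhere only.\<close>

definition is_FT :: "(real^'k => complex) => (real^'k => complex) => bool" where
 "is_FT f g \<longleftrightarrow> g : L2 & (\<exists>h. (\<forall>m::nat. h m : L2 & integrable lebesgue (h m)) \<and>
   (%m. L2.sq (h m - f)) ----> 0 & (%m. L2.sq (fourier (h m) - g)) ----> 0)"

lemma L2_norm_tendsto_0: "(%m::nat. L2_norm (u m)) ----> 0 \<longleftrightarrow> (%m. L2.sq (u m)) ----> 0"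
proof
 assume "(%m. L2_norm (u m)) ----> 0"
 then have "(%m. (L2_norm (u m))\<^sup>2) ----> 0\<^sup>2" by (rule tendsto_power)
 then show "(%m. L2.sq (u m)) ----> 0" by (simp add: L2_norm_sq)
next
 assume "(%m. L2.sq (u m)) ----> 0"
 then have "(%m. sqrt (L2.sq (u m))) ----> sqrt 0" by (rule tendsto_real_sqrt)
 then show "(%m. L2_norm (u m)) ----> 0" by (simp add: L2_norm_eq)
qed

lemma L2_fourier_eq_SOME: "L2_fourier f = (SOME g. is_FT f g)"
 unfolding L2_fourier_def is_FT_def L2_norm_tendsto_0 ..

lemma is_FT_sq:
 assumes f: "f : L2" and g: "is_FT f g"
 shows "L2.sq g = L2.sq f"
proof -
 obtain h where h: "!!m::nat. h m : L2" "!!m. integrable lebesgue (h m)"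
  "(%m. L2.sq (h m - f)) ----> 0" "(%m. L2.sq (fourier (h m) - g)) ----> 0" and gL: "g : L2"
  using g unfolding is_FT_def by auto
 have "(%m. L2.sq (fourier (h m))) ----> L2.sq g"
  by (rule L2.sq_tendsto[OF plancherel(1)[OF h(2,1)] gL h(4)])
 moreover have "(%m. L2.sq (fourier (h m))) ----> L2.sq f"
  unfolding plancherel(2)[OF h(2,1)] by (rule L2.sq_tendsto[OF h(1) f h(3)])
 ultimately show ?thesis by (rule LIMSEQ_unique)
qed

lemma is_FT_lincomb:
 fixes f f' :: "real^'k => complex"
 assumes f: "f : L2" "f' : L2" and g: "is_FT f g" "is_FT f' g'"
 shows "is_FT (f + cscale c f') (g + cscale c g')"
proof -
 obtain h where h: "!!m::nat. h m : L2" "!!m. integrable lebesgue (h m)"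
  "(%m. L2.sq (h m - f)) ----> 0" "(%m. L2.sq (fourier (h m) - g)) ----> 0" and gL: "g : L2"
  using g(1) unfolding is_FT_def by auto
 obtain k where k: "!!m::nat. k m : L2" "!!m. integrable lebesgue (k m)"
  "(%m. L2.sq (k m - f')) ----> 0" "(%m. L2.sq (fourier (k m) - g')) ----> 0" and gL': "g' : L2"
  using g(2) unfolding is_FT_def by auto
 have comb: "(%m. L2.sq ((u m + cscale c (v m)) - (x + cscale c y))) ----> 0"
  if u: "!!m. u m : L2" "!!m. v m : L2" "x : L2" "y : L2"
   and l: "(%m::nat. L2.sq (u m - x)) ----> 0" "(%m. L2.sq (v m - y)) ----> 0"
  for u v :: "nat => real^'k => complex" and x y
 proof (rule tendsto_sandwich[OF _ _ tendsto_const])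
  have eq: "(u m + cscale c (v m)) - (x + cscale c y) = (u m - x) + cscale c (v m - y)" for m
   by (simp add: cscale_def fun_eq_iff algebra_simps)
  have L: "u m - x : L2" "v m - y : L2" for m using u by (auto intro: L2.V_diff)
  show "\<forall>\<^sub>F m in sequentially. L2.sq ((u m + cscale c (v m)) - (x + cscale c y)) <= 2 * L2.sq (u m - x) + 2 * ((cmod c)\<^sup>2 * L2.sq (v m - y))"
   unfolding eq using L2.sq_add_le[OF L(1) L2.V_scale[OF L(2)]] by (intro always_eventually allI) (simp add: L2.sq_scale[OF L(2)])
  show "\<forall>\<^sub>F m in sequentially. 0 <= L2.sq ((u m + cscale c (v m)) - (x + cscale c y))"
   unfolding eq using L by (intro always_eventually allI L2.sq_nonneg L2.V_add L2.V_scale)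
  have "(%m. 2 * L2.sq (u m - x) + 2 * ((cmod c)\<^sup>2 * L2.sq (v m - y))) ----> 2 * 0 + 2 * ((cmod c)\<^sup>2 * 0)"
   by (intro tendsto_intros l)
  then show "(%m. 2 * L2.sq (u m - x) + 2 * ((cmod c)\<^sup>2 * L2.sq (v m - y))) ----> 0" by simp
 qed
 have 1: "h m + cscale c (k m) : L2" for m by (intro L2.V_add L2.V_scale h k)
 have 2: "integrable lebesgue (h m + cscale c (k m))" for m
  unfolding plus_fun_def cscale_def using h(2)[of m] k(2)[of m] by simp
 have 3: "(%m. L2.sq ((h m + cscale c (k m)) - (f + cscale c f'))) ----> 0"
  by (rule comb[OF h(1) k(1) f h(3) k(3)])
 have 4: "(%m. L2.sq (fourier (h m + cscale c (k m)) - (g + cscale c g'))) ----> 0"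
  unfolding fourier_diff(2)[OF h(2) k(2)]
  by (rule comb[OF plancherel(1)[OF h(2,1)] plancherel(1)[OF k(2,1)] gL gL' h(4) k(4)])
 have 5: "g + cscale c g' : L2" by (intro L2.V_add L2.V_scale gL gL')
 show ?thesis unfolding is_FT_def using 1 2 3 4 5 by (intro conjI exI[of _ "%m. h m + cscale c (k m)"]) auto
qed

lemma is_FT_unique:
 fixes f :: "real^'k => complex"
 assumes f: "f : L2" and g: "is_FT f g" "is_FT f g'"
 shows "AE x in lebesgue. g x = g' x"
proof -
 have d: "is_FT (f + cscale (-1) f) (g + cscale (-1) g')" by (rule is_FT_lincomb[OF f f g])
 have gL: "g + cscale (-1) g' : L2" using d unfolding is_FT_def by simp
 have fL: "f + cscale (-1) f : L2" by (intro L2.V_add L2.V_scale f)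
 have "L2.sq (g + cscale (-1) g') = L2.sq (f + cscale (-1) f)" by (rule is_FT_sq[OF fL d])
 also have "f + cscale (-1) f = 0" by (simp add: cscale_def fun_eq_iff)
 also have "L2.sq (0 :: real^'k => complex) = 0" unfolding L2_sq by simp
 finally have "AE x in lebesgue. (g + cscale (-1) g') x = 0" by (rule iffD1[OF L2_sq_eq_0_iff[OF gL]])
 then show ?thesis by eventually_elim (simp add: cscale_def)
qed

text \<open>Cutting off to balls gives integrable approximations, whose transforms form a Cauchy
  sequence by Plancherel's identity.\<close>

lemma is_FT_exists:
 fixes f :: "real^'k => complex"
 assumes f: "f : L2"
 shows "\<exists>g. is_FT f g"
proof -
 define h where "h = (%m x. indicator (cball 0 (real m)) x * f x)"
 have ind: "(indicator (cball 0 (real m)) :: real^'k => complex) : L2" for m :: nat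
  unfolding L2_def mem_Collect_eq
 proof (intro conjI)
  show "(indicator (cball 0 (real m)) :: real^'k => complex) : leb_meas"
   by (rule borel_measurable_indicator) simp
  have "integrable lebesgue (%x. indicat_real (cball (0::real^'k) (real m)) x)"
   using lmeasurable_cball[of "0::real^'k" "real m"] by (intro integrable_real_indicator) (auto simp: fmeasurable_def)
  moreover have "(%x. (cmod (indicator (cball (0::real^'k) (real m)) x))\<^sup>2) = (%x. indicat_real (cball (0::real^'k) (real m)) x)"
   by (auto simp: indicator_def fun_eq_iff)
  ultimately show "integrable lebesgue (%x. (cmod (indicator (cball (0::real^'k) (real m)) x))\<^sup>2)"
   by (simp only:)
 qed
 have hL: "h m : L2" for m
  unfolding h_def
  by (rule L2_bounded_mult[OF f, of _ 1], rule borel_measurable_indicator) (simp_all add: indicator_def)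
 have hi: "integrable lebesgue (h m)" for m
 proof -
  have "h m = (%x. f x * cnj (indicator (cball 0 (real m)) x))"
   by (auto simp: h_def indicator_def fun_eq_iff)
  then show ?thesis using L2_mult_integrable[OF f ind[of m]] by (simp only:)
 qed
 have conv: "(%m. L2.sq (h m - f)) ----> 0"
 proof (rule L2_dominated[OF hL f f])
  show "AE x in lebesgue. (%m. h m x) ----> f x"
  proof (rule AE_I2)
   fix x :: "real^'k"
   obtain N where "norm x <= real N" using real_arch_simple by blast
   then show "(%m. h m x) ----> f x"
    by (intro tendsto_eventually) (auto simp: eventually_sequentially h_def indicator_def intro!: exI[of _ N])
  qed
 qed (auto simp: h_def indicator_def)
 have FL: "fourier (h m) : L2" for m by (rule plancherel(1)[OF hi hL])
 have cau: "\<exists>N. \<forall>m\<ge>N. \<forall>k\<ge>N. L2.sq (fourier (h m) - fourier (h k)) < e" if "e > 0" for e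
 proof -
  have "L2.sq (fourier (h m) - fourier (h k)) = L2.sq (h m - h k)" for m k
  proof -
   have "integrable lebesgue (h m - h k)" using hi unfolding fun_diff_def by simp
   then show ?thesis
    unfolding fourier_diff(1)[OF hi hi, symmetric] by (rule plancherel(2)[OF _ L2.V_diff[OF hL hL]])
  qed
  then show ?thesis using L2.limit_cauchy[OF hL f conv that] by simp
 qed
 obtain g where "g : L2" "(%m. L2.sq (fourier (h m) - g)) ----> 0"
  by (rule L2_complete[of "%m. fourier (h m)", OF FL cau])
 then show ?thesis unfolding is_FT_def using hL hi conv by blast
qed

lemma is_FT_L2_fourier: "f : L2 ==> is_FT f (L2_fourier f)"
 unfolding L2_fourier_eq_SOME using is_FT_exists by (rule someI_ex)

lemma L2_fourier_L2: "f : L2 ==> L2_fourier f : L2"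
 using is_FT_L2_fourier unfolding is_FT_def by blast

lemma L2_fourier_sq: "f : L2 ==> L2.sq (L2_fourier f) = L2.sq f"
 by (rule is_FT_sq[OF _ is_FT_L2_fourier])

lemma L2_fourier_lincomb:
 assumes "f : L2" "g : L2"
 shows "AE x in lebesgue. L2_fourier (f + cscale c g) x = (L2_fourier f + cscale c (L2_fourier g)) x"
 using assms by (intro is_FT_unique[OF _ is_FT_L2_fourier is_FT_lincomb] is_FT_L2_fourier L2.V_add L2.V_scale)

lemma L2_fourier_inner:
 assumes f: "f : L2" and g: "g : L2"
 shows "L2_inner (L2_fourier f) (L2_fourier g) = L2_inner f g"
proof -
 have "L2.sq (L2_fourier f + cscale c (L2_fourier g)) = L2.sq (f + cscale c g)" for c
 proof -
  have L: "f + cscale c g : L2" by (intro L2.V_add L2.V_scale f g)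
  have "L2.sq (L2_fourier f + cscale c (L2_fourier g)) = L2.sq (L2_fourier (f + cscale c g))"
   by (rule L2_AE_cong(2)[OF L2_fourier_L2[OF L] L2_fourier_lincomb[OF f g]])
  then show ?thesis using L2_fourier_sq[OF L] by simp
 qed
 from this[of 1] this[of \<i>] show ?thesis
  unfolding L2.polarization[OF f g] L2.polarization[OF L2_fourier_L2[OF f] L2_fourier_L2[OF g]]
  using L2_fourier_sq[OF f] L2_fourier_sq[OF g] by simp
qed

lemma lebesgue_translate:
 shows "(%x. x + t) : measurable lebesgue lebesgue" "distr lebesgue lebesgue (%x::real^'k. x + t) = lebesgue"
proof -
 have T: "(%x::real^'k. t + (\<Sum>j\<in>Basis. (1 * (x \<bullet> j)) *\<^sub>R j)) = (%x. x + t)"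
  by (simp add: euclidean_representation add.commute)
 show m: "(%x::real^'k. x + t) : measurable lebesgue lebesgue"
  using lebesgue_affine_measurable[of "%_. 1" t] unfolding T by simp
 show "distr lebesgue lebesgue (%x::real^'k. x + t) = lebesgue"
  using lebesgue_affine_euclidean[of "%_. 1" t] unfolding T by (simp add: density_1)
qed

lemma lebesgue_integral_translate:
 fixes f :: "real^'k => 'b::{banach, second_countable_topology}"
 assumes "f : leb_meas"
 shows "(LINT x|lebesgue. f (x + t)) = (LINT x|lebesgue. f x)"
  and "integrable lebesgue (%x. f (x + t)) \<longleftrightarrow> integrable lebesgue f"
 using integral_distr[OF lebesgue_translate(1) assms, of t] integrable_distr_eq[OF lebesgue_translate(1) assms, of t]
 unfolding lebesgue_translate(2) by auto

lemma AE_lebesgue_translate: "AE x in lebesgue. P x ==> AE x in lebesgue. P (x + t)"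
 for P :: "real^'k => bool"
 using AE_distrD[OF lebesgue_translate(1)[of t], of P] unfolding lebesgue_translate(2) .

lemma translate_L2:
 fixes f :: "real^'k => complex"
 assumes f: "f : L2"
 shows "translate y f : L2" "L2.sq (translate y f) = L2.sq f"
proof -
 have m: "(%x. f (x + - y)) : leb_meas"
  by (rule measurable_compose[OF lebesgue_translate(1) L2D(1)[OF f]])
 have m2: "(%x. (cmod (f x))\<^sup>2) : leb_meas" using L2D(1)[OF f] by measurable
 show "translate y f : L2" "L2.sq (translate y f) = L2.sq f"
  using m L2D(2)[OF f] lebesgue_integral_translate[OF m2, of "- y"]
  unfolding translate_def L2_def L2_sq by auto
qed

lemma fourier_translate: "f : leb_meas ==> fourier (translate y f) x = expi y x * fourier f x"
proof -
 assume f: "f : leb_meas"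
 have e: "(%z. expi (z + y) x) : leb_meas"
  by (rule measurable_completion) measurable
 have "fourier (translate y f) x = (LINT z|lebesgue. f (z + - y) * expi ((z + - y) + y) x)"
  unfolding fourier_expi translate_def by simp
 also have "... = (LINT z|lebesgue. f z * expi (z + y) x)"
  by (rule lebesgue_integral_translate(1)) (use f e in measurable)
 also have "... = (LINT z|lebesgue. expi y x * (f z * expi z x))" by (simp add: expi_add mult_ac)
 also have "... = expi y x * fourier f x" unfolding fourier_expi by (rule Bochner_Integration.integral_mult_right_zero)
 finally show ?thesis .
qed

lemma expi_mult_L2:
 fixes u :: "real^'k => complex"
 assumes u: "u : L2"
 shows "(%x. expi y x * u x) : L2" "L2.sq (%x. expi y x * u x) = L2.sq u"
proof -
 have e: "expi y : leb_meas" by (rule measurable_completion) measurable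
 show "(%x. expi y x * u x) : L2" by (rule L2_bounded_mult[OF u e, of 1]) (simp add: cmod_expi)
 show "L2.sq (%x. expi y x * u x) = L2.sq u" unfolding L2_sq by (simp add: norm_mult cmod_expi)
qed

lemma is_FT_translate:
 assumes f: "f : L2" and g: "is_FT f g"
 shows "is_FT (translate y f) (%x. expi y x * g x)"
proof -
 obtain h where h: "!!m::nat. h m : L2" "!!m. integrable lebesgue (h m)"
  "(%m. L2.sq (h m - f)) ----> 0" "(%m. L2.sq (fourier (h m) - g)) ----> 0" and gL: "g : L2"
  using g unfolding is_FT_def by auto
 have i: "integrable lebesgue (translate y (h m))" for m
  using lebesgue_integral_translate(2)[OF L2D(1)[OF h(1)], of m "- y"] h(2)[of m] unfolding translate_def by simp
 have "L2.sq (translate y (h m) - translate y f) = L2.sq (h m - f)" for m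
 proof -
  have "translate y (h m) - translate y f = translate y (h m - f)" by (simp add: translate_def fun_eq_iff)
  then show ?thesis using translate_L2(2)[OF L2.V_diff[OF h(1) f]] by simp
 qed
 moreover have "L2.sq (fourier (translate y (h m)) - (%x. expi y x * g x)) = L2.sq (fourier (h m) - g)" for m
 proof -
  have "fourier (translate y (h m)) - (%x. expi y x * g x) = (%x. expi y x * (fourier (h m) - g) x)"
   using fourier_translate[OF L2D(1)[OF h(1)]] by (simp add: fun_eq_iff right_diff_distrib)
  then show ?thesis using expi_mult_L2(2)[OF L2.V_diff[OF plancherel(1)[OF h(2,1)] gL]] by simp
 qed
 ultimately show ?thesis
  unfolding is_FT_def using expi_mult_L2(1)[OF gL] translate_L2(1)[OF h(1)] i h(3,4)
  by (intro conjI exI[of _ "%m. translate y (h m)"]) auto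
qed

lemma L2_fourier_translate: "f : L2 ==> AE x in lebesgue. L2_fourier (translate y f) x = expi y x * L2_fourier f x"
 by (intro is_FT_unique[OF _ is_FT_L2_fourier is_FT_translate] is_FT_L2_fourier translate_L2)

section \<open>Fiberization\<close>

lemma lattice_vec_add: "lattice_vec (a + b) = lattice_vec a + lattice_vec b"
 and lattice_vec_minus: "lattice_vec (- a) = - lattice_vec a"
 and lattice_vec_0: "lattice_vec 0 = 0"
 unfolding lattice_vec_def by (simp_all add: vec_eq_iff)

lemma expi_lattice: "expi (lattice_vec l) (lattice_vec k) = 1"
proof -
 have "lattice_vec l \<bullet> lattice_vec k = of_int (\<Sum>i\<in>UNIV. l $ i * k $ i)"
  unfolding lattice_vec_def inner_vec_def by simp
 then obtain n :: int where n: "lattice_vec l \<bullet> lattice_vec k = of_int n" by blast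
 have "- 2 * of_real pi * \<i> * of_real (lattice_vec l \<bullet> lattice_vec k) = 2 * of_real pi * \<i> * of_int (- n)"
  unfolding n by simp
 then show ?thesis unfolding expi_def using exp_integer_2pi[of "of_int (- n)"] by (simp add: mult_ac)
qed

definition periodic :: "(real^'k => 'b) => bool" where
 "periodic m \<longleftrightarrow> (\<forall>x l. m (x + lattice_vec l) = m x)"

lemma periodicD: "periodic m ==> m (x + lattice_vec l) = m x" unfolding periodic_def by simp

lemma expi_lattice_periodic: "periodic (expi (lattice_vec l))"
 unfolding periodic_def by (simp add: expi_commute[of "lattice_vec l"] expi_add) (simp add: expi_commute expi_lattice)

text \<open>The minus sign makes this the lattice vector to be added, not subtracted, in order to
  bring \<open>x\<close> into the torus.\<close>

definition floor_vec :: "real^'k => int^'k" where "floor_vec x = (\<chi> i. - \<lfloor>x $ i + 1/2\<rfloor>)"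

lemma floor_vec_torus: "x + lattice_vec (floor_vec x) : torus"
 unfolding torus_def floor_vec_def lattice_vec_def by (auto simp: algebra_simps) linarith+

lemma torus_unique: "x + lattice_vec a : torus ==> x + lattice_vec b : torus ==> a = b"
proof -
 assume a: "x + lattice_vec a : torus" and b: "x + lattice_vec b : torus"
 have "a $ i = b $ i" for i
 proof -
  have "-1/2 <= x $ i + of_int (a $ i)" "x $ i + of_int (a $ i) < 1/2"
   "-1/2 <= x $ i + of_int (b $ i)" "x $ i + of_int (b $ i) < 1/2"
   using a b unfolding torus_def lattice_vec_def by auto
  then have "of_int (a $ i) - of_int (b $ i) < (1::real)" "of_int (b $ i) - of_int (a $ i) < (1::real)" by linarith+
  then show ?thesis by linarith
 qed
 then show ?thesis by (simp add: vec_eq_iff)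
qed

lemma torus_borel [measurable]: "torus : sets borel"
proof -
 have eq: "torus = (\<Inter>i. {x::real^'k. -1/2 <= x $ i} \<inter> {x. x $ i < 1/2})" unfolding torus_def by auto
 have c: "{x::real^'k. -1/2 <= x $ i} : sets borel" for i
  by (rule borel_closed, rule closed_Collect_le) (intro continuous_intros)+
 have o: "{x::real^'k. x $ i < 1/2} : sets borel" for i
  by (rule borel_open, rule open_Collect_less) (intro continuous_intros)+
 show ?thesis unfolding eq by (intro sets.finite_INT sets.Int c o finite UNIV_not_empty)
qed

lemma torus_lebesgue: "(torus :: (real^'k) set) : sets lebesgue" and torus_lmeasurable: "(torus :: (real^'k) set) : lmeasurable"
proof -
 show 1: "(torus :: (real^'k) set) : sets lebesgue" using torus_borel by auto
 have "bounded (torus :: (real^'k) set)"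
 proof (rule bounded_subset[OF bounded_cbox])
  show "torus <= cbox (\<chi> i. (-1/2::real)) (\<chi> i. (1/2::real))"
   unfolding torus_def by (auto simp: mem_box_cart) (blast intro: less_imp_le)
 qed
 then show "(torus :: (real^'k) set) : lmeasurable"
  using 1 bounded_set_imp_lmeasurable by blast
qed

lemma infinite_int_vec: "infinite (UNIV :: (int^'k) set)"
proof
 assume fin: "finite (UNIV :: (int^'k) set)"
 have "finite (range (%n::int. (\<chi> i. n) :: int^'k))" by (rule finite_subset[OF subset_UNIV fin])
 moreover have "inj (%n::int. (\<chi> i. n) :: int^'k)" by (auto simp: inj_on_def vec_eq_iff)
 ultimately have "finite (UNIV :: int set)" by (rule finite_imageD)
 then show False using infinite_UNIV_int by simp
qed

text \<open>An enumeration of the lattice, which turns unordered lattice sums into series over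
  \<open>nat\<close>, the form in which sums and integrals are interchanged.\<close>

definition bl :: "nat => int^'k" where "bl = from_nat_into UNIV"

lemma bij_bl: "bij bl"
 unfolding bl_def using bij_betw_from_nat_into[OF _ infinite_int_vec] by auto

lemma AE_all_lattice: "(!!l. AE x in lebesgue. P l x) ==> AE x in lebesgue. \<forall>l :: int^'k. P l x"
 by (subst AE_all_countable) auto

lemma AE_lattice: "AE x in lebesgue. P x ==> AE x in lebesgue. \<forall>l. P (x + lattice_vec l)"
 by (intro AE_all_lattice AE_lebesgue_translate)

text \<open>Almost every point has all its lattice translates outside the exceptional null set,
  among them its representative in the torus.\<close>

lemma AE_periodic:
 assumes "AE x in lebesgue. x : torus --> P x" and per: "periodic P"
 shows "AE x in lebesgue. P x"
 using AE_lattice[OF assms(1)]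
proof eventually_elim
 case (elim x)
 then have "P (x + lattice_vec (floor_vec x))" using floor_vec_torus by blast
 then show ?case using periodicD[OF per] by simp
qed

text \<open>The lattice translates of the torus tile the space: at each point exactly one term of
  the sum in \<open>one\<close> survives. Each tile is then translated back to the torus.\<close>

lemma nn_periodization:
 fixes F :: "real^'k => ennreal"
 assumes F: "F : leb_meas"
 shows "(\<integral>\<^sup>+x. F x \<partial>lebesgue) = (\<integral>\<^sup>+x. indicator torus x * (\<Sum>n. F (x + lattice_vec (bl n))) \<partial>lebesgue)"
proof -
 have shift: "(%x. F (x + t)) : leb_meas" for t
  by (rule measurable_compose[OF lebesgue_translate(1) F])
 have indm: "(%x. indicator torus (x + t) :: ennreal) : leb_meas" for t :: "real^'k"
  by (rule measurable_compose[OF lebesgue_translate(1)]) (use torus_lebesgue in measurable)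
 have one: "(\<Sum>n. indicator torus (x + - lattice_vec (bl n)) * F x) = F x" for x
 proof -
  obtain n0 where n0: "bl n0 = - floor_vec x" using bij_bl by (metis bij_pointE)
  have ind: "indicator torus (x + - lattice_vec (bl n)) = (if n = n0 then 1 else 0 :: ennreal)" for n
  proof -
   have "x + lattice_vec (- bl n) : torus \<longleftrightarrow> - bl n = floor_vec x"
    by (auto dest: torus_unique[OF _ floor_vec_torus] simp: floor_vec_torus)
   also have "... \<longleftrightarrow> bl n = (bl n0 :: int^'k)" unfolding n0 minus_equation_iff[of "bl n"] by auto
   also have "... \<longleftrightarrow> n = n0" using bij_is_inj[OF bij_bl] by (rule inj_eq)
   finally show ?thesis by (simp add: indicator_def lattice_vec_minus)
  qed
  have "(\<Sum>n. indicator torus (x + - lattice_vec (bl n)) * F x) = (\<Sum>n\<in>{n0}. indicator torus (x + - lattice_vec (bl n)) * F x)"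
   by (rule suminf_finite) (auto simp: ind simp del: add_uminus_conv_diff)
  then show ?thesis by (simp add: ind del: add_uminus_conv_diff)
 qed
 have "(\<integral>\<^sup>+x. F x \<partial>lebesgue) = (\<integral>\<^sup>+x. (\<Sum>n. indicator torus (x + - lattice_vec (bl n)) * F x) \<partial>lebesgue)"
  by (simp only: one)
 also have "... = (\<Sum>n. \<integral>\<^sup>+x. indicator torus (x + - lattice_vec (bl n)) * F x \<partial>lebesgue)"
  by (rule nn_integral_suminf) (intro borel_measurable_times_ennreal indm F)
 also have "... = (\<Sum>n. \<integral>\<^sup>+x. indicator torus x * F (x + lattice_vec (bl n)) \<partial>lebesgue)"
 proof (rule suminf_cong)
  fix n
  let ?t = "lattice_vec (bl n) :: real^'k"
  have m: "(%x. indicator torus (x + - ?t) * F x) : leb_meas"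
   by (intro borel_measurable_times_ennreal indm F)
  have "(\<integral>\<^sup>+x. indicator torus (x + - ?t) * F x \<partial>lebesgue) = (\<integral>\<^sup>+x. indicator torus (x + - ?t) * F x \<partial>distr lebesgue lebesgue (%x. x + ?t))"
   by (simp only: lebesgue_translate(2))
  also have "... = (\<integral>\<^sup>+x. indicator torus ((x + ?t) + - ?t) * F (x + ?t) \<partial>lebesgue)"
   by (rule nn_integral_distr[OF lebesgue_translate(1)]) (use m in \<open>simp only: lebesgue_translate(2)\<close>)
  finally show "(\<integral>\<^sup>+x. indicator torus (x + - ?t) * F x \<partial>lebesgue) = (\<integral>\<^sup>+x. indicator torus x * F (x + ?t) \<partial>lebesgue)" by simp
 qed
 also have "... = (\<integral>\<^sup>+x. (\<Sum>n. indicator torus x * F (x + lattice_vec (bl n))) \<partial>lebesgue)"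
  by (rule nn_integral_suminf[symmetric])
    (intro borel_measurable_times_ennreal shift borel_measurable_indicator torus_lebesgue)
 also have "... = (\<integral>\<^sup>+x. indicator torus x * (\<Sum>n. F (x + lattice_vec (bl n))) \<partial>lebesgue)"
  by (simp only: ennreal_suminf_cmult)
 finally show ?thesis .
qed

text \<open>The fiber of a function that already lives on the Fourier side. Separating it from
  \<open>L2_fourier\<close> makes sums and periodic multiples pass to fibers exactly, not just
  almost everywhere.\<close>

definition fib :: "(real^'k => complex) => real^'k => int^'k => complex" where
 "fib g x = (%l. g (x + lattice_vec l))"

lemma Gam_fib: "Gam f x = fib (L2_fourier f) x" unfolding Gam_def fib_def ..

lemma fib_shift: "fib g (x + lattice_vec k) l = fib g x (k + l)"
 unfolding fib_def by (simp add: lattice_vec_add add.assoc)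

lemma fib_add: "fib (f + g) x = fib f x + fib g x" and fib_cscale: "fib (cscale c f) x = cscale c (fib f x)"
 and fib_diff: "fib (f - g) x = fib f x - fib g x" and fib_sum: "fib (\<Sum>i\<in>I. F i) x = (\<Sum>i\<in>I. fib (F i) x)"
 unfolding fib_def cscale_def by (auto simp: fun_eq_iff sum_fun_apply)

lemma fib_mult: "periodic m ==> fib (%x. m x * g x) x = cscale (m x) (fib g x)"
 unfolding fib_def cscale_def by (simp add: periodicD)

lemma fib_AE_cong: "AE x in lebesgue. f x = g x ==> AE x in lebesgue. fib f x = fib g x"
 unfolding fib_def fun_eq_iff by (rule AE_lattice)

lemma bij_plus: "bij_betw ((+) (k :: int^'k)) UNIV UNIV"
 by (rule bij_betwI[where g="(+) (- k)"]) auto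

lemma fib_ell2_periodic: "periodic (%x. fib g x : ell2)"
 unfolding periodic_def
proof (intro allI)
 fix x and k :: "int^'a"
 have "(%l. (cmod (fib g x (k + l)))\<^sup>2) summable_on UNIV \<longleftrightarrow> (%l. (cmod (fib g x l))\<^sup>2) summable_on UNIV"
  by (rule summable_on_reindex_bij_betw[OF bij_plus, of "%l. (cmod (fib g x l))\<^sup>2" k])
 then show "(fib g (x + lattice_vec k) : ell2) = (fib g x : ell2)" unfolding ell2_def by (simp add: fib_shift)
qed

text \<open>The bracket product of the theory of shift invariant spaces. It is periodic at every
  point, because a lattice shift of \<open>x\<close> only permutes the coordinates of the
  fibers.\<close>

definition br :: "(real^'k => complex) => (real^'k => complex) => real^'k => complex" where
 "br f g x = ell2_inner (fib f x) (fib g x)"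

lemma br_periodic: "periodic (br f g)"
 unfolding periodic_def br_def ell2_inner_def fib_shift
 by (intro allI infsum_reindex_bij_betw[OF bij_plus])

definition fsq :: "(real^'k => complex) => real^'k => real" where
 "fsq g x = ell2.sq (fib g x)"

lemma fsq_br: "fsq g x = Re (br g g x)" unfolding fsq_def br_def ell2.sq_def ..

lemma fsq_periodic: "periodic (fsq g)"
 using br_periodic[of g g] unfolding periodic_def fsq_br by simp

lemma fib_ell2_nat: "fib g x : ell2 \<longleftrightarrow> summable (%n. (cmod (g (x + lattice_vec (bl n))))\<^sup>2)"
  and fsq_nat: "fib g x : ell2 ==> fsq g x = (\<Sum>n. (cmod (g (x + lattice_vec (bl n))))\<^sup>2)"
proof -
 have re: "(%l. (cmod (fib g x l))\<^sup>2) summable_on UNIV \<longleftrightarrow> (%n. (cmod (fib g x (bl n)))\<^sup>2) summable_on UNIV"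
  by (rule summable_on_reindex_bij_betw[OF bij_bl, symmetric])
 also have "... \<longleftrightarrow> summable (%n. (cmod (fib g x (bl n)))\<^sup>2)"
  by (rule summable_on_UNIV_nonneg_real_iff) simp
 finally show 1: "fib g x : ell2 \<longleftrightarrow> summable (%n. (cmod (g (x + lattice_vec (bl n))))\<^sup>2)"
  unfolding ell2_def fib_def by simp
 show "fsq g x = (\<Sum>n. (cmod (g (x + lattice_vec (bl n))))\<^sup>2)" if g: "fib g x : ell2"
 proof -
  have "fsq g x = (\<Sum>\<^sub>\<infinity>n. (cmod (fib g x (bl n)))\<^sup>2)"
   unfolding fsq_def ell2_sq[OF g] by (rule infsum_reindex_bij_betw[OF bij_bl, symmetric])
  also have "... = (\<Sum>n. (cmod (fib g x (bl n)))\<^sup>2)"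
  proof (rule infsumI)
   have "((%n. (cmod (fib g x (bl n)))\<^sup>2) has_sum (\<Sum>\<^sub>\<infinity>n. (cmod (fib g x (bl n)))\<^sup>2)) UNIV"
    using g re unfolding ell2_def by (intro has_sum_infsum) simp
   moreover from this have "(%n. (cmod (fib g x (bl n)))\<^sup>2) sums (\<Sum>\<^sub>\<infinity>n. (cmod (fib g x (bl n)))\<^sup>2)"
    by (rule has_sum_imp_sums)
   ultimately show "((%n. (cmod (fib g x (bl n)))\<^sup>2) has_sum (\<Sum>n. (cmod (fib g x (bl n)))\<^sup>2)) UNIV"
    by (simp add: sums_iff)
  qed
  finally show ?thesis unfolding fib_def .
 qed
qed

lemma ennreal_fsq: "fib g x : ell2 ==> ennreal (fsq g x) = (\<Sum>n. ennreal ((cmod (g (x + lattice_vec (bl n))))\<^sup>2))"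
proof -
 assume f: "fib g x : ell2"
 show ?thesis
  unfolding fsq_nat[OF f] by (rule suminf_ennreal2[symmetric]) (use f in \<open>simp_all add: fib_ell2_nat\<close>)
qed

lemma L2_fib_ell2:
 fixes g :: "real^'k => complex"
 assumes g: "g : L2"
 shows "AE x in lebesgue. fib g x : ell2"
proof (rule AE_periodic[OF _ fib_ell2_periodic])
 have m: "(%x. ennreal ((cmod (g x))\<^sup>2)) : leb_meas" using L2D(1)[OF g] by measurable
 have ms: "(%x. ennreal ((cmod (g (x + t)))\<^sup>2)) : leb_meas" for t
  by (rule measurable_compose[OF lebesgue_translate(1) m])
 have "(\<integral>\<^sup>+x. indicator torus x * (\<Sum>n. ennreal ((cmod (g (x + lattice_vec (bl n))))\<^sup>2)) \<partial>lebesgue) ~= \<infinity>"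
  unfolding nn_periodization[OF m, symmetric] L2_sq_nn[OF g, symmetric] by simp
 then have "AE x in lebesgue. indicator torus x * (\<Sum>n. ennreal ((cmod (g (x + lattice_vec (bl n))))\<^sup>2)) ~= \<infinity>"
  by (intro nn_integral_noteq_infinite borel_measurable_times_ennreal borel_measurable_suminf_order ms
     borel_measurable_indicator torus_lebesgue)
 then show "AE x in lebesgue. x : torus --> fib g x : ell2"
 proof eventually_elim
  case (elim x)
  then show ?case unfolding fib_ell2_nat by (auto intro: summable_suminf_not_top)
 qed
qed

lemma fsq_measurable:
 assumes g: "g : L2"
 shows "fsq g : leb_meas"
proof (rule borel_measurable_AE)
 have m: "(%x. (cmod (g x))\<^sup>2) : leb_meas" using L2D(1)[OF g] by measurable
 show "(%x. \<Sum>n. (cmod (g (x + lattice_vec (bl n))))\<^sup>2) : leb_meas"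
  by (intro borel_measurable_suminf measurable_compose[OF lebesgue_translate(1) m])
 show "AE x in lebesgue. (\<Sum>n. (cmod (g (x + lattice_vec (bl n))))\<^sup>2) = fsq g x"
  using L2_fib_ell2[OF g] by eventually_elim (simp add: fsq_nat)
qed

lemma L2_sq_nn_fsq:
 assumes g: "g : L2"
 shows "ennreal (L2.sq g) = (\<integral>\<^sup>+x. ennreal (indicator torus x * fsq g x) \<partial>lebesgue)"
proof -
 have m: "(%x. ennreal ((cmod (g x))\<^sup>2)) : leb_meas" using L2D(1)[OF g] by measurable
 have "ennreal (L2.sq g) = (\<integral>\<^sup>+x. indicator torus x * (\<Sum>n. ennreal ((cmod (g (x + lattice_vec (bl n))))\<^sup>2)) \<partial>lebesgue)"
  unfolding L2_sq_nn[OF g] by (rule nn_periodization[OF m])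
 also have "... = (\<integral>\<^sup>+x. ennreal (indicator torus x * fsq g x) \<partial>lebesgue)"
 proof (rule nn_integral_cong_AE)
  show "AE x in lebesgue. indicator torus x * (\<Sum>n. ennreal ((cmod (g (x + lattice_vec (bl n))))\<^sup>2)) = ennreal (indicator torus x * fsq g x)"
   using L2_fib_ell2[OF g]
  proof eventually_elim
   case (elim x)
   show ?case unfolding ennreal_fsq[OF elim, symmetric] by (simp add: indicator_def)
  qed
 qed
 finally show ?thesis .
qed

lemma fsq_nonneg_AE: "g : L2 ==> AE x in lebesgue. 0 <= fsq g x"
 using L2_fib_ell2[of g] by (auto simp: fsq_def intro: ell2.sq_nonneg)

lemma fsq_integral:
 assumes g: "g : L2"
 shows "integrable lebesgue (%x. indicator torus x * fsq g x)" "L2.sq g = (LINT x|lebesgue. indicator torus x * fsq g x)"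
proof -
 have m: "(%x. indicator torus x * fsq g x) : leb_meas"
  by (intro borel_measurable_times fsq_measurable[OF g] borel_measurable_indicator torus_lebesgue)
 have nn: "AE x in lebesgue. 0 <= indicator torus x * fsq g x"
  using fsq_nonneg_AE[OF g] by eventually_elim simp
 have "(\<integral>\<^sup>+x. ennreal (indicator torus x * fsq g x) \<partial>lebesgue) < \<infinity>" unfolding L2_sq_nn_fsq[OF g, symmetric] by simp
 then show i: "integrable lebesgue (%x. indicator torus x * fsq g x)"
  by (intro integrableI_nonneg m nn)
 have "ennreal (L2.sq g) = ennreal (LINT x|lebesgue. indicator torus x * fsq g x)"
  unfolding L2_sq_nn_fsq[OF g] by (rule nn_integral_eq_integral[OF i nn])
 moreover have "0 <= (LINT x|lebesgue. indicator torus x * fsq g x)" by (rule integral_nonneg_AE[OF nn])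
 ultimately show "L2.sq g = (LINT x|lebesgue. indicator torus x * fsq g x)"
  using L2.sq_nonneg[OF g] by simp
qed

lemma L2I_fsq:
 assumes m: "g : leb_meas" and e: "AE x in lebesgue. x : torus --> fib g x : ell2 & fsq g x <= fsq h x" and h: "h : L2"
 shows "g : L2" "L2.sq g <= L2.sq h"
proof -
 have m': "(%x. ennreal ((cmod (g x))\<^sup>2)) : leb_meas" using m by measurable
 have "(\<integral>\<^sup>+x. ennreal ((cmod (g x))\<^sup>2) \<partial>lebesgue) = (\<integral>\<^sup>+x. indicator torus x * (\<Sum>n. ennreal ((cmod (g (x + lattice_vec (bl n))))\<^sup>2)) \<partial>lebesgue)"
  by (rule nn_periodization[OF m'])
 also have "... <= (\<integral>\<^sup>+x. ennreal (indicator torus x * fsq h x) \<partial>lebesgue)"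
 proof (rule nn_integral_mono_AE)
  show "AE x in lebesgue. indicator torus x * (\<Sum>n. ennreal ((cmod (g (x + lattice_vec (bl n))))\<^sup>2)) <= ennreal (indicator torus x * fsq h x)"
   using e
  proof eventually_elim
   case (elim x)
   show ?case
   proof (cases "x : torus")
    case True
    then have f: "fib g x : ell2" "fsq g x <= fsq h x" using elim by auto
    show ?thesis unfolding ennreal_fsq[OF f(1), symmetric] using True f(2) by (simp add: ennreal_leI)
   qed simp
  qed
 qed
 also have "... = ennreal (L2.sq h)" by (rule L2_sq_nn_fsq[OF h, symmetric])
 finally show "g : L2" "L2.sq g <= L2.sq h" using L2I_nn[OF m _ L2.sq_nonneg[OF h]] by auto
qed

lemma br_polarization:
 assumes f: "f : L2" and g: "g : L2"
 shows "AE x in lebesgue. br f g x = Complex ((fsq (f + g) x - fsq f x - fsq g x) / 2) ((fsq (f + cscale \<i> g) x - fsq f x - fsq g x) / 2)"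
 using L2_fib_ell2[OF f] L2_fib_ell2[OF g]
 by eventually_elim (simp add: br_def fsq_def ell2.polarization fib_add fib_cscale)

lemma br_measurable:
 assumes f: "f : L2" and g: "g : L2"
 shows "br f g : leb_meas"
proof (rule borel_measurable_AE)
 have m: "fsq f : leb_meas" "fsq g : leb_meas"
  "fsq (f + g) : leb_meas" "fsq (f + cscale \<i> g) : leb_meas"
  by (intro fsq_measurable L2.V_add L2.V_scale f g)+
 show "(%x. Complex ((fsq (f + g) x - fsq f x - fsq g x) / 2) ((fsq (f + cscale \<i> g) x - fsq f x - fsq g x) / 2)) : leb_meas"
  unfolding Complex_eq using m by measurable
 show "AE x in lebesgue. Complex ((fsq (f + g) x - fsq f x - fsq g x) / 2) ((fsq (f + cscale \<i> g) x - fsq f x - fsq g x) / 2) = br f g x"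
  using br_polarization[OF f g] by eventually_elim simp
qed

text \<open>The isometry of fiberization, known for \<open>fsq\<close>, is polarized:
  \<open>P 1\<close> and \<open>P \<i>\<close> are the real and imaginary parts of the bracket cut
  off to the torus.\<close>

lemma br_integral:
 assumes f: "f : L2" and g: "g : L2"
 shows "integrable lebesgue (%x. indicator torus x * br f g x)"
  and "L2_inner f g = (LINT x|lebesgue. indicator torus x * br f g x)"
proof -
 define P where "P = (%c x. indicator torus x * ((fsq (f + cscale c g) x - fsq f x - fsq g x) / 2))"
 have fg: "f + cscale c g : L2" for c by (intro L2.V_add L2.V_scale f g)
 have Pe: "P c x = (indicator torus x * fsq (f + cscale c g) x - indicator torus x * fsq f x - indicator torus x * fsq g x) / 2" for c x
  unfolding P_def by (simp add: algebra_simps diff_divide_distrib)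
 have Pi: "integrable lebesgue (P c)" for c
  unfolding Pe[abs_def] by (intro integrable_divide_zero Bochner_Integration.integrable_diff fsq_integral fg f g)
 have PI: "(LINT x|lebesgue. P c x) = (L2.sq (f + cscale c g) - L2.sq f - L2.sq g) / 2" for c
  unfolding Pe using fsq_integral[OF fg, of c] fsq_integral[OF f] fsq_integral[OF g] by simp
 have ae: "AE x in lebesgue. indicator torus x * br f g x = of_real (P 1 x) + \<i> * of_real (P \<i> x)"
  using br_polarization[OF f g]
 proof eventually_elim
  case (elim x)
  have "cscale 1 g = g" by simp
  then show ?case unfolding elim P_def by (auto simp: Complex_eq indicator_def)
 qed
 have m: "(%x. indicator torus x * br f g x) : leb_meas"
  by (intro borel_measurable_times br_measurable[OF f g] borel_measurable_indicator torus_lebesgue)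
 have i2: "integrable lebesgue (%x. of_real (P 1 x) + \<i> * complex_of_real (P \<i> x))" using Pi by simp
 then have m2: "(%x. of_real (P 1 x) + \<i> * complex_of_real (P \<i> x)) : leb_meas" by auto
 show "integrable lebesgue (%x. indicator torus x * br f g x)"
  using integrable_cong_AE[OF m m2 ae] i2 by simp
 have "(LINT x|lebesgue. indicator torus x * br f g x) = (LINT x|lebesgue. of_real (P 1 x) + \<i> * complex_of_real (P \<i> x))"
  by (rule integral_cong_AE[OF m m2 ae])
 also have "... = of_real (LINT x|lebesgue. P 1 x) + \<i> * of_real (LINT x|lebesgue. P \<i> x)"
  using Pi by (simp add: integral_complex_of_real)
 also have "... = L2_inner f g"
  unfolding PI L2.polarization[OF f g] Complex_eq by simp
 finally show "L2_inner f g = (LINT x|lebesgue. indicator torus x * br f g x)" ..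
qed

section \<open>Multiplication by periodic functions\<close>

text \<open>What a closed shift invariant space becomes on the Fourier side: translations turn into
  multiplications by characters. Closedness is stated for sequences.\<close>

definition char_module :: "(real^'k => complex) set => bool" where
 "char_module V \<longleftrightarrow> cfun.subspace V & V <= L2 \<and>
   (\<forall>h g. (\<forall>m::nat. h m : V) --> g : L2 --> (%m. L2.sq (h m - g)) ----> 0 --> g : V) \<and>
   (\<forall>l. \<forall>g\<in>V. (%x. expi (lattice_vec l) x * g x) : V)"

lemma char_moduleD:
 assumes "char_module V"
 shows "cfun.subspace V" "g : V ==> g : L2"
  and "(!!m::nat. h m : V) ==> g : L2 ==> (%m. L2.sq (h m - g)) ----> 0 ==> g : V"
  and "g : V ==> (%x. expi (lattice_vec l) x * g x) : V"
 using assms unfolding char_module_def by blast+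

lemma char_module_AE:
 assumes V: "char_module V" and g: "g : V" and ae: "AE x in lebesgue. g x = g' x"
 shows "g' : V"
proof (rule char_moduleD(3)[OF V, of "%_. g"])
 have gL: "g : L2" by (rule char_moduleD(2)[OF V g])
 show g'L: "g' : L2" by (rule L2_AE_cong(1)[OF gL ae])
 have "AE x in lebesgue. (g - g') x = 0" using ae by eventually_elim simp
 then have "L2.sq (g - g') = 0" using L2_sq_eq_0_iff[OF L2.V_diff[OF gL g'L]] by blast
 then show "(%m::nat. L2.sq (g - g')) ----> 0" by simp
qed (rule g)

context
 fixes V :: "(real^'k => complex) set"
 assumes V: "char_module V"
begin

text \<open>The multipliers of \<open>V\<close>, without any condition of measurability or size. The
  set is enlarged stepwise from constants and characters; being closed under sums and products, it
  contains all trigonometric polynomials.\<close>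

definition Mu :: "(real^'k => complex) set" where
 "Mu = {m. \<forall>g\<in>V. (%x. m x * g x) : V}"

lemma MuD: "m : Mu ==> g : V ==> (%x. m x * g x) : V" unfolding Mu_def by auto
lemma MuI: "(!!g. g : V ==> (%x. m x * g x) : V) ==> m : Mu" unfolding Mu_def by auto

lemma Mu_const: "(%_. c) : Mu"
 using cfun.subspace_scale[OF char_moduleD(1)[OF V], of _ c] by (intro MuI) (simp add: cscale_def)

lemma Mu_mult: "a : Mu ==> b : Mu ==> (%x. a x * b x) : Mu"
proof (rule MuI)
 fix g assume "a : Mu" "b : Mu" "g : V"
 then have "(%x. a x * (b x * g x)) : V" by (intro MuD)
 then show "(%x. a x * b x * g x) : V" by (simp add: mult.assoc)
qed

lemma Mu_add: "a : Mu ==> b : Mu ==> (%x. a x + b x) : Mu"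
proof (rule MuI)
 fix g assume "a : Mu" "b : Mu" "g : V"
 then have "(%x. a x * g x) + (%x. b x * g x) : V"
  by (intro cfun.subspace_add[OF char_moduleD(1)[OF V]] MuD)
 then show "(%x. (a x + b x) * g x) : V" by (simp add: distrib_right plus_fun_def)
qed

lemma Mu_sum: "finite I ==> (!!i. i : I ==> a i : Mu) ==> (%x. \<Sum>i\<in>I. a i x) : Mu"
 by (induction I rule: finite_induct) (auto intro: Mu_add Mu_const)

lemma Mu_expi: "expi (lattice_vec l) : Mu"
 by (rule MuI) (rule char_moduleD(4)[OF V])

text \<open>Dominated convergence. The bound \<open>u\<close> concerns the products with the given
  \<open>g\<close>, so limits that are unbounded as multipliers are reached too.\<close>

lemma V_limit:
 assumes b: "!!n::nat. b n : Mu" and g: "g : V" and mg: "(%x. m x * g x) : L2" and u: "u : L2"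
  and lim: "!!x. (%n. b n x) ----> m x" and dom: "!!n x. cmod (b n x * g x) <= cmod (u x)"
 shows "(%x. m x * g x) : V"
proof (rule char_moduleD(3)[OF V, of "%n x. b n x * g x"])
 show bV: "(%x. b n x * g x) : V" for n by (rule MuD[OF b g])
 have "(%n. L2.sq ((%x. b n x * g x) - (%x. m x * g x))) ----> 0"
 proof (rule L2_dominated[OF char_moduleD(2)[OF V bV] mg u])
  show "AE x in lebesgue. (%n. b n x * g x) ----> m x * g x"
   by (intro AE_I2 tendsto_intros lim)
  show "AE x in lebesgue. cmod (b n x * g x) <= cmod (u x)" for n using dom by simp
 qed
 then show "(%n. L2.sq ((%x. b n x * g x) - (%x. m x * g x))) ----> 0" .
qed (rule mg)

lemma Mu_bounded_limit:
 assumes b: "!!n::nat. b n : Mu" and lim: "!!x. (%n. b n x) ----> m x"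
  and dom: "!!n x. cmod (b n x) <= C" and m: "m : borel_measurable borel"
 shows "m : Mu"
proof (rule MuI)
 fix g assume g: "g : V"
 have gL: "g : L2" by (rule char_moduleD(2)[OF V g])
 have mC: "cmod (m x) <= C" for x
  by (rule LIMSEQ_le_const2[OF tendsto_norm[OF lim]]) (use dom in auto)
 have ml: "m : leb_meas" by (rule measurable_completion) (use m in simp)
 have mg: "(%x. m x * g x) : L2" by (rule L2_bounded_mult[OF gL ml, of C]) (use mC in auto)
 show "(%x. m x * g x) : V"
 proof (rule V_limit[OF b g mg L2.V_scale[OF gL, of "of_real C"] lim])
  fix n x
  have "cmod (b n x) * cmod (g x) <= C * cmod (g x)" using dom by (intro mult_right_mono) auto
  also have "... <= \<bar>C\<bar> * cmod (g x)" by (intro mult_right_mono) auto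
  finally show "cmod (b n x * g x) <= cmod (cscale (of_real C) g x)" by (simp add: cscale_def norm_mult)
 qed
qed

end

section \<open>From characters to measurable periodic functions\<close>

text \<open>The space is wrapped onto a product of circles in real coordinates. Functions of
  \<open>circ x\<close> are periodic and live on a compact set, and polynomials in the coordinates
  are multipliers, so the theorem of Stone and Weierstrass applies.\<close>

definition circ :: "real^'k => (real^'k) \<times> (real^'k)" where
 "circ x = ((\<chi> i. cos (2 * pi * x $ i)), (\<chi> i. sin (2 * pi * x $ i)))"

lemma continuous_circ: "continuous_on UNIV circ"
 unfolding circ_def by (intro continuous_intros)

lemma circ_measurable [measurable]: "circ : borel_measurable borel"
 by (rule borel_measurable_continuous_onI[OF continuous_circ])

lemma circ_periodic: "periodic (circ :: real^'k => _)"
proof -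
 have "cos (2 * pi * (x $ i + of_int n)) = cos (2 * pi * x $ i)" "sin (2 * pi * (x $ i + of_int n)) = sin (2 * pi * x $ i)"
  for x :: "real^'k" and i n
  using cos_int_2pin[of n] sin_int_2pin[of n] by (simp_all add: distrib_left cos_add sin_add mult.commute mult.left_commute)
 then show ?thesis unfolding periodic_def circ_def lattice_vec_def by simp
qed

text \<open>A Borel measurable function on the whole space that inverts \<open>circ\<close> on the
  torus; clamping keeps \<open>arccos\<close> in its domain. The sign convention sends the point
  with cosine -1 and sine 0 to -1/2, the end point that belongs to the torus.\<close>

definition uncirc :: "(real^'k) \<times> (real^'k) => real^'k" where
 "uncirc y = (\<chi> i. (if 0 < snd y $ i \<or> snd y $ i = 0 & fst y $ i = 1 then 1 else - 1) *
   arccos (max (-1) (min 1 (fst y $ i))) / (2 * pi))"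

lemma uncirc_circ:
 assumes "x : torus"
 shows "uncirc (circ x) = x"
proof -
 have "uncirc (circ x) $ i = x $ i" for i
 proof -
  define t where "t = 2 * pi * x $ i"
  have x: "-1/2 <= x $ i" "x $ i < 1/2" using assms unfolding torus_def by auto
  have "pi * (-1) <= pi * (2 * x $ i)" using x by (intro mult_left_mono) auto
  moreover have "pi * (2 * x $ i) < pi * 1" using x by (intro mult_strict_left_mono) auto
  ultimately have t: "- pi <= t" "t < pi" unfolding t_def by (simp_all add: mult_ac)
  have mm: "max (-1) (min 1 (cos t)) = cos t" by simp
  have u: "uncirc (circ x) $ i = (if 0 < sin t \<or> sin t = 0 & cos t = 1 then 1 else - 1) * arccos (cos t) / (2 * pi)"
   unfolding uncirc_def circ_def t_def[symmetric] by (simp add: t_def[symmetric] mm)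
  have "(if 0 < sin t \<or> sin t = 0 & cos t = 1 then 1 else - 1) * arccos (cos t) = t"
  proof -
   consider "0 < t" | "t = 0" | "t < 0" "- pi < t" | "t = - pi" using t by linarith
   then show ?thesis
   proof cases
    case 1
    then show ?thesis using t sin_gt_zero[of t] by (simp add: arccos_cos)
   next
    case 3
    then have "sin t < 0" using sin_gt_zero[of "- t"] by simp
    moreover have "arccos (cos t) = - t" using 3 t arccos_cos[of "- t"] by simp
    ultimately show ?thesis by simp
   qed auto
  qed
  then show ?thesis unfolding u by (simp add: t_def)
 qed
 then show ?thesis by (simp add: vec_eq_iff)
qed

lemma uncirc_measurable [measurable]: "uncirc : borel_measurable (borel :: ((real^'k) \<times> (real^'k)) measure)"
proof -
 have "continuous_on UNIV (%c. arccos (max (-1) (min 1 c)))"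
  by (rule continuous_on_compose2[OF continuous_on_arccos']) (auto intro!: continuous_intros)
 then have ac [measurable]: "(%c::real. arccos (max (-1) (min 1 c))) : borel_measurable borel"
  by (rule borel_measurable_continuous_onI)
 have f [measurable]: "(%y::(real^'k) \<times> (real^'k). fst y $ i) : borel_measurable borel"
  and s [measurable]: "(%y::(real^'k) \<times> (real^'k). snd y $ i) : borel_measurable borel" for i
  by (intro borel_measurable_continuous_onI continuous_intros)+
 have c: "(%y::(real^'k) \<times> (real^'k). uncirc y $ i) : borel_measurable borel" for i
  unfolding uncirc_def vec_lambda_beta by measurable
 show ?thesis
 proof (rule borel_measurable_euclidean_space[THEN iffD2], rule ballI)
  fix b :: "real^'k" assume "b : Basis"
  then obtain i where "b = axis i 1" by (auto simp: Basis_vec_def)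
  then show "(%y. uncirc y \<bullet> b) : borel_measurable borel" using c[of i] by (simp add: inner_axis)
 qed
qed

lemma expi_axis: "expi (lattice_vec (axis i 1)) x = cis (- (2 * pi * x $ i))" "expi (lattice_vec (- axis i 1)) x = cis (2 * pi * x $ i)"
proof -
 have "lattice_vec (axis i 1) = (axis i 1 :: real^'a)" unfolding lattice_vec_def by (simp add: axis_def vec_eq_iff)
 then have "lattice_vec (axis i 1) \<bullet> x = x $ i" by (simp add: inner_axis')
 then show "expi (lattice_vec (axis i 1)) x = cis (- (2 * pi * x $ i))" "expi (lattice_vec (- axis i 1)) x = cis (2 * pi * x $ i)"
  unfolding expi_def lattice_vec_minus cis_conv_exp by (simp_all add: mult_ac)
qed

context
 fixes V :: "(real^'k => complex) set"
 assumes V: "char_module V"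
begin

lemma Mu_cos: "(%x. of_real (cos (2 * pi * x $ i))) : Mu V"
 and Mu_sin: "(%x. of_real (sin (2 * pi * x $ i))) : Mu V"
proof -
 have "(%x. 1/2 * expi (lattice_vec (axis i 1)) x + 1/2 * expi (lattice_vec (- axis i 1)) x) : Mu V"
  by (intro Mu_add[OF V] Mu_mult[OF V] Mu_const[OF V] Mu_expi[OF V])
 moreover have "1/2 * expi (lattice_vec (axis i 1)) x + 1/2 * expi (lattice_vec (- axis i 1)) x = of_real (cos (2 * pi * x $ i))" for x :: "real^'k"
  unfolding expi_axis by (simp add: complex_eq_iff)
 ultimately show "(%x. of_real (cos (2 * pi * x $ i))) : Mu V" by simp
 have "(%x. \<i>/2 * expi (lattice_vec (axis i 1)) x + (- \<i>/2) * expi (lattice_vec (- axis i 1)) x) : Mu V"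
  by (intro Mu_add[OF V] Mu_mult[OF V] Mu_const[OF V] Mu_expi[OF V])
 moreover have "\<i>/2 * expi (lattice_vec (axis i 1)) x + (- \<i>/2) * expi (lattice_vec (- axis i 1)) x = of_real (sin (2 * pi * x $ i))" for x :: "real^'k"
  unfolding expi_axis by (simp add: complex_eq_iff)
 ultimately show "(%x. of_real (sin (2 * pi * x $ i))) : Mu V" by (simp only:)
qed

lemma Mu_polynomial: "real_polynomial_function q ==> (%x. of_real (q (circ x))) : Mu V"
proof (induction q rule: real_polynomial_function.induct)
 case (linear f)
 interpret bounded_linear f by (rule linear)
 have rep: "f y = (\<Sum>b\<in>Basis. (y \<bullet> b) * f b)" for y
 proof -
  have "f y = f (\<Sum>b\<in>Basis. (y \<bullet> b) *\<^sub>R b)" by (simp only: euclidean_representation)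
  also have "... = (\<Sum>b\<in>Basis. (y \<bullet> b) * f b)" by (simp add: sum scaleR)
  finally show ?thesis .
 qed
 have comp: "(%x. of_real (circ x \<bullet> b)) : Mu V" if b: "b : Basis" for b :: "(real^'k) \<times> (real^'k)"
 proof -
  have "(\<exists>i. b = (axis i 1, 0)) \<or> (\<exists>i. b = (0, axis i 1))"
   using b by (auto simp: Basis_prod_def Basis_vec_def)
  then show ?thesis
   using Mu_cos Mu_sin by (auto simp: circ_def inner_axis)
 qed
 have "(%x. \<Sum>b\<in>Basis. of_real (circ x \<bullet> b) * of_real (f b)) : Mu V"
  by (intro Mu_sum[OF V] finite_Basis Mu_mult[OF V] comp Mu_const[OF V])
 then show ?case by (subst rep) simp
next
 case (const c)
 show ?case by (rule Mu_const[OF V])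
next
 case (add f g)
 then show ?case using Mu_add[OF V] by simp
next
 case (mult f g)
 then show ?case using Mu_mult[OF V] by simp
qed

lemma Mu_continuous:
 fixes q :: "(real^'k) \<times> (real^'k) => real"
 assumes q: "continuous_on UNIV q"
 shows "(%x. of_real (q (circ x))) : Mu V"
proof -
 define S where "S = circ ` cbox (\<chi> i. (-1/2::real)) (\<chi> i. (1/2::real) :: real^'k)"
 have S: "compact S" unfolding S_def
  by (intro compact_continuous_image continuous_on_subset[OF continuous_circ] compact_cbox) auto
 have circS: "circ x : S" for x
 proof -
  have "x + lattice_vec (floor_vec x) : cbox (\<chi> i. (-1/2::real)) (\<chi> i. (1/2::real))"
   using floor_vec_torus[of x] unfolding torus_def mem_box_cart by (auto intro: less_imp_le)
  then show ?thesis unfolding S_def using periodicD[OF circ_periodic, of x "floor_vec x"] by (metis imageI)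
 qed
 have qS: "continuous_on S q" by (rule continuous_on_subset[OF q]) auto
 obtain B where B: "!!y. y : S ==> \<bar>q y\<bar> <= B"
  using compact_imp_bounded[OF compact_continuous_image[OF qS S]] unfolding bounded_iff by auto
 have "\<exists>p. real_polynomial_function p & (\<forall>y\<in>S. \<bar>q y - p y\<bar> < 1 / real (Suc n))" for n
  by (rule Stone_Weierstrass_real_polynomial_function[OF S qS, of "1 / real (Suc n)"]) auto
 then obtain p where p: "!!n. real_polynomial_function (p n)" "!!n y. y : S ==> \<bar>q y - p n y\<bar> < 1 / real (Suc n)"
  by metis
 show ?thesis
 proof (rule Mu_bounded_limit[OF V, where b="%n x. of_real (p n (circ x))" and C="B + 1"])
  show "(%x. of_real (p n (circ x))) : Mu V" for n by (rule Mu_polynomial[OF p(1)])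
  show "(%n. complex_of_real (p n (circ x))) ----> of_real (q (circ x))" for x
  proof (rule tendsto_of_real, rule LIM_zero_cancel, rule Lim_null_comparison)
   show "(%n. 1 / real (Suc n)) ----> 0" by (rule LIMSEQ_inverse_real_of_nat[unfolded inverse_eq_divide])
   show "\<forall>\<^sub>F n in sequentially. norm (p n (circ x) - q (circ x)) <= 1 / real (Suc n)"
    using p(2)[OF circS[of x]] by (intro always_eventually allI) (simp add: abs_minus_commute less_imp_le)
  qed
  show "cmod (of_real (p n (circ x))) <= B + 1" for n x
  proof -
   have "\<bar>q (circ x) - p n (circ x)\<bar> < 1 / real (Suc n)" by (rule p(2)[OF circS])
   moreover have "1 / real (Suc n) <= 1" by simp
   ultimately have "\<bar>p n (circ x)\<bar> <= B + 1" using B[OF circS[of x]] by linarith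
   then show ?thesis by simp
  qed
  have "(%x. q (circ x)) : borel_measurable borel"
   by (rule measurable_compose[OF circ_measurable borel_measurable_continuous_onI[OF q]])
  then show "(%x. complex_of_real (q (circ x))) : borel_measurable borel" by measurable
 qed
qed

lemma Mu_closed_indicator:
 fixes C :: "((real^'k) \<times> (real^'k)) set"
 assumes C: "closed C"
 shows "(%x. indicator C (circ x)) : Mu V"
proof (cases "C = {}")
 case True
 then show ?thesis using Mu_const[OF V, of 0] by simp
next
 case False
 show ?thesis
 proof (rule Mu_bounded_limit[OF V, where b="%n x. of_real (max 0 (1 - real n * infdist (circ x) C))" and C=1])
  show "(%x. of_real (max 0 (1 - real n * infdist (circ x) C))) : Mu V" for n
   by (rule Mu_continuous) (intro continuous_intros)
  show "(%n. complex_of_real (max 0 (1 - real n * infdist (circ x) C))) ----> indicator C (circ x)" for x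
  proof (cases "circ x : C")
   case True
   then show ?thesis by simp
  next
   case f: False
   then have d: "infdist (circ x) C > 0"
    using in_closed_iff_infdist_zero[OF C False] infdist_nonneg[of "circ x" C] by (simp add: less_le)
   obtain N where N: "1 / infdist (circ x) C <= real N" using real_arch_simple by blast
   have "max 0 (1 - real n * infdist (circ x) C) = 0" if "n >= N" for n
   proof -
    have "1 / infdist (circ x) C <= real n" using N that by linarith
    then show ?thesis using d by (simp add: field_simps)
   qed
   then show ?thesis using f by (intro tendsto_eventually) (auto simp: eventually_sequentially)
  qed
  show "cmod (of_real (max 0 (1 - real n * infdist (circ x) C))) <= 1" for n x
   using infdist_nonneg[of "circ x" C] by (simp add: max_def)
  have "C : sets borel" using C by simp
  then show "(%x. indicator C (circ x) :: complex) : borel_measurable borel" by measurable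
 qed
qed

text \<open>Closed sets are stable under intersection and generate the Borel sets, so complements
  and disjoint countable unions suffice. Disjointness keeps the partial sums of indicators bounded
  by 1.\<close>

lemma Mu_borel_indicator:
 fixes A :: "((real^'k) \<times> (real^'k)) set"
 assumes A: "A : sets borel"
 shows "(%x. indicator A (circ x)) : Mu V"
proof -
 have sb: "sigma_sets UNIV (Collect closed) = sets (borel :: ((real^'k) \<times> (real^'k)) measure)"
  by (subst borel_eq_closed) simp
 have st: "Int_stable (Collect closed :: ((real^'k) \<times> (real^'k)) set set)"
  by (auto simp: Int_stable_def)
 have pw: "(Collect closed :: ((real^'k) \<times> (real^'k)) set set) <= Pow UNIV" by simp
 from A have "A : sigma_sets UNIV (Collect closed)" using sb by simp
 with st pw show ?thesis
 proof (induction A rule: sigma_sets_induct_disjoint)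
  case (basic A)
  then show ?case using Mu_closed_indicator by simp
 next
  case empty
  then show ?case using Mu_const[OF V, of 0] by simp
 next
  case (compl A)
  have "(%x. 1 + (- 1) * indicator A (circ x)) : Mu V"
   by (intro Mu_add[OF V] Mu_mult[OF V] Mu_const[OF V] compl)
  moreover have "1 + (- 1) * indicator A y = (indicator (UNIV - A) y :: complex)" for y by (auto simp: indicator_def)
  ultimately show ?case by simp
 next
  case (union A)
  have Am: "A i : sets borel" for i using union(2) sb by auto
  show ?case
  proof (rule Mu_bounded_limit[OF V, where b="%n x. \<Sum>i<n. indicator (A i) (circ x)" and C=1])
   show "(%x. \<Sum>i<n. indicator (A i) (circ x)) : Mu V" for n by (intro Mu_sum[OF V] union) auto
   have eq: "(\<Sum>i<n. indicator (A i) y) = (indicator (\<Union>i<n. A i) y :: complex)" for n y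
   proof -
    have "disjoint_family_on A {..<n}" using union(1) by (rule disjoint_family_on_mono[rotated]) auto
    then show ?thesis by (simp add: indicator_UN_disjoint)
   qed
   show "(%n. \<Sum>i<n. indicator (A i) (circ x) :: complex) ----> indicator (\<Union>i. A i) (circ x)" for x
   proof (cases "circ x : (\<Union>i. A i)")
    case True
    then obtain i where "circ x : A i" by auto
    then show ?thesis unfolding eq using True
     by (intro tendsto_eventually) (auto simp: eventually_sequentially indicator_def intro!: exI[of _ "Suc i"])
   next
    case False
    then have "indicator (\<Union>i<n. A i) (circ x) = (0::complex)" for n by auto
    then show ?thesis unfolding eq using False by simp
   qed
   show "cmod (\<Sum>i<n. indicator (A i) (circ x)) <= 1" for n x unfolding eq by (auto simp: indicator_def)
   have "(\<Union>i. A i) : sets borel" using Am by auto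
   then show "(%x. indicator (\<Union>i. A i) (circ x) :: complex) : borel_measurable borel" by measurable
  qed
 qed
qed

text \<open>Simple functions approximate \<open>b\<close> and are bounded by
  \<open>2 * cmod (b y)\<close>. The products with \<open>g\<close> are therefore dominated by twice
  the square integrable product of \<open>b\<close> and \<open>g\<close>, even when \<open>b\<close>
  is unbounded.\<close>

lemma circ_multiplier:
 assumes b: "b : borel_measurable (borel :: ((real^'k) \<times> (real^'k)) measure)" and g: "g : V"
  and bg: "(%x. b (circ x) * g x) : L2"
 shows "(%x. b (circ x) * g x) : V"
proof -
 obtain F where F: "!!i. simple_function borel (F i)" "!!y. (%i. F i y) ----> b y" "!!i y. cmod (F i y) <= 2 * cmod (b y)"
  using borel_measurable_implies_sequence_metric[OF b, of 0] by (auto simp: dist_norm)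
 have FM: "(%x. F i (circ x)) : Mu V" for i
 proof -
  have fin: "finite (F i ` UNIV)" using simple_functionD(1)[OF F(1)] by simp
  have "(%x. \<Sum>z\<in>F i ` UNIV. z * indicator (F i -` {z}) (circ x)) : Mu V"
   using simple_functionD(2)[OF F(1), of i] by (intro Mu_sum[OF V] fin Mu_mult[OF V] Mu_const[OF V] Mu_borel_indicator) simp
  moreover have "(\<Sum>z\<in>F i ` UNIV. z * indicator (F i -` {z}) y) = F i y" for y
  proof -
   have "(\<Sum>z\<in>F i ` UNIV. z * indicator (F i -` {z}) y) = (\<Sum>z\<in>F i ` UNIV. if z = F i y then F i y else 0)"
    by (intro sum.cong) (auto simp: indicator_def)
   then show ?thesis using fin by simp
  qed
  ultimately show ?thesis by simp
 qed
 show ?thesis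
 proof (rule V_limit[OF V FM g bg L2.V_scale[OF bg, of 2] F(2)])
  fix n x
  have "cmod (F n (circ x)) * cmod (g x) <= (2 * cmod (b (circ x))) * cmod (g x)"
   using F(3) by (intro mult_right_mono) auto
  then show "cmod (F n (circ x) * g x) <= cmod (cscale 2 (%x. b (circ x) * g x) x)"
   by (simp add: cscale_def norm_mult)
 qed
qed

text \<open>A Borel representative \<open>m'\<close> of \<open>m\<close> need not be periodic.
  Composing it with \<open>uncirc\<close> and \<open>circ\<close> uses only its values on the torus
  and restores periodicity, at the cost of a null set.\<close>

theorem periodic_multiplier:
 assumes m: "m : leb_meas" and per: "periodic m" and g: "g : V"
  and mg: "(%x. m x * g x) : L2"
 shows "(%x. m x * g x) : V"
proof -
 obtain m' where m': "m' : borel_measurable borel" and ae: "AE x in lebesgue. m x = m' x"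
  using complex_borel_representative[OF m] by blast
 define b where "b = (%y. m' (uncirc y))"
 have b: "b : borel_measurable borel"
  unfolding b_def by (rule measurable_compose[OF uncirc_measurable m'])
 have bm: "AE x in lebesgue. m x * g x = b (circ x) * g x"
  using AE_lattice[OF ae]
 proof eventually_elim
  case (elim x)
  let ?y = "x + lattice_vec (floor_vec x)"
  have "b (circ x) = b (circ ?y)" by (simp add: periodicD[OF circ_periodic])
  also have "... = m' ?y" unfolding b_def by (simp add: uncirc_circ floor_vec_torus)
  also have "... = m ?y" using elim by simp
  also have "... = m x" by (rule periodicD[OF per])
  finally show ?case by simp
 qed
 have "(%x. b (circ x) * g x) : V" by (rule circ_multiplier[OF b g L2_AE_cong(1)[OF mg bm]])
 moreover have "AE x in lebesgue. b (circ x) * g x = m x * g x" using bm by eventually_elim (rule sym)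
 ultimately show ?thesis by (rule char_module_AE[OF V])
qed

end

section \<open>The Parseval identity for translates\<close>

context semi_inner
begin

text \<open>An approximation \<open>g\<close> from the span involves finitely many indices
  \<open>I\<close>. For every finite \<open>Y\<close> containing \<open>I\<close> the partial
  expansion over \<open>Y\<close> is the best approximation from its span, hence at least as good as
  \<open>g\<close>.\<close>

lemma parseval_family:
 assumes b: "!!i. b i : V" and on: "!!i j. ip (b i) (b j) = (if i = j then 1 else 0)" and f: "f : V"
  and ap: "!!e. e > 0 ==> \<exists>g\<in>cfun.span (range b). sq (f - g) < e"
 shows "((%i. (cmod (ip f (b i)))\<^sup>2) has_sum sq f) UNIV"
 unfolding has_sum_def
proof (rule tendstoI)
 fix e :: real assume "e > 0"
 then obtain g where g: "g : cfun.span (range b)" "sq (f - g) < e" using ap by blast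
 obtain t r where t: "finite t" "t <= range b" "g = (\<Sum>a\<in>t. cscale (r a) a)"
  using g(1) unfolding cfun.span_explicit by auto
 obtain I where I: "finite I" "t = b ` I" using finite_subset_image[OF t(1,2)] by blast
 show "\<forall>\<^sub>F Y in finite_subsets_at_top UNIV. dist (\<Sum>i\<in>Y. (cmod (ip f (b i)))\<^sup>2) (sq f) < e"
  unfolding eventually_finite_subsets_at_top
 proof (intro exI[of _ I] conjI allI impI I(1))
  fix Y assume Y: "finite Y & I <= Y & Y <= UNIV"
  define s where "s = f - (\<Sum>i\<in>Y. cscale (ip f (b i)) (b i))"
  have fe: "s : V" "!!j. j : Y ==> ip s (b j) = 0" "sq f = (\<Sum>i\<in>Y. (cmod (ip f (b i)))\<^sup>2) + sq s"
   using finite_expansion[of Y b f] Y b on f unfolding s_def by auto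
  define Q where "Q = {v : V. ip s v = 0}"
  have Qs: "cfun.subspace Q" unfolding Q_def
   by (rule cfun.subspaceI) (auto simp: V_zero V_add V_scale zero_right add_right scale_right fe(1))
  have bQ: "b j : Q" if "j : Y" for j unfolding Q_def using b fe(2) that by auto
  have "g : Q" unfolding t(3) I(2) using Y bQ by (intro cfun.subspace_sum[OF Qs] cfun.subspace_scale[OF Qs]) auto
  moreover have "(\<Sum>i\<in>Y. cscale (ip f (b i)) (b i)) : Q"
   using bQ by (intro cfun.subspace_sum[OF Qs] cfun.subspace_scale[OF Qs])
  ultimately have "(\<Sum>i\<in>Y. cscale (ip f (b i)) (b i)) - g : Q" by (intro cfun.subspace_diff[OF Qs])
  then have q: "(\<Sum>i\<in>Y. cscale (ip f (b i)) (b i)) - g : V" "ip s ((\<Sum>i\<in>Y. cscale (ip f (b i)) (b i)) - g) = 0"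
   unfolding Q_def by auto
  have "f - g = s + ((\<Sum>i\<in>Y. cscale (ip f (b i)) (b i)) - g)" unfolding s_def by simp
  then have "sq (f - g) = sq s + sq ((\<Sum>i\<in>Y. cscale (ip f (b i)) (b i)) - g)"
   by (simp only: sq_add[OF fe(1) q(1)] q(2)) simp
  then have "sq s < e" using g(2) sq_nonneg[OF q(1)] by linarith
  then show "dist (\<Sum>i\<in>Y. (cmod (ip f (b i)))\<^sup>2) (sq f) < e"
   using fe(3) sq_nonneg[OF fe(1)] by (simp add: dist_real_def)
 qed simp
qed

end

text \<open>Characters cut off to the torus, so as to be elements of \<open>L2\<close> on the whole
  space. The fibers of \<open>tchar 0\<close> are unit coordinate vectors; bracketing with
  \<open>tchar 0\<close> therefore produces the periodic extension of the restriction to the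
  torus.\<close>

definition tchar :: "int^'k => real^'k => complex" where
 "tchar l = (%x. indicator torus x * expi (lattice_vec l) x)"

lemma expi_lattice_0: "expi (lattice_vec 0) x = 1"
 by (simp add: expi_def lattice_vec_0)

lemma tchar_0: "tchar 0 = indicator torus"
 unfolding tchar_def by (simp add: expi_lattice_0 fun_eq_iff)

lemma tchar_L2: "tchar l : L2"
proof -
 have t: "(indicator torus :: real^'k => complex) : L2"
 proof -
  have "integrable lebesgue (indicat_real (torus :: (real^'k) set))"
   using torus_lmeasurable unfolding fmeasurable_def by (intro integrable_real_indicator) auto
  moreover have "(cmod (indicator torus x))\<^sup>2 = indicat_real torus x" for x :: "real^'k" by (simp split: split_indicator)
  moreover have "(indicator torus :: real^'k => complex) : leb_meas"
   by (rule borel_measurable_indicator[OF torus_lebesgue])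
  ultimately show ?thesis unfolding L2_def by simp
 qed
 have "tchar l = (%x. expi (lattice_vec l) x * indicator torus x)"
  unfolding tchar_def by (rule ext) (rule mult.commute)
 then show ?thesis by (simp only: expi_mult_L2(1)[OF t])
qed

lemma fib_tchar_0: "fib (tchar 0) x = unit_family (floor_vec x)"
proof
 fix l
 have "x + lattice_vec l : torus \<longleftrightarrow> l = floor_vec x"
  using torus_unique[OF _ floor_vec_torus] floor_vec_torus[of x] by metis
 then show "fib (tchar 0) x l = unit_family (floor_vec x) l"
  unfolding fib_def tchar_0 unit_family_def indicator_def by simp
qed

lemma br_tchar_0: "br u (tchar 0) x = u (x + lattice_vec (floor_vec x))"
 unfolding br_def fib_tchar_0 by (simp add: ell2_inner_unit fib_def)

lemma floor_vec_on_torus: "x : torus ==> floor_vec x = 0"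
 using torus_unique[of x "floor_vec x" 0] floor_vec_torus[of x] by (simp add: lattice_vec_0)

lemma measure_torus: "measure lebesgue (torus :: (real^'k) set) = 1"
proof -
 let ?a = "(\<chi> i. -1/2) :: real^'k" and ?b = "(\<chi> i. 1/2) :: real^'k"
 have m: "measure lebesgue (cbox ?a ?b) = measure lborel (cbox ?a ?b)" "measure lebesgue (box ?a ?b) = measure lborel (box ?a ?b)"
  by (simp_all add: measure_completion)
 have c: "measure lebesgue (cbox ?a ?b) = 1"
  unfolding m
  by (subst content_cbox_cart) (auto simp: interval_ne_empty_cart)
 have b: "measure lebesgue (box ?a ?b) = measure lebesgue (cbox ?a ?b)"
  unfolding m by (simp add: measure_lborel_box_eq measure_lborel_cbox_eq)
 have "measure lebesgue (box ?a ?b) <= measure lebesgue (torus :: (real^'k) set)"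
  by (rule measure_mono_fmeasurable[OF _ _ torus_lmeasurable]) (auto simp: torus_def mem_box_cart less_imp_le)
 moreover have "measure lebesgue (torus :: (real^'k) set) <= measure lebesgue (cbox ?a ?b)"
  by (rule measure_mono_fmeasurable[OF _ torus_lebesgue]) (auto simp: torus_def mem_box_cart less_imp_le)
 ultimately show ?thesis using b c by linarith
qed

text \<open>The integral of a periodic function over the torus does not change under translations; a
 translation by a point where the character is -1 therefore shows that its integral vanishes.\<close>

lemma tchar_integral:
 "(LINT x|lebesgue. tchar l x) = (if l = (0 :: int^'k) then 1 else 0)"
proof (cases "l = 0")
 case True
 have "(LINT x|lebesgue. (indicator (torus :: (real^'k) set) x :: complex)) = of_real (measure lebesgue (torus :: (real^'k) set))"
 proof -
  have "(LINT x|lebesgue. (indicator (torus :: (real^'k) set) x :: complex)) = (LINT x|lebesgue. complex_of_real (indicat_real (torus :: (real^'k) set) x))"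
   by (rule Bochner_Integration.integral_cong) (simp_all split: split_indicator)
  then show ?thesis by simp
 qed
 then show ?thesis using True by (simp add: tchar_0 measure_torus)
next
 case False
 then obtain i where i: "l $ i ~= 0" by (auto simp: vec_eq_iff)
 define y :: "real^'k" where "y = axis i (1 / (2 * of_int (l $ i)))"
 define I where "I = (LINT x|lebesgue. tchar l x)"
 have I1: "I = L2_inner (tchar l) (tchar 0)"
  unfolding I_def L2_inner_def by (intro Bochner_Integration.integral_cong) (auto simp: tchar_def expi_lattice_0 indicator_def)
 have ly: "lattice_vec l \<bullet> y = 1/2" unfolding y_def using i by (simp add: inner_axis lattice_vec_def)
 have m: "expi (lattice_vec l) (x - y) = - expi (lattice_vec l) x" for x
 proof -
  have "expi (lattice_vec l) (x - y) = exp (- 2 * of_real pi * \<i> * of_real (lattice_vec l \<bullet> x) + of_real pi * \<i>)"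
   unfolding expi_def inner_diff_right ly
   by (rule arg_cong[of _ _ exp]) (simp add: inner_commute algebra_simps)
  then show ?thesis unfolding exp_add expi_def by (simp add: inner_commute)
 qed
 have br': "br (translate y (tchar l)) (translate y (tchar 0)) x = - expi (lattice_vec l) x" for x
 proof -
  have "fib (translate y g) x = fib g (x - y)" for g :: "real^'k => complex"
   unfolding fib_def translate_def by (simp add: fun_eq_iff algebra_simps)
  then have "br (translate y (tchar l)) (translate y (tchar 0)) x = br (tchar l) (tchar 0) (x - y)"
   unfolding br_def by simp
  also have "... = expi (lattice_vec l) (x - y)"
   unfolding br_tchar_0 using floor_vec_torus[of "x - y"] by (simp add: tchar_def periodicD[OF expi_lattice_periodic])
  finally show ?thesis using m by simp
 qed
 have "I = L2_inner (translate y (tchar l)) (translate y (tchar 0))"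
 proof -
  have "(%x. tchar l x * cnj (tchar 0 x)) : leb_meas"
   using L2_mult_integrable[OF tchar_L2 tchar_L2] by (rule borel_measurable_integrable)
  from lebesgue_integral_translate(1)[OF this, of "- y"] show ?thesis
   unfolding I1 L2_inner_def translate_def by simp
 qed
 also have "... = (LINT x|lebesgue. - tchar l x)"
  unfolding br_integral(2)[OF translate_L2(1)[OF tchar_L2] translate_L2(1)[OF tchar_L2]] br'
  by (simp add: tchar_def)
 also have "... = - I" unfolding I_def by (rule Bochner_Integration.integral_minus)
 finally have "I = 0" by simp
 then show ?thesis using False unfolding I_def by simp
qed

lemma tchar_orthonormal: "L2_inner (tchar l) (tchar k) = (if l = k then 1 else 0)"
proof -
 have "tchar l x * cnj (tchar k x) = tchar (l - k) x" for x
  unfolding tchar_def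
  by (auto simp: indicator_def cnj_expi expi_add[symmetric] lattice_vec_minus[symmetric] lattice_vec_add[symmetric])
 then show ?thesis unfolding L2_inner_def by (simp add: tchar_integral)
qed

text \<open>This makes the multiplier theorem applicable to the closed span of the exponentials
  themselves, which replaces a separate proof that they are complete on the torus.\<close>

lemma char_module_approximable:
 "char_module {u : L2. \<forall>e>0. \<exists>g\<in>cfun.span (range tchar). L2.sq (u - g) < e}" (is "char_module ?V")
proof -
 have tl: "g : L2" if "g : cfun.span (range tchar)" for g
  using that cfun.span_minimal[OF _ L2.sub, of "range tchar"] tchar_L2 by auto
 have "cfun.subspace ?V"
 proof (rule cfun.subspaceI)
  show "0 : ?V"
   using L2.V_zero cfun.span_zero[of "range tchar"] by (auto simp: L2.sq_def L2.zero_left intro!: bexI[of _ 0])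
 next
  fix u v assume u: "u : ?V" and v: "v : ?V"
  have "\<exists>g\<in>cfun.span (range tchar). L2.sq (u + v - g) < e" if "e > 0" for e
  proof -
   have "e / 4 > 0" using that by simp
   then obtain g h where g: "g : cfun.span (range tchar)" "L2.sq (u - g) < e / 4"
    and h: "h : cfun.span (range tchar)" "L2.sq (v - h) < e / 4" using u v by blast
   have "L2.sq ((u - g) + (v - h)) <= 2 * L2.sq (u - g) + 2 * L2.sq (v - h)"
    using u v tl[OF g(1)] tl[OF h(1)] by (intro L2.sq_add_le L2.V_diff) auto
   then have "L2.sq (u + v - (g + h)) < e" using g(2) h(2) by (simp add: algebra_simps)
   then show ?thesis using cfun.span_add[OF g(1) h(1)] by blast
  qed
  then show "u + v : ?V" using u v L2.V_add by auto
 next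
  fix c u assume u: "u : ?V"
  have "\<exists>g\<in>cfun.span (range tchar). L2.sq (cscale c u - g) < e" if "e > 0" for e
  proof -
   have "e / ((cmod c)\<^sup>2 + 1) > 0" using that by (simp add: add_nonneg_pos)
   then obtain g where g: "g : cfun.span (range tchar)" "L2.sq (u - g) < e / ((cmod c)\<^sup>2 + 1)" using u by blast
   have ug: "u - g : L2" using u tl[OF g(1)] L2.V_diff by auto
   have "L2.sq (cscale c u - cscale c g) = (cmod c)\<^sup>2 * L2.sq (u - g)"
    using L2.sq_scale[OF ug, of c] by (simp add: cfun.scale_right_diff_distrib)
   also have "... <= ((cmod c)\<^sup>2 + 1) * L2.sq (u - g)" using L2.sq_nonneg[OF ug] by (intro mult_right_mono) auto
   also have "... < e" using g(2) by (simp add: pos_less_divide_eq add_nonneg_pos mult.commute)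
   finally show ?thesis using cfun.span_scale[OF g(1)] by blast
  qed
  then show "cscale c u : ?V" using u L2.V_scale by auto
 qed
 moreover have "u : ?V" if h: "!!m::nat. h m : ?V" and u: "u : L2" and lim: "(%m. L2.sq (h m - u)) ----> 0" for h u
 proof -
  have "\<exists>g\<in>cfun.span (range tchar). L2.sq (u - g) < e" if "e > 0" for e
  proof -
   have "e / 4 > 0" using that by simp
   with lim have "\<forall>\<^sub>F m in sequentially. L2.sq (h m - u) < e / 4" by (rule order_tendstoD)
   then obtain m where m: "L2.sq (h m - u) < e / 4" by (auto simp: eventually_sequentially)
   obtain g where g: "g : cfun.span (range tchar)" "L2.sq (h m - g) < e / 4" using h[of m] \<open>e / 4 > 0\<close> by blast
   have hm: "h m : L2" using h by auto
   have "L2.sq (u - g) <= 2 * L2.sq (u - h m) + 2 * L2.sq (h m - g)"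
    by (rule L2.sq_triangle_le[OF u hm tl[OF g(1)]])
   then have "L2.sq (u - g) < e" using m g(2) L2.sq_diff_commute[OF u hm] by simp
   then show ?thesis using g(1) by blast
  qed
  then show ?thesis using u by auto
 qed
 moreover have "(%x. expi (lattice_vec l) x * u x) : ?V" if u: "u : ?V" for l u
 proof -
  let ?m = "%g x. expi (lattice_vec l) x * g x"
  have "cfun.span (range tchar) <= {g. ?m g : cfun.span (range tchar)}"
  proof (rule cfun.span_minimal)
   have "?m (tchar k) = tchar (l + k)" for k
    unfolding tchar_def by (simp add: fun_eq_iff lattice_vec_add expi_add mult.left_commute)
   then show "range tchar <= {g. ?m g : cfun.span (range tchar)}" by (auto intro: cfun.span_base)
   show "cfun.subspace {g. ?m g : cfun.span (range tchar)}"
   proof (rule cfun.subspaceI)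
    show "0 : {g. ?m g : cfun.span (range tchar)}" using cfun.span_zero[of "range tchar"] by (simp add: zero_fun_def)
    show "x + y : {g. ?m g : cfun.span (range tchar)}"
     if "x : {g. ?m g : cfun.span (range tchar)}" "y : {g. ?m g : cfun.span (range tchar)}" for x y
     using cfun.span_add[of "?m x" "range tchar" "?m y"] that by (simp add: plus_fun_def distrib_left)
    show "cscale c x : {g. ?m g : cfun.span (range tchar)}" if "x : {g. ?m g : cfun.span (range tchar)}" for c x
     using cfun.span_scale[of "?m x" "range tchar" c] that by (simp add: cscale_def mult.left_commute)
   qed
  qed
  moreover have "L2.sq (?m u - ?m g) = L2.sq (u - g)" if "g : cfun.span (range tchar)" for g
  proof -
   have "u - g : L2" using u tl[OF that] L2.V_diff by auto
   from expi_mult_L2(2)[OF this, of "lattice_vec l"] show ?thesis by (simp add: fun_diff_def right_diff_distrib)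
  qed
  ultimately have "\<exists>g\<in>cfun.span (range tchar). L2.sq (?m u - g) < e" if "e > 0" for e
  proof -
   obtain g where "g : cfun.span (range tchar)" "L2.sq (u - g) < e" using u \<open>0 < e\<close> by blast
   then show ?thesis using \<open>cfun.span (range tchar) <= _\<close>
    \<open>!!g. g : cfun.span (range tchar) ==> L2.sq (?m u - ?m g) = L2.sq (u - g)\<close> by (intro bexI[of _ "?m g"]) auto
  qed
  then show ?thesis using u expi_mult_L2(1)[of u] by auto
 qed
 ultimately show ?thesis unfolding char_module_def by blast
qed

text \<open>A function supported on the torus is its periodic extension times
  \<open>tchar 0\<close>, hence lies in the closed span of the exponentials by the multiplier
  theorem.\<close>

lemma torus_parseval:
 assumes u: "u : L2" and off: "!!x. x ~: torus ==> u x = 0"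
 shows "((%l. (cmod (L2_inner u (tchar l)))\<^sup>2) has_sum L2.sq u) UNIV"
proof (rule L2.parseval_family[OF tchar_L2 tchar_orthonormal u])
 define V :: "(real^'a => complex) set" where
  "V = {u : L2. \<forall>e>0. \<exists>g\<in>cfun.span (range tchar). L2.sq (u - g) < e}"
 have V: "char_module V" unfolding V_def by (rule char_module_approximable)
 have "tchar 0 : cfun.span (range tchar)" by (rule cfun.span_base) simp
 then have t0: "tchar 0 : V"
  unfolding V_def using tchar_L2 by (auto intro!: bexI[of _ "tchar 0"] simp: L2.sq_def L2.zero_left L2.V_zero)
 have e: "br u (tchar 0) x * tchar 0 x = u x" for x
  unfolding br_tchar_0 using off[of x] by (cases "x : torus") (simp_all add: tchar_0 floor_vec_on_torus lattice_vec_0)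
 have "(%x. br u (tchar 0) x * tchar 0 x) : V"
  by (rule periodic_multiplier[OF V br_measurable[OF u tchar_L2] br_periodic t0]) (use e u in simp)
 then have "u : V" using e by simp
 then show "\<exists>g\<in>cfun.span (range tchar). L2.sq (u - g) < e" if "e > 0" for e using that unfolding V_def by blast
qed

text \<open>Translating \<open>h\<close> multiplies the bracket by a conjugate character, so these
  inner products are Fourier coefficients of a function on the torus.\<close>

lemma L2_inner_translate:
 assumes f: "f : L2" and h: "h : L2"
 shows "L2_inner f (translate (lattice_vec l) h) =
  L2_inner (%x. indicator torus x * br (L2_fourier f) (L2_fourier h) x) (tchar l)"
proof -
 note F = L2_fourier_L2[OF f] and H = L2_fourier_L2[OF h]
 let ?e = "%x. expi (lattice_vec l) x * L2_fourier h x"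
 note eH = expi_mult_L2(1)[OF H, of "lattice_vec l"]
 have "L2_inner f (translate (lattice_vec l) h) = L2_inner (L2_fourier f) (L2_fourier (translate (lattice_vec l) h))"
  by (rule L2_fourier_inner[OF f translate_L2(1)[OF h], symmetric])
 also have "... = L2_inner (L2_fourier f) ?e"
  by (rule L2_inner_AE_cong[OF L2D(1)[OF F] L2D(1)[OF L2_fourier_L2[OF translate_L2(1)[OF h]]] _ L2_fourier_translate[OF h]]) simp
 also have "... = (LINT x|lebesgue. indicator torus x * br (L2_fourier f) ?e x)"
  by (rule br_integral(2)[OF F eH])
 also have "... = (LINT x|lebesgue. (indicator torus x * br (L2_fourier f) (L2_fourier h) x) * cnj (tchar l x))"
 proof (rule Bochner_Integration.integral_cong_AE)
  show "(%x. indicator torus x * br (L2_fourier f) ?e x) : leb_meas"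
   using torus_lebesgue br_measurable[OF F eH] by measurable
  have [measurable]: "tchar l : leb_meas" by (rule L2D(1)[OF tchar_L2])
  show "(%x. (indicator torus x * br (L2_fourier f) (L2_fourier h) x) * cnj (tchar l x)) : leb_meas"
   using torus_lebesgue br_measurable[OF F H] by measurable
  show "AE x in lebesgue. indicator torus x * br (L2_fourier f) ?e x = (indicator torus x * br (L2_fourier f) (L2_fourier h) x) * cnj (tchar l x)"
   using L2_fib_ell2[OF F] L2_fib_ell2[OF H]
  proof eventually_elim
   case (elim x)
   then have "br (L2_fourier f) ?e x = cnj (expi (lattice_vec l) x) * br (L2_fourier f) (L2_fourier h) x"
    unfolding br_def fib_mult[OF expi_lattice_periodic] by (intro ell2.scale_right)
   then show ?case by (simp add: tchar_def indicator_def)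
  qed
 qed
 finally show ?thesis unfolding L2_inner_def .
qed

theorem translates_parseval:
 assumes f: "f : L2" and h: "h : L2"
  and u: "(%x. indicator torus x * br (L2_fourier f) (L2_fourier h) x) : L2"
 shows "((%l. (cmod (L2_inner f (translate (lattice_vec l) h)))\<^sup>2) has_sum
  (LINT x|lebesgue. indicator torus x * (cmod (br (L2_fourier f) (L2_fourier h) x))\<^sup>2)) UNIV"
proof -
 have "(cmod (indicator torus x * z))\<^sup>2 = indicator torus x * (cmod z)\<^sup>2" for x :: "real^'a" and z
  by (simp add: indicator_def)
 with torus_parseval[OF u] show ?thesis unfolding L2_inner_translate[OF f h] L2_sq by simp
qed

section \<open>Orthonormal fiber bases\<close>

definition orth01 :: "nat => (nat => 'a => complex) => bool" where
 "orth01 N e \<longleftrightarrow> (\<forall>k<N. e k : ell2 & (ell2.sq (e k) = 0 \<or> ell2.sq (e k) = 1)) \<and>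
   (\<forall>k<N. \<forall>j<N. k ~= j --> ell2_inner (e k) (e j) = 0)"

definition residual :: "nat => (nat => 'a => complex) => ('a => complex) => 'a => complex" where
 "residual N e g = g - (\<Sum>k<N. cscale (ell2_inner g (e k)) (e k))"

context
 fixes N :: nat and e :: "nat => 'a => complex"
 assumes oe: "orth01 N e"
begin

lemma orth01_ell2: "k < N ==> e k : ell2"
 using oe unfolding orth01_def by blast

lemma orth01_coefficient_sq:
 assumes g: "g : ell2" and k: "k < N"
 shows "ell2.sq (cscale (ell2_inner g (e k)) (e k)) <= ell2.sq g"
proof -
 have s: "ell2.sq (e k) = 0 \<or> ell2.sq (e k) = 1" using oe k unfolding orth01_def by blast
 have "(cmod (ell2_inner g (e k)))\<^sup>2 <= ell2.sq g * ell2.sq (e k)"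
  by (rule ell2.Cauchy_Schwarz_sq[OF g orth01_ell2[OF k]])
 then show ?thesis
  using s ell2.sq_nonneg[OF g] by (auto simp: ell2.sq_scale[OF orth01_ell2[OF k]])
qed

lemma residual_ell2: "g : ell2 ==> residual N e g : ell2"
 unfolding residual_def by (intro ell2.V_diff ell2.V_sum ell2.V_scale orth01_ell2) auto

lemma residual_orth:
 assumes g: "g : ell2" and j: "j < N"
 shows "ell2_inner (residual N e g) (e j) = 0"
proof -
 have "ell2_inner (\<Sum>k<N. cscale (ell2_inner g (e k)) (e k)) (e j) = (\<Sum>k<N. ell2_inner g (e k) * ell2_inner (e k) (e j))"
  using j by (subst ell2.sum_left) (auto intro!: ell2.V_scale orth01_ell2 sum.cong ell2.scale_left)
 also have "... = (\<Sum>k<N. if k = j then ell2_inner g (e j) * ell2_inner (e j) (e j) else 0)"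
  using oe j unfolding orth01_def by (intro sum.cong) auto
 also have "... = ell2_inner g (e j)"
 proof (cases "ell2.sq (e j) = 0")
  case True
  then have "e j = 0" using ell2_sq_eq_0_iff[OF orth01_ell2[OF j]] by simp
  then show ?thesis using g j by (simp add: ell2.zero_right)
 next
  case False
  then have "ell2.sq (e j) = 1" using oe j unfolding orth01_def by blast
  then show ?thesis using ell2.ip_self[OF orth01_ell2[OF j]] j by simp
 qed
 finally show ?thesis unfolding residual_def
  using g j by (subst ell2.diff_left) (auto intro!: ell2.V_sum ell2.V_scale orth01_ell2)
qed

lemma residual_orth_span:
 assumes g: "g : ell2" and s: "s : cfun.span (e ` {..<N})"
 shows "s : ell2" "ell2_inner (residual N e g) s = 0"
proof -
 define Q where "Q = {v : ell2. ell2_inner (residual N e g) v = 0}"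
 have "cfun.subspace Q" unfolding Q_def
  by (rule cfun.subspaceI) (auto simp: ell2.V_zero ell2.V_add ell2.V_scale ell2.zero_right ell2.add_right ell2.scale_right residual_ell2[OF g])
 moreover have "e ` {..<N} <= Q" unfolding Q_def using residual_orth[OF g] orth01_ell2 by auto
 ultimately have "s : Q" using cfun.span_minimal s by blast
 then show "s : ell2" "ell2_inner (residual N e g) s = 0" unfolding Q_def by auto
qed

lemma residual_span: "g - residual N e g : cfun.span (e ` {..<N})"
 unfolding residual_def by (simp, intro cfun.span_sum cfun.span_scale cfun.span_base) simp

text \<open>The residual is the shortest difference of \<open>g\<close> and the span, by
  Pythagoras.\<close>

lemma residual_sq_le:
 assumes g: "g : ell2" and s: "s : cfun.span (e ` {..<N})"
 shows "ell2.sq (residual N e g) <= ell2.sq (g - s)"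
proof -
 let ?r = "residual N e g"
 have t: "(g - ?r) - s : cfun.span (e ` {..<N})" by (intro cfun.span_diff residual_span s)
 have "ell2.sq (?r + ((g - ?r) - s)) = ell2.sq ?r + ell2.sq ((g - ?r) - s)"
  using ell2.sq_add[OF residual_ell2[OF g] residual_orth_span(1)[OF g t]] residual_orth_span(2)[OF g t] by simp
 then show ?thesis using ell2.sq_nonneg[OF residual_orth_span(1)[OF g t]] by simp
qed

lemma orth01_extend:
 assumes g: "g : ell2" and c: "c = (if ell2.sq (residual N e g) = 0 then 0 else of_real (1 / sqrt (ell2.sq (residual N e g))))"
 defines "e' \<equiv> e(N := cscale c (residual N e g))"
 shows "orth01 (Suc N) e'" "cfun.span (e' ` {..<Suc N}) = cfun.span (insert g (e ` {..<N}))"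
proof -
 let ?r = "residual N e g"
 have r: "?r : ell2" by (rule residual_ell2[OF g])
 have e'k: "e' k = e k" if "k < N" for k unfolding e'_def using that by simp
 have e'N: "e' N = cscale c ?r" unfolding e'_def by simp
 have sqN: "ell2.sq (e' N) = 0 \<or> ell2.sq (e' N) = 1"
 proof (cases "ell2.sq ?r = 0")
  case True
  then show ?thesis unfolding e'N ell2.sq_scale[OF r] by simp
 next
  case False
  then have "ell2.sq ?r > 0" using ell2.sq_nonneg[OF r] by simp
  then show ?thesis unfolding e'N ell2.sq_scale[OF r] using False
   by (simp add: c norm_divide real_sqrt_ge_zero power_divide)
 qed
 have oN: "ell2_inner (e' N) (e j) = 0" "ell2_inner (e j) (e' N) = 0" if j: "j < N" for j
 proof -
  show 1: "ell2_inner (e' N) (e j) = 0"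
   unfolding e'N using residual_orth[OF g j] ell2.scale_left[OF r orth01_ell2[OF j]] by simp
  show "ell2_inner (e j) (e' N) = 0"
   using ell2.commute[of "e' N" "e j"] 1 orth01_ell2[OF j] r unfolding e'N by (simp add: ell2.V_scale)
 qed
 show "orth01 (Suc N) e'"
  unfolding orth01_def
 proof (intro conjI allI impI)
  fix k assume "k < Suc N"
  then have k: "k < N \<or> k = N" by linarith
  then show "e' k : ell2" using orth01_ell2[of k] ell2.V_scale[OF r] e'k[of k] e'N by auto
  have "k < N ==> ell2.sq (e k) = 0 \<or> ell2.sq (e k) = 1" using oe unfolding orth01_def by blast
  then show "ell2.sq (e' k) = 0 \<or> ell2.sq (e' k) = 1" using k sqN e'k[of k] by auto
 next
  fix k j assume "k < Suc N" "j < Suc N" "k ~= j"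
  then consider "k < N" "j < N" | "k = N" "j < N" | "k < N" "j = N" by linarith
  then show "ell2_inner (e' k) (e' j) = 0"
  proof cases
   case 1
   then show ?thesis using oe \<open>k ~= j\<close> unfolding orth01_def by (simp add: e'k)
  qed (simp_all add: e'k oN)
 qed
 let ?S = "e ` {..<N}"
 have im: "e' ` {..<Suc N} = insert (e' N) ?S"
  unfolding lessThan_Suc using e'k by (auto simp: image_iff)
 have gr: "g - ?r : cfun.span ?S" by (rule residual_span)
 have mono: "cfun.span ?S <= cfun.span (insert v ?S)" for v by (rule cfun.span_mono) auto
 show "cfun.span (e' ` {..<Suc N}) = cfun.span (insert g ?S)"
  unfolding im
 proof (rule antisym)
  have "g - (g - ?r) : cfun.span (insert g ?S)"
   by (rule cfun.span_diff) (use gr mono in \<open>auto intro: cfun.span_base\<close>)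
  then have "e' N : cfun.span (insert g ?S)" unfolding e'N by (intro cfun.span_scale) simp
  then show "cfun.span (insert (e' N) ?S) <= cfun.span (insert g ?S)"
   by (intro cfun.span_minimal cfun.subspace_span) (auto intro: cfun.span_base)
  have "?r : cfun.span (insert (e' N) ?S)"
  proof (cases "ell2.sq ?r = 0")
   case True
   then have "?r = 0" using ell2_sq_eq_0_iff[OF r] by simp
   then show ?thesis by (simp add: cfun.span_zero)
  next
   case False
   then have "c ~= 0" unfolding c by simp
   then have "?r = cscale (1 / c) (e' N)" unfolding e'N by simp
   moreover have "cscale (1 / c) (e' N) : cfun.span (insert (e' N) ?S)" by (intro cfun.span_scale cfun.span_base) simp
   ultimately show ?thesis by simp
  qed
  then have "?r + (g - ?r) : cfun.span (insert (e' N) ?S)" using gr mono by (intro cfun.span_add) auto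
  then show "cfun.span (insert g ?S) <= cfun.span (insert (e' N) ?S)"
   by (intro cfun.span_minimal cfun.subspace_span) (auto intro: cfun.span_base)
 qed
qed

text \<open>The number of unit vectors up to and including index \<open>k\<close>. With it
  \<open>ordered\<close> lists the unit vectors without gaps, starting at 1. The selection is
  written as a sum with coefficients 0 and 1, so that it can be repeated for functions with periodic
  measurable coefficients.\<close>

definition position :: "nat => nat" where "position k = card {i : {..k}. i < N & ell2.sq (e i) = 1}"

definition ordered :: "nat => 'a => complex" where
 "ordered j = (\<Sum>k<N. cscale (of_bool (ell2.sq (e k) = 1 & position k = j)) (e k))"

lemma ordered_orthonormal:
 obtains d where "orthonormal d ordered" "cfun.span (ordered ` {1..d}) = cfun.span (e ` {..<N})" "!!j. j ~: {1..d} ==> ordered j = 0"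
proof -
 define I where "I = {i. i < N & ell2.sq (e i) = 1}"
 have fin: "finite I" unfolding I_def by simp
 have rk: "position k = card {i : I. i <= k}" for k
  unfolding position_def I_def by (rule arg_cong[of _ _ card]) auto
 have less: "position k < position m" if "k : I" "m : I" "k < m" for k m
  unfolding rk
 proof (rule psubset_card_mono)
  have "m : {i : I. i <= m} - {i : I. i <= k}" using that by simp
  moreover have "{i : I. i <= k} <= {i : I. i <= m}" using that by auto
  ultimately show "{i : I. i <= k} \<subset> {i : I. i <= m}" by blast
 qed (simp add: fin)
 have inj: "inj_on position I"
 proof (rule inj_onI)
  fix k m assume "k : I" "m : I" "position k = position m"
  then show "k = m" using less[of k m] less[of m k] by (cases k m rule: linorder_cases) auto
 qed
 have im: "position ` I = {1..card I}"
 proof (rule card_subset_eq)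
  show "position ` I <= {1..card I}"
  proof
   fix r assume "r : position ` I"
   then obtain k where k: "k : I" "r = position k" by auto
   have "0 < position k" unfolding rk using k fin by (auto simp: card_gt_0_iff)
   moreover have "position k <= card I" unfolding rk by (rule card_mono[OF fin]) auto
   ultimately show "r : {1..card I}" using k by simp
  qed
 qed (use card_image[OF inj] in auto)
 have or: "ordered (position k) = e k" if k: "k : I" for k
 proof -
  have "ordered (position k) = (\<Sum>i<N. if i = k then e k else 0)"
   unfolding ordered_def
  proof (intro sum.cong refl)
   fix i assume "i : {..<N}"
   then show "cscale (of_bool (ell2.sq (e i) = 1 & position i = position k)) (e i) = (if i = k then e k else 0)"
    using k inj_onD[OF inj, of i k] unfolding I_def by (auto simp: of_bool_def)
  qed
  then show ?thesis using k unfolding I_def by simp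
 qed
 have on: "ell2_inner (ordered (position k)) (ordered (position m)) = (if position k = position m then 1 else 0)" if "k : I" "m : I" for k m
 proof -
  have "ell2_inner (e k) (e m) = (if k = m then 1 else 0)"
  proof (cases "k = m")
   case True
   then show ?thesis using that ell2.ip_self[OF orth01_ell2, of k] unfolding I_def by simp
  next
   case False
   then show ?thesis using that oe unfolding I_def orth01_def by simp
  qed
  moreover have "position k = position m \<longleftrightarrow> k = m" using inj_on_eq_iff[OF inj that] .
  ultimately show ?thesis using or[OF that(1)] or[OF that(2)] by simp
 qed
 have "orthonormal (card I) ordered"
  unfolding orthonormal_def im[symmetric] using on or orth01_ell2 I_def by auto
 moreover have "cfun.span (ordered ` {1..card I}) = cfun.span (e ` {..<N})"
 proof -
  have i: "ordered ` {1..card I} = e ` I" unfolding im[symmetric] image_image using or by simp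
  have "e k : cfun.span (e ` I)" if "k < N" for k
  proof (cases "k : I")
   case False
   then have "ell2.sq (e k) = 0" using that oe unfolding I_def orth01_def by blast
   then have "e k = 0" using ell2_sq_eq_0_iff[OF orth01_ell2[OF that]] by simp
   then show ?thesis by (simp add: cfun.span_zero)
  qed (auto intro: cfun.span_base)
  then have "cfun.span (e ` {..<N}) <= cfun.span (e ` I)"
   by (intro cfun.span_minimal cfun.subspace_span) auto
  moreover have "cfun.span (e ` I) <= cfun.span (e ` {..<N})"
   by (intro cfun.span_mono) (auto simp: I_def)
  ultimately show ?thesis unfolding i by simp
 qed
 moreover have "ordered j = 0" if j: "j ~: {1..card I}" for j
  unfolding ordered_def
 proof (rule sum.neutral, rule ballI)
  fix k assume k: "k : {..<N}"
  have "k : I ==> position k ~= j" using im j by blast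
  then have "of_bool (ell2.sq (e k) = 1 & position k = j) = (0::complex)" using k unfolding I_def by auto
  then show "cscale (of_bool (ell2.sq (e k) = 1 & position k = j)) (e k) = 0" by (simp only: cfun.scale_zero_left)
 qed
 ultimately show ?thesis by (rule that)
qed

end

lemma fib_residual:
 "fib (%x. g x - (\<Sum>k<N. br g (E k) x * E k x)) x = residual N (%k. fib (E k) x) (fib g x)"
 unfolding residual_def
 by (simp add: fun_eq_iff fib_def sum_fun_apply cscale_def periodicD[OF br_periodic]) (simp add: br_def fib_def)

context
 fixes V :: "(real^'k => complex) set"
 assumes V: "char_module V"
begin

text \<open>Each coefficient \<open>br g (E k)\<close> is periodic and measurable, and its product
  with \<open>E k\<close> is dominated in the fibers by \<open>g\<close>, because the fibers of
  \<open>E k\<close> have norm 0 or 1.\<close>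

lemma residual_V:
 assumes EV: "E ` {..<N} <= V" and oe: "AE x in lebesgue. orth01 N (%k. fib (E k) x)" and g: "g : L2"
 shows "(%x. \<Sum>k<N. br g (E k) x * E k x) : V"
proof -
 have E: "E k : V" if "k < N" for k using EV that by auto
 have "(%x. br g (E k) x * E k x) : V" if k: "k < N" for k
 proof (rule periodic_multiplier[OF V _ br_periodic E[OF k]])
  have Ek: "E k : L2" by (rule char_moduleD(2)[OF V E[OF k]])
  show b: "br g (E k) : leb_meas" by (rule br_measurable[OF g Ek])
  show "(%x. br g (E k) x * E k x) : L2"
  proof (rule L2I_fsq(1)[OF _ _ g])
   show "(%x. br g (E k) x * E k x) : leb_meas" using b L2D(1)[OF Ek] by measurable
   show "AE x in lebesgue. x : torus --> fib (%x. br g (E k) x * E k x) x : ell2 & fsq (%x. br g (E k) x * E k x) x <= fsq g x"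
    using oe L2_fib_ell2[OF g]
   proof eventually_elim
    case (elim x)
    show ?case unfolding fsq_def fib_mult[OF br_periodic] unfolding br_def
     using orth01_coefficient_sq[OF elim k] ell2.V_scale[OF orth01_ell2[OF elim(1) k]] by simp
   qed
  qed
 qed
 then have "(\<Sum>k<N. (%x. br g (E k) x * E k x)) : V"
  by (intro cfun.subspace_sum[OF char_moduleD(1)[OF V]]) auto
 moreover have "(\<Sum>k<N. (%x. br g (E k) x * E k x)) = (%x. \<Sum>k<N. br g (E k) x * E k x)"
  by (rule ext) (rule sum_fun_apply)
 ultimately show ?thesis by simp
qed

lemma gram_schmidt:
 assumes "g ` {..<N} <= V"
 shows "\<exists>E. E ` {..<N} <= V & (AE x in lebesgue. orth01 N (%k. fib (E k) x) \<and>
  cfun.span ((%k. fib (E k) x) ` {..<N}) = cfun.span ((%k. fib (g k) x) ` {..<N}))"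
 using assms
proof (induction N)
 case 0
 then show ?case by (simp add: orth01_def)
next
 case (Suc N)
 have "g ` {..<N} <= V" using Suc.prems by auto
 from Suc.IH[OF this] obtain E where E: "E ` {..<N} <= V" and ae: "AE x in lebesgue. orth01 N (%k. fib (E k) x) \<and>
  cfun.span ((%k. fib (E k) x) ` {..<N}) = cfun.span ((%k. fib (g k) x) ` {..<N})"
  by blast
 have gN: "g N : V" using Suc.prems by auto
 have gL: "g N : L2" by (rule char_moduleD(2)[OF V gN])
 define w where "w = (%x. g N x - (\<Sum>k<N. br (g N) (E k) x * E k x))"
 have "AE x in lebesgue. orth01 N (%k. fib (E k) x)" using ae by eventually_elim simp
 from residual_V[OF E this gL] have "g N - (%x. \<Sum>k<N. br (g N) (E k) x * E k x) : V"
  by (intro cfun.subspace_diff[OF char_moduleD(1)[OF V] gN])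
 then have wV: "w : V" unfolding w_def by (simp add: fun_diff_def)
 have wL: "w : L2" by (rule char_moduleD(2)[OF V wV])
 have fw: "fib w x = residual N (%k. fib (E k) x) (fib (g N) x)" for x unfolding w_def by (rule fib_residual)
 define m where "m = (%x. if fsq w x = 0 then 0 else complex_of_real (1 / sqrt (fsq w x)))"
 have mm: "m : leb_meas" unfolding m_def using fsq_measurable[OF wL] by measurable
 have mp: "periodic m" unfolding m_def periodic_def by (simp add: periodicD[OF fsq_periodic])
 define E' where "E' = E(N := (%x. m x * w x))"
 have f': "(%k. fib (E' k) x) = (%k. fib (E k) x)(N := cscale (m x) (fib w x))" for x
  unfolding E'_def by (auto simp: fib_mult[OF mp])
 have key: "AE x in lebesgue. orth01 (Suc N) (%k. fib (E' k) x) \<and>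
  cfun.span ((%k. fib (E' k) x) ` {..<Suc N}) = cfun.span ((%k. fib (g k) x) ` {..<Suc N})"
  using ae L2_fib_ell2[OF gL]
 proof eventually_elim
  case (elim x)
  let ?e = "%k. fib (E k) x" and ?S = "(%k. fib (g k) x) ` {..<N}"
  have c: "m x = (if ell2.sq (residual N ?e (fib (g N) x)) = 0 then 0 else of_real (1 / sqrt (ell2.sq (residual N ?e (fib (g N) x)))))"
   unfolding m_def fsq_def fw ..
  note ext = orth01_extend[OF conjunct1[OF elim(1)] elim(2) c]
  have "cfun.span (insert v (?e ` {..<N})) = cfun.span (insert v ?S)" for v
   using conjunct2[OF elim(1)] by (simp only: cfun.span_insert)
  then show ?case unfolding f' fw using ext by (simp only: lessThan_Suc[of N] image_insert)
 qed
 \<comment> \<open>The factor \<open>m\<close> may be unbounded, so integrability is read off after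
   normalization: the fibers of the product have norm at most 1, those of \<open>tchar 0\<close>
   norm exactly 1.\<close>
 have "(%x. m x * w x) : L2"
 proof (rule L2I_fsq(1)[OF _ _ tchar_L2[of 0]])
  show "(%x. m x * w x) : leb_meas" using mm L2D(1)[OF wL] by measurable
  show "AE x in lebesgue. x : torus --> fib (%x. m x * w x) x : ell2 & fsq (%x. m x * w x) x <= fsq (tchar 0) x"
   using key
  proof eventually_elim
   case (elim x)
   then have "fib (E' N) x : ell2" "ell2.sq (fib (E' N) x) <= 1" unfolding orth01_def by force+
   moreover have "fsq (tchar 0) x = 1"
    unfolding fsq_def fib_tchar_0 ell2.sq_def by (subst ell2_inner_unit) (simp add: unit_family_def)
   ultimately show ?case unfolding E'_def fsq_def by simp
  qed
 qed
 then have "(%x. m x * w x) : V" by (rule periodic_multiplier[OF V mm mp wV])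
 then have "E' ` {..<Suc N} <= V" unfolding E'_def using E by (auto simp: less_Suc_eq)
 with key show ?case by blast
qed

text \<open>In each fiber the unit vectors left by Gram-Schmidt are moved to the first positions.
  Membership in \<open>V\<close> survives, since the selecting coefficients \<open>m j k\<close> are
  periodic and measurable with values 0 and 1.\<close>

theorem orthonormal_sections:
 assumes "g ` {..<N::nat} <= V"
 obtains E where "!!j. E j : V"
  "AE x in lebesgue. \<exists>d. orthonormal d (%j. fib (E j) x) & (\<forall>j. j ~: {1..d} --> fib (E j) x = 0) \<and>
    cfun.span ((%j. fib (E j) x) ` {1..d}) = cfun.span ((%k. fib (g k) x) ` {..<N})"
proof -
 obtain D where DV: "D ` {..<N} <= V" and ae: "AE x in lebesgue. orth01 N (%k. fib (D k) x) \<and>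
  cfun.span ((%k. fib (D k) x) ` {..<N}) = cfun.span ((%k. fib (g k) x) ` {..<N})"
  using gram_schmidt[OF assms] by blast
 have D: "D k : V" if "k < N" for k using DV that by auto
 define rk where "rk = (%x k. card {i : {..k}. i < N & fsq (D i) x = 1})"
 define m where "m = (%j k x. of_bool (fsq (D k) x = 1 & rk x k = j) :: complex)"
 have mp: "periodic (m j k)" for j k
  unfolding m_def rk_def periodic_def by (simp add: periodicD[OF fsq_periodic])
 have mE: "(%x. m j k x * D k x) : V" if k: "k < N" for j k
 proof (rule periodic_multiplier[OF V _ mp D[OF k]])
  have DL: "D i : L2" if "i < N" for i by (rule char_moduleD(2)[OF V D[OF that]])
  have P: "{x. i < N & fsq (D i) x = 1} : sets lebesgue" for i
  proof (cases "i < N")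
   case True
   have "fsq (D i) -` {1} \<inter> space lebesgue : sets lebesgue"
    by (rule measurable_sets[OF fsq_measurable[OF DL[OF True]]]) simp
   then show ?thesis using True by (simp add: vimage_def)
  qed simp
  have rks: "real (rk x k) = (\<Sum>i\<le>k. indicat_real {x. i < N & fsq (D i) x = 1} x)" for x
   unfolding rk_def by (simp add: indicator_def sum.If_cases Int_def conj_commute)
  have rkm: "(%x. real (rk x k)) : leb_meas"
   unfolding rks by (intro borel_measurable_sum borel_measurable_indicator P)
  have "m j k x = indicator {x. k < N & fsq (D k) x = 1} x * (if real (rk x k) = real j then 1 else 0)" for x
   unfolding m_def using k by (simp add: indicator_def)
  then have mf: "m j k = (%x. indicator {x. k < N & fsq (D k) x = 1} x * (if real (rk x k) = real j then 1 else 0))"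
   by (rule ext)
  show mm: "m j k : leb_meas"
   unfolding mf using P[of k] rkm by measurable
  have "cmod (m j k x) <= 1" for x unfolding m_def by simp
  then show "(%x. m j k x * D k x) : L2" by (intro L2_bounded_mult[OF DL[OF k] mm, of 1]) simp
 qed
 define E where "E = (%j. \<Sum>k<N. (%x. m j k x * D k x))"
 show ?thesis
 proof (rule that[of E])
  show "E j : V" for j unfolding E_def by (intro cfun.subspace_sum[OF char_moduleD(1)[OF V]] mE) simp
  show "AE x in lebesgue. \<exists>d. orthonormal d (%j. fib (E j) x) & (\<forall>j. j ~: {1..d} --> fib (E j) x = 0) \<and>
    cfun.span ((%j. fib (E j) x) ` {1..d}) = cfun.span ((%k. fib (g k) x) ` {..<N})"
   using ae
  proof eventually_elim
   case (elim x)
   have "fib (E j) x = ordered N (%k. fib (D k) x) j" for j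
   proof -
    have "fib (E j) x = (\<Sum>k<N. cscale (m j k x) (fib (D k) x))" unfolding E_def fib_sum fib_mult[OF mp] ..
    then show ?thesis unfolding ordered_def[OF conjunct1[OF elim]] m_def rk_def fsq_def
     position_def[OF conjunct1[OF elim]] .
   qed
   then have f: "(%j. fib (E j) x) = ordered N (%k. fib (D k) x)" by (rule ext)
   show ?case
   proof (rule ordered_orthonormal[OF conjunct1[OF elim]])
    fix d
    assume "orthonormal d (ordered N (%k. fib (D k) x))" "!!j. j ~: {1..d} ==> ordered N (%k. fib (D k) x) j = 0"
     "cfun.span (ordered N (%k. fib (D k) x) ` {1..d}) = cfun.span ((%k. fib (D k) x) ` {..<N})"
    then show ?case using conjunct2[OF elim] f fun_cong[OF f] by (intro exI[of _ d]) simp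
   qed
  qed
 qed
qed

end

section \<open>Shift invariant spaces on the Fourier side\<close>

text \<open>Equality is required only almost everywhere, because \<open>L2_fourier\<close> returns
  an arbitrary representative and the plain image would not be a subspace.\<close>

definition fourier_image :: "(real^'k => complex) set => (real^'k => complex) set" where
 "fourier_image W = {g : L2. \<exists>f\<in>W. AE x in lebesgue. L2_fourier f x = g x}"

lemma L2_fourier_diff:
 assumes "f : L2" "g : L2"
 shows "AE x in lebesgue. L2_fourier (f - g) x = (L2_fourier f - L2_fourier g) x"
  "L2.sq (L2_fourier f - L2_fourier g) = L2.sq (f - g)"
proof -
 have "f + cscale (- 1) g = f - g" "L2_fourier f + cscale (- 1) (L2_fourier g) = L2_fourier f - L2_fourier g"
  by (auto simp: cscale_def)
 then show ae: "AE x in lebesgue. L2_fourier (f - g) x = (L2_fourier f - L2_fourier g) x"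
  using L2_fourier_lincomb[OF assms, of "- 1"] by simp
 show "L2.sq (L2_fourier f - L2_fourier g) = L2.sq (f - g)"
  using L2_AE_cong(2)[OF L2_fourier_L2[OF L2.V_diff[OF assms]] ae] L2_fourier_sq[OF L2.V_diff[OF assms]] by (simp add: fun_diff_def)
qed

lemma L2_fourier_0: "AE x in (lebesgue :: (real^'k) measure). L2_fourier 0 x = 0"
proof -
 have "L2.sq (L2_fourier (0 :: real^'k => complex)) = 0"
  by (subst L2_fourier_sq[OF L2.V_zero]) (simp add: L2.sq_def L2.zero_left L2.V_zero)
 then show ?thesis using L2_sq_eq_0_iff[OF L2_fourier_L2[OF L2.V_zero]] by blast
qed

context
 fixes W :: "(real^'k => complex) set"
 assumes W: "shift_invariant W"
begin

lemma W_subspace: "cfun.subspace W" and W_L2: "f : W ==> f : L2" and W_closed: "L2_closure W <= W"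
 and W_translate: "f : W ==> translate (lattice_vec l) f : W"
 using W unfolding shift_invariant_def closed_L2_subspace_def by auto

lemma fourier_image_I: "f : W ==> L2_fourier f : fourier_image W"
 unfolding fourier_image_def using L2_fourier_L2[OF W_L2] by auto

text \<open>Closedness uses the isometry: a convergent sequence of transforms comes from a Cauchy
  sequence in \<open>W\<close>, whose limit lies in \<open>W\<close> and has the required
  transform.\<close>

theorem char_module_fourier_image: "char_module (fourier_image W)"
 unfolding char_module_def
proof (intro conjI allI impI ballI)
 show "fourier_image W <= L2" unfolding fourier_image_def by auto
 show "cfun.subspace (fourier_image W)"
 proof (rule cfun.subspaceI)
  show "0 : fourier_image W"
   unfolding fourier_image_def using L2.V_zero cfun.subspace_0[OF W_subspace] L2_fourier_0 by auto
 next
  fix g g' assume "g : fourier_image W" "g' : fourier_image W"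
  then obtain f f' where f: "f : W" "f' : W" "AE x in lebesgue. L2_fourier f x = g x" "AE x in lebesgue. L2_fourier f' x = g' x"
   and g: "g : L2" "g' : L2" unfolding fourier_image_def by auto
  have "AE x in lebesgue. L2_fourier (f + cscale 1 f') x = (g + g') x"
   using L2_fourier_lincomb[OF W_L2[OF f(1)] W_L2[OF f(2)], of 1] f(3,4) by eventually_elim (simp add: cscale_def)
  moreover have "f + cscale 1 f' : W" by (intro cfun.subspace_add[OF W_subspace] cfun.subspace_scale[OF W_subspace] f)
  ultimately show "g + g' : fourier_image W" unfolding fourier_image_def using L2.V_add[OF g] by blast
 next
  fix c g assume "g : fourier_image W"
  then obtain f where f: "f : W" "AE x in lebesgue. L2_fourier f x = g x" and g: "g : L2" unfolding fourier_image_def by auto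
  have "AE x in lebesgue. L2_fourier (0 + cscale c f) x = (cscale c g) x"
   using L2_fourier_lincomb[OF L2.V_zero W_L2[OF f(1)], of c] f(2) L2_fourier_0 by eventually_elim (simp add: cscale_def)
  moreover have "0 + cscale c f : W" using cfun.subspace_scale[OF W_subspace f(1)] by simp
  ultimately show "cscale c g : fourier_image W" unfolding fourier_image_def using L2.V_scale[OF g] by blast
 qed
next
 fix h :: "nat => real^'k => complex" and g
 assume h: "\<forall>m. h m : fourier_image W" and g: "g : L2" and lim: "(%m. L2.sq (h m - g)) ----> 0"
 have hL: "h m : L2" for m using h unfolding fourier_image_def by auto
 have "\<forall>m. \<exists>f\<in>W. AE x in lebesgue. L2_fourier f x = h m x" using h unfolding fourier_image_def by auto
 then obtain f where f: "!!m. f m : W" and fh: "!!m. AE x in lebesgue. L2_fourier (f m) x = h m x" by metis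
 have fL: "f m : L2" for m by (rule W_L2[OF f])
 have sq: "L2.sq (f m - f k) = L2.sq (h m - h k)" for m k
 proof -
  have "AE x in lebesgue. (L2_fourier (f m) - L2_fourier (f k)) x = (h m - h k) x" using fh[of m] fh[of k] by eventually_elim simp
  from L2_AE_cong(2)[OF L2.V_diff[OF L2_fourier_L2[OF fL] L2_fourier_L2[OF fL]] this] show ?thesis
   using L2_fourier_diff(2)[OF fL fL, of m k] by (simp add: fun_diff_def)
 qed
 have cauchy: "\<exists>N. \<forall>m\<ge>N. \<forall>k\<ge>N. L2.sq (f m - f k) < e" if "e > 0" for e
  unfolding sq by (rule L2.limit_cauchy[OF hL g lim that])
 obtain u where u: "u : L2" and fu: "(%m. L2.sq (f m - u)) ----> 0"
 proof (rule L2_complete[of f])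
  show "f m : L2" for m by (rule fL)
  show "\<exists>N. \<forall>m\<ge>N. \<forall>k\<ge>N. L2.sq (f m - f k) < e" if "e > 0" for e by (rule cauchy[OF that])
 qed (rule that)
 have "u : W"
 proof -
  have "\<exists>v\<in>W. L2_norm (u - v) < e" if "e > 0" for e
  proof -
   have "0 < e\<^sup>2" using that by simp
   with fu have "\<forall>\<^sub>F m in sequentially. L2.sq (f m - u) < e\<^sup>2" by (rule order_tendstoD)
   then obtain m where "L2.sq (f m - u) < e\<^sup>2" by (auto simp: eventually_sequentially)
   then have "sqrt (L2.sq (f m - u)) < sqrt (e\<^sup>2)" by (rule real_sqrt_less_mono)
   then have "L2_norm (u - f m) < e"
    unfolding L2_norm_eq L2.sq_diff_commute[OF u fL] using that by simp
   then show ?thesis using f by blast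
  qed
  then show ?thesis using W_closed u unfolding L2_closure_def by auto
 qed
 moreover have "AE x in lebesgue. L2_fourier u x = g x"
 proof -
  note U = L2_fourier_L2[OF u]
  have b: "L2.sq (L2_fourier u - g) <= 2 * L2.sq (f m - u) + 2 * L2.sq (h m - g)" for m
  proof -
   have "AE x in lebesgue. (L2_fourier u - L2_fourier (f m)) x = (L2_fourier u - h m) x" using fh[of m] by eventually_elim simp
   from L2_AE_cong(2)[OF L2.V_diff[OF U L2_fourier_L2[OF fL]] this]
   have "L2.sq (L2_fourier u - h m) = L2.sq (f m - u)"
    using L2_fourier_diff(2)[OF u fL, of m] L2.sq_diff_commute[OF u fL] by (simp add: fun_diff_def)
   then show ?thesis using L2.sq_triangle_le[OF U hL g, of m] by simp
  qed
  have "(%m. 2 * L2.sq (f m - u) + 2 * L2.sq (h m - g)) ----> 2 * 0 + 2 * 0" by (intro tendsto_intros fu lim)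
  then have "L2.sq (L2_fourier u - g) <= 2 * 0 + 2 * 0" by (rule LIMSEQ_le_const) (use b in auto)
  then have "L2.sq (L2_fourier u - g) = 0" using L2.sq_nonneg[OF L2.V_diff[OF U g]] by simp
  then show ?thesis using L2_sq_eq_0_iff[OF L2.V_diff[OF U g]] by simp
 qed
 ultimately show "g : fourier_image W" unfolding fourier_image_def using g by blast
next
 fix l g assume "g : fourier_image W"
 then obtain f where f: "f : W" "AE x in lebesgue. L2_fourier f x = g x" and g: "g : L2" unfolding fourier_image_def by auto
 have "AE x in lebesgue. L2_fourier (translate (lattice_vec l) f) x = expi (lattice_vec l) x * g x"
  using L2_fourier_translate[OF W_L2[OF f(1)], of "lattice_vec l"] f(2) by eventually_elim simp
 then show "(%x. expi (lattice_vec l) x * g x) : fourier_image W"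
  unfolding fourier_image_def using W_translate[OF f(1)] expi_mult_L2(1)[OF g] by blast
qed

lemma generator_in_W:
 assumes "W = si_span A" "A <= L2" "f : A"
 shows "f : W"
proof -
 have "translate (lattice_vec 0) f = f" unfolding translate_def lattice_vec_0 by simp
 then have "f : cfun.span {translate (lattice_vec l) f |l f. f : A}"
  using assms(3) by (intro cfun.span_base) (auto intro!: exI[of _ 0] exI[of _ f])
 moreover have "L2_norm (f - f) = 0" unfolding L2_norm_eq by (simp add: L2.sq_def L2.zero_left L2.V_zero)
 moreover have "f : L2" using assms(2,3) by blast
 ultimately show ?thesis unfolding assms(1) si_span_def L2_closure_def by (auto intro!: bexI[of _ f])
qed

text \<open>\<open>Q\<close> collects the functions whose fibers lie in the spans
  \<open>S x\<close>, among them all translates of generators. Closedness of \<open>Q\<close> is not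
  proved directly: the fiberwise residual \<open>R\<close> of \<open>f\<close> has norm at most the
  distance from \<open>f\<close> to any element of \<open>Q\<close>, and this distance can be made
  arbitrarily small.\<close>

theorem fiber_in_range:
 assumes gen: "W = si_span A" "A <= L2" "finite A" and f: "f : W"
 shows "AE x in lebesgue. Gam f x : cfun.span ((%h. Gam h x) ` A)"
proof -
 obtain h N where A: "A = h ` {..<N::nat}" using assms(3) unfolding finite_conv_nat_seg_image lessThan_def by blast
 define S where "S = (%x. cfun.span ((%h. Gam h x) ` A))"
 define Q where "Q = {u : L2. AE x in lebesgue. fib (L2_fourier u) x : S x}"
 note V = char_module_fourier_image
 have "(%k. L2_fourier (h k)) ` {..<N} <= fourier_image W"
  using generator_in_W[OF gen(1,2)] fourier_image_I A by auto
 from gram_schmidt[OF V this] obtain E where E: "E ` {..<N} <= fourier_image W"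
  and ae0: "AE x in lebesgue. orth01 N (%k. fib (E k) x) \<and>
    cfun.span ((%k. fib (E k) x) ` {..<N}) = cfun.span ((%k. fib (L2_fourier (h k)) x) ` {..<N})" by blast
 have ae: "AE x in lebesgue. orth01 N (%k. fib (E k) x) & S x = cfun.span ((%k. fib (E k) x) ` {..<N})"
  using ae0 unfolding S_def A image_image Gam_fib by eventually_elim simp
 have oe: "AE x in lebesgue. orth01 N (%k. fib (E k) x)" using ae by eventually_elim simp
 have Ss: "cfun.subspace (S x)" for x unfolding S_def by (rule cfun.subspace_span)
 have Qadd: "u + cscale c v : Q" if "u : Q" "v : Q" for c u v
 proof -
  have uv: "u : L2" "v : L2" and a: "AE x in lebesgue. fib (L2_fourier u) x : S x" "AE x in lebesgue. fib (L2_fourier v) x : S x"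
   using that unfolding Q_def by auto
  have "AE x in lebesgue. fib (L2_fourier (u + cscale c v)) x : S x"
   using a fib_AE_cong[OF L2_fourier_lincomb[OF uv, of c]]
  proof eventually_elim
   case (elim x)
   then show ?case unfolding elim(3) fib_add fib_cscale by (intro cfun.subspace_add[OF Ss] cfun.subspace_scale[OF Ss])
  qed
  then show ?thesis unfolding Q_def using L2.V_add[OF uv(1) L2.V_scale[OF uv(2)]] by simp
 qed
 have Q0: "0 : Q"
 proof -
  have "AE x in lebesgue. L2_fourier 0 x = 0 x" using L2_fourier_0 by simp
  from fib_AE_cong[OF this] have "AE x in lebesgue. fib (L2_fourier 0) x : S x"
  proof eventually_elim
   case (elim x)
   moreover have "fib (%x. 0) x = 0" unfolding fib_def by auto
   ultimately show ?case using cfun.subspace_0[OF Ss] by simp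
  qed
  then show ?thesis unfolding Q_def using L2.V_zero by simp
 qed
 have Qs: "cfun.subspace Q"
 proof (rule cfun.subspaceI[OF Q0])
  show "u + v : Q" if "u : Q" "v : Q" for u v using Qadd[OF that, of 1] by simp
  show "cscale c v : Q" if "v : Q" for c v using Qadd[OF Q0 that, of c] by simp
 qed
 have "translate (lattice_vec l) u : Q" if u: "u : A" for l u
 proof -
  have uL: "u : L2" using u gen(2) by auto
  have "AE x in lebesgue. fib (L2_fourier (translate (lattice_vec l) u)) x : S x"
   using fib_AE_cong[OF L2_fourier_translate[OF uL, of "lattice_vec l"]]
  proof eventually_elim
   case (elim x)
   show ?case unfolding elim fib_mult[OF expi_lattice_periodic] unfolding S_def Gam_fib
    by (intro cfun.span_scale cfun.span_base) (use u in auto)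
  qed
  then show ?thesis unfolding Q_def using translate_L2(1)[OF uL] by simp
 qed
 then have spanQ: "cfun.span {translate (lattice_vec l) f |l f. f : A} <= Q"
  by (intro cfun.span_minimal[OF _ Qs]) auto
 have fL: "f : L2" by (rule W_L2[OF f])
 note G = L2_fourier_L2[OF fL]
 define s where "s = (%x. \<Sum>k<N. br (L2_fourier f) (E k) x * E k x)"
 define R where "R = L2_fourier f - s"
 have sL: "s : L2" unfolding s_def by (rule char_moduleD(2)[OF V residual_V[OF V E oe G]])
 have RL: "R : L2" unfolding R_def by (rule L2.V_diff[OF G sL])
 have fR: "fib R x = residual N (%k. fib (E k) x) (fib (L2_fourier f) x)" for x
  using fib_residual[where g="L2_fourier f" and N=N and E=E and x=x] unfolding R_def s_def by (simp add: fun_diff_def)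
 have le: "L2.sq R <= L2.sq (f - q)" if q: "q : Q" for q
 proof -
  have qL: "q : L2" and qa: "AE x in lebesgue. fib (L2_fourier q) x : S x" using q unfolding Q_def by auto
  have "L2.sq R <= L2.sq (L2_fourier f - L2_fourier q)"
  proof (rule L2I_fsq(2)[OF L2D(1)[OF RL] _ L2.V_diff[OF G L2_fourier_L2[OF qL]]])
   show "AE x in lebesgue. x : torus --> fib R x : ell2 & fsq R x <= fsq (L2_fourier f - L2_fourier q) x"
    using ae qa L2_fib_ell2[OF G]
   proof eventually_elim
    case (elim x)
    have s: "fib (L2_fourier q) x : cfun.span ((%k. fib (E k) x) ` {..<N})" using elim(1,2) by simp
    show ?case unfolding fsq_def fR fib_diff
     using residual_sq_le[OF conjunct1[OF elim(1)] elim(3) s] residual_ell2[OF conjunct1[OF elim(1)] elim(3)] by simp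
   qed
  qed
  then show ?thesis using L2_fourier_diff(2)[OF fL qL] by simp
 qed
 have "L2.sq R <= 0"
 proof (rule field_le_epsilon)
  fix e :: real assume e: "0 < e"
  then have "0 < sqrt e" by simp
  then obtain q where q: "q : Q" "L2_norm (f - q) < sqrt e"
   using f spanQ unfolding gen(1) si_span_def L2_closure_def by blast
  then show "L2.sq R <= 0 + e" using le[OF q(1)] unfolding L2_norm_eq by simp
 qed
 then have "L2.sq R = 0" using L2.sq_nonneg[OF RL] by simp
 then have "AE x in lebesgue. R x = 0 x" using L2_sq_eq_0_iff[OF RL] by simp
 from ae fib_AE_cong[OF this] show ?thesis
 proof eventually_elim
  case (elim x)
  have "fib (%x. 0) x = 0" unfolding fib_def by auto
  then have "residual N (%k. fib (E k) x) (fib (L2_fourier f) x) = 0" using elim(2) fR[of x] by simp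
  then show ?case
   using residual_span[OF conjunct1[OF elim(1)], of "fib (L2_fourier f) x"] elim(1) unfolding S_def Gam_fib by simp
 qed
qed

end

section \<open>Bessel families and bounded fibers\<close>

lemma has_sum_Times_finite:
 fixes c :: "'a => 'b => real"
 assumes "finite I" "!!i. i : I ==> ((%l. c l i) has_sum s i) A"
 shows "((%(l, i). c l i) has_sum (\<Sum>i\<in>I. s i)) (A \<times> I)"
 using assms
proof (induction I rule: finite_induct)
 case (insert i I)
 have "(((%(l, i). c l i) \<circ> (%l. (l, i))) has_sum s i) A" using insert.prems[of i] by (simp add: comp_def)
 then have "((%(l, i). c l i) has_sum s i) ((%l. (l, i)) ` A)" by (subst has_sum_reindex) (auto simp: inj_on_def)
 moreover have "(%l. (l, i)) ` A = A \<times> {i}" by auto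
 ultimately have "((%(l, i). c l i) has_sum s i) (A \<times> {i})" by simp
 moreover have "((%(l, i). c l i) has_sum (\<Sum>i\<in>I. s i)) (A \<times> I)" by (rule insert.IH) (simp add: insert.prems)
 ultimately have "((%(l, i). c l i) has_sum (s i + (\<Sum>i\<in>I. s i))) (A \<times> {i} \<union> A \<times> I)"
  by (rule has_sum_Un_disjoint) (use insert.hyps in auto)
 moreover have "A \<times> {i} \<union> A \<times> I = A \<times> insert i I" by auto
 ultimately show ?case using insert by simp
qed simp

text \<open>A bound on the fibers of \<open>h\<close> makes the bracket square integrable over the
  torus, by the Cauchy-Schwarz inequality in the fibers; the Parseval identity for translates then
  applies.\<close>

lemma bounded_fiber_parseval:
 assumes f: "f : L2" and h: "h : L2" and C: "AE x in lebesgue. fsq (L2_fourier h) x <= C"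
 shows "integrable lebesgue (%x. indicator torus x * (cmod (br (L2_fourier f) (L2_fourier h) x))\<^sup>2)"
  and "((%l. (cmod (L2_inner f (translate (lattice_vec l) h)))\<^sup>2) has_sum
   (LINT x|lebesgue. indicator torus x * (cmod (br (L2_fourier f) (L2_fourier h) x))\<^sup>2)) UNIV"
  and "(LINT x|lebesgue. indicator torus x * (cmod (br (L2_fourier f) (L2_fourier h) x))\<^sup>2) <= C * L2.sq f"
proof -
 note F = L2_fourier_L2[OF f] and H = L2_fourier_L2[OF h]
 note bm = br_measurable[OF F H]
 have ae: "AE x in lebesgue. norm (indicator torus x * (cmod (br (L2_fourier f) (L2_fourier h) x))\<^sup>2)
   <= C * (indicator torus x * fsq (L2_fourier f) x)"
  using L2_fib_ell2[OF F] L2_fib_ell2[OF H] C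
 proof eventually_elim
  case (elim x)
  have "(cmod (br (L2_fourier f) (L2_fourier h) x))\<^sup>2 <= fsq (L2_fourier f) x * fsq (L2_fourier h) x"
   unfolding br_def fsq_def by (rule ell2.Cauchy_Schwarz_sq[OF elim(1,2)])
  also have "... <= fsq (L2_fourier f) x * C"
   using elim(3) ell2.sq_nonneg[OF elim(1)] unfolding fsq_def by (intro mult_left_mono)
  finally show ?case by (simp add: indicator_def mult.commute)
 qed
 have m: "(%x. indicator torus x * (cmod (br (L2_fourier f) (L2_fourier h) x))\<^sup>2) : leb_meas"
  using bm torus_lebesgue by measurable
 have i: "integrable lebesgue (%x. C * (indicator torus x * fsq (L2_fourier f) x))"
  using fsq_integral(1)[OF F] by simp
 show int: "integrable lebesgue (%x. indicator torus x * (cmod (br (L2_fourier f) (L2_fourier h) x))\<^sup>2)"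
  by (rule Bochner_Integration.integrable_bound[OF i m]) (use ae in eventually_elim, auto)
 have "(%x. indicator torus x * br (L2_fourier f) (L2_fourier h) x) : L2"
 proof -
  have "(cmod (indicator torus x * z))\<^sup>2 = indicator torus x * (cmod z)\<^sup>2" for x :: "real^'a" and z
   by (simp add: indicator_def)
  moreover have "(%x. indicator torus x * br (L2_fourier f) (L2_fourier h) x) : leb_meas"
   using bm torus_lebesgue by measurable
  ultimately show ?thesis unfolding L2_def using int by simp
 qed
 from translates_parseval[OF f h this]
 show "((%l. (cmod (L2_inner f (translate (lattice_vec l) h)))\<^sup>2) has_sum
   (LINT x|lebesgue. indicator torus x * (cmod (br (L2_fourier f) (L2_fourier h) x))\<^sup>2)) UNIV" .
 have "(LINT x|lebesgue. indicator torus x * (cmod (br (L2_fourier f) (L2_fourier h) x))\<^sup>2)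
  <= (LINT x|lebesgue. C * (indicator torus x * fsq (L2_fourier f) x))"
  by (rule integral_mono_AE[OF int i]) (use ae in eventually_elim, auto)
 also have "... = C * L2.sq f" using fsq_integral(2)[OF F] L2_fourier_sq[OF f] by simp
 finally show "(LINT x|lebesgue. indicator torus x * (cmod (br (L2_fourier f) (L2_fourier h) x))\<^sup>2) <= C * L2.sq f" .
qed

lemma bounded_family_parseval:
 assumes f: "f : L2" and F: "F ` {1..n} <= L2" and C: "\<forall>i\<in>{1..n::nat}. AE x in lebesgue. fsq (L2_fourier (F i)) x <= C"
 defines "s \<equiv> LINT x|lebesgue. indicator torus x * (\<Sum>i\<in>{1..n}. (cmod (br (L2_fourier f) (L2_fourier (F i)) x))\<^sup>2)"
 shows "integrable lebesgue (%x. indicator torus x * (\<Sum>i\<in>{1..n}. (cmod (br (L2_fourier f) (L2_fourier (F i)) x))\<^sup>2))"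
  and "((%(l, i). (cmod (L2_inner f (translate (lattice_vec l) (F i))))\<^sup>2) has_sum s) (UNIV \<times> {1..n})"
  and "s <= real n * C * L2.sq f"
proof -
 let ?s = "%i. LINT x|lebesgue. indicator torus x * (cmod (br (L2_fourier f) (L2_fourier (F i)) x))\<^sup>2"
 have b: "F i : L2" "AE x in lebesgue. fsq (L2_fourier (F i)) x <= C" if "i : {1..n}" for i using F C that by auto
 note B = bounded_fiber_parseval[OF f b]
 show "integrable lebesgue (%x. indicator torus x * (\<Sum>i\<in>{1..n}. (cmod (br (L2_fourier f) (L2_fourier (F i)) x))\<^sup>2))"
  unfolding sum_distrib_left by (intro Bochner_Integration.integrable_sum B(1))
 have s: "s = (\<Sum>i\<in>{1..n}. ?s i)"
  unfolding s_def sum_distrib_left by (rule Bochner_Integration.integral_sum) (rule B(1))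
 show "((%(l, i). (cmod (L2_inner f (translate (lattice_vec l) (F i))))\<^sup>2) has_sum s) (UNIV \<times> {1..n})"
  unfolding s by (rule has_sum_Times_finite) (simp, rule B(2))
 have "s <= (\<Sum>i\<in>{1..n}. C * L2.sq f)" unfolding s by (rule sum_mono) (rule B(3))
 then show "s <= real n * C * L2.sq f" by simp
qed

theorem bounded_imp_bessel:
 assumes F: "F ` {1..n} <= L2" and C: "\<forall>i\<in>{1..n::nat}. AE x in lebesgue. fsq (L2_fourier (F i)) x <= C"
 shows "bessel n F"
 unfolding bessel_def
proof (intro exI[of _ "real n * \<bar>C\<bar> + 1"] conjI ballI)
 fix f :: "real^'a => complex" assume f: "f : L2"
 note P = bounded_family_parseval[OF f F C]
 show "(%(l, i). (cmod (L2_inner f (translate (lattice_vec l) (F i))))\<^sup>2) summable_on UNIV \<times> {1..n}"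
  using P(2) by (rule has_sum_imp_summable)
 have "real n * C <= real n * \<bar>C\<bar>" by (intro mult_left_mono) auto
 then have "real n * C * L2.sq f <= (real n * \<bar>C\<bar> + 1) * L2.sq f"
  using L2.sq_nonneg[OF f] by (intro mult_right_mono) auto
 then show "(\<Sum>\<^sub>\<infinity>(l, i)\<in>UNIV \<times> {1..n}. (cmod (L2_inner f (translate (lattice_vec l) (F i))))\<^sup>2) <= (real n * \<bar>C\<bar> + 1) * (L2_norm f)\<^sup>2"
  unfolding infsumI[OF P(2)] L2_norm_sq using P(3) by linarith
qed (simp add: add_nonneg_pos)

text \<open>The Bessel inequality is tested on the functions with Fourier transform \<open>1\<^sub>B h\<close>, where \<open>B\<close>
 is a set on which the norm of the fiber of \<open>h\<close> is bounded but exceeds the Bessel bound.\<close>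

theorem bessel_imp_bounded:
 assumes W: "shift_invariant W" and F: "F ` {1..n} <= W" and bes: "bessel n F"
 shows "\<exists>b. \<forall>i\<in>{1..n}. AE x in lebesgue. fsq (L2_fourier (F i)) x <= b"
proof -
 obtain b where b: "b > 0" and B: "!!f. f : L2 ==>
   (%(l, i). (cmod (L2_inner f (translate (lattice_vec l) (F i))))\<^sup>2) summable_on (UNIV \<times> {1..n})"
  "!!f. f : L2 ==> (\<Sum>\<^sub>\<infinity>(l, i)\<in>UNIV \<times> {1..n}. (cmod (L2_inner f (translate (lattice_vec l) (F i))))\<^sup>2) <= b * (L2_norm f)\<^sup>2"
  using bes unfolding bessel_def by blast
 have "AE x in lebesgue. fsq (L2_fourier (F i)) x <= b" if i: "i : {1..n}" for i
 proof -
  define h where "h = L2_fourier (F i)"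
  have Fi: "F i : W" using F i by auto
  then have Fi: "F i : W" "F i : L2" using W_L2[OF W] by blast+
  have hL: "h : L2" unfolding h_def by (rule L2_fourier_L2[OF Fi(2)])
  have hV: "h : fourier_image W" unfolding h_def by (rule fourier_image_I[OF W Fi(1)])
  have "AE x in lebesgue. x : torus --> \<not> (b < fsq h x & fsq h x <= real N)" for N
  proof -
   \<comment> \<open>The upper cut at \<open>N\<close> makes the bracket with \<open>h\<close>
     bounded on the test set, so that the Parseval identity can be used before the boundedness of
     the fibers is known.\<close>
   define m where "m = (%x. indicat_real {x. b < fsq h x & fsq h x <= real N} x)"
   have mp: "periodic (%x. complex_of_real (m x))"
    unfolding periodic_def m_def by (simp add: periodicD[OF fsq_periodic] indicator_def)
   have fm: "fsq h : leb_meas" by (rule fsq_measurable[OF hL])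
   have "{x : space lebesgue. b < fsq h x & fsq h x <= real N} : sets lebesgue" using fm by measurable
   then have mm [measurable]: "m : leb_meas" unfolding m_def by (intro borel_measurable_indicator) simp
   have mc: "(%x. complex_of_real (m x)) : leb_meas" by measurable
   have gL: "(%x. of_real (m x) * h x) : L2"
    by (rule L2_bounded_mult[OF hL mc, of 1]) (simp add: m_def indicator_def)
   have "(%x. of_real (m x) * h x) : fourier_image W"
    by (rule periodic_multiplier[OF char_module_fourier_image[OF W] mc mp hV gL])
   then obtain f where f: "f : W" "AE x in lebesgue. L2_fourier f x = of_real (m x) * h x" unfolding fourier_image_def by auto
   have fL: "f : L2" by (rule W_L2[OF W f(1)])
   have br': "AE x in lebesgue. br (L2_fourier f) h x = of_real (m x * fsq h x)"
    using fib_AE_cong[OF f(2)] L2_fib_ell2[OF hL]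
   proof eventually_elim
    case (elim x)
    have "br (L2_fourier f) h x = ell2_inner (cscale (of_real (m x)) (fib h x)) (fib h x)"
     unfolding br_def elim(1) fib_mult[OF mp] ..
    then show ?case using ell2.scale_left[OF elim(2) elim(2)] ell2.ip_self[OF elim(2)] unfolding fsq_def by simp
   qed
   have fs: "AE x in lebesgue. fsq (L2_fourier f) x = m x * fsq h x"
    using fib_AE_cong[OF f(2)] L2_fib_ell2[OF hL]
   proof eventually_elim
    case (elim x)
    have "fsq (L2_fourier f) x = (m x)\<^sup>2 * fsq h x"
     unfolding fsq_def elim(1) fib_mult[OF mp] ell2.sq_scale[OF elim(2)] by simp
    then show ?case unfolding m_def by (simp add: indicator_def)
   qed
   let ?v = "%x. indicat_real torus x * (m x * fsq h x)" and ?w = "%x. indicat_real torus x * (m x * (fsq h x)\<^sup>2)"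
   have vm [measurable]: "?v : leb_meas" "?w : leb_meas"
    using fm torus_lebesgue by measurable
   have vi: "integrable lebesgue ?v" and vs: "L2.sq f = (LINT x|lebesgue. ?v x)"
   proof -
    note I = fsq_integral[OF L2_fourier_L2[OF fL]]
    have a: "AE x in lebesgue. indicat_real torus x * fsq (L2_fourier f) x = ?v x" using fs by eventually_elim simp
    show "integrable lebesgue ?v" by (rule integrable_cong_AE_imp[OF I(1) vm(1)]) (use a in eventually_elim, simp)
    show "L2.sq f = (LINT x|lebesgue. ?v x)"
     using integral_cong_AE[OF borel_measurable_integrable[OF I(1)] vm(1) a] I(2) L2_fourier_sq[OF fL] by simp
   qed
   have u: "(%x. indicator torus x * br (L2_fourier f) h x) : L2"
   proof -
    have "(%x. complex_of_real (m x * fsq h x) * tchar 0 x) : L2"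
    proof (rule L2_bounded_mult[OF tchar_L2, of _ "real N"])
     show "(%x. complex_of_real (m x * fsq h x)) : leb_meas" using fm by measurable
     show "AE x in lebesgue. cmod (of_real (m x * fsq h x)) <= real N"
      using fsq_nonneg_AE[OF hL] by eventually_elim (auto simp: m_def indicator_def)
    qed
    moreover have "AE x in lebesgue. complex_of_real (m x * fsq h x) * tchar 0 x = indicator torus x * br (L2_fourier f) h x"
     using br' by eventually_elim (simp add: tchar_0)
    ultimately show ?thesis by (rule L2_AE_cong(1))
   qed
   have a: "AE x in lebesgue. indicat_real torus x * (cmod (br (L2_fourier f) h x))\<^sup>2 = ?w x"
    using br' by eventually_elim (simp add: m_def indicator_def power_mult_distrib)
   have wi: "integrable lebesgue ?w" and ws: "(LINT x|lebesgue. indicat_real torus x * (cmod (br (L2_fourier f) h x))\<^sup>2) = (LINT x|lebesgue. ?w x)"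
   proof -
    have "AE x in lebesgue. norm (?w x) <= norm (real N * ?v x)"
     using fsq_nonneg_AE[OF hL] by eventually_elim (auto simp: m_def indicator_def power2_eq_square intro!: mult_right_mono)
    moreover have "integrable lebesgue (%x. real N * ?v x)" using vi by simp
    ultimately show "integrable lebesgue ?w" by (intro Bochner_Integration.integrable_bound[OF _ vm(2)])
    have [measurable]: "br (L2_fourier f) h : leb_meas" by (rule br_measurable[OF L2_fourier_L2[OF fL] hL])
    show "(LINT x|lebesgue. indicat_real torus x * (cmod (br (L2_fourier f) h x))\<^sup>2) = (LINT x|lebesgue. ?w x)"
     by (rule integral_cong_AE[OF _ vm(2) a]) (use torus_lebesgue in measurable)
   qed
   have hs: "((%l. (cmod (L2_inner f (translate (lattice_vec l) (F i))))\<^sup>2) has_sum (LINT x|lebesgue. ?w x)) UNIV"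
    using translates_parseval[OF fL Fi(2) u[unfolded h_def]] ws unfolding h_def by simp
   have "(LINT x|lebesgue. ?w x) <= b * (L2_norm f)\<^sup>2"
   proof (rule has_sum_le_finite_sums[OF hs])
    fix Y :: "(int^'a) set" assume Y: "finite Y"
    have "(\<Sum>l\<in>Y. (cmod (L2_inner f (translate (lattice_vec l) (F i))))\<^sup>2)
     = (\<Sum>(l, i)\<in>Y \<times> {i}. (cmod (L2_inner f (translate (lattice_vec l) (F i))))\<^sup>2)"
     by (simp add: sum.cartesian_product[symmetric])
    also have "... <= (\<Sum>\<^sub>\<infinity>(l, i)\<in>UNIV \<times> {1..n}. (cmod (L2_inner f (translate (lattice_vec l) (F i))))\<^sup>2)"
     by (rule finite_sum_le_infsum[OF B(1)[OF fL]]) (use Y i in auto)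
    also have "... <= b * (L2_norm f)\<^sup>2" by (rule B(2)[OF fL])
    finally show "(\<Sum>l\<in>Y. (cmod (L2_inner f (translate (lattice_vec l) (F i))))\<^sup>2) <= b * (L2_norm f)\<^sup>2" .
   qed
   \<comment> \<open>With s for \<open>fsq h x\<close>, the Bessel bound makes the integral of s (s
     - b) over the part of the test set in the torus at most 0, although the integrand is positive
     there. So that part is a null set.\<close>
   then have "(LINT x|lebesgue. ?w x - b * ?v x) <= 0"
    unfolding L2_norm_sq vs using vi wi by simp
   moreover have nn: "AE x in lebesgue. 0 <= ?w x - b * ?v x"
   proof (rule AE_I2)
    fix x
    have "b * fsq h x <= (fsq h x)\<^sup>2" if "b < fsq h x" using that b by (simp add: power2_eq_square)
    then show "0 <= ?w x - b * ?v x" by (simp add: m_def indicator_def)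
   qed
   moreover have wv: "integrable lebesgue (%x. ?w x - b * ?v x)" using vi wi by simp
   ultimately have "(LINT x|lebesgue. ?w x - b * ?v x) = 0"
    using integral_nonneg_AE[OF nn] by linarith
   then have "AE x in lebesgue. ?w x - b * ?v x = 0"
    using integral_nonneg_eq_0_iff_AE[OF wv nn] by simp
   then show ?thesis
   proof eventually_elim
    case (elim x)
    show ?case
    proof (intro impI notI)
     assume x: "x : torus" "b < fsq h x & fsq h x <= real N"
     then have "fsq h x * (fsq h x - b) = 0" using elim by (simp add: m_def power2_eq_square algebra_simps)
     then show False using x b by simp
    qed
   qed
  qed
  then have "AE x in lebesgue. \<forall>N. x : torus --> \<not> (b < fsq h x & fsq h x <= real N)" unfolding AE_all_countable by (rule allI)
  then have "AE x in lebesgue. x : torus --> fsq h x <= b"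
  proof eventually_elim
   case (elim x)
   obtain N where "fsq h x <= real N" using real_arch_simple by blast
   then show ?case using elim by (meson not_less)
  qed
  then show ?thesis unfolding h_def[symmetric]
   by (rule AE_periodic) (simp add: periodic_def periodicD[OF fsq_periodic])
 qed
 then show ?thesis by blast
qed

section \<open>Spectra of Bessel families\<close>

text \<open>The sections \<open>E\<close> are an orthonormal basis of \<open>J x\<close> at the
  positions up to \<open>d x\<close> and vanish beyond; they stand in for the original generators.
  The dimension \<open>d\<close> enters without measurability, which is derived from the
  sections.\<close>

locale fsi =
 fixes W :: "(real^'k => complex) set" and J :: "real^'k => (int^'k => complex) set"
  and d :: "real^'k => nat" and Z :: "nat => (real^'k) set" and p :: "nat => real"
  and n L :: nat and alp :: "nat => real" and E :: "nat => real^'k => complex"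
 assumes W: "shift_invariant W"
  and dL: "AE x in lebesgue. x : torus --> d x <= L"
  and Z: "Z i = {x : torus. d x = i}" and p: "p i = measure lebesgue (Z i)"
  and E: "E j : fourier_image W"
  and Eon: "AE x in lebesgue. x : torus --> orthonormal (d x) (%j. fib (E j) x) \<and>
   (\<forall>j. j ~: {1..d x} --> fib (E j) x = 0) & J x = cfun.span ((%j. fib (E j) x) ` {1..d x})"
  and rng: "f : W ==> AE x in lebesgue. x : torus --> Gam f x : J x"
begin

text \<open>The dimensions that occur with positive measure. Dimension 0 is excluded, since the
  fibers of functions in \<open>W\<close> vanish there.\<close>

definition R :: "nat set" where "R = {i : {1..L}. 0 < p i}"

abbreviation ZM :: "nat => (real^'k) measure" where "ZM i \<equiv> restrict_space lebesgue (Z i)"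

lemma finite_R: "finite R" and R_D: "i : R ==> 1 <= i" "i : R ==> i <= L" "i : R ==> 0 < p i"
 unfolding R_def by auto

lemma E_L2: "E j : L2"
 using E unfolding fourier_image_def by auto

text \<open>Almost everywhere on the torus the sum of the \<open>fsq (E j)\<close> counts the unit
  vectors of the fiber and so equals \<open>d x\<close>.\<close>

lemma Z_sets [measurable]: "Z i : sets lebesgue"
proof -
 let ?s = "%x. \<Sum>j\<in>{1..L}. fsq (E j) x"
 have s: "?s : leb_meas" by (intro borel_measurable_sum fsq_measurable E_L2)
 have "(%x. if ?s x = real i then indicat_real torus x else 0) : leb_meas"
  using s torus_lebesgue by measurable
 then have "indicat_real (Z i) : leb_meas"
 proof (rule borel_measurable_AE)
  show "AE x in lebesgue. (if ?s x = real i then indicat_real torus x else 0) = indicat_real (Z i) x"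
   using dL Eon
  proof eventually_elim
   case (elim x)
   show ?case
   proof (cases "x : torus")
    case True
    then have on: "orthonormal (d x) (%j. fib (E j) x)" and z: "\<forall>j. j ~: {1..d x} --> fib (E j) x = 0" and "d x <= L"
     using elim by auto
    have "fsq (E j) x = (if j : {1..d x} then 1 else 0)" for j
     using orthonormalD(2)[OF on, of j j] z unfolding fsq_def ell2.sq_def by (auto simp: ell2.zero_left ell2.V_zero)
    then have "?s x = (\<Sum>j\<in>{1..L}. if j : {1..d x} then 1 else 0)" by simp
    also have "... = (\<Sum>j\<in>{1..L} \<inter> {1..d x}. 1)" by (rule sum.inter_restrict[symmetric]) simp
    also have "{1..L} \<inter> {1..d x} = {1..d x}" using \<open>d x <= L\<close> by auto
    finally have "?s x = real (d x)" by simp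
    then show ?thesis using True by (simp add: Z indicator_def)
   qed (simp add: Z)
  qed
 qed
 then show ?thesis by (simp add: borel_measurable_indicator_iff)
qed

lemma Z_lmeasurable: "Z i : lmeasurable"
 by (rule fmeasurableI2[OF torus_lmeasurable _ Z_sets]) (auto simp: Z)

lemma space_ZM: "space (ZM i) = Z i" by (simp add: space_restrict_space)

lemma ZM_measure: "measure (ZM i) (space (ZM i)) = p i"
 unfolding space_ZM p by (rule measure_restrict_space) auto

lemma ZM_finite: "finite_measure (ZM i)"
proof (rule finite_measureI)
 have "emeasure (ZM i) (space (ZM i)) = emeasure lebesgue (Z i)"
  unfolding space_ZM by (rule emeasure_restrict_space) auto
 then show "emeasure (ZM i) (space (ZM i)) ~= \<infinity>" using fmeasurableD2[OF Z_lmeasurable[of i]] by (simp add: top.not_eq_extremum)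
qed

lemma AE_ZM: "(AE x in ZM i. P x) \<longleftrightarrow> (AE x in lebesgue. x : Z i --> P x)"
 by (rule AE_restrict_space_iff) simp

lemma ZM_measurable: "f : leb_meas ==> f : borel_measurable (ZM i)"
 by (rule measurable_restrict_space1)

lemma ZM_integral:
 fixes f :: "real^'k => real"
 shows "integrable (ZM i) f \<longleftrightarrow> integrable lebesgue (%x. indicator (Z i) x * f x)"
  "(LINT x|ZM i. f x) = (LINT x|lebesgue. indicator (Z i) x * f x)"
 using integrable_restrict_space[of "Z i" lebesgue f] integral_restrict_space[of "Z i" lebesgue f] by simp_all

lemma AE_R: "AE x in lebesgue. x : torus --> d x = 0 \<or> d x : R"
proof -
 have "AE x in lebesgue. p i = 0 --> x ~: Z i" for i
 proof (cases "p i = 0")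
  case True
  then have "emeasure lebesgue (Z i) = 0" using emeasure_eq_measure2[OF Z_lmeasurable] p[of i] by simp
  then have "Z i : null_sets lebesgue" using Z_sets by (rule null_setsI)
  then show ?thesis using AE_not_in by fastforce
 qed simp
 then have "AE x in lebesgue. \<forall>i. p i = 0 --> x ~: Z i" by (simp add: AE_all_countable)
 with dL show ?thesis
 proof eventually_elim
  case (elim x)
  show ?case
  proof (intro impI)
   assume x: "x : torus"
   then have "p (d x) ~= 0" using elim(2) by (auto simp: Z)
   moreover have "0 <= p (d x)" unfolding p by simp
   ultimately have "0 < p (d x)" by linarith
   then show "d x = 0 \<or> d x : R" using elim(1) x unfolding R_def by auto
  qed
 qed
qed

lemma torus_split:
 fixes f :: "real^'k => real"
 assumes z: "AE x in lebesgue. x : torus --> d x = 0 --> f x = 0" and int: "\<forall>i\<in>R. integrable (ZM i) f"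
 shows "integrable lebesgue (%x. indicator torus x * f x)"
  "(LINT x|lebesgue. indicator torus x * f x) = (\<Sum>i\<in>R. LINT x|ZM i. f x)"
proof -
 have i: "integrable lebesgue (%x. indicator (Z i) x * f x)" if "i : R" for i
  using int that ZM_integral(1) by blast
 have s: "integrable lebesgue (%x. \<Sum>i\<in>R. indicator (Z i) x * f x)" by (rule Bochner_Integration.integrable_sum[OF i])
 have ae: "AE x in lebesgue. (\<Sum>i\<in>R. indicator (Z i) x * f x) = indicator torus x * f x"
  using z AE_R
 proof eventually_elim
  case (elim x)
  show ?case
  proof (cases "x : torus")
   case True
   have "(\<Sum>i\<in>R. indicator (Z i) x * f x) = (\<Sum>i\<in>R. if i = d x then f x else 0)"
    using True by (intro sum.cong) (auto simp: Z indicator_def)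
   then show ?thesis using True elim finite_R by auto
  qed (simp add: Z)
 qed
 have m: "(%x. indicator torus x * f x) : leb_meas"
  by (rule borel_measurable_AE[OF borel_measurable_integrable[OF s] ae])
 show "integrable lebesgue (%x. indicator torus x * f x)" by (rule integrable_cong_AE_imp[OF s m]) (use ae in eventually_elim, auto)
 have "(LINT x|lebesgue. indicator torus x * f x) = (LINT x|lebesgue. (\<Sum>i\<in>R. indicator (Z i) x * f x))"
  by (rule integral_cong_AE[OF m borel_measurable_integrable[OF s]]) (use ae in eventually_elim, auto)
 also have "... = (\<Sum>i\<in>R. LINT x|lebesgue. indicator (Z i) x * f x)" by (rule Bochner_Integration.integral_sum) (rule i)
 finally show "(LINT x|lebesgue. indicator torus x * f x) = (\<Sum>i\<in>R. LINT x|ZM i. f x)" unfolding ZM_integral(2) .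
qed

lemma fsq_W:
 assumes f: "f : W"
 shows "AE x in lebesgue. x : torus --> d x = 0 --> fsq (L2_fourier f) x = 0"
  and "integrable (ZM i) (fsq (L2_fourier f))"
  and "L2.sq f = (\<Sum>i\<in>R. LINT x|ZM i. fsq (L2_fourier f) x)"
proof -
 have fL: "f : L2" by (rule W_L2[OF W f])
 note I = fsq_integral[OF L2_fourier_L2[OF fL]]
 show z: "AE x in lebesgue. x : torus --> d x = 0 --> fsq (L2_fourier f) x = 0"
  using rng[OF f] Eon by eventually_elim (auto simp: fsq_def Gam_fib ell2.sq_def ell2.zero_left ell2.V_zero)
 show i: "integrable (ZM i) (fsq (L2_fourier f))" for i
 proof -
  have "integrable lebesgue (%x. indicat_real (Z i) x *\<^sub>R (indicator torus x * fsq (L2_fourier f) x))"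
   by (rule integrable_mult_indicator[OF Z_sets I(1)])
  moreover have "(%x. indicat_real (Z i) x *\<^sub>R (indicator torus x * fsq (L2_fourier f) x)) = (%x. indicator (Z i) x * fsq (L2_fourier f) x)"
   by (rule ext) (simp add: Z indicator_def)
  ultimately show ?thesis unfolding ZM_integral(1) by (simp only:)
 qed
 show "L2.sq f = (\<Sum>i\<in>R. LINT x|ZM i. fsq (L2_fourier f) x)"
  using torus_split(2)[OF z] i I(2) L2_fourier_sq[OF fL] by simp
qed

lemma R_nonempty:
 assumes "f : W" "L2_norm f ~= 0"
 shows "R ~= {}"
 using fsq_W(3)[OF assms(1)] assms(2) unfolding L2_norm_eq by auto

context
 fixes F
 assumes F: "F : bessel_prescribed n alp W"
begin

lemma F_W: "r : {1..n} ==> F r : W" and F_sq: "r : {1..n} ==> L2.sq (F r) = alp r" and F_bessel: "bessel n F"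
 using F unfolding bessel_prescribed_def L2_norm_sq by auto

definition good :: "real^'k => bool" where
 "good x \<longleftrightarrow> x : torus & d x <= L & (%r. Gam (F r) x) ` {1..n} <= J x \<and>
   (\<exists>e l. spectral_res (fop n (%r. Gam (F r) x)) (d x) e l & J x = cfun.span (e ` {1..d x}))"

text \<open>The value 0 on exceptional fibers, and at the meaningless index 0, lets sign, order and
  vanishing beyond \<open>d x\<close> hold at every point instead of almost everywhere.\<close>

definition lam :: "real^'k => nat => real" where
 "lam x j = (if good x & 1 <= j then eigval j (frame_op_fiber n F x) else 0)"

lemma frame_op_fiber_fop: "frame_op_fiber n F x = fop n (%r. Gam (F r) x)"
 by (rule ext) (simp add: frame_op_fiber_def fop_def)

lemma good_spectral:
 assumes "good x"
 obtains e where "spectral_res (fop n (%r. Gam (F r) x)) (d x) e (lam x)" "J x = cfun.span (e ` {1..d x})"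
proof -
 obtain e l where res: "spectral_res (fop n (%r. Gam (F r) x)) (d x) e l" and J: "J x = cfun.span (e ` {1..d x})"
  using assms unfolding good_def by auto
 have "lam x j = l j" for j
  using eigval_res[OF res, of j] res_zero[OF res, of 0] assms unfolding lam_def frame_op_fiber_fop by (cases "j = 0") auto
 then have "lam x = l" by (rule ext)
 then show ?thesis using that res J by simp
qed

lemma AE_good: "AE x in lebesgue. x : torus --> good x"
proof -
 have "AE x in lebesgue. \<forall>r\<in>{1..n}. x : torus --> Gam (F r) x : J x"
  by (intro AE_ball_countable[THEN iffD2] ballI rng F_W) auto
 with dL Eon show ?thesis
 proof eventually_elim
  case (elim x)
  show ?case
  proof
   assume x: "x : torus"
   then have on: "orthonormal (d x) (%j. fib (E j) x)" and J: "J x = cfun.span ((%j. fib (E j) x) ` {1..d x})"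
    and vJ: "(%r. Gam (F r) x) ` {1..n} <= J x" using elim by auto
   have dim: "cfun.dim (J x) = d x" unfolding J by (rule dim_span_orthonormal[OF on])
   have H: "finite ((%j. fib (E j) x) ` {1..d x})" "(%j. fib (E j) x) ` {1..d x} <= ell2" using orthonormalD(1)[OF on] by auto
   obtain e l where "spectral_res (fop n (%r. Gam (F r) x)) (cfun.dim (J x)) e l" "J x = cfun.span (e ` {1..cfun.dim (J x)})"
    using fop_spectral[OF vJ H J] by blast
   then show "good x" unfolding good_def dim using x elim vJ by blast
  qed
 qed
qed

lemma lam_nonneg: "0 <= lam x j"
proof (cases "good x")
 case True
 obtain e where e: "spectral_res (fop n (%r. Gam (F r) x)) (d x) e (lam x)" by (rule good_spectral[OF True])
 show ?thesis by (rule res_nonneg[OF e])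
qed (simp add: lam_def)

lemma lam_mono: "1 <= j ==> j <= k ==> lam x k <= lam x j"
proof (cases "good x")
 case True
 obtain e where e: "spectral_res (fop n (%r. Gam (F r) x)) (d x) e (lam x)" by (rule good_spectral[OF True])
 show "1 <= j ==> j <= k ==> lam x k <= lam x j" by (rule res_mono[OF e])
qed (simp add: lam_def)

lemma lam_zero: "j ~: {1..d x} ==> lam x j = 0"
proof (cases "good x")
 case True
 obtain e where e: "spectral_res (fop n (%r. Gam (F r) x)) (d x) e (lam x)" by (rule good_spectral[OF True])
 show "j ~: {1..d x} ==> lam x j = 0" by (rule res_zero[OF e])
qed (simp add: lam_def)

text \<open>The power sums of the eigenvalues are traces of powers of the Gram matrix, whose entries
  are polynomials in brackets.\<close>

lemma lam_measurable: "(%x. lam x j) : leb_meas"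
proof (cases "j : {1..L}")
 case True
 have FL: "r : {1..n} ==> L2_fourier (F r) : L2" for r by (intro L2_fourier_L2 W_L2[OF W] F_W)
 have gp: "(%x. gram_power n (%r. Gam (F r) x) k r s) : leb_meas" if "r : {1..n}" "s : {1..n}" for k r s
  using that
 proof (induction k arbitrary: s)
  case 0
  then show ?case using br_measurable[OF FL FL, of r s] by (simp add: br_def[abs_def] Gam_fib)
 next
  case (Suc k)
  have "(%x. gram_power n (%r. Gam (F r) x) k r t * br (L2_fourier (F t)) (L2_fourier (F s)) x) : leb_meas"
   if t: "t : {1..n}" for t using Suc t br_measurable[OF FL FL, of t s] by (intro borel_measurable_times) auto
  then show ?case by (simp add: br_def Gam_fib)
 qed
 show ?thesis
 proof (rule measurable_from_power_sums[OF lam_nonneg lam_mono])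
  fix k
  let ?g = "%x. indicator torus x * Re (\<Sum>r\<in>{1..n}. gram_power n (%r. Gam (F r) x) k r r)"
  have "(%x. \<Sum>r\<in>{1..n}. gram_power n (%r. Gam (F r) x) k r r) : leb_meas"
   by (intro borel_measurable_sum gp)
  then have "?g : leb_meas" using torus_lebesgue by measurable
  then show "(%x. \<Sum>j\<in>{1..L}. lam x j ^ Suc k) : leb_meas"
  proof (rule borel_measurable_AE)
   show "AE x in lebesgue. ?g x = (\<Sum>j\<in>{1..L}. lam x j ^ Suc k)"
    using AE_good
   proof eventually_elim
    case (elim x)
    show ?case
    proof (cases "x : torus")
     case True
     then have g: "good x" using elim by simp
     obtain e where e: "spectral_res (fop n (%r. Gam (F r) x)) (d x) e (lam x)" "J x = cfun.span (e ` {1..d x})"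
      by (rule good_spectral[OF g])
     have vJ: "(%r. Gam (F r) x) ` {1..n} <= J x" using g unfolding good_def by simp
     have "?g x = (\<Sum>j\<in>{1..d x}. lam x j ^ Suc k)"
      using True gram_power_trace[OF vJ e(2,1), of k] by (simp del: of_real_sum power_Suc)
     also have "... = (\<Sum>j\<in>{1..L}. lam x j ^ Suc k)"
      using g lam_zero[of _ x] unfolding good_def by (intro sum.mono_neutral_left) auto
     finally show ?thesis .
    next
     case False
     then have "lam x j = 0" for j unfolding lam_def good_def by simp
     then show ?thesis using False by simp
    qed
   qed
  qed
 qed (use True in auto)
next
 case False
 have "lam x j = 0" for x
 proof (cases "good x")
  case True
  then show ?thesis using False lam_zero[of j x] unfolding good_def by auto
 qed (simp add: lam_def)
 then show ?thesis by simp
qed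

lemma good_weights:
 assumes g: "good x"
 shows "T <= {1..n} ==> (\<Sum>r\<in>T. fsq (L2_fourier (F r)) x) <= (\<Sum>j\<in>{1..card T}. lam x j)"
  and "(\<Sum>r\<in>{1..n}. fsq (L2_fourier (F r)) x) = (\<Sum>j\<in>{1..d x}. lam x j)"
  and "Re (ell2_trace (%xi. fun_calc phi (frame_op_fiber n F x) (ell2_proj (J x) xi))) = (\<Sum>j\<in>{1..d x}. phi (lam x j))"
  and "xi : J x ==> (!!j. j : {1..d x} ==> c <= lam x j) ==>
   c * ell2.sq xi <= (\<Sum>r\<in>{1..n}. (cmod (ell2_inner xi (Gam (F r) x)))\<^sup>2)"
proof -
 obtain e where e: "spectral_res (fop n (%r. Gam (F r) x)) (d x) e (lam x)" "J x = cfun.span (e ` {1..d x})"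
  by (rule good_spectral[OF g])
 have vJ: "(%r. Gam (F r) x) ` {1..n} <= J x" using g unfolding good_def by simp
 show "(\<Sum>r\<in>T. fsq (L2_fourier (F r)) x) <= (\<Sum>j\<in>{1..card T}. lam x j)" if "T <= {1..n}"
  using schur_majorization[OF vJ e(2,1) that] by (simp add: fsq_def Gam_fib)
 show "(\<Sum>r\<in>{1..n}. fsq (L2_fourier (F r)) x) = (\<Sum>j\<in>{1..d x}. lam x j)"
  using fop_total[OF vJ e(2,1)] by (simp add: fsq_def Gam_fib)
 show "Re (ell2_trace (%xi. fun_calc phi (frame_op_fiber n F x) (ell2_proj (J x) xi))) = (\<Sum>j\<in>{1..d x}. phi (lam x j))"
  unfolding frame_op_fiber_fop by (rule trace_res[OF e])
 show "c * ell2.sq xi <= (\<Sum>r\<in>{1..n}. (cmod (ell2_inner xi (Gam (F r) x)))\<^sup>2)"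
  if "xi : J x" "!!j. j : {1..d x} ==> c <= lam x j"
  by (rule fop_lower_bound[OF vJ e(2,1)]) (use that in auto)
qed

text \<open>Each eigenvalue is at most the trace, which is the sum of the squared fiber norms, and
  these are bounded for a Bessel family.\<close>

lemma lam_bounded: "\<exists>B. AE x in lebesgue. \<forall>j. lam x j <= B"
proof -
 have "F ` {1..n} <= W" using F_W by auto
 then obtain b where "\<forall>i\<in>{1..n}. AE x in lebesgue. fsq (L2_fourier (F i)) x <= b"
  using bessel_imp_bounded[OF W _ F_bessel] by blast
 then have "AE x in lebesgue. \<forall>i\<in>{1..n}. fsq (L2_fourier (F i)) x <= b"
  by (intro AE_ball_countable[THEN iffD2]) auto
 then have "AE x in lebesgue. \<forall>j. lam x j <= \<bar>real n * b\<bar>"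
 proof eventually_elim
  case (elim x)
  show ?case
  proof
   fix j
   show "lam x j <= \<bar>real n * b\<bar>"
   proof (cases "good x & j : {1..d x}")
    case True
    have "lam x j <= (\<Sum>j\<in>{1..d x}. lam x j)" using True lam_nonneg by (intro member_le_sum) auto
    also have "... = (\<Sum>r\<in>{1..n}. fsq (L2_fourier (F r)) x)" by (rule good_weights(2)[symmetric]) (use True in simp)
    also have "... <= (\<Sum>r\<in>{1..n}. b)" by (rule sum_mono) (use elim in simp)
    also have "... <= \<bar>real n * b\<bar>" by simp
    finally show ?thesis .
   next
    case False
    then have "lam x j = 0" using lam_zero[of j x] by (auto simp: lam_def)
    then show ?thesis by simp
   qed
  qed
 qed
 then show ?thesis by blast
qed

lemma lam_integrable:
 assumes phi: "phi : Conv"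
 shows "integrable (ZM i) (%x. lam x j)" "integrable (ZM i) (%x. phi (lam x j))"
proof -
 interpret finite_measure "ZM i" by (rule ZM_finite)
 obtain B where B: "AE x in lebesgue. \<forall>j. lam x j <= B" using lam_bounded by blast
 have B': "AE x in ZM i. lam x j <= B" unfolding AE_ZM using B by eventually_elim simp
 have m: "(%x. lam x j) : borel_measurable (ZM i)" by (rule ZM_measurable[OF lam_measurable])
 show "integrable (ZM i) (%x. lam x j)"
  by (rule integrable_const_bound[OF _ m, of B]) (use B' in eventually_elim, use lam_nonneg in auto)
 have c: "convex_on {0..} phi" using phi unfolding Conv_def by simp
 show "integrable (ZM i) (%x. phi (lam x j))"
 proof (rule integrable_const_bound[OF _ convex_Ici_measurable[OF c m lam_nonneg], of "max (phi 0) (phi B)"])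
  show "AE x in ZM i. norm (phi (lam x j)) <= max (phi 0) (phi B)"
   using B' by eventually_elim (use convex_Ici_bounded[OF phi lam_nonneg] in force)
 qed
qed

lemma convex_potential_eq:
 assumes phi: "phi : Conv"
 shows "convex_potential phi J n F = (\<Sum>i\<in>R. \<Sum>j\<in>{1..i}. LINT x|ZM i. phi (lam x j))"
proof -
 let ?g = "%x. \<Sum>j\<in>{1..d x}. phi (lam x j)"
 let ?t = "%x. Re (ell2_trace (%xi. fun_calc phi (frame_op_fiber n F x) (ell2_proj (J x) xi)))"
 have gi: "?g x = (\<Sum>j\<in>{1..i}. phi (lam x j))" if "x : space (ZM i)" for i x using that unfolding space_ZM Z by simp
 have int: "integrable (ZM i) ?g" for i
 proof -
  have "integrable (ZM i) (%x. \<Sum>j\<in>{1..i}. phi (lam x j))" by (intro Bochner_Integration.integrable_sum lam_integrable(2)[OF phi])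
  moreover have "integrable (ZM i) ?g \<longleftrightarrow> integrable (ZM i) (%x. \<Sum>j\<in>{1..i}. phi (lam x j))"
   by (rule Bochner_Integration.integrable_cong[OF refl gi])
  ultimately show ?thesis by simp
 qed
 have z: "AE x in lebesgue. x : torus --> d x = 0 --> ?g x = 0" by simp
 have int': "\<forall>i\<in>R. integrable (ZM i) ?g" using int by simp
 note S = torus_split[OF z int']
 have ae: "AE x in lebesgue. indicator torus x * ?g x = indicator torus x * ?t x"
  using AE_good by eventually_elim (auto simp: indicator_def good_weights(3))
 have m: "(%x. indicator torus x * ?t x) : leb_meas"
  by (rule borel_measurable_AE[OF borel_measurable_integrable[OF S(1)] ae])
 have "convex_potential phi J n F = (LINT x|lebesgue. indicator torus x * ?t x)"
  unfolding convex_potential_def set_lebesgue_integral_def by simp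
 also have "... = (LINT x|lebesgue. indicator torus x * ?g x)"
  by (rule integral_cong_AE[OF m borel_measurable_integrable[OF S(1)]]) (use ae in eventually_elim, auto)
 also have "... = (\<Sum>i\<in>R. LINT x|ZM i. ?g x)" by (rule S(2))
 also have "... = (\<Sum>i\<in>R. LINT x|ZM i. (\<Sum>j\<in>{1..i}. phi (lam x j)))"
  by (rule sum.cong[OF refl], rule Bochner_Integration.integral_cong[OF refl gi])
 also have "... = (\<Sum>i\<in>R. \<Sum>j\<in>{1..i}. LINT x|ZM i. phi (lam x j))"
  by (rule sum.cong[OF refl], rule Bochner_Integration.integral_sum) (rule lam_integrable(2)[OF phi])
 finally show ?thesis .
qed

text \<open>Means over \<open>Z i\<close>; outside \<open>R\<close> the value is the one that
  \<open>feasible\<close> prescribes.\<close>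

definition ma :: "nat => nat => real" where
 "ma i r = (if i : R & r : {1..n} then (LINT x|ZM i. fsq (L2_fourier (F r)) x) / p i else 0)"

definition mlam :: "nat => nat => real" where
 "mlam i j = (if i : R then (LINT x|ZM i. lam x j) / p i else 0)"

text \<open>The conditions hold in almost every fiber and are linear, so integration preserves them;
  multiplying the means by \<open>p i\<close> and summing restores the full norms
  \<open>alp r\<close>.\<close>

lemma averages_feasible:
 assumes phi: "phi : Conv"
 shows "feasible R p n alp ma mlam"
proof (rule feasibleI)
 note li = lam_integrable(1)[OF phi]
 have aeg: "AE x in ZM i. good x & d x = i" for i
  unfolding AE_ZM using AE_good by eventually_elim (auto simp: Z)
 have sma: "(\<Sum>r\<in>T. ma i r) = (LINT x|ZM i. (\<Sum>r\<in>T. fsq (L2_fourier (F r)) x)) / p i"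
  and ima: "integrable (ZM i) (%x. \<Sum>r\<in>T. fsq (L2_fourier (F r)) x)" if T: "T <= {1..n}" and i: "i : R" for T i
 proof -
  have fi: "integrable (ZM i) (fsq (L2_fourier (F r)))" if "r : T" for r
   using fsq_W(2)[OF F_W, of r] that T by auto
  show "integrable (ZM i) (%x. \<Sum>r\<in>T. fsq (L2_fourier (F r)) x)" by (rule Bochner_Integration.integrable_sum[OF fi])
  have "(\<Sum>r\<in>T. ma i r) = (\<Sum>r\<in>T. (LINT x|ZM i. fsq (L2_fourier (F r)) x) / p i)"
   unfolding ma_def using T i by (intro sum.cong) auto
  also have "... = (\<Sum>r\<in>T. LINT x|ZM i. fsq (L2_fourier (F r)) x) / p i" by (rule sum_divide_distrib[symmetric])
  also have "(\<Sum>r\<in>T. LINT x|ZM i. fsq (L2_fourier (F r)) x) = (LINT x|ZM i. (\<Sum>r\<in>T. fsq (L2_fourier (F r)) x))"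
   by (rule Bochner_Integration.integral_sum[symmetric]) (rule fi)
  finally show "(\<Sum>r\<in>T. ma i r) = (LINT x|ZM i. (\<Sum>r\<in>T. fsq (L2_fourier (F r)) x)) / p i" .
 qed
 have sml: "(\<Sum>j\<in>K. mlam i j) = (LINT x|ZM i. (\<Sum>j\<in>K. lam x j)) / p i" if "i : R" for K i
  unfolding mlam_def Bochner_Integration.integral_sum[OF li] using that by (simp add: sum_divide_distrib)
 show "0 <= ma i r" for i r
 proof (cases "i : R & r : {1..n}")
  case True
  have "AE x in ZM i. 0 <= fsq (L2_fourier (F r)) x"
   unfolding AE_ZM using fsq_nonneg_AE[OF L2_fourier_L2[OF W_L2[OF W F_W]], of r] True by auto
  then show ?thesis unfolding ma_def using True R_D(3)[of i] by (auto intro!: divide_nonneg_pos integral_nonneg_AE)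
 qed (auto simp: ma_def)
 show "ma i r = 0" if "i ~: R \<or> r ~: {1..n}" for i r using that by (auto simp: ma_def)
 show "0 <= mlam i j" for i j
  unfolding mlam_def using R_D(3)[of i] lam_nonneg by (auto intro!: divide_nonneg_pos Bochner_Integration.integral_nonneg)
 show "mlam i j = 0" if "i ~: R \<or> j ~: {1..i}" for i j
 proof (cases "i : R")
  case True
  then have "lam x j = 0" if "x : space (ZM i)" for x
   using that lam_zero[of j x] \<open>i ~: R \<or> j ~: {1..i}\<close> unfolding space_ZM Z by auto
  then have "(LINT x|ZM i. lam x j) = (LINT x|ZM i. 0)" by (intro Bochner_Integration.integral_cong) auto
  then show ?thesis by (simp add: mlam_def)
 qed (simp add: mlam_def)
 show "mlam i (Suc j) <= mlam i j" if "1 <= j" for i j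
 proof -
  have "0 <= p i" unfolding p by simp
  then show ?thesis unfolding mlam_def using lam_mono[OF that, of "Suc j"]
   by (auto intro!: divide_right_mono integral_mono li)
 qed
 show "(\<Sum>r\<in>T. ma i r) <= (\<Sum>j\<in>{1..card T}. mlam i j)" if T: "T <= {1..n}" for i T
 proof (cases "i : R")
  case True
  have "(LINT x|ZM i. (\<Sum>r\<in>T. fsq (L2_fourier (F r)) x)) <= (LINT x|ZM i. (\<Sum>j\<in>{1..card T}. lam x j))"
  proof (rule integral_mono_AE[OF ima[OF T True] Bochner_Integration.integrable_sum[OF li]])
   show "AE x in ZM i. (\<Sum>r\<in>T. fsq (L2_fourier (F r)) x) <= (\<Sum>j\<in>{1..card T}. lam x j)"
    using aeg[of i] by eventually_elim (use good_weights(1)[OF _ T] in auto)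
  qed
  then show ?thesis unfolding sma[OF T True] sml[OF True] using R_D(3)[OF True] by (intro divide_right_mono) auto
 qed (simp add: ma_def mlam_def)
 show "(\<Sum>r\<in>{1..n}. ma i r) = (\<Sum>j\<in>{1..i}. mlam i j)" for i
 proof (cases "i : R")
  case True
  have "(LINT x|ZM i. (\<Sum>r\<in>{1..n}. fsq (L2_fourier (F r)) x)) = (LINT x|ZM i. (\<Sum>j\<in>{1..i}. lam x j))"
  proof (rule integral_cong_AE[OF borel_measurable_integrable borel_measurable_integrable])
   show "integrable (ZM i) (%x. \<Sum>r\<in>{1..n}. fsq (L2_fourier (F r)) x)" by (rule ima[OF subset_refl True])
   show "integrable (ZM i) (%x. \<Sum>j\<in>{1..i}. lam x j)" by (rule Bochner_Integration.integrable_sum[OF li])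
   show "AE x in ZM i. (\<Sum>r\<in>{1..n}. fsq (L2_fourier (F r)) x) = (\<Sum>j\<in>{1..i}. lam x j)"
    using aeg[of i] by eventually_elim (use good_weights(2) in auto)
  qed
  then show ?thesis unfolding sma[OF subset_refl True] sml[OF True] by simp
 qed (simp add: ma_def mlam_def)
 show "(\<Sum>i\<in>R. p i * ma i r) = alp r" if r: "r : {1..n}" for r
 proof -
  have "(\<Sum>i\<in>R. p i * ma i r) = (\<Sum>i\<in>R. LINT x|ZM i. fsq (L2_fourier (F r)) x)"
  proof (intro sum.cong refl)
   fix i assume i: "i : R"
   then have "p i ~= 0" using R_D(3)[of i] by simp
   then show "p i * ma i r = (LINT x|ZM i. fsq (L2_fourier (F r)) x)" using i r by (simp add: ma_def)
  qed
  then show ?thesis using fsq_W(3)[OF F_W[OF r]] F_sq[OF r] by simp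
 qed
qed

text \<open>Jensen's inequality for each dimension and each eigenvalue separately. All differences
  being nonnegative, equality of the totals forces equality in every single instance.\<close>

lemma potential_averages:
 assumes phi: "phi : Conv"
 shows "potential R p phi mlam <= convex_potential phi J n F"
  and "phi : Conv_s ==> convex_potential phi J n F <= potential R p phi mlam ==> i : R ==> j : {1..i} ==>
   AE x in lebesgue. x : Z i --> lam x j = mlam i j"
proof -
 have c: "convex_on {0..} phi" using phi unfolding Conv_def by simp
 have pos: "0 < measure (ZM i) (space (ZM i))" if "i : R" for i using R_D(3)[OF that] unfolding ZM_measure .
 note jen = jensen_Ici[OF ZM_finite pos c lam_nonneg lam_integrable[OF phi], unfolded ZM_measure]
 have m: "(LINT x|ZM i. lam x j) / p i = mlam i j" if "i : R" for i j using that by (simp add: mlam_def)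
 have le: "p i * phi (mlam i j) <= (LINT x|ZM i. phi (lam x j))" if "i : R" for i j
  using jen(1)[OF that, of j] m[OF that] by simp
 have pot: "potential R p phi mlam = (\<Sum>i\<in>R. \<Sum>j\<in>{1..i}. p i * phi (mlam i j))"
  unfolding potential_def by (simp add: sum_distrib_left)
 show "potential R p phi mlam <= convex_potential phi J n F"
  unfolding pot convex_potential_eq[OF phi] by (intro sum_mono le)
 show "AE x in lebesgue. x : Z i --> lam x j = mlam i j"
  if s: "phi : Conv_s" and eq: "convex_potential phi J n F <= potential R p phi mlam" and i: "i : R" and j: "j : {1..i}"
 proof -
  have "(\<Sum>i\<in>R. \<Sum>j\<in>{1..i}. (LINT x|ZM i. phi (lam x j)) - p i * phi (mlam i j)) <= 0"
   using eq unfolding pot convex_potential_eq[OF phi] sum_subtractf by simp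
  moreover have nn: "0 <= (LINT x|ZM i. phi (lam x j)) - p i * phi (mlam i j)" if "i : R" for i j using le[OF that] by simp
  ultimately have "(\<Sum>i\<in>R. \<Sum>j\<in>{1..i}. (LINT x|ZM i. phi (lam x j)) - p i * phi (mlam i j)) = 0"
   by (intro antisym sum_nonneg) auto
  then have "(\<Sum>j\<in>{1..i}. (LINT x|ZM i. phi (lam x j)) - p i * phi (mlam i j)) = 0"
   using sum_nonneg_eq_0_iff[OF finite_R, of "%i. \<Sum>j\<in>{1..i}. (LINT x|ZM i. phi (lam x j)) - p i * phi (mlam i j)"] nn i
   by (simp add: sum_nonneg)
  then have "(LINT x|ZM i. phi (lam x j)) - p i * phi (mlam i j) = 0"
   using sum_nonneg_eq_0_iff[of "{1..i}" "%j. (LINT x|ZM i. phi (lam x j)) - p i * phi (mlam i j)"] nn[OF i] j by simp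
  then have "(LINT x|ZM i. phi (lam x j)) <= p i * phi ((LINT x|ZM i. lam x j) / p i)" unfolding m[OF i] by simp
  from jen(2)[OF i s this] show ?thesis unfolding m[OF i] AE_ZM .
 qed
qed

end

end

section \<open>Optimal families\<close>

context fsi
begin

text \<open>For each dimension the Horn half supplies one constant matrix of coordinates with
  respect to the sections \<open>E\<close>. The glued coefficients are bounded, measurable and
  periodic, so the generators stay in the Fourier image of \<open>W\<close>; their fibers have
  bounded norm, which gives the Bessel property.\<close>

lemma realization:
 assumes feas: "feasible R p n alp a psi"
 shows "\<exists>F\<in>bessel_prescribed n alp W. AE x in lebesgue. x : torus -->
  (\<forall>j\<ge>1. eigval j (frame_op_fiber n F x) = psi (d x) j)"
proof -
 note f = feasibleD[OF feas]
 note V = char_module_fourier_image[OF W]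
 have "\<exists>M. (\<forall>r\<in>{1..n}. (\<Sum>j\<in>{1..i}. (M r j)\<^sup>2) = a i r) \<and>
  (\<forall>j\<in>{1..i}. \<forall>k\<in>{1..i}. (\<Sum>r\<in>{1..n}. M r j * M r k) = (if j = k then psi i j else (0::real)))" for i
 proof (rule matrix_with_row_norms[where psi="psi i" and a="a i" and d=i and n=n])
  show "0 <= psi i j" for j by (rule f(3))
  show "psi i (Suc j) <= psi i j" if "1 <= j" for j by (rule f(5)[OF that])
  show "psi i j = 0" if "j ~: {1..i} \<or> n < j" for j using that f(4) feasible_zero_beyond[OF feas] by blast
  show "(\<Sum>r\<in>T. a i r) <= (\<Sum>j\<in>{1..card T}. psi i j)" if "T <= {1..n}" for T by (rule f(6)[OF that])
  show "(\<Sum>r\<in>{1..n}. a i r) = (\<Sum>j\<in>{1..i}. psi i j)" by (rule f(7))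
 qed blast
 then have "\<forall>i. \<exists>M. (\<forall>r\<in>{1..n}. (\<Sum>j\<in>{1..i}. (M r j)\<^sup>2) = a i r) \<and>
  (\<forall>j\<in>{1..i}. \<forall>k\<in>{1..i}. (\<Sum>r\<in>{1..n}. M r j * M r k) = (if j = k then psi i j else (0::real)))" by (rule allI)
 then obtain M where M: "\<forall>i. (\<forall>r\<in>{1..n}. (\<Sum>j\<in>{1..i}. (M i r j)\<^sup>2) = a i r) \<and>
  (\<forall>j\<in>{1..i}. \<forall>k\<in>{1..i}. (\<Sum>r\<in>{1..n}. M i r j * M i r k) = (if j = k then psi i j else (0::real)))"
  unfolding choice_iff by blast
 \<comment> \<open>The periodic extension of the indicator of \<open>Z i\<close>, written as a
   bracket in order to have periodicity and measurability at once.\<close>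
 define z :: "nat => real^'k => complex" where "z = (%i. br (indicator (Z i)) (tchar 0))"
 have zL: "(indicator (Z i) :: real^'k => complex) : L2" for i
 proof -
  have "(%x. indicator (Z i) x * tchar 0 x) : L2"
   by (rule L2_bounded_mult[OF tchar_L2, of _ 1]) (auto intro: borel_measurable_indicator simp: indicator_def)
  moreover have "(%x. indicator (Z i) x * tchar 0 x) = (indicator (Z i) :: real^'k => complex)"
   by (rule ext) (simp add: tchar_0 Z indicator_def)
  ultimately show ?thesis by simp
 qed
 have zm: "z i : leb_meas" and zp: "periodic (z i)" for i
  unfolding z_def by (rule br_measurable[OF zL tchar_L2], rule br_periodic)
 have z1: "cmod (z i x) <= 1" for i x unfolding z_def br_tchar_0 by (simp add: indicator_def)
 define c where "c = (%r j x. \<Sum>i\<in>R. complex_of_real (M i r j) * z i x)"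
 have cm: "c r j : leb_meas" for r j unfolding c_def using zm by measurable
 have cp: "periodic (c r j)" for r j unfolding c_def periodic_def by (simp add: periodicD[OF zp])
 have c1: "cmod (c r j x) <= (\<Sum>i\<in>R. \<bar>M i r j\<bar>)" for r j x
 proof -
  have "cmod (c r j x) <= (\<Sum>i\<in>R. cmod (complex_of_real (M i r j) * z i x))" unfolding c_def by (rule norm_sum)
  also have "... <= (\<Sum>i\<in>R. \<bar>M i r j\<bar>)"
   by (rule sum_mono) (use z1 in \<open>simp add: norm_mult mult_left_le\<close>)
  finally show ?thesis .
 qed
 define g where "g = (%r. \<Sum>j\<in>{1..L}. (%x. c r j x * E j x))"
 have "(%x. c r j x * E j x) : fourier_image W" for r j
  by (rule periodic_multiplier[OF V cm cp E L2_bounded_mult[OF E_L2 cm]]) (rule AE_I2, rule c1)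
 then have "g r : fourier_image W" for r unfolding g_def by (intro cfun.subspace_sum[OF char_moduleD(1)[OF V]])
 then have "\<forall>r. \<exists>u. u : W & (AE x in lebesgue. L2_fourier u x = g r x)" unfolding fourier_image_def by blast
 then obtain F where F: "\<forall>r. F r : W & (AE x in lebesgue. L2_fourier (F r) x = g r x)" unfolding choice_iff by blast
 have "AE x in lebesgue. \<forall>r. fib (L2_fourier (F r)) x = fib (g r) x"
  unfolding AE_all_countable by (intro allI fib_AE_cong) (use F in blast)
 with Eon dL AE_R have key: "AE x in lebesgue. x : torus --> (\<forall>r\<in>{1..n}. fsq (L2_fourier (F r)) x = a (d x) r) \<and>
  (\<forall>j\<ge>1. eigval j (frame_op_fiber n F x) = psi (d x) j)"
 proof eventually_elim
  case (elim x)
  show ?case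
  proof
   assume x: "x : torus"
   let ?e = "%j. fib (E j) x" and ?v = "%r. Gam (F r) x"
   have on: "orthonormal (d x) ?e" and e0: "\<forall>j. j ~: {1..d x} --> ?e j = 0" and dL': "d x <= L"
    and dR: "d x = 0 \<or> d x : R" using elim x by auto
   have zx: "z i x = (if i = d x then 1 else 0)" for i
    unfolding z_def br_tchar_0 floor_vec_on_torus[OF x] lattice_vec_0 using x by (simp add: Z)
   have cx: "c r j x = of_real (M (d x) r j)" if "d x : R" for r j
    unfolding c_def zx using that finite_R by (simp add: if_distrib cong: if_cong)
   have v: "?v r = (\<Sum>j\<in>{1..d x}. cscale (of_real (M (d x) r j)) (?e j))" for r
   proof -
    have "?v r = (\<Sum>j\<in>{1..L}. cscale (c r j x) (?e j))"
     using elim(4) unfolding Gam_fib g_def fib_sum fib_mult[OF cp] by simp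
    also have "... = (\<Sum>j\<in>{1..d x}. cscale (c r j x) (?e j))"
     using e0 dL' by (intro sum.mono_neutral_right) auto
    \<comment> \<open>For \<open>d x = 0\<close> both sums are empty; otherwise \<open>d x\<close>
      lies in \<open>R\<close> and the coefficient is the matrix entry of that dimension.\<close>
    also have "... = (\<Sum>j\<in>{1..d x}. cscale (of_real (M (d x) r j)) (?e j))"
     using dR by (intro sum.cong) (auto simp: cx)
    finally show ?thesis .
   qed
   have Mx: "(\<Sum>r\<in>{1..n}. M (d x) r j * M (d x) r k) = (if j = k then psi (d x) j else 0)"
    if "j : {1..d x}" "k : {1..d x}" for j k using M that by blast
   have pz: "psi (d x) j = 0" if "j ~: {1..d x}" for j using f(4) that by blast
   have S: "spectral_res (fop n ?v) (d x) ?e (psi (d x))"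
    by (rule fop_matrix_res(1)[OF on, where M="M (d x)"]) (rule v | (rule Mx; assumption) | rule f(3) | (rule pz; assumption) | (rule f(5); assumption))+
   have sq: "ell2.sq (?v r) = (\<Sum>j\<in>{1..d x}. (M (d x) r j)\<^sup>2)" if r: "r : {1..n}" for r
    by (rule fop_matrix_res(2)[OF on, where M="M (d x)" and n=n and l="psi (d x)"]) (rule v | (rule Mx; assumption) | rule f(3) | (rule pz; assumption) | (rule f(5); assumption) | rule r)+
   have "fop n ?v = frame_op_fiber n F x" by (rule ext) (simp add: frame_op_fiber_def fop_def)
   then have "\<forall>j\<ge>1. eigval j (frame_op_fiber n F x) = psi (d x) j" using eigval_res[OF S] by simp
   moreover have "\<forall>r\<in>{1..n}. fsq (L2_fourier (F r)) x = a (d x) r"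
    using sq M unfolding fsq_def Gam_fib by simp
   ultimately show "(\<forall>r\<in>{1..n}. fsq (L2_fourier (F r)) x = a (d x) r) \<and>
    (\<forall>j\<ge>1. eigval j (frame_op_fiber n F x) = psi (d x) j)" by blast
  qed
 qed
 have FW: "F r : W" and FL: "F r : L2" for r using F W_L2[OF W] by blast+
 have norm: "L2.sq (F r) = alp r" if r: "r : {1..n}" for r
 proof -
  have "(LINT x|ZM i. fsq (L2_fourier (F r)) x) = p i * a i r" for i
  proof -
   have "(LINT x|ZM i. fsq (L2_fourier (F r)) x) = (LINT x|ZM i. a i r)"
   proof (rule integral_cong_AE[OF ZM_measurable[OF fsq_measurable[OF L2_fourier_L2[OF FL]]]])
    show "AE x in ZM i. fsq (L2_fourier (F r)) x = a i r"
     unfolding AE_ZM using key by eventually_elim (use r in \<open>auto simp: Z\<close>)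
   qed simp
   then show ?thesis using ZM_measure[of i] by (simp add: space_ZM)
  qed
  then show ?thesis using fsq_W(3)[OF FW, of r] f(8)[OF r] by simp
 qed
 define C where "C = (\<Sum>i\<in>R. \<Sum>r\<in>{1..n}. a i r)"
 have "AE x in lebesgue. fsq (L2_fourier (F r)) x <= C" if r: "r : {1..n}" for r
 proof (rule AE_periodic)
  show "AE x in lebesgue. x : torus --> fsq (L2_fourier (F r)) x <= C"
   using key AE_R
  proof eventually_elim
   case (elim x)
   show ?case
   proof
    assume x: "x : torus"
    have "a (d x) r <= C"
    proof (cases "d x : R")
     case True
     have "a (d x) r <= (\<Sum>r\<in>{1..n}. a (d x) r)" using r f(1) by (intro member_le_sum) auto
     also have "... <= C" unfolding C_def using True finite_R f(1)
      by (intro member_le_sum[where f="%i. \<Sum>r\<in>{1..n}. a i r"] sum_nonneg) auto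
     finally show ?thesis .
    next
     case False
     then show ?thesis unfolding C_def using f(1,2) by (auto intro!: sum_nonneg)
    qed
    then show "fsq (L2_fourier (F r)) x <= C" using elim x r by simp
   qed
  qed
  show "periodic (%x. fsq (L2_fourier (F r)) x <= C)" unfolding periodic_def by (simp add: periodicD[OF fsq_periodic])
 qed
 then have "bessel n F" using bounded_imp_bessel[of F n C] FL by blast
 then have "F : bessel_prescribed n alp W" unfolding bessel_prescribed_def L2_norm_sq using FW norm by simp
 moreover have "AE x in lebesgue. x : torus --> (\<forall>j\<ge>1. eigval j (frame_op_fiber n F x) = psi (d x) j)"
  using key by eventually_elim blast
 ultimately show ?thesis by blast
qed

lemma AE_spectrum:
 assumes F: "F : bessel_prescribed n alp W"
 shows "(AE x in lebesgue. x : torus --> (\<forall>j\<ge>1. eigval j (frame_op_fiber n F x) = psi (d x) j)) \<longleftrightarrow>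
  (AE x in lebesgue. x : torus --> (\<forall>j\<ge>1. lam F x j = psi (d x) j))"
proof -
 have "AE x in lebesgue. (x : torus --> (\<forall>j\<ge>1. eigval j (frame_op_fiber n F x) = psi (d x) j)) \<longleftrightarrow>
  (x : torus --> (\<forall>j\<ge>1. lam F x j = psi (d x) j))"
  using AE_good[OF F] by eventually_elim (simp add: lam_def[OF F])
 then show ?thesis by (rule eventually_cong)
qed

text \<open>A lower bound for the eigenvalues bounds the quadratic form of the fiber operator on
  \<open>J x\<close> from below, and the Parseval identity integrates this to the lower frame
  inequality.\<close>

lemma minimal_spectrum_frame:
 assumes F: "F : bessel_prescribed n alp W" and phi: "phi : Conv" and c: "0 < c"
  and lb: "AE x in lebesgue. x : torus --> (\<forall>j\<in>{1..d x}. c <= lam F x j)"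
 shows "frame_for W n F"
proof -
 have FW: "F ` {1..n} <= W" using F_W[OF F] by auto
 then have FL: "F ` {1..n} <= L2" using W_L2[OF W] by blast
 obtain b where b: "\<forall>i\<in>{1..n}. AE x in lebesgue. fsq (L2_fourier (F i)) x <= b"
  using bessel_imp_bounded[OF W FW F_bessel[OF F]] by blast
 show ?thesis unfolding frame_for_def
 \<comment> \<open>The summand \<open>c\<close> in the upper constant secures the order of the two
   frame bounds.\<close>
 proof (rule exI[of _ c], rule exI[of _ "c + \<bar>real n * b\<bar>"], intro conjI ballI)
  fix f assume f: "f : W"
  have fL: "f : L2" by (rule W_L2[OF W f])
  note P = bounded_family_parseval[OF fL FL b]
  note S = fsq_integral[OF L2_fourier_L2[OF fL]]
  have nn: "0 <= L2.sq f" by (rule L2.sq_nonneg[OF fL])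
  show "(%(l, i). (cmod (L2_inner f (translate (lattice_vec l) (F i))))\<^sup>2) summable_on UNIV \<times> {1..n}"
   using P(2) by (rule has_sum_imp_summable)
  have "(LINT x|lebesgue. c * (indicator torus x * fsq (L2_fourier f) x)) \<le>
   (LINT x|lebesgue. indicator torus x * (\<Sum>i\<in>{1..n}. (cmod (br (L2_fourier f) (L2_fourier (F i)) x))\<^sup>2))"
  proof (rule integral_mono_AE[OF _ P(1)])
   show "integrable lebesgue (%x. c * (indicator torus x * fsq (L2_fourier f) x))" using S(1) by simp
   show "AE x in lebesgue. c * (indicator torus x * fsq (L2_fourier f) x) \<le>
    indicator torus x * (\<Sum>i\<in>{1..n}. (cmod (br (L2_fourier f) (L2_fourier (F i)) x))\<^sup>2)"
    using lb AE_good[OF F] rng[OF f]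
   proof eventually_elim
    case (elim x)
    show ?case
    proof (cases "x : torus")
     case True
     have "c * ell2.sq (Gam f x) <= (\<Sum>r\<in>{1..n}. (cmod (ell2_inner (Gam f x) (Gam (F r) x)))\<^sup>2)"
      by (rule good_weights(4)[OF F]) (use elim True in auto)
     then show ?thesis using True by (simp add: br_def fsq_def Gam_fib)
    qed simp
   qed
  qed
  then have "c * L2.sq f <= (LINT x|lebesgue. indicator torus x * (\<Sum>i\<in>{1..n}. (cmod (br (L2_fourier f) (L2_fourier (F i)) x))\<^sup>2))"
   using S(2) L2_fourier_sq[OF fL] by simp
  then show "c * (L2_norm f)\<^sup>2 <= (\<Sum>\<^sub>\<infinity>(l, i)\<in>UNIV \<times> {1..n}. (cmod (L2_inner f (translate (lattice_vec l) (F i))))\<^sup>2)"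
   unfolding infsumI[OF P(2)] L2_norm_sq .
  have "real n * b * L2.sq f <= (c + \<bar>real n * b\<bar>) * L2.sq f" using c nn by (intro mult_right_mono) auto
  then show "(\<Sum>\<^sub>\<infinity>(l, i)\<in>UNIV \<times> {1..n}. (cmod (L2_inner f (translate (lattice_vec l) (F i))))\<^sup>2) <= (c + \<bar>real n * b\<bar>) * (L2_norm f)\<^sup>2"
   unfolding infsumI[OF P(2)] L2_norm_sq using P(3) by linarith
 qed (use c in auto)
qed

theorem optimal_family:
 assumes ne: "\<exists>f\<in>W. L2_norm f ~= 0" and alp: "!!i. 1 <= i ==> i <= n ==> 0 < alp i" and phi: "phi : Conv"
 shows "\<exists>Fop\<in>bessel_prescribed n alp W. \<exists>psi :: nat => nat => real.
   (\<forall>i\<in>{1..L}. \<forall>j\<in>{1..i}. 0 <= psi i j \<and>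
     (AE x in lebesgue. x : Z i --> eigval j (frame_op_fiber n Fop x) = psi i j)) \<and>
   (\<Sum>i\<in>{1..L}. p i * (\<Sum>j\<in>{1..i}. phi (psi i j))) = convex_potential phi J n Fop \<and>
   (\<forall>F\<in>bessel_prescribed n alp W.
     convex_potential phi J n Fop <= convex_potential phi J n F) \<and>
   (phi : Conv_s -->
     (\<forall>F\<in>bessel_prescribed n alp W.
      convex_potential phi J n F = convex_potential phi J n Fop -->
      (AE x in lebesgue. x : torus -->
        (\<forall>j\<ge>1. eigval j (frame_op_fiber n F x) = eigval j (frame_op_fiber n Fop x)))) \<and>
     (phi differentiable_on {0..} & (\<forall>i\<in>{1..L}. 0 < p i --> i <= n) -->
      (\<forall>F\<in>bessel_prescribed n alp W.
        convex_potential phi J n F = convex_potential phi J n Fop -->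
        frame_for W n F)))"
proof -
 have cvx: "convex_on {0..} phi" using phi unfolding Conv_def by simp
 obtain a psi where feas: "feasible R p n alp a psi"
  and min: "!!a' psi'. feasible R p n alp a' psi' ==> potential R p phi psi <= potential R p phi psi'"
 proof (rule potential_attains_min[where R=R and p=p and n=n and alp=alp and phi=phi])
  show "finite R" by (rule finite_R)
  show "R ~= {}" using ne R_nonempty by blast
  show "0 < p i" "1 <= i" if "i : R" for i using R_D[OF that] by auto
  show "0 < alp r" if "r : {1..n}" for r using alp that by auto
 qed (use cvx in auto)
 note f = feasibleD[OF feas]
 obtain Fop where B: "Fop : bessel_prescribed n alp W"
  and op: "AE x in lebesgue. x : torus --> (\<forall>j\<ge>1. eigval j (frame_op_fiber n Fop x) = psi (d x) j)"
  using realization[OF feas] by blast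
 have lop: "AE x in lebesgue. x : torus --> (\<forall>j\<ge>1. lam Fop x j = psi (d x) j)" using op unfolding AE_spectrum[OF B] .
 have "(LINT x|ZM i. phi (lam Fop x j)) = p i * phi (psi i j)" if "j : {1..i}" for i j
 proof -
  have "(LINT x|ZM i. phi (lam Fop x j)) = (LINT x|ZM i. phi (psi i j))"
  proof (rule integral_cong_AE[OF borel_measurable_integrable[OF lam_integrable(2)[OF B phi]]])
   show "AE x in ZM i. phi (lam Fop x j) = phi (psi i j)"
    unfolding AE_ZM using lop by eventually_elim (use that in \<open>auto simp: Z\<close>)
  qed simp
  then show ?thesis using ZM_measure[of i] by (simp add: space_ZM)
 qed
 then have pot: "convex_potential phi J n Fop = potential R p phi psi"
  unfolding convex_potential_eq[OF B phi] potential_def sum_distrib_left by (intro sum.cong refl)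
 have tot: "(\<Sum>i\<in>{1..L}. p i * (\<Sum>j\<in>{1..i}. phi (psi i j))) = potential R p phi psi"
  unfolding potential_def
 proof (rule sum.mono_neutral_right)
  show "\<forall>i\<in>{1..L} - R. p i * (\<Sum>j\<in>{1..i}. phi (psi i j)) = 0"
  proof
   fix i assume "i : {1..L} - R"
   then have "p i <= 0" unfolding R_def by auto
   moreover have "0 <= p i" unfolding p by simp
   ultimately show "p i * (\<Sum>j\<in>{1..i}. phi (psi i j)) = 0" by simp
  qed
 qed (auto simp: R_def)
 have le: "convex_potential phi J n Fop <= convex_potential phi J n F" if F: "F : bessel_prescribed n alp W" for F
  using min[OF averages_feasible[OF F phi]] potential_averages(1)[OF F phi] unfolding pot by linarith
 have eq: "AE x in lebesgue. x : torus --> (\<forall>j\<ge>1. lam F x j = psi (d x) j)"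
  if s: "phi : Conv_s" and F: "F : bessel_prescribed n alp W" and e: "convex_potential phi J n F = convex_potential phi J n Fop" for F
 proof -
  \<comment> \<open>The means of an optimal family are feasible with a potential no larger than the
    minimum, so they are the unique minimizer. Equality in Jensen's inequality then makes the
    eigenvalues equal to their means almost everywhere.\<close>
  have m: "mlam F = psi"
  proof (rule minimizer_unique[where R=R and p=p and n=n and alp=alp and phi=phi and a=a and a'="ma F"])
   show "finite R" by (rule finite_R)
   show "0 < p i" if "i : R" for i by (rule R_D(3)[OF that])
   show "potential R p phi (mlam F) <= potential R p phi psi"
    using potential_averages(1)[OF F phi] e unfolding pot by simp
  qed (use s feas averages_feasible[OF F phi] min in auto)
  have "convex_potential phi J n F <= potential R p phi (mlam F)" unfolding m e pot by simp
  note A = potential_averages(2)[OF F phi s this, unfolded m]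
  have "AE x in lebesgue. \<forall>i j. i : R & j : {1..i} --> x : Z i --> lam F x j = psi i j"
   unfolding AE_all_countable using A by (intro allI) auto
  with AE_R show ?thesis
  proof eventually_elim
   case (elim x)
   show ?case
   proof (intro impI allI)
    fix j :: nat assume x: "x : torus" and j: "1 <= j"
    show "lam F x j = psi (d x) j"
    proof (cases "j : {1..d x}")
     case True
     then have "d x : R" using elim(1) x by auto
     then show ?thesis using elim(2) True x by (simp add: Z)
    next
     case False
     then show ?thesis using lam_zero[OF F False] f(4)[of "d x" j] by simp
    qed
   qed
  qed
 qed
 have "0 <= psi i j & (AE x in lebesgue. x : Z i --> eigval j (frame_op_fiber n Fop x) = psi i j)" if "j : {1..i}" for i j
 proof
  show "AE x in lebesgue. x : Z i --> eigval j (frame_op_fiber n Fop x) = psi i j"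
   using op by eventually_elim (use that in \<open>auto simp: Z\<close>)
 qed (rule f(3))
 moreover have "AE x in lebesgue. x : torus --> (\<forall>j\<ge>1. eigval j (frame_op_fiber n F x) = eigval j (frame_op_fiber n Fop x))"
  if "phi : Conv_s" "F : bessel_prescribed n alp W" "convex_potential phi J n F = convex_potential phi J n Fop" for F
  using eq[OF that, unfolded AE_spectrum[OF that(2), symmetric]] op by eventually_elim simp
 moreover have "frame_for W n F"
  if s: "phi : Conv_s" and n: "\<forall>i\<in>{1..L}. 0 < p i --> i <= n"
   and F: "F : bessel_prescribed n alp W" and e: "convex_potential phi J n F = convex_potential phi J n Fop" for F
 proof -
  have pos: "0 < psi i j" if i: "i : R" and j: "j : {1..i}" for i j
  proof (rule minimizer_pos[where R=R and p=p and n=n and alp=alp and phi=phi and a=a])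
   show "finite R" by (rule finite_R)
   show "0 < p i" if "i : R" for i by (rule R_D(3)[OF that])
   show "0 < alp r" if "r : {1..n}" for r using alp that by auto
   show "j <= n" using n i j unfolding R_def by auto
  qed (use s feas min i j in auto)
  \<comment> \<open>The inserted 1 keeps the minimum well defined when there are no pairs of
    indices.\<close>
  define c where "c = Min (insert 1 ((%(i, j). psi i j) ` (SIGMA i:R. {1..i})))"
  have fin: "finite (insert 1 ((%(i, j). psi i j) ` (SIGMA i:R. {1..i})))" using finite_R by auto
  have "0 < c" unfolding c_def using fin pos by (subst Min_gr_iff) auto
  moreover have cl: "c <= psi i j" if "i : R" "j : {1..i}" for i j
   unfolding c_def by (rule Min_le[OF fin]) (use that in force)
  have "AE x in lebesgue. x : torus --> (\<forall>j\<in>{1..d x}. c <= lam F x j)"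
   using eq[OF s F e] AE_R by eventually_elim (use cl in force)
  ultimately show ?thesis using minimal_spectrum_frame[OF F phi] by blast
 qed
 ultimately show ?thesis using B tot pot le by (intro bexI[OF _ B] exI[of _ psi]) auto
qed

end

theorem theorem4p13:
  fixes W :: "(real^'k \<Rightarrow> complex) set"
    and J :: "real^'k \<Rightarrow> (int^'k \<Rightarrow> complex) set"
    and d :: "real^'k \<Rightarrow> nat"
    and Z :: "nat \<Rightarrow> (real^'k) set"
    and p :: "nat \<Rightarrow> real"
    and \<alpha> :: "nat \<Rightarrow> real"
    and \<phi> :: "real \<Rightarrow> real"
    and n L :: nat
  assumes "finitely_generated_si W"
    and "\<exists>f\<in>W. L2_norm f \<noteq> 0"
    and "is_range_function W J"
    and "\<And>x. d x = cfun.dim (J x)"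
    and "AE x in lebesgue. x \<in> torus \<longrightarrow> d x \<le> L"
    and "\<And>i. Z i = {x \<in> torus. d x = i}"
    and "\<And>i. p i = measure lebesgue (Z i)"
    and "n \<ge> 1"
    and "\<And>i j. 1 \<le> i \<Longrightarrow> i \<le> j \<Longrightarrow> j \<le> n \<Longrightarrow> \<alpha> j \<le> \<alpha> i"
    and "\<And>i. 1 \<le> i \<Longrightarrow> i \<le> n \<Longrightarrow> 0 < \<alpha> i"
    and "\<phi> \<in> Conv"
  shows "\<exists>Fop \<in> bessel_prescribed n \<alpha> W. \<exists>\<psi> :: nat \<Rightarrow> nat \<Rightarrow> real.
      (\<forall>i\<in>{1..L}. \<forall>j\<in>{1..i}. 0 \<le> \<psi> i j \<and>
         (AE x in lebesgue. x \<in> Z i \<longrightarrow> eigval j (frame_op_fiber n Fop x) = \<psi> i j)) \<and>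
      (\<Sum>i\<in>{1..L}. p i * (\<Sum>j\<in>{1..i}. \<phi> (\<psi> i j))) = convex_potential \<phi> J n Fop \<and>
      (\<forall>F \<in> bessel_prescribed n \<alpha> W.
         convex_potential \<phi> J n Fop \<le> convex_potential \<phi> J n F) \<and>
      (\<phi> \<in> Conv_s \<longrightarrow>
         (\<forall>F \<in> bessel_prescribed n \<alpha> W.
            convex_potential \<phi> J n F = convex_potential \<phi> J n Fop \<longrightarrow>
            (AE x in lebesgue. x \<in> torus \<longrightarrow>
               (\<forall>j\<ge>1. eigval j (frame_op_fiber n F x) = eigval j (frame_op_fiber n Fop x)))) \<and>
         (\<phi> differentiable_on {0..} \<and> (\<forall>i\<in>{1..L}. 0 < p i \<longrightarrow> i \<le> n) \<longrightarrow>
            (\<forall>F \<in> bessel_prescribed n \<alpha> W.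
               convex_potential \<phi> J n F = convex_potential \<phi> J n Fop \<longrightarrow>
               frame_for W n F)))"
proof -
 have si: "shift_invariant W" using assms(1) unfolding finitely_generated_si_def by blast
 obtain A where A: "finite A" "A <= L2" "W = si_span A"
  and J: "AE x in lebesgue. x : torus --> J x = cfun.span ((%h. Gam h x) ` A)"
  using assms(3) unfolding is_range_function_def by blast
 obtain h N where h: "A = h ` {..<N::nat}" using A(1) unfolding finite_conv_nat_seg_image lessThan_def by blast
 have "(%k. L2_fourier (h k)) ` {..<N} <= fourier_image W"
  using generator_in_W[OF si A(3,2)] fourier_image_I[OF si] h by auto
 from orthonormal_sections[OF char_module_fourier_image[OF si] this]
 obtain E where E: "!!j. E j : fourier_image W"
  and on: "AE x in lebesgue. \<exists>d. orthonormal d (%j. fib (E j) x) & (\<forall>j. j ~: {1..d} --> fib (E j) x = 0) \<and>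
    cfun.span ((%j. fib (E j) x) ` {1..d}) = cfun.span ((%k. fib (L2_fourier (h k)) x) ` {..<N})" by blast
 interpret fsi W J d Z p n L \<alpha> E
 proof unfold_locales
  show "AE x in lebesgue. x : torus --> orthonormal (d x) (%j. fib (E j) x) \<and>
   (\<forall>j. j ~: {1..d x} --> fib (E j) x = 0) & J x = cfun.span ((%j. fib (E j) x) ` {1..d x})"
   using J on
  proof eventually_elim
   case (elim x)
   show ?case
   proof
    assume x: "x : torus"
    obtain m where m: "orthonormal m (%j. fib (E j) x)" "\<forall>j. j ~: {1..m} --> fib (E j) x = 0"
     "cfun.span ((%j. fib (E j) x) ` {1..m}) = cfun.span ((%k. fib (L2_fourier (h k)) x) ` {..<N})"
     using elim(2) by blast
    have Jx: "J x = cfun.span ((%j. fib (E j) x) ` {1..m})"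
     using elim(1) x m(3) unfolding h image_image Gam_fib by simp
    \<comment> \<open>The number of nonzero sections in the fiber is its dimension, which ties the
      fiberwise existential \<open>m\<close> to the given function \<open>d\<close>.\<close>
    have "d x = m" unfolding assms(4) Jx by (rule dim_span_orthonormal[OF m(1)])
    then show "orthonormal (d x) (%j. fib (E j) x) \<and>
     (\<forall>j. j ~: {1..d x} --> fib (E j) x = 0) & J x = cfun.span ((%j. fib (E j) x) ` {1..d x})" using m Jx by blast
   qed
  qed
  show "AE x in lebesgue. x : torus --> Gam f x : J x" if "f : W" for f
   using fiber_in_range[OF si A(3,2,1) that] J by eventually_elim simp
 qed (use si assms E in auto)
 show ?thesis by (rule optimal_family[OF assms(2,10,11)])
qed

end
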